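(* Let $p\in[1,+\infty[$, and let $\mu$ be a positive Radon measure on $E$. (1) Suppose that ${\bf X}$ is transient and satisfies (AC). Assume either $\mu\in S_{CK_\infty}^{p}({\bf X})$, or both $\mu\in S_K^{p}({\bf X})$ and $\mathfrak m\in S_{CK_\infty}^{1}({\bf X})$. Then $(\mathscr E,\mathscr F_e)$ is compactly embedded into $L^{2p}(E;\mu)$. (2) Suppose that ${\bf X}$ satisfies (AC). Assume either $\mu\in S_{CK_\infty}^{p}({\bf X}^{(1)})$, or both $\mu\in S_K^{p}({\bf X})$ and $\mathfrak m\in S_{CK_\infty}^{1}({\bf X}^{(1)})$. Then $(\mathscr E_1,\mathscr F)$ is compactly embedded into $L^{2p}(E;\mu)$.
   Context: Setting. $(E,d)$ is a locally compact separable metric space, $\mathfrak m$ a positive Radon measure on $E$ with full support, $(\mathscr E,\mathscr F)$ a symmetric regular Dirichlet form on $L^2(E;\mathfrak m)$, and ${\bf X}=(\Omega,X_t,\zeta,{\bf P}_x)$ an associated Hunt process on $E$ with life time $\zeta$ and cemetery $\partial$; $P_tu(x)={\bf E}_x[u(X_t)]$ (functions are $0$ at $\partial$). Condition (AC): $\mathfrak m(B)=0$ implies ${\bf P}_x(X_t\in B)=0$ for all $t>0$, $x\in E$. Under (AC) there is a jointly measurable kernel $p_t(x,y)\in[0,+\infty]$ on $]0,+\infty[\times E\times E$ with $p_t(x,y)=p_t(y,x)$, $P_tu(x)=\int_E p_t(x,y)u(y)\,\mathfrak m(dy)$ for all $x$, and $p_{t+s}(x,y)=\int_E p_s(x,z)p_t(z,y)\,\mathfrak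 m(dz)$ for all $x,y$. Put $R_\alpha(x,y)=\int_0^\infty e^{-\alpha t}p_t(x,y)\,dt$ for $\alpha\ge 0$, and $R(x,y)=R_0(x,y)$. $\mathscr F_e$ is the extended Dirichlet space (the $\mathfrak m$-a.e. finite $\mathfrak m$-a.e. limits of $\mathscr E$-Cauchy sequences in $\mathscr F$, with $\mathscr E$ extended); in the transient case $(\mathscr E,\mathscr F_e)$ is a Hilbert space. $\mathscr E_1(u,v)=\mathscr E(u,v)+\int_E uv\,d\mathfrak m$. Elements of $\mathscr F_e$ are represented by $\mathscr E$-quasi-continuous versions when integrated against $\mu$. Compact embedding means that the identification map $u\mapsto u$ from the Hilbert space in question into $L^{2p}(E;\mu)$ is a compact operator. ${\bf X}^{(1)}$ is the $1$-subprocess: ${\bf P}_x^{(1)}(X_t\in A)=e^{-t}{\bf P}_x(X_t\in A)$. It is transient, and its $\alpha$-order resolvent kernel is $R_{\alpha+1}$ (its $0$-order kernel is $R_1$); classes for ${\bf X}^{(1)}$ are defined with these kernels. Classes of a positive Radon measure $\nu$ on $E$: - $\nu\in S_K^{p}({\bf X})$ ($L^p$-Kato class) iff $\lim_{\alpha\to\infty}\sup_{x\in E}\int_E R_\alpha(x,y)^p\,\nu(dy)=0$. - $\nu\in S_{CK_\infty}^{p}({\bf X})$ ($L^p$-Green-tight measures of $L^p$-Kato class in the sense of Chen; ${\bf X}$ transient) iff for any $\varepsilon>0$ there exist a Borel set $K$ with $\nu(K)<+\infty$ and $\delta>0$ such that $\sup_{x\in E}\int_{K^c\cup B}R(x,y)^p\,\nu(dy)<\varepsilon$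 for every Borel $B\subset K$ with $\nu(B)<\delta$.
   Formalization: The class S_CK∞^p is taken to contain only measures charging no Borel set of zero capacity; without this a Dirac mass at a polar point (Brownian motion on R^3) meets the displayed condition, yet the identification map into L^{2p}(E;μ) is not well defined. *)

theory Defs
  imports "HOL-Probability.Probability"
begin

section \<open>Measures and function spaces\<close>

text \<open>
  The state space is a type of class \<open>{metric_space, second_countable_topology}\<close>, i.e. a
  separable metric space; local compactness is assumed separately.  Elements of the various
  function spaces are everywhere defined real Borel functions, and identification of functions
  agreeing almost everywhere is stated explicitly wherever it plays a role.
\<close>

text \<open>On a locally compact separable metric space every Borel measure that is finite on compact
  sets is automatically inner and outer regular.\<close>

definition radon_measure :: "'a::{metric_space, second_countable_topology} measure \<Rightarrow> bool" where
  "radon_measure \<nu> \<longleftrightarrow> sets \<nu> = sets borel \<and> (\<forall>K. compact K \<longrightarrow> emeasure \<nu> K < \<top>)"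

definition full_support :: "'a::{metric_space, second_countable_topology} measure \<Rightarrow> bool" where
  "full_support \<nu> \<longleftrightarrow> (\<forall>U. open U \<and> U \<noteq> {} \<longrightarrow> emeasure \<nu> U > 0)"

definition Lp :: "'a::{metric_space, second_countable_topology} measure \<Rightarrow> real \<Rightarrow> ('a \<Rightarrow> real) set" where
  "Lp \<nu> q = {u \<in> borel_measurable borel. integrable \<nu> (\<lambda>x. \<bar>u x\<bar> powr q)}"

definition Lp_norm :: "'a::{metric_space, second_countable_topology} measure \<Rightarrow> real \<Rightarrow> ('a \<Rightarrow> real) \<Rightarrow> real" where
  "Lp_norm \<nu> q u = (\<integral>x. \<bar>u x\<bar> powr q \<partial>\<nu>) powr (1 / q)"

definition L2_inner :: "'a::{metric_space, second_countable_topology} measure \<Rightarrow> ('a \<Rightarrow> real) \<Rightarrow> ('a \<Rightarrow> real) \<Rightarrow> real" where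
  "L2_inner \<nu> u v = (\<integral>x. u x * v x \<partial>\<nu>)"

definition C_c :: "('a::{metric_space, second_countable_topology} \<Rightarrow> real) set" where
  "C_c = {f. continuous_on UNIV f \<and> compact (closure {x. f x \<noteq> 0})}"

definition ennreal_powr :: "ennreal \<Rightarrow> real \<Rightarrow> ennreal" where
  "ennreal_powr a p = (if a = \<top> then \<top> else ennreal (enn2real a powr p))"

section \<open>Dirichlet forms\<close>

definition form1 :: "'a::{metric_space, second_countable_topology} measure \<Rightarrow>
    (('a \<Rightarrow> real) \<Rightarrow> ('a \<Rightarrow> real) \<Rightarrow> real) \<Rightarrow> ('a \<Rightarrow> real) \<Rightarrow> ('a \<Rightarrow> real) \<Rightarrow> real" where
  "form1 m \<E> u v = \<E> u v + L2_inner m u v"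

text \<open>Cauchy sequences and convergence with respect to the seminorm of a quadratic form.\<close>

definition form_Cauchy :: "(('a \<Rightarrow> real) \<Rightarrow> ('a \<Rightarrow> real) \<Rightarrow> real) \<Rightarrow> (nat \<Rightarrow> 'a \<Rightarrow> real) \<Rightarrow> bool" where
  "form_Cauchy a un \<longleftrightarrow>
    (\<forall>\<epsilon>>0. \<exists>N. \<forall>i\<ge>N. \<forall>j\<ge>N. a (\<lambda>x. un i x - un j x) (\<lambda>x. un i x - un j x) < \<epsilon>)"

definition form_converges :: "(('a \<Rightarrow> real) \<Rightarrow> ('a \<Rightarrow> real) \<Rightarrow> real) \<Rightarrow> (nat \<Rightarrow> 'a \<Rightarrow> real) \<Rightarrow> ('a \<Rightarrow> real) \<Rightarrow> bool" where
  "form_converges a un u \<longleftrightarrow>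
    (\<lambda>n. a (\<lambda>x. un n x - u x) (\<lambda>x. un n x - u x)) \<longlonglongrightarrow> 0"

locale symmetric_dirichlet_form =
  fixes m :: "'a::{metric_space, second_countable_topology} measure"
    and \<E> :: "('a \<Rightarrow> real) \<Rightarrow> ('a \<Rightarrow> real) \<Rightarrow> real"
    and \<F> :: "('a \<Rightarrow> real) set"
  assumes domain_L2: "\<F> \<subseteq> Lp m 2"
    and domain_zero: "(\<lambda>x. 0) \<in> \<F>"
    and domain_add: "u \<in> \<F> \<Longrightarrow> v \<in> \<F> \<Longrightarrow> (\<lambda>x. u x + v x) \<in> \<F>"
    and domain_scale: "u \<in> \<F> \<Longrightarrow> (\<lambda>x. c * u x) \<in> \<F>"
    and domain_AE: "u \<in> \<F> \<Longrightarrow> u' \<in> borel_measurable borel \<Longrightarrow> AE x in m. u x = u' x \<Longrightarrow> u' \<in> \<F>"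
    and domain_dense: "f \<in> Lp m 2 \<Longrightarrow> \<epsilon> > 0 \<Longrightarrow> \<exists>u\<in>\<F>. Lp_norm m 2 (\<lambda>x. f x - u x) < \<epsilon>"
    and form_AE: "u \<in> \<F> \<Longrightarrow> u' \<in> \<F> \<Longrightarrow> v \<in> \<F> \<Longrightarrow> AE x in m. u x = u' x \<Longrightarrow> \<E> u v = \<E> u' v"
    and form_sym: "u \<in> \<F> \<Longrightarrow> v \<in> \<F> \<Longrightarrow> \<E> u v = \<E> v u"
    and form_add: "u \<in> \<F> \<Longrightarrow> v \<in> \<F> \<Longrightarrow> w \<in> \<F> \<Longrightarrow> \<E> (\<lambda>x. u x + v x) w = \<E> u w + \<E> v w"
    and form_scale: "u \<in> \<F> \<Longrightarrow> v \<in> \<F> \<Longrightarrow> \<E> (\<lambda>x. c * u x) v = c * \<E> u v"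
    and form_nonneg: "u \<in> \<F> \<Longrightarrow> \<E> u u \<ge> 0"
    and form_closed: "(\<And>n. un n \<in> \<F>) \<Longrightarrow> form_Cauchy (form1 m \<E>) un \<Longrightarrow>
           \<exists>u\<in>\<F>. form_converges (form1 m \<E>) un u"
    and domain_unit_contraction: "u \<in> \<F> \<Longrightarrow> (\<lambda>x. min (max 0 (u x)) 1) \<in> \<F>"
    and form_unit_contraction: "u \<in> \<F> \<Longrightarrow>
           \<E> (\<lambda>x. min (max 0 (u x)) 1) (\<lambda>x. min (max 0 (u x)) 1) \<le> \<E> u u"

locale regular_dirichlet_form = symmetric_dirichlet_form m \<E> \<F>
  for m :: "'a::{metric_space, second_countable_topology} measure" and \<E> \<F> +
  assumes core_dense_domain: "u \<in> \<F> \<Longrightarrow> \<epsilon> > 0 \<Longrightarrow>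
           \<exists>f \<in> \<F> \<inter> C_c. form1 m \<E> (\<lambda>x. u x - f x) (\<lambda>x. u x - f x) < \<epsilon>"
    and core_dense_C_c: "g \<in> C_c \<Longrightarrow> \<epsilon> > 0 \<Longrightarrow> \<exists>f \<in> \<F> \<inter> C_c. \<forall>x. \<bar>g x - f x\<bar> < \<epsilon>"

text \<open>The extended Dirichlet space.  The value of the extended form does not depend on the
  approximating sequences; this is what makes the definite description meaningful.\<close>

definition approximating_sequence :: "'a::{metric_space, second_countable_topology} measure \<Rightarrow>
    (('a \<Rightarrow> real) \<Rightarrow> ('a \<Rightarrow> real) \<Rightarrow> real) \<Rightarrow> ('a \<Rightarrow> real) set \<Rightarrow> (nat \<Rightarrow> 'a \<Rightarrow> real) \<Rightarrow> ('a \<Rightarrow> real) \<Rightarrow> bool" where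
  "approximating_sequence m \<E> \<F> un u \<longleftrightarrow>
     (\<forall>n. un n \<in> \<F>) \<and> form_Cauchy \<E> un \<and> (AE x in m. (\<lambda>n. un n x) \<longlonglongrightarrow> u x)"

definition extended_domain :: "'a::{metric_space, second_countable_topology} measure \<Rightarrow>
    (('a \<Rightarrow> real) \<Rightarrow> ('a \<Rightarrow> real) \<Rightarrow> real) \<Rightarrow> ('a \<Rightarrow> real) set \<Rightarrow> ('a \<Rightarrow> real) set" where
  "extended_domain m \<E> \<F> =
     {u \<in> borel_measurable borel. \<exists>un. approximating_sequence m \<E> \<F> un u}"

definition extended_form :: "'a::{metric_space, second_countable_topology} measure \<Rightarrow>
    (('a \<Rightarrow> real) \<Rightarrow> ('a \<Rightarrow> real) \<Rightarrow> real) \<Rightarrow> ('a \<Rightarrow> real) set \<Rightarrow> ('a \<Rightarrow> real) \<Rightarrow> ('a \<Rightarrow> real) \<Rightarrow> real" where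
  "extended_form m \<E> \<F> u v =
     (THE l. \<exists>un vn. approximating_sequence m \<E> \<F> un u \<and> approximating_sequence m \<E> \<F> vn v \<and>
        (\<lambda>n. \<E> (un n) (vn n)) \<longlonglongrightarrow> l)"

text \<open>The 1-capacity of an open set; the infimum over the empty set is \<open>\<top>\<close>.\<close>

definition capacity_open :: "'a::{metric_space, second_countable_topology} measure \<Rightarrow>
    (('a \<Rightarrow> real) \<Rightarrow> ('a \<Rightarrow> real) \<Rightarrow> real) \<Rightarrow> ('a \<Rightarrow> real) set \<Rightarrow> 'a set \<Rightarrow> ennreal" where
  "capacity_open m \<E> \<F> G =
     (INF u \<in> {u \<in> \<F>. AE x in m. x \<in> G \<longrightarrow> u x \<ge> 1}. ennreal (form1 m \<E> u u))"

definition capacity :: "'a::{metric_space, second_countable_topology} measure \<Rightarrow>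
    (('a \<Rightarrow> real) \<Rightarrow> ('a \<Rightarrow> real) \<Rightarrow> real) \<Rightarrow> ('a \<Rightarrow> real) set \<Rightarrow> 'a set \<Rightarrow> ennreal" where
  "capacity m \<E> \<F> A = (INF G \<in> {G. open G \<and> A \<subseteq> G}. capacity_open m \<E> \<F> G)"

text \<open>For a Radon measure this is smoothness with respect to the Dirichlet form.\<close>

definition charges_no_null_capacity :: "'a::{metric_space, second_countable_topology} measure \<Rightarrow>
    (('a \<Rightarrow> real) \<Rightarrow> ('a \<Rightarrow> real) \<Rightarrow> real) \<Rightarrow> ('a \<Rightarrow> real) set \<Rightarrow> 'a measure \<Rightarrow> bool" where
  "charges_no_null_capacity m \<E> \<F> \<nu> \<longleftrightarrow>
     (\<forall>B\<in>sets borel. capacity m \<E> \<F> B = 0 \<longrightarrow> emeasure \<nu> B = 0)"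

definition quasi_continuous :: "'a::{metric_space, second_countable_topology} measure \<Rightarrow>
    (('a \<Rightarrow> real) \<Rightarrow> ('a \<Rightarrow> real) \<Rightarrow> real) \<Rightarrow> ('a \<Rightarrow> real) set \<Rightarrow> ('a \<Rightarrow> real) \<Rightarrow> bool" where
  "quasi_continuous m \<E> \<F> v \<longleftrightarrow>
     (\<forall>\<epsilon>>0. \<exists>G. open G \<and> capacity_open m \<E> \<F> G < ennreal \<epsilon> \<and> continuous_on (- G) v)"

text \<open>Borel measurability of \<open>v\<close> is no restriction: a quasi-continuous function becomes Borel
  measurable when set to 0 on a Borel set of capacity zero.\<close>

definition quasi_continuous_version :: "'a::{metric_space, second_countable_topology} measure \<Rightarrow>
    (('a \<Rightarrow> real) \<Rightarrow> ('a \<Rightarrow> real) \<Rightarrow> real) \<Rightarrow> ('a \<Rightarrow> real) set \<Rightarrow> ('a \<Rightarrow> real) \<Rightarrow> ('a \<Rightarrow> real) \<Rightarrow> bool" where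
  "quasi_continuous_version m \<E> \<F> u v \<longleftrightarrow>
     v \<in> borel_measurable borel \<and> quasi_continuous m \<E> \<F> v \<and> (AE x in m. v x = u x)"

text \<open>
  Here \<open>H\<close> with inner product \<open>a\<close> stands for \<open>(\<F>\<^sub>e, \<E>)\<close> or \<open>(\<F>, \<E>\<^sub>1)\<close>.  The first three conditions
  say that sending \<open>u\<close> to the \<open>\<mu>\<close>-class of a quasi-continuous version is a well-defined map from
  all of \<open>H\<close> into \<open>L\<^sup>q(\<mu>)\<close>, the last one that this map is a compact operator.
\<close>

definition compactly_embedded :: "'a::{metric_space, second_countable_topology} measure \<Rightarrow>
    (('a \<Rightarrow> real) \<Rightarrow> ('a \<Rightarrow> real) \<Rightarrow> real) \<Rightarrow> ('a \<Rightarrow> real) set \<Rightarrow>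
    ('a \<Rightarrow> real) set \<Rightarrow> (('a \<Rightarrow> real) \<Rightarrow> ('a \<Rightarrow> real) \<Rightarrow> real) \<Rightarrow> 'a measure \<Rightarrow> real \<Rightarrow> bool" where
  "compactly_embedded m \<E> \<F> H a \<mu> q \<longleftrightarrow>
     (\<forall>u\<in>H. \<exists>v. quasi_continuous_version m \<E> \<F> u v) \<and>
     (\<forall>u\<in>H. \<forall>v w. quasi_continuous_version m \<E> \<F> u v \<and> quasi_continuous_version m \<E> \<F> u w \<longrightarrow>
        (AE x in \<mu>. v x = w x)) \<and>
     (\<forall>u\<in>H. \<forall>v. quasi_continuous_version m \<E> \<F> u v \<longrightarrow> v \<in> Lp \<mu> q) \<and>
     (\<forall>un vn. (\<forall>n. un n \<in> H \<and> quasi_continuous_version m \<E> \<F> (un n) (vn n)) \<and>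
        (\<exists>C. \<forall>n. sqrt (a (un n) (un n)) \<le> C) \<longrightarrow>
        (\<exists>(r :: nat \<Rightarrow> nat) f. strict_mono r \<and> f \<in> Lp \<mu> q \<and>
           (\<lambda>n. Lp_norm \<mu> q (\<lambda>x. vn (r n) x - f x)) \<longlonglongrightarrow> 0))"

section \<open>Hunt processes\<close>

text \<open>The state space with the cemetery \<open>None\<close> adjoined as the point at infinity (an isolated
  point if the state space is compact).\<close>

abbreviation cemetery_topology :: "'a::{metric_space, second_countable_topology} option topology" where
  "cemetery_topology \<equiv> Alexandroff_compactification euclidean"

definition cemetery_borel :: "'a::{metric_space, second_countable_topology} option measure" where
  "cemetery_borel = sigma UNIV {U. openin cemetery_topology U}"

text \<open>
  The measurable space of \<open>M\<close> is the sample space.  Time runs through \<open>[0, \<infinity>]\<close>, represented by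
  \<^typ>\<open>ennreal\<close>, with \<open>X\<^sub>\<infinity>\<close> the cemetery.  The strong Markov property and quasi-left-continuity
  are required under \<open>P x\<close> for every starting point \<open>x\<close> including the cemetery; integration in
  \<open>x\<close> gives them for every initial distribution.  The simple Markov property is the case of
  constant stopping times.
\<close>

locale hunt_process =
  fixes M :: "'w measure"
    and X :: "ennreal \<Rightarrow> 'w \<Rightarrow> 'a::{metric_space, second_countable_topology} option"
    and \<zeta> :: "'w \<Rightarrow> ennreal"
    and P :: "'a option \<Rightarrow> 'w measure"
  assumes prob: "prob_space (P x)"
    and sets_P: "sets (P x) = sets M"
    and measurable_X: "X t \<in> M \<rightarrow>\<^sub>M cemetery_borel"
    and measurable_start: "B \<in> sets cemetery_borel \<Longrightarrow>
           (\<lambda>x. measure (P x) {\<omega> \<in> space M. X t \<omega> \<in> B}) \<in> borel_measurable cemetery_borel"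
    and normal: "AE \<omega> in P x. X 0 \<omega> = x"
    and cemetery_trap: "AE \<omega> in P None. X t \<omega> = None"
    and at_infinity: "\<omega> \<in> space M \<Longrightarrow> X \<top> \<omega> = None"
    and lifetime: "\<omega> \<in> space M \<Longrightarrow> \<zeta> \<omega> = Inf {t. X t \<omega> = None}"
    and after_lifetime: "\<omega> \<in> space M \<Longrightarrow> \<zeta> \<omega> \<le> t \<Longrightarrow> X t \<omega> = None"
    and shift: "\<exists>\<theta>. \<forall>t. \<forall>\<omega> \<in> space M. \<theta> t \<omega> \<in> space M \<and> (\<forall>s. X s (\<theta> t \<omega>) = X (t + s) \<omega>)"
    and right_continuous: "\<omega> \<in> space M \<Longrightarrow> t \<ge> 0 \<Longrightarrow>
           limitin cemetery_topology (\<lambda>s. X (ennreal s) \<omega>) (X (ennreal t) \<omega>) (at_right t)"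
    and left_limits: "\<omega> \<in> space M \<Longrightarrow> t > 0 \<Longrightarrow>
           \<exists>l. limitin cemetery_topology (\<lambda>s. X (ennreal s) \<omega>) l (at_left t)"
    and admissible_filtration: "\<exists>\<G>.
           filtration (space M) \<G> \<and>
           (\<forall>t. sets (\<G> t) \<subseteq> sets M) \<and>
           (\<forall>t. X t \<in> \<G> t \<rightarrow>\<^sub>M cemetery_borel) \<and>
           (\<forall>t<\<top>. sets (\<G> t) = (\<Inter>s\<in>{t<..}. sets (\<G> s))) \<and>
           (\<forall>\<sigma> s B x. stopping_time \<G> \<sigma> \<and> B \<in> sets cemetery_borel \<longrightarrow>
              (AE \<omega> in P x.
                 real_cond_exp (P x) (filtration.pre_sigma (space M) \<G> \<sigma>)
                   (indicator {\<omega>' \<in> space M. X (\<sigma> \<omega>' + s) \<omega>' \<in> B}) \<omega> =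
                 measure (P (X (\<sigma> \<omega>) \<omega>)) {\<omega>' \<in> space M. X s \<omega>' \<in> B})) \<and>
           (\<forall>\<sigma> x. (\<forall>n. stopping_time \<G> (\<sigma> n)) \<and> (\<forall>\<omega>\<in>space M. incseq (\<lambda>n. \<sigma> n \<omega>)) \<longrightarrow>
              (AE \<omega> in P x. (SUP n. \<sigma> n \<omega>) < \<top> \<longrightarrow>
                 limitin cemetery_topology (\<lambda>n. X (\<sigma> n \<omega>) \<omega>) (X (SUP n. \<sigma> n \<omega>) \<omega>) sequentially))"

text \<open>\<open>P\<^sub>t u (x) = \<^bold>E\<^sub>x[u (X\<^sub>t)]\<close> with \<open>u = 0\<close> at the cemetery, for real functions and for functions
  with values in \<open>[0, \<infinity>]\<close>.\<close>

definition transition :: "(ennreal \<Rightarrow> 'w \<Rightarrow> 'a option) \<Rightarrow> ('a option \<Rightarrow> 'w measure) \<Rightarrow>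
    real \<Rightarrow> ('a \<Rightarrow> real) \<Rightarrow> 'a \<Rightarrow> real" where
  "transition X P t u x = (\<integral>\<omega>. case_option 0 u (X (ennreal t) \<omega>) \<partial>P (Some x))"

definition nn_transition :: "(ennreal \<Rightarrow> 'w \<Rightarrow> 'a option) \<Rightarrow> ('a option \<Rightarrow> 'w measure) \<Rightarrow>
    real \<Rightarrow> ('a \<Rightarrow> ennreal) \<Rightarrow> 'a \<Rightarrow> ennreal" where
  "nn_transition X P t u x = (\<integral>\<^sup>+\<omega>. case_option 0 u (X (ennreal t) \<omega>) \<partial>P (Some x))"

text \<open>The process is associated with the form if it is \<open>m\<close>-symmetric and \<open>(\<E>, \<F>)\<close> is the Dirichlet
  form on \<open>L\<^sup>2(m)\<close> of its semigroup, i.e.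
  \<open>\<E>(u,v) = lim\<^sub>t\<^sub>\<rightarrow>\<^sub>0 (u - P\<^sub>t u, v) / t\<close> on the domain of those \<open>u\<close> for which the limit is finite when
  \<open>v = u\<close>.\<close>

definition associated :: "'a::{metric_space, second_countable_topology} measure \<Rightarrow>
    (('a \<Rightarrow> real) \<Rightarrow> ('a \<Rightarrow> real) \<Rightarrow> real) \<Rightarrow> ('a \<Rightarrow> real) set \<Rightarrow>
    (ennreal \<Rightarrow> 'w \<Rightarrow> 'a option) \<Rightarrow> ('a option \<Rightarrow> 'w measure) \<Rightarrow> bool" where
  "associated m \<E> \<F> X P \<longleftrightarrow>
     (\<forall>t>0. \<forall>f\<in>borel_measurable borel. \<forall>g\<in>borel_measurable borel.
        (\<integral>\<^sup>+x. nn_transition X P t f x * g x \<partial>m) = (\<integral>\<^sup>+x. f x * nn_transition X P t g x \<partial>m)) \<and>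
     \<F> = {u \<in> Lp m 2. \<exists>l. ((\<lambda>t. L2_inner m (\<lambda>x. u x - transition X P t u x) u / t) \<longlongrightarrow> l) (at_right 0)} \<and>
     (\<forall>u\<in>\<F>. \<forall>v\<in>\<F>.
        ((\<lambda>t. L2_inner m (\<lambda>x. u x - transition X P t u x) v / t) \<longlongrightarrow> \<E> u v) (at_right 0))"

text \<open>Transience of the semigroup: the potential of every nonnegative integrable function is
  finite almost everywhere.\<close>

definition transient_process :: "'a::{metric_space, second_countable_topology} measure \<Rightarrow>
    (ennreal \<Rightarrow> 'w \<Rightarrow> 'a option) \<Rightarrow> ('a option \<Rightarrow> 'w measure) \<Rightarrow> bool" where
  "transient_process m X P \<longleftrightarrow>
     (\<forall>f\<in>borel_measurable borel. (\<integral>\<^sup>+x. f x \<partial>m) < \<top> \<longrightarrow>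
        (AE x in m. (\<integral>\<^sup>+t\<in>{0<..}. nn_transition X P t f x \<partial>lborel) < \<top>))"

definition absolute_continuity :: "'a::{metric_space, second_countable_topology} measure \<Rightarrow>
    (ennreal \<Rightarrow> 'w \<Rightarrow> 'a option) \<Rightarrow> ('a option \<Rightarrow> 'w measure) \<Rightarrow> bool" where
  "absolute_continuity m X P \<longleftrightarrow>
     (\<forall>B\<in>sets borel. emeasure m B = 0 \<longrightarrow>
        (\<forall>t>0. \<forall>x. emeasure (P (Some x)) {\<omega> \<in> space (P (Some x)). X (ennreal t) \<omega> \<in> Some ` B} = 0))"

section \<open>Heat kernel and classes of measures\<close>

text \<open>These conditions determine \<open>k t x y\<close> uniquely for \<open>t > 0\<close> and all \<open>x\<close>, \<open>y\<close>.\<close>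

definition heat_kernel :: "'a::{metric_space, second_countable_topology} measure \<Rightarrow>
    (ennreal \<Rightarrow> 'w \<Rightarrow> 'a option) \<Rightarrow> ('a option \<Rightarrow> 'w measure) \<Rightarrow> (real \<Rightarrow> 'a \<Rightarrow> 'a \<Rightarrow> ennreal) \<Rightarrow> bool" where
  "heat_kernel m X P k \<longleftrightarrow>
     (\<lambda>(t, x, y). k t x y) \<in> borel_measurable (restrict_space borel ({0<..} \<times> UNIV \<times> UNIV)) \<and>
     (\<forall>t>0. \<forall>x y. k t x y = k t y x) \<and>
     (\<forall>t>0. \<forall>u\<in>borel_measurable borel. \<forall>x. nn_transition X P t u x = (\<integral>\<^sup>+y. k t x y * u y \<partial>m)) \<and>
     (\<forall>t>0. \<forall>s>0. \<forall>x y. k (t + s) x y = (\<integral>\<^sup>+z. k s x z * k t z y \<partial>m))"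

definition resolvent_kernel :: "(real \<Rightarrow> 'a \<Rightarrow> 'a \<Rightarrow> ennreal) \<Rightarrow> real \<Rightarrow> 'a \<Rightarrow> 'a \<Rightarrow> ennreal" where
  "resolvent_kernel k \<alpha> x y = (\<integral>\<^sup>+t\<in>{0<..}. ennreal (exp (- \<alpha> * t)) * k t x y \<partial>lborel)"

text \<open>The heat kernel of the 1-subprocess.\<close>

definition subprocess1_kernel :: "(real \<Rightarrow> 'a \<Rightarrow> 'a \<Rightarrow> ennreal) \<Rightarrow> real \<Rightarrow> 'a \<Rightarrow> 'a \<Rightarrow> ennreal" where
  "subprocess1_kernel k t x y = ennreal (exp (- t)) * k t x y"

lemma resolvent_kernel_subprocess1:
  "resolvent_kernel (subprocess1_kernel k) \<alpha> = resolvent_kernel k (\<alpha> + 1)"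
proof (intro ext)
  fix x y
  have "ennreal (exp (- \<alpha> * t)) * (ennreal (exp (- t)) * k t x y) =
      ennreal (exp (- (\<alpha> + 1) * t)) * k t x y" for t
    by (simp add: mult.assoc[symmetric] ennreal_mult'[symmetric] exp_add[symmetric] algebra_simps)
  then show "resolvent_kernel (subprocess1_kernel k) \<alpha> x y = resolvent_kernel k (\<alpha> + 1) x y"
    unfolding resolvent_kernel_def subprocess1_kernel_def by simp
qed

definition kato_class :: "(real \<Rightarrow> 'a \<Rightarrow> 'a \<Rightarrow> ennreal) \<Rightarrow> real \<Rightarrow>
    'a::{metric_space, second_countable_topology} measure set" where
  "kato_class k p = {\<nu>. radon_measure \<nu> \<and>
     ((\<lambda>\<alpha>. SUP x. \<integral>\<^sup>+y. ennreal_powr (resolvent_kernel k \<alpha> x y) p \<partial>\<nu>) \<longlongrightarrow> 0) at_top}"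

text \<open>
  \<open>k\<close> is the heat kernel of a transient process, either the given one or its 1-subprocess (whose
  sets of capacity zero are the same).  As in Chen's definition, the class consists of smooth
  measures.  This cannot be dropped: a Dirac measure at a point of capacity zero would satisfy the
  remaining conditions vacuously, with \<open>K\<close> that point and \<open>\<delta> = 1\<close>.  Measures in \<^term>\<open>kato_class\<close>,
  and \<open>m\<close> itself, are smooth automatically.
\<close>

definition chen_green_tight_class :: "'a::{metric_space, second_countable_topology} measure \<Rightarrow>
    (('a \<Rightarrow> real) \<Rightarrow> ('a \<Rightarrow> real) \<Rightarrow> real) \<Rightarrow> ('a \<Rightarrow> real) set \<Rightarrow>
    (real \<Rightarrow> 'a \<Rightarrow> 'a \<Rightarrow> ennreal) \<Rightarrow> real \<Rightarrow> 'a measure set" where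
  "chen_green_tight_class m \<E> \<F> k p = {\<nu>. radon_measure \<nu> \<and> charges_no_null_capacity m \<E> \<F> \<nu> \<and>
     (\<forall>\<epsilon>>0. \<exists>K\<in>sets borel. emeasure \<nu> K < \<top> \<and> (\<exists>\<delta>>0. \<forall>B\<in>sets borel.
        B \<subseteq> K \<and> emeasure \<nu> B < ennreal \<delta> \<longrightarrow>
        (SUP x. \<integral>\<^sup>+y\<in>- K \<union> B. ennreal_powr (resolvent_kernel k 0 x y) p \<partial>\<nu>) < ennreal \<epsilon>))}"

end

theory Submission
  imports Defs "HOL-Library.Diagonal_Subsequence"
begin

text \<open>
  Write \<open>S\<^sub>t\<close> for the semigroup and \<open>R\<^sub>\<alpha>\<close> for the resolvent kernel.  The approximating forms
  \<open>(u - S\<^sub>t u, u) / t\<close> extend to an energy \<open>Q u\<close> in \<open>[0, \<infinity>]\<close> of arbitrary Borel functions, which is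
  lower semicontinuous under convergence almost everywhere and decreases under contractions, and
  \<open>Q\<^sub>\<alpha> u = Q u + \<alpha> \<parallel>u\<parallel>\<^sup>2\<close>.  For a finite measure \<open>\<sigma>\<close> one has
  \<open>(\<integral>u d\<sigma>)\<^sup>2 \<le> Q\<^sub>\<alpha> u \<integral>\<integral>R\<^sub>\<alpha> d\<sigma> d\<sigma>\<close>, by Cauchy--Schwarz for the approximating forms applied to Riemann sums
  of the potential of \<open>\<sigma>\<close>.  Choosing \<open>\<sigma> = |u|\<^sup>2\<^sup>p\<^sup>-\<^sup>1 \<nu>\<close> and using Schur's test turns
  \<open>\<integral>R\<^sub>\<alpha>(x, y)\<^sup>p \<nu>(dy) \<le> \<Theta>\<close> for all \<open>x\<close> into \<open>\<integral>|u|\<^sup>2\<^sup>p d\<nu> \<le> \<Theta> (Q\<^sub>\<alpha> u)\<^sup>p\<close>.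

  If \<open>\<mu>\<close> belongs to the Kato class, this inequality with \<open>\<alpha> \<rightarrow> \<infinity>\<close> reduces compactness for \<open>\<mu>\<close> to
  compactness for \<open>m\<close> with \<open>p = 1\<close>.  If \<open>\<mu>\<close> is Green-tight, the inequality makes the contribution of
  \<open>-K \<union> B\<close> small, and \<open>K\<close> consists of finitely many atoms and a part with bounded potentials.  Points
  of positive capacity have bounded evaluations, which settles the atoms.  On the other part
  \<open>R\<^sub>\<beta>\<close> is small for large \<open>\<beta>\<close> off a set of small measure, so that a truncation of \<open>u\<close> is close to its
  image under \<open>S\<^sub>1\<^sub>/\<^sub>\<beta>\<close>; for bounded sequences these images converge pointwise along a subsequence,
  because \<open>S\<^sub>t\<close> has integral kernels in \<open>L\<^sup>1(m)\<close>.
\<close>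

section \<open>Symmetric sub-Markovian kernels\<close>

text \<open>All estimates are made for core functions: these have values at single points, which
  matters because \<mu> may charge \<open>m\<close>-null sets. Quasi-continuous versions enter only
  when the result is transferred. One parameter \<alpha> serves both assertions: 0 for (1), and 1
  for (2), since the 1-subprocess has 0-order kernel \<open>R_1\<close>. For \<alpha> = 0 the energy
  controls no L2 norm. The substitute is a strictly positive weight g with int |u| g dm <= Gamma
  sqrt(Q u), called \<open>testable\<close>; transience enters only through it. It turns fast
  convergence in energy into convergence outside open sets of small capacity. Atoms have to be
  separated because Green-tightness bounds potentials only over sets of measure below \<delta>, and
  a heavy point lies in no such set. Its positive capacity comes from the smoothness of \<mu>.
  Compactness is obtained as a Cauchy estimate with two independent small numbers: one comes from
  the splitting of the space and is uniform along the sequence, the other from the index in the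
  sequence.\<close>

locale symmetric_kernel = sigma_finite_measure m
  for m :: "'a::{metric_space, second_countable_topology} measure" +
  fixes k :: "real \<Rightarrow> 'a \<Rightarrow> 'a \<Rightarrow> ennreal"
  assumes sets_m [measurable_cong]: "sets m = sets borel"
    and k_measurable: "(\<lambda>(t, x, y). k t x y) \<in> borel_measurable (borel \<Otimes>\<^sub>M borel \<Otimes>\<^sub>M borel)"
    and k_sym: "k t x y = k t y x"
    and k_sub: "(\<integral>\<^sup>+y. k t x y \<partial>m) \<le> 1"
    and k_CK: "t > 0 \<Longrightarrow> s > 0 \<Longrightarrow> k (t + s) x y = (\<integral>\<^sup>+z. k s x z * k t z y \<partial>m)"
begin

sublocale mm: pair_sigma_finite m m ..

lemma space_m [simp]: "space m = UNIV"
  using sets_eq_imp_space_eq[OF sets_m] by simp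

lemma k_meas [measurable]:
  assumes [measurable]: "f \<in> borel_measurable N" "g \<in> borel_measurable N" "h \<in> borel_measurable N"
  shows "(\<lambda>w. k (f w) (g w) (h w)) \<in> borel_measurable N"
proof -
  have "(\<lambda>w. (\<lambda>(t, x, y). k t x y) (f w, g w, h w)) \<in> borel_measurable N"
    by (rule measurable_compose[OF _ k_measurable]) measurable
  then show ?thesis by simp
qed

definition nnP :: "real \<Rightarrow> ('a \<Rightarrow> ennreal) \<Rightarrow> 'a \<Rightarrow> ennreal" where
  "nnP t f x = (\<integral>\<^sup>+y. k t x y * f y \<partial>m)"

lemma nnP_meas [measurable]:
  assumes [measurable]: "f \<in> borel_measurable borel" "g \<in> borel_measurable N" "h \<in> borel_measurable N"
  shows "(\<lambda>w. nnP (h w) f (g w)) \<in> borel_measurable N"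
  unfolding nnP_def by measurable

lemma nnP_sym:
  assumes [measurable]: "f \<in> borel_measurable borel" "g \<in> borel_measurable borel"
  shows "(\<integral>\<^sup>+x. f x * nnP t g x \<partial>m) = (\<integral>\<^sup>+x. nnP t f x * g x \<partial>m)"
proof -
  have "(\<integral>\<^sup>+x. f x * nnP t g x \<partial>m) = (\<integral>\<^sup>+x. \<integral>\<^sup>+y. f x * (k t x y * g y) \<partial>m \<partial>m)"
    unfolding nnP_def by (simp add: nn_integral_cmult)
  also have "\<dots> = (\<integral>\<^sup>+y. \<integral>\<^sup>+x. f x * (k t x y * g y) \<partial>m \<partial>m)"
    by (rule mm.Fubini') measurable
  also have "\<dots> = (\<integral>\<^sup>+y. nnP t f y * g y \<partial>m)"
    unfolding nnP_def by (subst nn_integral_multc[symmetric]) (auto simp: k_sym ac_simps intro!: nn_integral_cong)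
  finally show ?thesis .
qed

lemma nnP_nnP:
  assumes [measurable]: "f \<in> borel_measurable borel" and "t > 0" "s > 0"
  shows "nnP t (nnP s f) x = nnP (t + s) f x"
proof -
  have "nnP t (nnP s f) x = (\<integral>\<^sup>+z. \<integral>\<^sup>+y. k t x z * (k s z y * f y) \<partial>m \<partial>m)"
    unfolding nnP_def by (simp add: nn_integral_cmult)
  also have "\<dots> = (\<integral>\<^sup>+y. \<integral>\<^sup>+z. k t x z * (k s z y * f y) \<partial>m \<partial>m)"
    by (rule mm.Fubini') measurable
  also have "\<dots> = (\<integral>\<^sup>+y. (\<integral>\<^sup>+z. k t x z * k s z y \<partial>m) * f y \<partial>m)"
    by (subst nn_integral_multc[symmetric]) (auto simp: ac_simps)
  also have "\<dots> = nnP (t + s) f x"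
    unfolding nnP_def using k_CK[of s t x] assms by (simp add: add.commute)
  finally show ?thesis .
qed

lemma nnP_cong_AE: "AE y in m. f y = g y \<Longrightarrow> nnP t f x = nnP t g x"
  unfolding nnP_def by (intro nn_integral_cong_AE) auto

text \<open>Cauchy-Schwarz for f against 1 under the measure with density \<open>k t x\<close>,
  whose mass is at most 1.\<close>

lemma nnP_square:
  assumes [measurable]: "f \<in> borel_measurable borel"
  shows "(nnP t f x)\<^sup>2 \<le> nnP t (\<lambda>y. (f y)\<^sup>2) x"
proof -
  let ?K = "density m (k t x)"
  have e: "(\<integral>\<^sup>+y. h y \<partial>?K) = nnP t h x" if [measurable]: "h \<in> borel_measurable borel" for h
    unfolding nnP_def by (subst nn_integral_density) auto
  have "(\<integral>\<^sup>+y. f y * 1 \<partial>?K)\<^sup>2 \<le> (\<integral>\<^sup>+y. (f y)\<^sup>2 \<partial>?K) * (\<integral>\<^sup>+y. 1\<^sup>2 \<partial>?K)"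
    by (rule Cauchy_Schwarz_nn_integral) auto
  also have "(\<integral>\<^sup>+y. 1\<^sup>2 \<partial>?K) \<le> 1"
    using k_sub[of t x] by (simp only: e[of "\<lambda>y. 1\<^sup>2"] borel_measurable_const nnP_def) simp
  then have "(\<integral>\<^sup>+y. (f y)\<^sup>2 \<partial>?K) * (\<integral>\<^sup>+y. 1\<^sup>2 \<partial>?K) \<le> (\<integral>\<^sup>+y. (f y)\<^sup>2 \<partial>?K) * 1"
    by (intro mult_left_mono) auto
  finally show ?thesis by (simp add: e)
qed

text \<open>Symmetry moves the semigroup onto the constant 1, where \<open>k_sub\<close>
  applies.\<close>

lemma nnP_integral_le:
  assumes [measurable]: "f \<in> borel_measurable borel"
  shows "(\<integral>\<^sup>+x. nnP t f x \<partial>m) \<le> (\<integral>\<^sup>+x. f x \<partial>m)"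
proof -
  have "(\<integral>\<^sup>+x. nnP t f x \<partial>m) = (\<integral>\<^sup>+x. nnP t (\<lambda>_. 1) x * f x \<partial>m)"
    using nnP_sym[of "\<lambda>_. 1" f t] by simp
  also have "\<dots> \<le> (\<integral>\<^sup>+x. 1 * f x \<partial>m)"
    using k_sub by (intro nn_integral_mono mult_right_mono) (auto simp: nnP_def)
  finally show ?thesis by simp
qed

lemma nnP_square_integral_le:
  assumes [measurable]: "f \<in> borel_measurable borel"
  shows "(\<integral>\<^sup>+x. (nnP t f x)\<^sup>2 \<partial>m) \<le> (\<integral>\<^sup>+x. (f x)\<^sup>2 \<partial>m)"
proof -
  have "(\<integral>\<^sup>+x. (nnP t f x)\<^sup>2 \<partial>m) \<le> (\<integral>\<^sup>+x. nnP t (\<lambda>y. (f y)\<^sup>2) x \<partial>m)"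
    by (intro nn_integral_mono nnP_square assms)
  also have "\<dots> \<le> (\<integral>\<^sup>+x. (f x)\<^sup>2 \<partial>m)"
    by (rule nnP_integral_le) measurable
  finally show ?thesis .
qed

section \<open>The semigroup on square integrable functions\<close>

text \<open>\<open>enn2real\<close> sends the value infinity to 0. By \<open>k_AE_finite\<close>
  this alters \<open>k t x\<close> on a null set only, so integrals against \<open>kr\<close> and
  \<open>k\<close> agree (\<open>nnP_kr\<close>).\<close>

definition kr :: "real \<Rightarrow> 'a \<Rightarrow> 'a \<Rightarrow> real" where "kr t x y = enn2real (k t x y)"
definition S :: "real \<Rightarrow> ('a \<Rightarrow> real) \<Rightarrow> 'a \<Rightarrow> real" where "S t u x = (\<integral>y. kr t x y * u y \<partial>m)"
definition L2 :: "('a \<Rightarrow> real) set" where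
  "L2 = {u \<in> borel_measurable borel. integrable m (\<lambda>x. (u x)\<^sup>2)}"
definition ip :: "('a \<Rightarrow> real) \<Rightarrow> ('a \<Rightarrow> real) \<Rightarrow> real" where "ip u v = (\<integral>x. u x * v x \<partial>m)"
definition nsq :: "('a \<Rightarrow> real) \<Rightarrow> ennreal" where "nsq u = (\<integral>\<^sup>+x. ennreal ((u x)\<^sup>2) \<partial>m)"

lemma kr_nonneg [simp]: "0 \<le> kr t x y" by (simp add: kr_def)
lemma kr_sym: "kr t x y = kr t y x" by (simp add: kr_def k_sym)
lemma kr_meas [measurable]:
  assumes [measurable]: "f \<in> borel_measurable N" "g \<in> borel_measurable N" "h \<in> borel_measurable N"
  shows "(\<lambda>w. kr (f w) (g w) (h w)) \<in> borel_measurable N"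
  unfolding kr_def by measurable

lemma S_meas [measurable]:
  assumes [measurable]: "u \<in> borel_measurable borel" "f \<in> borel_measurable N" "g \<in> borel_measurable N"
  shows "(\<lambda>w. S (f w) u (g w)) \<in> borel_measurable N"
  unfolding S_def by measurable

lemma k_AE_finite: "AE y in m. k t x y < \<top>"
proof -
  have "(\<integral>\<^sup>+y. k t x y \<partial>m) \<noteq> \<top>" using k_sub[of t x] by (auto simp: top_unique)
  then show ?thesis
    using nn_integral_PInf_AE[of "k t x" m] by (simp add: less_top)
qed

lemma nnP_kr: "nnP t f x = (\<integral>\<^sup>+y. ennreal (kr t x y) * f y \<partial>m)"
  unfolding nnP_def using k_AE_finite[of t x]
  by (intro nn_integral_cong_AE) (auto simp: kr_def)

lemma L2_borel [measurable_dest]: "u \<in> L2 \<Longrightarrow> u \<in> borel_measurable borel" by (simp add: L2_def)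

lemma L2_iff: "u \<in> L2 \<longleftrightarrow> u \<in> borel_measurable borel \<and> nsq u < \<top>"
  unfolding L2_def nsq_def by (auto simp: integrable_iff_bounded)

lemma nsq_L2: "u \<in> L2 \<Longrightarrow> nsq u = ennreal (ip u u)"
  unfolding L2_def nsq_def ip_def by (simp add: power2_eq_square nn_integral_eq_integral)

lemma L2_integrable_mult: "u \<in> L2 \<Longrightarrow> v \<in> L2 \<Longrightarrow> integrable m (\<lambda>x. u x * v x)"
proof (rule Bochner_Integration.integrable_bound)
  show "integrable m (\<lambda>x. (u x)\<^sup>2 + (v x)\<^sup>2)" if "u \<in> L2" "v \<in> L2"
    using that by (simp add: L2_def)
  have "\<bar>a * b\<bar> \<le> a\<^sup>2 + b\<^sup>2" for a b :: real
  proof -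
    have "2 * \<bar>a * b\<bar> \<le> a\<^sup>2 + b\<^sup>2"
      using sum_squares_bound[of "\<bar>a\<bar>" "\<bar>b\<bar>"] by (simp add: abs_mult)
    then show ?thesis using abs_ge_zero[of "a * b"] by linarith
  qed
  then show "AE x in m. norm (u x * v x) \<le> norm ((u x)\<^sup>2 + (v x)\<^sup>2)" if "u \<in> L2" "v \<in> L2"
    by auto
qed (auto dest: L2_borel)

lemma L2_add: assumes "u \<in> L2" "v \<in> L2" shows "(\<lambda>x. u x + v x) \<in> L2"
proof -
  have "integrable m (\<lambda>x. (u x)\<^sup>2 + (v x)\<^sup>2 + 2 * (u x * v x))"
    using assms L2_integrable_mult[OF assms] by (auto simp: L2_def)
  then have "integrable m (\<lambda>x. (u x + v x)\<^sup>2)" by (simp add: power2_sum mult.assoc)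
  with assms show ?thesis by (auto simp: L2_def intro: borel_measurable_add)
qed
lemma L2_scale: "u \<in> L2 \<Longrightarrow> (\<lambda>x. c * u x) \<in> L2"
  by (auto simp: L2_def power_mult_distrib)
lemma L2_diff: "u \<in> L2 \<Longrightarrow> v \<in> L2 \<Longrightarrow> (\<lambda>x. u x - v x) \<in> L2"
  using L2_add[of u "\<lambda>x. (-1) * v x"] L2_scale[of v "-1"] by simp
lemma L2_zero: "(\<lambda>x. 0) \<in> L2" by (simp add: L2_def)
lemma L2_dominated:
  assumes "u \<in> L2" "v \<in> borel_measurable borel" "\<And>x. \<bar>v x\<bar> \<le> \<bar>u x\<bar>" shows "v \<in> L2"
proof -
  have "integrable m (\<lambda>x. (v x)\<^sup>2)"
    by (rule Bochner_Integration.integrable_bound[of _ "\<lambda>x. (u x)\<^sup>2"])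
      (use assms in \<open>auto simp: L2_def abs_le_square_iff[symmetric]\<close>)
  with assms show ?thesis by (simp add: L2_def)
qed
lemma L2_abs: "u \<in> L2 \<Longrightarrow> (\<lambda>x. \<bar>u x\<bar>) \<in> L2"
  by (auto simp: L2_def)

lemma ip_add: "u \<in> L2 \<Longrightarrow> v \<in> L2 \<Longrightarrow> w \<in> L2 \<Longrightarrow> ip (\<lambda>x. u x + v x) w = ip u w + ip v w"
  unfolding ip_def by (simp add: distrib_right L2_integrable_mult)
lemma ip_scale: "ip (\<lambda>x. c * u x) w = c * ip u w"
  unfolding ip_def by (simp add: mult.assoc)
lemma ip_sym: "ip u v = ip v u" unfolding ip_def by (simp add: mult.commute)
lemma ip_diff: "u \<in> L2 \<Longrightarrow> v \<in> L2 \<Longrightarrow> w \<in> L2 \<Longrightarrow> ip (\<lambda>x. u x - v x) w = ip u w - ip v w"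
  unfolding ip_def by (simp add: left_diff_distrib L2_integrable_mult)
lemma ip_nonneg: "0 \<le> ip u u" unfolding ip_def by simp
lemma ip_cong:
  assumes "AE x in m. u x = u' x" "AE x in m. v x = v' x"
    "u \<in> borel_measurable borel" "u' \<in> borel_measurable borel"
    "v \<in> borel_measurable borel" "v' \<in> borel_measurable borel"
  shows "ip u v = ip u' v'"
  unfolding ip_def using assms by (intro integral_cong_AE) (auto, measurable)

lemma CS_real:
  fixes A B C :: real
  assumes h: "\<And>\<theta>. A + 2 * \<theta> * B + \<theta>\<^sup>2 * C \<ge> 0" and C: "C \<ge> 0" shows "B\<^sup>2 \<le> A * C"
proof (cases "C = 0")
  case True
  have "B = 0"
  proof (rule ccontr)
    assume b: "B \<noteq> 0"
    \<comment> \<open>With C = 0 the hypothesis is affine in \<theta>; this choice gives it the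
      value -1.\<close>
    define \<theta> where "\<theta> = - (A + 1) / (2 * B)"
    have "2 * \<theta> * B = - (A + 1)" using b by (simp add: \<theta>_def)
    then show False using h[of \<theta>] True by simp
  qed
  then show ?thesis using True by simp
next
  case False
  define q where "q = B / C"
  have B: "B = q * C" using False by (simp add: q_def)
  have "0 \<le> A + 2 * (- q) * (q * C) + (- q)\<^sup>2 * C" using h[of "- q"] unfolding B .
  then have "q\<^sup>2 * C \<le> A" by (simp add: power2_eq_square ac_simps)
  then have "q\<^sup>2 * C * C \<le> A * C" using C by (rule mult_right_mono)
  then show ?thesis unfolding B by (simp add: power2_eq_square ac_simps)
qed

lemma nn_abs_eq_ip:
  assumes [measurable]: "u \<in> borel_measurable borel" "v \<in> borel_measurable borel"
    and "integrable m (\<lambda>x. u x * v x)" "\<And>x. 0 \<le> u x" "\<And>x. 0 \<le> v x"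
  shows "(\<integral>\<^sup>+x. ennreal (u x) * ennreal (v x) \<partial>m) = ennreal (ip u v)"
  unfolding ip_def using assms by (simp add: ennreal_mult[symmetric] nn_integral_eq_integral)

lemma nn_CS_finite:
  assumes "u \<in> L2" and [measurable]: "f \<in> borel_measurable borel" and "(\<integral>\<^sup>+x. (f x)\<^sup>2 \<partial>m) < \<top>"
  shows "(\<integral>\<^sup>+x. ennreal \<bar>u x\<bar> * f x \<partial>m) < \<top>"
proof -
  have [measurable]: "u \<in> borel_measurable borel" using assms by (simp add: L2_borel)
  have "(\<integral>\<^sup>+x. ennreal \<bar>u x\<bar> * f x \<partial>m)\<^sup>2 \<le> nsq u * (\<integral>\<^sup>+x. (f x)\<^sup>2 \<partial>m)"
    using Cauchy_Schwarz_nn_integral[of "\<lambda>x. ennreal \<bar>u x\<bar>" m f]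
    by (simp add: nsq_def ennreal_power)
  also have "\<dots> < \<top>" using assms by (auto simp: L2_iff ennreal_mult_less_top)
  finally show ?thesis by (auto simp: power2_eq_square ennreal_mult_less_top less_top[symmetric])
qed

lemma nnP_L2: assumes "u \<in> L2" shows "(\<integral>\<^sup>+x. (nnP t (\<lambda>y. ennreal \<bar>u y\<bar>) x)\<^sup>2 \<partial>m) < \<top>"
proof -
  have [measurable]: "u \<in> borel_measurable borel" using assms by (simp add: L2_borel)
  have "(\<integral>\<^sup>+x. (nnP t (\<lambda>y. ennreal \<bar>u y\<bar>) x)\<^sup>2 \<partial>m) \<le> nsq u"
    using nnP_square_integral_le[of "\<lambda>y. ennreal \<bar>u y\<bar>" t] by (simp add: nsq_def ennreal_power)
  then show ?thesis using assms by (auto simp: L2_iff)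
qed

lemma nnP_AE_finite: assumes "u \<in> L2" shows "AE x in m. nnP t (\<lambda>y. ennreal \<bar>u y\<bar>) x < \<top>"
proof -
  have [measurable]: "u \<in> borel_measurable borel" using assms by (simp add: L2_borel)
  have "AE x in m. (nnP t (\<lambda>y. ennreal \<bar>u y\<bar>) x)\<^sup>2 \<noteq> \<infinity>"
    using nnP_L2[OF assms, of t] by (intro nn_integral_PInf_AE) auto
  then show ?thesis by eventually_elim (auto simp: less_top[symmetric] power2_eq_square ennreal_mult_eq_top_iff)
qed

lemma S_integrable:
  assumes [measurable]: "u \<in> borel_measurable borel" and "nnP t (\<lambda>y. ennreal \<bar>u y\<bar>) x < \<top>"
  shows "integrable m (\<lambda>y. kr t x y * u y)"
  using assms unfolding integrable_iff_bounded nnP_kr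
  by (auto simp: abs_mult ennreal_mult)

lemma S_AE_integrable: "u \<in> L2 \<Longrightarrow> AE x in m. integrable m (\<lambda>y. kr t x y * u y)"
  using nnP_AE_finite[of u t] by (auto intro: S_integrable[OF L2_borel])

lemma S_abs_le:
  assumes [measurable]: "u \<in> borel_measurable borel"
  shows "ennreal \<bar>S t u x\<bar> \<le> nnP t (\<lambda>y. ennreal \<bar>u y\<bar>) x"
proof -
  have "ennreal \<bar>S t u x\<bar> \<le> (\<integral>\<^sup>+y. ennreal (norm (kr t x y * u y)) \<partial>m)"
    unfolding S_def using integral_norm_bound_ennreal[of m "\<lambda>y. kr t x y * u y"]
    by (cases "integrable m (\<lambda>y. kr t x y * u y)") (auto simp: not_integrable_integral_eq)
  then show ?thesis by (simp add: nnP_kr abs_mult ennreal_mult)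
qed

lemma S_square_le:
  assumes "u \<in> borel_measurable borel"
  shows "ennreal ((S t u x)\<^sup>2) \<le> (nnP t (\<lambda>y. ennreal \<bar>u y\<bar>) x)\<^sup>2"
proof -
  have "ennreal ((S t u x)\<^sup>2) = (ennreal \<bar>S t u x\<bar>)\<^sup>2" by (simp add: ennreal_power)
  also have "\<dots> \<le> (nnP t (\<lambda>y. ennreal \<bar>u y\<bar>) x)\<^sup>2"
    by (intro power_mono S_abs_le assms) simp
  finally show ?thesis .
qed

lemma S_nn:
  assumes [measurable]: "u \<in> borel_measurable borel" and "\<And>x. 0 \<le> u x"
  shows "S t u x = enn2real (nnP t (\<lambda>y. ennreal (u y)) x)"
  unfolding S_def nnP_kr using assms
  by (subst integral_eq_nn_integral) (auto simp: ennreal_mult)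

lemma S_nonneg: "(\<And>x. 0 \<le> u x) \<Longrightarrow> 0 \<le> S t u x"
  unfolding S_def by (intro integral_nonneg_AE) auto

lemma S_L2: assumes "u \<in> L2" shows "S t u \<in> L2"
proof -
  have [measurable]: "u \<in> borel_measurable borel" using assms by (simp add: L2_borel)
  have "nsq (S t u) \<le> (\<integral>\<^sup>+x. (nnP t (\<lambda>y. ennreal \<bar>u y\<bar>) x)\<^sup>2 \<partial>m)"
    unfolding nsq_def by (intro nn_integral_mono S_square_le) measurable
  also have "\<dots> < \<top>" by (rule nnP_L2[OF assms])
  finally show ?thesis by (simp add: L2_iff)
qed

lemma nsq_S_le: assumes "u \<in> L2" shows "ip (S t u) (S t u) \<le> ip u u"
proof -
  have [measurable]: "u \<in> borel_measurable borel" using assms by (simp add: L2_borel)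
  have "nsq (S t u) \<le> (\<integral>\<^sup>+x. (nnP t (\<lambda>y. ennreal \<bar>u y\<bar>) x)\<^sup>2 \<partial>m)"
    unfolding nsq_def by (intro nn_integral_mono S_square_le) measurable
  also have "\<dots> \<le> nsq u"
    using nnP_square_integral_le[of "\<lambda>y. ennreal \<bar>u y\<bar>" t] by (simp add: nsq_def ennreal_power)
  finally show ?thesis using assms S_L2[OF assms] ip_nonneg by (simp add: nsq_L2)
qed

lemma S_add:
  assumes "u \<in> L2" "v \<in> L2"
  shows "AE x in m. S t (\<lambda>y. u y + v y) x = S t u x + S t v x"
  using S_AE_integrable[OF assms(1), of t] S_AE_integrable[OF assms(2), of t]
  by eventually_elim (simp add: S_def distrib_left)

lemma S_diff:
  assumes "u \<in> L2" "v \<in> L2"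
  shows "AE x in m. S t (\<lambda>y. u y - v y) x = S t u x - S t v x"
  using S_AE_integrable[OF assms(1), of t] S_AE_integrable[OF assms(2), of t]
  by eventually_elim (simp add: S_def right_diff_distrib)

lemma S_cong: "AE x in m. u x = v x \<Longrightarrow> u \<in> borel_measurable borel \<Longrightarrow> v \<in> borel_measurable borel \<Longrightarrow> S t u x = S t v x"
  unfolding S_def by (intro integral_cong_AE) auto

lemma pair_integrable:
  assumes "u \<in> L2" "v \<in> L2"
  shows "integrable (m \<Otimes>\<^sub>M m) (\<lambda>(x, y). kr t x y * u x * v y)"
proof -
  have [measurable]: "u \<in> borel_measurable borel" "v \<in> borel_measurable borel"
    using assms by (simp_all add: L2_borel)
  have "(\<integral>\<^sup>+z. ennreal (norm (case z of (x, y) \<Rightarrow> kr t x y * u x * v y)) \<partial>(m \<Otimes>\<^sub>M m)) =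
     (\<integral>\<^sup>+x. \<integral>\<^sup>+y. ennreal \<bar>u x\<bar> * (ennreal (kr t x y) * ennreal \<bar>v y\<bar>) \<partial>m \<partial>m)"
    by (subst nn_integral_fst[symmetric]) (auto simp: abs_mult ennreal_mult ac_simps)
  also have "\<dots> = (\<integral>\<^sup>+x. ennreal \<bar>u x\<bar> * nnP t (\<lambda>y. ennreal \<bar>v y\<bar>) x \<partial>m)"
    by (simp add: nnP_kr nn_integral_cmult)
  also have "\<dots> < \<top>"
    using assms by (intro nn_CS_finite nnP_L2) auto
  finally show ?thesis by (auto simp: integrable_iff_bounded)
qed

lemma ip_S_pair:
  assumes "u \<in> L2" "v \<in> L2"
  shows "ip u (S t v) = (\<integral>(x, y). kr t x y * u x * v y \<partial>(m \<Otimes>\<^sub>M m))"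
proof -
  have "(\<integral>(x, y). kr t x y * u x * v y \<partial>(m \<Otimes>\<^sub>M m)) = (\<integral>x. (\<integral>y. kr t x y * u x * v y \<partial>m) \<partial>m)"
    using mm.integral_fst'[OF pair_integrable[OF assms, of t]] by simp
  also have "\<dots> = ip u (S t v)"
    unfolding ip_def S_def by (simp add: mult.assoc mult.left_commute[of _ "u _"])
  finally show ?thesis by simp
qed

lemma S_sym:
  assumes "u \<in> L2" "v \<in> L2" shows "ip (S t u) v = ip u (S t v)"
proof -
  have [measurable]: "u \<in> borel_measurable borel" "v \<in> borel_measurable borel"
    using assms by (simp_all add: L2_borel)
  have "ip (S t u) v = ip v (S t u)" by (rule ip_sym)
  also have "\<dots> = (\<integral>z. (case z of (x, y) \<Rightarrow> kr t x y * v x * u y) \<partial>(m \<Otimes>\<^sub>M m))"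
    by (rule ip_S_pair[OF assms(2,1)])
  also have "\<dots> = (\<integral>z. (case z of (x, y) \<Rightarrow> kr t y x * v y * u x) \<partial>(m \<Otimes>\<^sub>M m))"
    by (subst mm.integral_product_swap[symmetric]) (simp_all add: case_prod_beta)
  also have "\<dots> = (\<integral>z. (case z of (x, y) \<Rightarrow> kr t x y * u x * v y) \<partial>(m \<Otimes>\<^sub>M m))"
    by (intro Bochner_Integration.integral_cong refl) (simp add: case_prod_beta kr_sym[of t "snd _" "fst _"] ac_simps)
  also have "\<dots> = ip u (S t v)"
    by (rule ip_S_pair[OF assms, symmetric])
  finally show ?thesis .
qed

lemma S_S:
  assumes "u \<in> L2" "t > 0" "s > 0"
  shows "AE x in m. S t (S s u) x = S (t + s) u x"
proof -
  \<comment> \<open>For non-negative v the operator \<open>S\<close> is \<open>nnP\<close> read as a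
    real number, and the almost everywhere finiteness of \<open>nnP s v\<close> allows the inner
    conversion to be undone. The general case follows by splitting u into positive and negative
    part.\<close>
  have nn: "AE x in m. S t (S s v) x = S (t + s) v x" if v: "v \<in> L2" and pos: "\<And>x. 0 \<le> v x" for v
  proof -
    have [measurable]: "v \<in> borel_measurable borel" using v by (simp add: L2_borel)
    have f: "AE x in m. nnP s (\<lambda>y. ennreal (v y)) x < \<top>"
      using nnP_AE_finite[OF v, of s] pos by simp
    have "S t (S s v) x = S (t + s) v x" for x
    proof -
      have "S t (S s v) x = enn2real (nnP t (\<lambda>y. ennreal (S s v y)) x)"
        using pos by (intro S_nn S_nonneg) auto
      also have "nnP t (\<lambda>y. ennreal (S s v y)) x = nnP t (nnP s (\<lambda>y. ennreal (v y))) x"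
        by (intro nnP_cong_AE, use f in eventually_elim) (auto simp: S_nn[OF _ pos])
      finally show ?thesis using assms S_nn[of v "t + s" x] pos by (simp add: nnP_nnP)
    qed
    then show ?thesis by simp
  qed
  have [measurable]: "u \<in> borel_measurable borel" using assms by (simp add: L2_borel)
  define p where "p = (\<lambda>x. max 0 (u x))"
  define n where "n = (\<lambda>x. max 0 (- u x))"
  have [measurable]: "p \<in> borel_measurable borel" "n \<in> borel_measurable borel"
    unfolding p_def n_def by measurable
  have p: "p \<in> L2" "\<And>x. 0 \<le> p x" by (auto simp: p_def intro!: L2_dominated[OF assms(1)])
  have n: "n \<in> L2" "\<And>x. 0 \<le> n x" by (auto simp: n_def intro!: L2_dominated[OF assms(1)])
  have u: "u = (\<lambda>x. p x - n x)" by (auto simp: p_def n_def)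
  have "AE x in m. S s u x = S s p x - S s n x"
    unfolding u using p n by (intro S_diff) auto
  then have 1: "S t (S s u) x = S t (\<lambda>y. S s p y - S s n y) x" for x
    by (rule S_cong) (use L2_borel[OF p(1)] L2_borel[OF n(1)] in measurable)
  have 2: "AE x in m. S t (\<lambda>y. S s p y - S s n y) x = S t (S s p) x - S t (S s n) x"
    using p n by (intro S_diff S_L2)
  have 3: "AE x in m. S (t + s) u x = S (t + s) p x - S (t + s) n x"
    unfolding u using p n by (intro S_diff) auto
  from 2 3 nn[OF p] nn[OF n] show ?thesis
    by eventually_elim (simp add: 1)
qed

lemma ip_S_S:
  assumes "u \<in> L2" "v \<in> L2" "a > 0" "b > 0"
  shows "ip (S a u) (S b v) = ip u (S (a + b) v)"
proof -
  have "ip (S a u) (S b v) = ip u (S a (S b v))" using assms by (intro S_sym S_L2)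
  also have "\<dots> = ip u (S (a + b) v)"
    using S_S[OF assms(2,3,4)] assms by (intro ip_cong) (auto intro!: L2_borel S_L2)
  finally show ?thesis .
qed

lemma ip_S_half: "u \<in> L2 \<Longrightarrow> t > 0 \<Longrightarrow> ip u (S t u) = ip (S (t / 2) u) (S (t / 2) u)"
  using ip_S_S[of u u "t / 2" "t / 2"] by simp

lemma ip_S_nonneg: "u \<in> L2 \<Longrightarrow> t > 0 \<Longrightarrow> 0 \<le> ip u (S t u)"
  by (simp add: ip_S_half ip_nonneg)

lemma ip_S_le: "u \<in> L2 \<Longrightarrow> t > 0 \<Longrightarrow> ip u (S t u) \<le> ip u u"
  by (simp add: ip_S_half nsq_S_le)

text \<open>By \<open>ip_S_half\<close> both sides are squared norms, of S_{t/2} u = S_d S_{s/2} u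
  and of S_{s/2} u with d = (t - s) / 2, and S_d is a contraction.\<close>

lemma ip_S_decreasing:
  assumes "u \<in> L2" "0 < s" "s \<le> t" shows "ip u (S t u) \<le> ip u (S s u)"
proof (cases "s = t")
  case False
  define d where "d = (t - s) / 2"
  have d: "d > 0" "d + s / 2 = t / 2" using assms False by (auto simp: d_def field_simps)
  have "ip u (S t u) = ip (S (t / 2) u) (S (t / 2) u)" using assms by (intro ip_S_half) auto
  also have "\<dots> = ip (S d (S (s / 2) u)) (S d (S (s / 2) u))"
    using S_S[of u d "s / 2"] d assms by (intro ip_cong) (auto intro!: L2_borel S_L2)
  also have "\<dots> \<le> ip (S (s / 2) u) (S (s / 2) u)" using assms by (intro nsq_S_le S_L2)
  also have "\<dots> = ip u (S s u)" using assms by (simp add: ip_S_half)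
  finally show ?thesis .
qed simp

section \<open>The energy of a Borel function\<close>

text \<open>For a(x,y) = (u x - u y)^2 and b(x) = (u x)^2 this is (u - S_t u, u), written as a jump
  part plus a killing part (see \<open>Phi_L2\<close>). Both integrands are non-negative, so the
  expression has a meaning for every Borel function. Keeping a and b abstract lets series and lower
  limits pass through.\<close>

definition Phi :: "real \<Rightarrow> ('a \<Rightarrow> 'a \<Rightarrow> ennreal) \<Rightarrow> ('a \<Rightarrow> ennreal) \<Rightarrow> ennreal" where
  "Phi t a b = ennreal (1 / 2) * (\<integral>\<^sup>+x. \<integral>\<^sup>+y. k t x y * a x y \<partial>m \<partial>m) +
     (\<integral>\<^sup>+x. (1 - (\<integral>\<^sup>+y. k t x y \<partial>m)) * b x \<partial>m)"

definition Qt :: "real \<Rightarrow> ('a \<Rightarrow> real) \<Rightarrow> ennreal" where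
  "Qt t u = ennreal (1 / t) * Phi t (\<lambda>x y. ennreal ((u x - u y)\<^sup>2)) (\<lambda>x. ennreal ((u x)\<^sup>2))"

text \<open>A supremum instead of the limit t -> 0: it always exists, and it preserves inequalities
  and lower semicontinuity. On \<open>L2\<close> the two agree by \<open>Q_tendsto\<close>.\<close>

definition Q :: "('a \<Rightarrow> real) \<Rightarrow> ennreal" where "Q u = (SUP t\<in>{0<..}. Qt t u)"

definition Qa :: "real \<Rightarrow> ('a \<Rightarrow> real) \<Rightarrow> ennreal" where "Qa \<alpha> u = Q u + ennreal \<alpha> * nsq u"

lemma Phi_mono: "(\<And>x y. a x y \<le> a' x y) \<Longrightarrow> (\<And>x. b x \<le> b' x) \<Longrightarrow> Phi t a b \<le> Phi t a' b'"
  unfolding Phi_def by (intro add_mono mult_left_mono nn_integral_mono) auto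

lemma Phi_suminf:
  assumes [measurable]: "\<And>j. (\<lambda>(x, y). a j x y) \<in> borel_measurable (borel \<Otimes>\<^sub>M borel)"
    "\<And>j. b j \<in> borel_measurable borel"
  shows "Phi t (\<lambda>x y. \<Sum>j. a j x y) (\<lambda>x. \<Sum>j. b j x) = (\<Sum>j. Phi t (a j) (b j))"
proof -
  have 1: "(\<integral>\<^sup>+x. \<integral>\<^sup>+y. k t x y * (\<Sum>j. a j x y) \<partial>m \<partial>m) = (\<Sum>j. \<integral>\<^sup>+x. \<integral>\<^sup>+y. k t x y * a j x y \<partial>m \<partial>m)"
    by (simp del: ennreal_suminf_cmult add: ennreal_suminf_cmult[symmetric] nn_integral_suminf)
  have 2: "(\<integral>\<^sup>+x. (1 - (\<integral>\<^sup>+y. k t x y \<partial>m)) * (\<Sum>j. b j x) \<partial>m) =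
      (\<Sum>j. \<integral>\<^sup>+x. (1 - (\<integral>\<^sup>+y. k t x y \<partial>m)) * b j x \<partial>m)"
    by (simp del: ennreal_suminf_cmult add: ennreal_suminf_cmult[symmetric] nn_integral_suminf)
  show ?thesis
    unfolding Phi_def 1 2 by (simp add: suminf_add[symmetric])
qed

lemma Qt_le_Q: "t > 0 \<Longrightarrow> Qt t u \<le> Q u" unfolding Q_def by (intro SUP_upper) auto

lemma Q_le_Qa: "Q u \<le> Qa \<alpha> u" by (simp add: Qa_def)

lemma nsq_dominated:
  assumes [measurable]: "\<And>j. v j \<in> borel_measurable borel"
    and "\<And>x. ennreal ((u x)\<^sup>2) \<le> (\<Sum>j. ennreal ((v j x)\<^sup>2))"
  shows "nsq u \<le> (\<Sum>j. nsq (v j))"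
proof -
  have "nsq u \<le> (\<integral>\<^sup>+x. (\<Sum>j. ennreal ((v j x)\<^sup>2)) \<partial>m)"
    unfolding nsq_def using assms(2) by (intro nn_integral_mono)
  also have "\<dots> = (\<Sum>j. nsq (v j))" unfolding nsq_def by (simp add: nn_integral_suminf)
  finally show ?thesis .
qed

text \<open>The contraction property of the form, stated with countably many functions on the right
  so that it also covers countable suprema (\<open>Qa_sup1\<close>).\<close>

lemma Q_dominated:
  assumes [measurable]: "\<And>j. v j \<in> borel_measurable borel"
    and "\<And>x y. ennreal ((u x - u y)\<^sup>2) \<le> (\<Sum>j. ennreal ((v j x - v j y)\<^sup>2))"
    and "\<And>x. ennreal ((u x)\<^sup>2) \<le> (\<Sum>j. ennreal ((v j x)\<^sup>2))"
  shows "Q u \<le> (\<Sum>j. Q (v j))"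
  unfolding Q_def[of u]
proof (rule SUP_least)
  fix t :: real assume t: "t \<in> {0<..}"
  have "Phi t (\<lambda>x y. ennreal ((u x - u y)\<^sup>2)) (\<lambda>x. ennreal ((u x)\<^sup>2)) \<le>
      Phi t (\<lambda>x y. \<Sum>j. ennreal ((v j x - v j y)\<^sup>2)) (\<lambda>x. \<Sum>j. ennreal ((v j x)\<^sup>2))"
    using assms by (intro Phi_mono)
  also have "\<dots> = (\<Sum>j. Phi t (\<lambda>x y. ennreal ((v j x - v j y)\<^sup>2)) (\<lambda>x. ennreal ((v j x)\<^sup>2)))"
    by (rule Phi_suminf) measurable
  finally have "Qt t u \<le> (\<Sum>j. Qt t (v j))"
    unfolding Qt_def by (simp add: ennreal_suminf_cmult mult_left_mono)
  also have "\<dots> \<le> (\<Sum>j. Q (v j))"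
    using t by (intro suminf_le Qt_le_Q) auto
  finally show "Qt t u \<le> (\<Sum>j. Q (v j))" .
qed

lemma Qa_dominated:
  assumes "\<And>j. v j \<in> borel_measurable borel"
    and "\<And>x y. ennreal ((u x - u y)\<^sup>2) \<le> (\<Sum>j. ennreal ((v j x - v j y)\<^sup>2))"
    and "\<And>x. ennreal ((u x)\<^sup>2) \<le> (\<Sum>j. ennreal ((v j x)\<^sup>2))"
  shows "Qa \<alpha> u \<le> (\<Sum>j. Qa \<alpha> (v j))"
proof -
  have "Qa \<alpha> u \<le> (\<Sum>j. Q (v j)) + ennreal \<alpha> * (\<Sum>j. nsq (v j))"
    unfolding Qa_def using assms by (intro add_mono mult_left_mono Q_dominated nsq_dominated) auto
  also have "\<dots> = (\<Sum>j. Qa \<alpha> (v j))"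
    by (simp add: Qa_def suminf_add[symmetric] ennreal_suminf_cmult)
  finally show ?thesis .
qed

lemma Phi_scale:
  assumes [measurable]: "(\<lambda>(x, y). a x y) \<in> borel_measurable (borel \<Otimes>\<^sub>M borel)" "b \<in> borel_measurable borel"
  shows "Phi t (\<lambda>x y. c * a x y) (\<lambda>x. c * b x) = c * Phi t a b"
  unfolding Phi_def by (simp add: nn_integral_cmult mult.left_commute[of _ c] distrib_left)

lemma Q_scale:
  assumes [measurable]: "u \<in> borel_measurable borel"
  shows "Q (\<lambda>x. c * u x) = ennreal (c\<^sup>2) * Q u"
proof -
  have "Qt t (\<lambda>x. c * u x) = ennreal (c\<^sup>2) * Qt t u" for t
    unfolding Qt_def right_diff_distrib[symmetric] power_mult_distrib
    by (simp add: ennreal_mult Phi_scale mult.left_commute)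
  then show ?thesis
    by (simp add: Q_def SUP_mult_left_ennreal)
qed

lemma nsq_scale:
  assumes [measurable]: "u \<in> borel_measurable borel"
  shows "nsq (\<lambda>x. c * u x) = ennreal (c\<^sup>2) * nsq u"
  unfolding nsq_def power_mult_distrib by (simp add: ennreal_mult nn_integral_cmult)

lemma Qa_scale:
  assumes [measurable]: "u \<in> borel_measurable borel"
  shows "Qa \<alpha> (\<lambda>x. c * u x) = ennreal (c\<^sup>2) * Qa \<alpha> u"
  by (simp add: Qa_def Q_scale nsq_scale distrib_left mult.left_commute)

lemma Qa_zero: "Qa \<alpha> (\<lambda>x. 0) = 0"
  using Qa_scale[of "\<lambda>x. 0" \<alpha> 0] by simp

lemma Qa_dominated2:
  assumes [measurable]: "v \<in> borel_measurable borel" "w \<in> borel_measurable borel"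
    and "\<And>x y. (u x - u y)\<^sup>2 \<le> (v x - v y)\<^sup>2 + (w x - w y)\<^sup>2"
    and "\<And>x. (u x)\<^sup>2 \<le> (v x)\<^sup>2 + (w x)\<^sup>2"
  shows "Qa \<alpha> u \<le> Qa \<alpha> v + Qa \<alpha> w"
proof -
  let ?f = "\<lambda>j::nat. if j = 0 then v else if j = 1 then w else (\<lambda>x. 0)"
  have s: "(\<Sum>j. h (?f j)) = h v + h w" if "h (\<lambda>x. 0) = 0" for h :: "('a \<Rightarrow> real) \<Rightarrow> ennreal"
  proof -
    have "(\<Sum>j. h (?f j)) = (\<Sum>j\<in>{0, 1}. h (?f j))"
      by (rule suminf_finite) (use that in auto)
    then show ?thesis by simp
  qed
  have "Qa \<alpha> u \<le> (\<Sum>j. Qa \<alpha> (?f j))"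
  proof (rule Qa_dominated)
    show "ennreal ((u x - u y)\<^sup>2) \<le> (\<Sum>j. ennreal ((?f j x - ?f j y)\<^sup>2))" for x y
    proof -
      have "(\<Sum>j. ennreal ((?f j x - ?f j y)\<^sup>2)) = ennreal ((v x - v y)\<^sup>2) + ennreal ((w x - w y)\<^sup>2)"
        by (rule s[of "\<lambda>f. ennreal ((f x - f y)\<^sup>2)"]) simp
      then show ?thesis
        using ennreal_leI[OF assms(3)[of x y]] by (simp only: ennreal_plus zero_le_power2)
    qed
    show "ennreal ((u x)\<^sup>2) \<le> (\<Sum>j. ennreal ((?f j x)\<^sup>2))" for x
    proof -
      have "(\<Sum>j. ennreal ((?f j x)\<^sup>2)) = ennreal ((v x)\<^sup>2) + ennreal ((w x)\<^sup>2)"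
        by (rule s[of "\<lambda>f. ennreal ((f x)\<^sup>2)"]) simp
      then show ?thesis
        using ennreal_leI[OF assms(4)[of x]] by (simp only: ennreal_plus zero_le_power2)
    qed
  qed auto
  also have "\<dots> = Qa \<alpha> v + Qa \<alpha> w" by (rule s) (rule Qa_zero)
  finally show ?thesis .
qed

lemma Qa_dominated1:
  assumes [measurable]: "v \<in> borel_measurable borel"
    and "\<And>x y. \<bar>u x - u y\<bar> \<le> \<bar>v x - v y\<bar>" and "\<And>x. \<bar>u x\<bar> \<le> \<bar>v x\<bar>"
  shows "Qa \<alpha> u \<le> Qa \<alpha> v"
proof -
  have "Qa \<alpha> u \<le> Qa \<alpha> v + Qa \<alpha> (\<lambda>x. 0)"
    using assms(2,3) by (intro Qa_dominated2) (auto simp: abs_le_square_iff)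
  then show ?thesis by (simp add: Qa_zero)
qed

text \<open>Expand (sqrt \<eta> a - b / sqrt \<eta>)^2 >= 0. The weight stays free because
  \<open>Q_continuous\<close> lets it tend to 0; \<open>Qa_add2\<close> takes \<eta> = 1.\<close>

lemma weighted_square:
  fixes a b \<eta> :: real assumes "\<eta> > 0"
  shows "(a + b)\<^sup>2 \<le> (sqrt (1 + \<eta>) * a)\<^sup>2 + (sqrt (1 + 1 / \<eta>) * b)\<^sup>2"
proof -
  have "0 \<le> (sqrt \<eta> * a - b / sqrt \<eta>)\<^sup>2" by simp
  also have "\<dots> = \<eta> * a\<^sup>2 + b\<^sup>2 / \<eta> - 2 * a * b"
    using assms by (simp add: power2_diff power_mult_distrib power_divide)
  finally show ?thesis using assms by (simp add: power2_sum power_mult_distrib algebra_simps)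
qed

lemma Qa_add:
  assumes [measurable]: "u \<in> borel_measurable borel" "v \<in> borel_measurable borel" and "\<eta> > 0"
  shows "Qa \<alpha> (\<lambda>x. u x + v x) \<le> ennreal (1 + \<eta>) * Qa \<alpha> u + ennreal (1 + 1 / \<eta>) * Qa \<alpha> v"
proof -
  have "Qa \<alpha> (\<lambda>x. u x + v x) \<le> Qa \<alpha> (\<lambda>x. sqrt (1 + \<eta>) * u x) + Qa \<alpha> (\<lambda>x. sqrt (1 + 1 / \<eta>) * v x)"
  proof (rule Qa_dominated2)
    show "(u x + v x - (u y + v y))\<^sup>2 \<le> (sqrt (1 + \<eta>) * u x - sqrt (1 + \<eta>) * u y)\<^sup>2 +
        (sqrt (1 + 1 / \<eta>) * v x - sqrt (1 + 1 / \<eta>) * v y)\<^sup>2" for x y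
      using weighted_square[OF \<open>\<eta> > 0\<close>, of "u x - u y" "v x - v y"] by (simp add: algebra_simps)
  qed (use weighted_square[OF \<open>\<eta> > 0\<close>] in auto)
  then show ?thesis using assms by (simp add: Qa_scale)
qed

lemma Qa_add2:
  assumes "u \<in> borel_measurable borel" "v \<in> borel_measurable borel"
  shows "Qa \<alpha> (\<lambda>x. u x + v x) \<le> 2 * Qa \<alpha> u + 2 * Qa \<alpha> v"
  using Qa_add[OF assms, of 1 \<alpha>] by simp

lemma Qa_minus:
  assumes "v \<in> borel_measurable borel" shows "Qa \<alpha> (\<lambda>x. - v x) = Qa \<alpha> v"
  using Qa_scale[OF assms, of \<alpha> "-1"] by simp

lemma Qa_diff2:
  assumes "u \<in> borel_measurable borel" "v \<in> borel_measurable borel"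
  shows "Qa \<alpha> (\<lambda>x. u x - v x) \<le> 2 * Qa \<alpha> u + 2 * Qa \<alpha> v"
  using Qa_add2[of u "\<lambda>x. - v x" \<alpha>] assms by (simp add: Qa_minus)

lemma liminf_add_ennreal:
  fixes f g :: "nat \<Rightarrow> ennreal"
  shows "liminf f + liminf g \<le> liminf (\<lambda>n. f n + g n)"
proof -
  have "liminf f + liminf g = (SUP n. (INF i\<in>{n..}. f i) + (INF i\<in>{n..}. g i))"
    unfolding liminf_SUP_INF
    by (subst ennreal_SUP_add) (auto simp: incseq_def intro!: INF_superset_mono)
  also have "\<dots> \<le> liminf (\<lambda>n. f n + g n)"
    unfolding liminf_SUP_INF by (intro SUP_mono) (auto intro!: INF_greatest add_mono INF_lower2)
  finally show ?thesis .
qed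

lemma Phi_liminf:
  assumes [measurable]: "\<And>n. (\<lambda>(x, y). a n x y) \<in> borel_measurable (borel \<Otimes>\<^sub>M borel)"
    "\<And>n. b n \<in> borel_measurable borel"
  shows "Phi t (\<lambda>x y. liminf (\<lambda>n. a n x y)) (\<lambda>x. liminf (\<lambda>n. b n x)) \<le> liminf (\<lambda>n. Phi t (a n) (b n))"
proof -
  have le: "c * liminf f \<le> liminf (\<lambda>n. c * f n)" for c :: ennreal and f
    unfolding liminf_SUP_INF SUP_mult_left_ennreal
    by (intro SUP_mono) (auto intro!: INF_greatest mult_left_mono INF_lower2)
  have "(\<integral>\<^sup>+x. \<integral>\<^sup>+y. k t x y * liminf (\<lambda>n. a n x y) \<partial>m \<partial>m) \<le>
      (\<integral>\<^sup>+x. \<integral>\<^sup>+y. liminf (\<lambda>n. k t x y * a n x y) \<partial>m \<partial>m)"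
    by (intro nn_integral_mono le)
  also have "\<dots> \<le> (\<integral>\<^sup>+x. liminf (\<lambda>n. \<integral>\<^sup>+y. k t x y * a n x y \<partial>m) \<partial>m)"
    by (intro nn_integral_mono nn_integral_liminf) measurable
  also have "\<dots> \<le> liminf (\<lambda>n. \<integral>\<^sup>+x. \<integral>\<^sup>+y. k t x y * a n x y \<partial>m \<partial>m)"
    by (intro nn_integral_liminf) measurable
  finally have 1: "ennreal (1 / 2) * (\<integral>\<^sup>+x. \<integral>\<^sup>+y. k t x y * liminf (\<lambda>n. a n x y) \<partial>m \<partial>m) \<le>
      liminf (\<lambda>n. ennreal (1 / 2) * (\<integral>\<^sup>+x. \<integral>\<^sup>+y. k t x y * a n x y \<partial>m \<partial>m))"
    by (intro order_trans[OF mult_left_mono le]) auto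
  have "(\<integral>\<^sup>+x. (1 - (\<integral>\<^sup>+y. k t x y \<partial>m)) * liminf (\<lambda>n. b n x) \<partial>m) \<le>
      (\<integral>\<^sup>+x. liminf (\<lambda>n. (1 - (\<integral>\<^sup>+y. k t x y \<partial>m)) * b n x) \<partial>m)"
    by (intro nn_integral_mono le)
  also have "\<dots> \<le> liminf (\<lambda>n. \<integral>\<^sup>+x. (1 - (\<integral>\<^sup>+y. k t x y \<partial>m)) * b n x \<partial>m)"
    by (intro nn_integral_liminf) measurable
  finally show ?thesis
    unfolding Phi_def by (intro order_trans[OF add_mono[OF 1] liminf_add_ennreal])
qed

end

lemma mult_liminf_le:
  fixes c :: ennreal shows "c * liminf f \<le> liminf (\<lambda>n. c * f n)"
  unfolding liminf_SUP_INF SUP_mult_left_ennreal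
  by (intro SUP_mono) (auto intro!: INF_greatest mult_left_mono INF_lower2)

context symmetric_kernel begin

text \<open>Fatou, in x and in y, makes each \<open>Qt t\<close> lower semicontinuous, and the
  supremum over t inherits this.\<close>

lemma Q_liminf:
  assumes [measurable]: "\<And>n. v n \<in> borel_measurable borel" "u \<in> borel_measurable borel"
    and ae: "AE x in m. (\<lambda>n. v n x) \<longlonglongrightarrow> u x"
  shows "Q u \<le> liminf (\<lambda>n. Q (v n))"
  unfolding Q_def[of u]
proof (rule SUP_least)
  fix t :: real assume "t \<in> {0<..}" then have t: "t > 0" by simp
  have lim2: "liminf (\<lambda>n. ennreal ((v n x - v n y)\<^sup>2)) = ennreal ((u x - u y)\<^sup>2)"
    if "(\<lambda>n. v n x) \<longlonglongrightarrow> u x" "(\<lambda>n. v n y) \<longlonglongrightarrow> u y" for x y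
    using that by (intro lim_imp_Liminf tendsto_ennrealI tendsto_intros) auto
  have lim1: "liminf (\<lambda>n. ennreal ((v n x)\<^sup>2)) = ennreal ((u x)\<^sup>2)"
    if "(\<lambda>n. v n x) \<longlonglongrightarrow> u x" for x
    using that by (intro lim_imp_Liminf tendsto_ennrealI tendsto_intros) auto
  have "Phi t (\<lambda>x y. ennreal ((u x - u y)\<^sup>2)) (\<lambda>x. ennreal ((u x)\<^sup>2)) \<le>
     Phi t (\<lambda>x y. liminf (\<lambda>n. ennreal ((v n x - v n y)\<^sup>2))) (\<lambda>x. liminf (\<lambda>n. ennreal ((v n x)\<^sup>2)))"
    unfolding Phi_def
  proof (intro add_mono mult_left_mono nn_integral_mono_AE)
    show "AE x in m. (\<integral>\<^sup>+y. k t x y * ennreal ((u x - u y)\<^sup>2) \<partial>m) \<le>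
        (\<integral>\<^sup>+y. k t x y * liminf (\<lambda>n. ennreal ((v n x - v n y)\<^sup>2)) \<partial>m)"
      using ae
    proof eventually_elim
      case (elim x)
      show ?case using ae
        by (intro nn_integral_mono_AE, eventually_elim) (simp add: lim2 elim)
    qed
    show "AE x in m. (1 - (\<integral>\<^sup>+y. k t x y \<partial>m)) * ennreal ((u x)\<^sup>2) \<le>
        (1 - (\<integral>\<^sup>+y. k t x y \<partial>m)) * liminf (\<lambda>n. ennreal ((v n x)\<^sup>2))"
      using ae by eventually_elim (simp add: lim1)
  qed auto
  also have "\<dots> \<le> liminf (\<lambda>n. Phi t (\<lambda>x y. ennreal ((v n x - v n y)\<^sup>2)) (\<lambda>x. ennreal ((v n x)\<^sup>2)))"
    by (rule Phi_liminf) measurable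
  finally have "Qt t u \<le> liminf (\<lambda>n. Qt t (v n))"
    unfolding Qt_def by (rule order_trans[OF mult_left_mono mult_liminf_le]) auto
  also have "\<dots> \<le> liminf (\<lambda>n. Q (v n))"
    using t by (intro Liminf_mono always_eventually allI Qt_le_Q)
  finally show "Qt t u \<le> liminf (\<lambda>n. Q (v n))" .
qed

lemma nsq_liminf:
  assumes [measurable]: "\<And>n. v n \<in> borel_measurable borel" "u \<in> borel_measurable borel"
    and ae: "AE x in m. (\<lambda>n. v n x) \<longlonglongrightarrow> u x"
  shows "nsq u \<le> liminf (\<lambda>n. nsq (v n))"
proof -
  have "nsq u = (\<integral>\<^sup>+x. liminf (\<lambda>n. ennreal ((v n x)\<^sup>2)) \<partial>m)"
    unfolding nsq_def
  proof (rule nn_integral_cong_AE)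
    show "AE x in m. ennreal ((u x)\<^sup>2) = liminf (\<lambda>n. ennreal ((v n x)\<^sup>2))"
      using ae
    proof eventually_elim
      case (elim x)
      then show ?case
        by (intro lim_imp_Liminf[symmetric] tendsto_ennrealI tendsto_intros) auto
    qed
  qed
  also have "\<dots> \<le> liminf (\<lambda>n. nsq (v n))" unfolding nsq_def by (rule nn_integral_liminf) measurable
  finally show ?thesis .
qed

lemma Qa_liminf:
  assumes "\<And>n. v n \<in> borel_measurable borel" "u \<in> borel_measurable borel"
    and "AE x in m. (\<lambda>n. v n x) \<longlonglongrightarrow> u x"
  shows "Qa \<alpha> u \<le> liminf (\<lambda>n. Qa \<alpha> (v n))"
proof -
  have "Qa \<alpha> u \<le> liminf (\<lambda>n. Q (v n)) + liminf (\<lambda>n. ennreal \<alpha> * nsq (v n))"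
    unfolding Qa_def using assms
    by (intro add_mono Q_liminf order_trans[OF mult_left_mono[OF nsq_liminf] mult_liminf_le]) auto
  also have "\<dots> \<le> liminf (\<lambda>n. Qa \<alpha> (v n))" unfolding Qa_def by (rule liminf_add_ennreal)
  finally show ?thesis .
qed

section \<open>The energy of square integrable functions\<close>

text \<open>Put c = S_t 1 and J = int c u^2 dm. Expanding the square, the jump part equals J - (u,
  S_t u) by symmetry of the kernel, and the killing part equals (u, u) - J; the sum no longer
  contains J.\<close>

lemma Phi_L2:
  assumes "u \<in> L2"
  shows "Phi t (\<lambda>x y. ennreal ((u x - u y)\<^sup>2)) (\<lambda>x. ennreal ((u x)\<^sup>2)) = ennreal (ip u u - ip u (S t u))"
proof -
  have [measurable]: "u \<in> borel_measurable borel" using assms by (rule L2_borel)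
  define c where "c x = (\<integral>y. kr t x y \<partial>m)" for x
  have nnc: "(\<integral>\<^sup>+y. k t x y \<partial>m) = (\<integral>\<^sup>+y. ennreal (kr t x y) \<partial>m)" for x
    using nnP_kr[of t "\<lambda>_. 1" x] by (simp add: nnP_def)
  have krint: "integrable m (kr t x)" for x
    using k_sub[of t x] nnc[of x] by (intro integrableI_bounded) (auto simp: order.strict_trans1)
  have c: "ennreal (c x) = (\<integral>\<^sup>+y. k t x y \<partial>m)" for x
    unfolding nnc c_def using krint by (subst nn_integral_eq_integral) auto
  have c0: "0 \<le> c x" for x unfolding c_def by simp
  have c1: "c x \<le> 1" for x using k_sub[of t x] c[of x] by (metis ennreal_le_1)
  have [measurable]: "c \<in> borel_measurable borel" unfolding c_def by measurable
  have cu: "c x * (u x)\<^sup>2 \<le> (u x)\<^sup>2" for x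
    using mult_left_le_one_le[OF zero_le_power2 c0 c1] .
  have u2: "integrable m (\<lambda>x. (u x)\<^sup>2)" using assms by (simp add: L2_def)
  have int1: "integrable (m \<Otimes>\<^sub>M m) (\<lambda>(x, y). kr t x y * (u x)\<^sup>2)"
  proof (rule mm.Fubini_integrable)
    have "(\<lambda>x. LINT y|m. norm (kr t x y * (u x)\<^sup>2)) = (\<lambda>x. c x * (u x)\<^sup>2)"
      by (auto simp: c_def abs_mult)
    moreover have "integrable m (\<lambda>x. c x * (u x)\<^sup>2)"
      using c0 cu by (intro Bochner_Integration.integrable_bound[OF u2]) auto
    ultimately show "integrable m (\<lambda>x. LINT y|m. norm (case (x, y) of (x, y) \<Rightarrow> kr t x y * (u x)\<^sup>2))" by simp
  qed (use krint in auto)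
  have int2: "integrable (m \<Otimes>\<^sub>M m) (\<lambda>(x, y). kr t x y * (u y)\<^sup>2)"
  proof -
    have "(\<lambda>(x, y). kr t x y * (u y)\<^sup>2) = (\<lambda>(x, y). kr t y x * (u y)\<^sup>2)"
      by (auto simp: fun_eq_iff intro: kr_sym)
    then show ?thesis using mm.integrable_product_swap[OF int1] by simp
  qed
  have int3: "integrable (m \<Otimes>\<^sub>M m) (\<lambda>(x, y). kr t x y * u x * u y)"
    using assms by (intro pair_integrable)
  define J where "J = (\<integral>x. c x * (u x)\<^sup>2 \<partial>m)"
  have J1: "(\<integral>z. (case z of (x, y) \<Rightarrow> kr t x y * (u x)\<^sup>2) \<partial>(m \<Otimes>\<^sub>M m)) = J"
    unfolding J_def c_def using mm.integral_fst'[OF int1] by simp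
  have J2: "(\<integral>z. (case z of (x, y) \<Rightarrow> kr t x y * (u y)\<^sup>2) \<partial>(m \<Otimes>\<^sub>M m)) = J"
  proof -
    have "(\<lambda>(x, y). kr t x y * (u y)\<^sup>2) = (\<lambda>(x, y). kr t y x * (u y)\<^sup>2)"
      by (auto simp: fun_eq_iff intro: kr_sym)
    then show ?thesis
      unfolding J1[symmetric] by (subst mm.integral_product_swap[symmetric]) simp_all
  qed
  have eq: "(\<lambda>(x, y). kr t x y * (u x - u y)\<^sup>2) =
      (\<lambda>z. (case z of (x, y) \<Rightarrow> kr t x y * (u x)\<^sup>2) + (case z of (x, y) \<Rightarrow> kr t x y * (u y)\<^sup>2) -
        2 * (case z of (x, y) \<Rightarrow> kr t x y * u x * u y))"
    by (auto simp: fun_eq_iff power2_diff algebra_simps)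
  have intF: "integrable (m \<Otimes>\<^sub>M m) (\<lambda>(x, y). kr t x y * (u x - u y)\<^sup>2)"
    unfolding eq using int1 int2 int3 by simp
  have F: "(\<integral>z. (case z of (x, y) \<Rightarrow> kr t x y * (u x - u y)\<^sup>2) \<partial>(m \<Otimes>\<^sub>M m)) = 2 * J - 2 * ip u (S t u)"
    unfolding eq using int1 int2 int3 by (simp add: J1 J2 ip_S_pair[OF assms assms])
  have P1: "(\<integral>\<^sup>+x. \<integral>\<^sup>+y. k t x y * ennreal ((u x - u y)\<^sup>2) \<partial>m \<partial>m) = ennreal (2 * J - 2 * ip u (S t u))"
  proof -
    have "(\<integral>\<^sup>+y. k t x y * ennreal ((u x - u y)\<^sup>2) \<partial>m) = (\<integral>\<^sup>+y. ennreal (kr t x y * (u x - u y)\<^sup>2) \<partial>m)" for x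
      using nnP_kr[of t "\<lambda>y. ennreal ((u x - u y)\<^sup>2)" x] by (simp add: nnP_def ennreal_mult)
    then have "(\<integral>\<^sup>+x. \<integral>\<^sup>+y. k t x y * ennreal ((u x - u y)\<^sup>2) \<partial>m \<partial>m) =
        (\<integral>\<^sup>+z. ennreal (case z of (x, y) \<Rightarrow> kr t x y * (u x - u y)\<^sup>2) \<partial>(m \<Otimes>\<^sub>M m))"
      by (subst nn_integral_fst[symmetric]) auto
    also have "\<dots> = ennreal (2 * J - 2 * ip u (S t u))"
      unfolding F[symmetric] using intF by (subst nn_integral_eq_integral) auto
    finally show ?thesis .
  qed
  have pos: "0 \<le> 2 * J - 2 * ip u (S t u)"
    unfolding F[symmetric] by (intro integral_nonneg_AE) auto
  have intc: "integrable m (\<lambda>x. c x * (u x)\<^sup>2)"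
    using c0 cu by (intro Bochner_Integration.integrable_bound[OF u2]) auto
  have "(\<integral>\<^sup>+x. (1 - (\<integral>\<^sup>+y. k t x y \<partial>m)) * ennreal ((u x)\<^sup>2) \<partial>m) = (\<integral>\<^sup>+x. ennreal ((u x)\<^sup>2 - c x * (u x)\<^sup>2) \<partial>m)"
  proof (rule nn_integral_cong)
    fix x
    have "1 - ennreal (c x) = ennreal (1 - c x)" using c0 by (simp add: ennreal_minus[symmetric])
    then show "(1 - (\<integral>\<^sup>+y. k t x y \<partial>m)) * ennreal ((u x)\<^sup>2) = ennreal ((u x)\<^sup>2 - c x * (u x)\<^sup>2)"
      using c1[of x] by (simp add: c[symmetric] ennreal_mult[symmetric] left_diff_distrib)
  qed
  also have "\<dots> = ennreal (\<integral>x. (u x)\<^sup>2 - c x * (u x)\<^sup>2 \<partial>m)"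
    using u2 intc cu by (intro nn_integral_eq_integral) auto
  also have "(\<integral>x. (u x)\<^sup>2 - c x * (u x)\<^sup>2 \<partial>m) = ip u u - J"
    using u2 intc by (simp add: J_def ip_def power2_eq_square)
  finally have P2: "(\<integral>\<^sup>+x. (1 - (\<integral>\<^sup>+y. k t x y \<partial>m)) * ennreal ((u x)\<^sup>2) \<partial>m) = ennreal (ip u u - J)" .
  have "0 \<le> (\<integral>x. (u x)\<^sup>2 - c x * (u x)\<^sup>2 \<partial>m)"
    using cu by (intro integral_nonneg_AE) auto
  also have "\<dots> = ip u u - J"
    using u2 intc by (simp add: J_def ip_def power2_eq_square)
  finally have pos': "0 \<le> ip u u - J" .
  have "ennreal (1 / 2) * ennreal (2 * J - 2 * ip u (S t u)) = ennreal (1 / 2 * (2 * J - 2 * ip u (S t u)))"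
    by (rule ennreal_mult'[symmetric]) simp
  also have "1 / 2 * (2 * J - 2 * ip u (S t u)) = J - ip u (S t u)" by simp
  finally show ?thesis
    unfolding Phi_def P1 P2 using pos pos' by (simp only: ennreal_plus[symmetric]) simp
qed

section \<open>Monotonicity in time of the difference quotients (u - S_t u, u) / t\<close>

definition quot :: "real \<Rightarrow> ('a \<Rightarrow> real) \<Rightarrow> real" where "quot t u = (ip u u - ip u (S t u)) / t"

lemma quot_nonneg: "u \<in> L2 \<Longrightarrow> t > 0 \<Longrightarrow> 0 \<le> quot t u"
  by (simp add: quot_def ip_S_le)

lemma Qt_L2: "u \<in> L2 \<Longrightarrow> t > 0 \<Longrightarrow> Qt t u = ennreal (quot t u)"
  unfolding Qt_def quot_def by (simp add: Phi_L2 ennreal_mult[symmetric] ip_S_le)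

lemma ip_add_add:
  assumes "u \<in> L2" "v \<in> L2"
  shows "ip (\<lambda>x. u x + v x) (\<lambda>x. u x + v x) = ip u u + 2 * ip u v + ip v v"
proof -
  let ?d = "\<lambda>x. u x + v x"
  have "ip ?d ?d = ip u ?d + ip v ?d" using assms by (intro ip_add L2_add)
  also have "ip u ?d = ip ?d u" by (rule ip_sym)
  also have "ip ?d u = ip u u + ip v u" using assms by (intro ip_add)
  also have "ip v ?d = ip ?d v" by (rule ip_sym)
  also have "ip ?d v = ip u v + ip v v" using assms by (intro ip_add)
  finally show ?thesis by (simp add: ip_sym[of v u])
qed

lemma ip_diff_diff:
  assumes "u \<in> L2" "v \<in> L2"
  shows "ip (\<lambda>x. u x - v x) (\<lambda>x. u x - v x) = ip u u - 2 * ip u v + ip v v"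
proof -
  let ?d = "\<lambda>x. u x - v x"
  have "ip ?d ?d = ip u ?d - ip v ?d" using assms by (intro ip_diff L2_diff)
  also have "ip u ?d = ip ?d u" by (rule ip_sym)
  also have "ip ?d u = ip u u - ip v u" using assms by (intro ip_diff)
  also have "ip v ?d = ip ?d v" by (rule ip_sym)
  also have "ip ?d v = ip u v - ip v v" using assms by (intro ip_diff)
  finally show ?thesis by (simp add: ip_sym[of v u])
qed

lemma second_difference:
  assumes "u \<in> L2" "r > 0"
  shows "ip (\<lambda>x. u x - S r u x) (\<lambda>x. u x - S r u x) = ip u u - 2 * ip u (S r u) + ip u (S (2 * r) u)"
proof -
  have s: "S r u \<in> L2" using assms by (intro S_L2)
  have "ip (S r u) (S r u) = ip u (S (2 * r) u)" using assms ip_S_S[of u u r r] by simp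
  then show ?thesis
    using ip_diff_diff[OF assms(1) s] by simp
qed

text \<open>The sequence (u, S_{nr} u). The value at n = 0 is given separately because
  \<open>S 0\<close> need not be the identity.\<close>

definition iter :: "real \<Rightarrow> ('a \<Rightarrow> real) \<Rightarrow> nat \<Rightarrow> real" where
  "iter r u n = (if n = 0 then ip u u else ip u (S (real n * r) u))"

text \<open>The second difference is the squared norm of w - S_r w, where w = S_{nr/2} u.\<close>

lemma iter_convex:
  assumes "u \<in> L2" "r > 0"
  shows "0 \<le> iter r u n - 2 * iter r u (Suc n) + iter r u (Suc (Suc n))"
proof (cases "n = 0")
  case True
  then show ?thesis using second_difference[OF assms] ip_nonneg[of "\<lambda>x. u x - S r u x"] by (simp add: iter_def)
next
  case False
  define w where "w = S (real n * r / 2) u"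
  have pos: "real n * r / 2 > 0" using False assms by simp
  have w: "w \<in> L2" unfolding w_def using assms by (intro S_L2)
  have e: "ip w (S s w) = ip u (S (real n * r + s) u)" if "s > 0" for s
  proof -
    have "ip w (S s w) = ip w (S (s + real n * r / 2) u)"
      unfolding w_def using S_S[OF assms(1) that pos] assms(1)
      by (intro ip_cong) (auto intro!: L2_borel S_L2)
    also have "\<dots> = ip u (S (real n * r + s) u)"
      unfolding w_def using ip_S_S[OF assms(1,1) pos, of "s + real n * r / 2"] that pos
      by (simp add: algebra_simps)
    finally show ?thesis .
  qed
  have "ip w w = ip u (S (real n * r) u)" unfolding w_def using ip_S_half[OF assms(1), of "real n * r"] pos by simp
  then show ?thesis
    using second_difference[OF w assms(2)] ip_nonneg[of "\<lambda>x. w x - S r w x"] e[of r] e[of "2 * r"] False assms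
    by (simp add: iter_def algebra_simps)
qed

lemma iter_diff_decreasing:
  assumes "u \<in> L2" "r > 0"
  shows "iter r u n - iter r u (Suc n) \<le> iter r u 0 - iter r u 1"
proof (induction n)
  case (Suc n)
  then show ?case using iter_convex[OF assms, of n] by simp
qed simp

text \<open>Telescoping: the total decrement over n steps is at most n times the first decrement,
  because decrements decrease by convexity.\<close>

lemma quot_multiple:
  assumes "u \<in> L2" "r > 0" "n > 0"
  shows "quot (real n * r) u \<le> quot r u"
proof -
  have "iter r u 0 - iter r u n \<le> real n * (iter r u 0 - iter r u 1)" for n
  proof (induction n)
    case (Suc n)
    then show ?case using iter_diff_decreasing[OF assms(1,2), of n] by (simp add: algebra_simps)
  qed simp
  from this[of n] have "(ip u u - ip u (S (real n * r) u)) \<le> real n * (ip u u - ip u (S r u))"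
    using assms by (simp add: iter_def)
  then have "(ip u u - ip u (S (real n * r) u)) / (real n * r) \<le> (real n * (ip u u - ip u (S r u))) / (real n * r)"
    using assms by (intro divide_right_mono) auto
  then show ?thesis using assms by (simp add: quot_def)
qed

text \<open>Comparison with the least multiple n t of t above r. Since n t <= r + t, the rounding
  costs only the factor r / (r + t), which tends to 1 as t -> 0.\<close>

lemma quot_almost_decreasing:
  assumes "u \<in> L2" "0 < t" "t \<le> r"
  shows "quot r u * (r / (r + t)) \<le> quot t u"
proof -
  define n where "n = nat \<lceil>r / t\<rceil>"
  have n: "r / t \<le> real n" "real n < r / t + 1" "n > 0"
    using assms by (auto simp: n_def) linarith
  then have nr: "r \<le> real n * t" "real n * t \<le> r + t" using assms by (auto simp: field_simps)
  have "quot r u * (r / (r + t)) = (ip u u - ip u (S r u)) / (r + t)" using assms by (simp add: quot_def)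
  also have "\<dots> \<le> (ip u u - ip u (S (real n * t) u)) / (real n * t)"
    using assms nr n ip_S_decreasing[OF assms(1), of r "real n * t"] ip_S_le[OF assms(1), of r]
    by (intro frac_le) auto
  also have "\<dots> \<le> quot t u" using quot_multiple[OF assms(1,2) n(3)] by (simp add: quot_def)
  finally show ?thesis .
qed

lemma tendsto_at_right_factor: "r > 0 \<Longrightarrow> ((\<lambda>t. c * (r / (r + t))) \<longlongrightarrow> c) (at_right (0::real))"
proof -
  assume r: "r > 0"
  have "((\<lambda>t. c * (r / (r + t))) \<longlongrightarrow> c * (r / (r + 0))) (at_right (0::real))"
    using r by (intro tendsto_intros) auto
  then show ?thesis using r by simp
qed

lemma eventually_at_right_le: "r > 0 \<Longrightarrow> eventually (\<lambda>t. 0 < t \<and> t \<le> r) (at_right (0::real))"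
  by (auto simp: eventually_at_right_field intro!: exI[of _ r])

lemma Q_L2_bound:
  assumes "u \<in> L2" "Q u \<le> ennreal c" "0 \<le> c" "t > 0" shows "quot t u \<le> c"
proof -
  have "ennreal (quot t u) \<le> ennreal c"
    using Qt_le_Q[OF assms(4), of u] assms by (simp add: Qt_L2 order_trans)
  then show ?thesis using assms by simp
qed

lemma Q_le_iff:
  assumes "u \<in> L2" "0 \<le> c" shows "Q u \<le> ennreal c \<longleftrightarrow> (\<forall>t>0. quot t u \<le> c)"
  using Q_L2_bound[OF assms(1) _ assms(2)] assms
  by (auto simp: Q_def Qt_L2 intro!: SUP_least ennreal_leI)

text \<open>Every quotient is below the supremum. Conversely, a time r whose quotient comes close to
  the supremum forces all much smaller times to do so, by
  \<open>quot_almost_decreasing\<close>.\<close>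

lemma Q_tendsto:
  assumes u: "u \<in> L2" and fin: "Q u < \<top>"
  shows "((\<lambda>t. quot t u) \<longlongrightarrow> enn2real (Q u)) (at_right 0)"
proof (rule order_tendstoI)
  define q where "q = enn2real (Q u)"
  have q: "Q u = ennreal q" "0 \<le> q" using fin by (auto simp: q_def)
  have le: "quot t u \<le> q" if "t > 0" for t using Q_L2_bound[OF u _ q(2) that] q by simp
  {
    fix a assume "enn2real (Q u) < a"
    then have "q < a" by (simp add: q_def)
    then show "eventually (\<lambda>t. quot t u < a) (at_right 0)"
      using eventually_at_right_le[of 1] by (auto elim!: eventually_mono intro: le_less_trans[OF le])
  next
    fix a assume "a < enn2real (Q u)"
    then have a: "a < q" by (simp add: q_def)
    have "\<exists>r>0. a < quot r u"
    proof (rule ccontr)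
      assume "\<not> ?thesis"
      then have *: "\<And>r. r > 0 \<Longrightarrow> quot r u \<le> a" by force
      have "0 \<le> a" using *[of 1] quot_nonneg[OF u, of 1] by simp
      then have "Q u \<le> ennreal a" using Q_le_iff[OF u] * by blast
      then show False using a q \<open>0 \<le> a\<close> by (simp add: ennreal_le_iff)
    qed
    then obtain r where r: "r > 0" "a < quot r u" by blast
    have "eventually (\<lambda>t. a < quot r u * (r / (r + t))) (at_right 0)"
      using tendsto_at_right_factor[OF r(1), of "quot r u"] r(2) by (rule order_tendstoD)
    with eventually_at_right_le[OF r(1)]
    show "eventually (\<lambda>t. a < quot t u) (at_right 0)"
    proof eventually_elim
      case (elim t)
      then show ?case using quot_almost_decreasing[OF u, of t r] by linarith
    qed
  }
qed

lemma Q_finite_if_tendsto: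
  assumes u: "u \<in> L2" and lim: "((\<lambda>t. quot t u) \<longlongrightarrow> l) (at_right 0)"
  shows "Q u < \<top>"
proof -
  have "quot r u \<le> l" if r: "r > 0" for r
  proof (rule tendsto_le[OF _ lim tendsto_at_right_factor[OF r, of "quot r u"]])
    show "eventually (\<lambda>t. quot r u * (r / (r + t)) \<le> quot t u) (at_right 0)"
      using eventually_at_right_le[OF r] by eventually_elim (rule quot_almost_decreasing[OF u], auto)
  qed simp
  moreover from this[of 1] have "0 \<le> l" using quot_nonneg[OF u, of 1] by simp
  ultimately have "Q u \<le> ennreal l" using Q_le_iff[OF u] by blast
  then show ?thesis by (simp add: order.strict_trans1)
qed

text \<open>A supremum of quadratic forms need not be quadratic, so the identity is proved for the
  quotients and carried to \<open>Q\<close> by the limit \<open>Q_tendsto\<close>. If one of the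
  energies on the right is infinite, nothing has to be shown.\<close>

lemma Qa_parallelogram:
  assumes u: "u \<in> L2" and v: "v \<in> L2" and "\<alpha> \<ge> 0"
  shows "Qa \<alpha> (\<lambda>x. u x + v x) + Qa \<alpha> (\<lambda>x. u x - v x) \<le> 2 * Qa \<alpha> u + 2 * Qa \<alpha> v"
proof (cases "Q u < \<top> \<and> Q v < \<top>")
  case False
  then have "2 * Qa \<alpha> u + 2 * Qa \<alpha> v = \<top>"
    by (auto simp: Qa_def less_top[symmetric] ennreal_mult_eq_top_iff)
  then show ?thesis by (metis top_greatest)
next
  case True
  let ?s = "\<lambda>x. u x + v x" and ?d = "\<lambda>x. u x - v x"
  have L: "?s \<in> L2" "?d \<in> L2" using u v by (auto intro: L2_add L2_diff)
  have fin: "Q w < \<top>" if "Qa 0 w \<le> 2 * Qa 0 u + 2 * Qa 0 v" for w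
    using that True by (auto simp: Qa_def ennreal_mult_less_top intro: le_less_trans)
  have f: "Q ?s < \<top>" "Q ?d < \<top>"
    using Qa_add2[of u v 0] Qa_diff2[of u v 0] u v by (auto intro!: fin dest: L2_borel)
  have ipn: "ip ?s ?s + ip ?d ?d = 2 * ip u u + 2 * ip v v"
    using ip_add_add[OF u v] ip_diff_diff[OF u v] by simp
  have quot: "quot t ?s + quot t ?d = 2 * quot t u + 2 * quot t v" for t
  proof -
    have S: "S t u \<in> L2" "S t v \<in> L2" using u v by (auto intro: S_L2)
    have 1: "ip ?s (S t ?s) = ip u (S t u) + ip v (S t u) + (ip u (S t v) + ip v (S t v))"
    proof -
      have "ip ?s (S t ?s) = ip ?s (\<lambda>x. S t u x + S t v x)"
        using S_add[OF u v] L S by (intro ip_cong) (auto intro!: L2_borel S_L2 L2_add)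
      also have "\<dots> = ip (\<lambda>x. S t u x + S t v x) ?s" by (rule ip_sym)
      also have "\<dots> = ip ?s (S t u) + ip ?s (S t v)"
        using S L by (simp add: ip_add ip_sym[of "S t _" ?s])
      finally show ?thesis using u v S by (simp add: ip_add)
    qed
    have 2: "ip ?d (S t ?d) = ip u (S t u) - ip v (S t u) - (ip u (S t v) - ip v (S t v))"
    proof -
      have "ip ?d (S t ?d) = ip ?d (\<lambda>x. S t u x - S t v x)"
        using S_diff[OF u v] L S by (intro ip_cong) (auto intro!: L2_borel S_L2 L2_diff)
      also have "\<dots> = ip (\<lambda>x. S t u x - S t v x) ?d" by (rule ip_sym)
      also have "\<dots> = ip ?d (S t u) - ip ?d (S t v)"
        using S L by (simp add: ip_diff ip_sym[of "S t _" ?d])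
      finally show ?thesis using u v S by (simp add: ip_diff)
    qed
    have "quot t ?s + quot t ?d = ((ip ?s ?s + ip ?d ?d) - (ip ?s (S t ?s) + ip ?d (S t ?d))) / t"
      by (simp add: quot_def add_divide_distrib diff_divide_distrib)
    also have "\<dots> = 2 * quot t u + 2 * quot t v"
      unfolding ipn 1 2 by (simp add: quot_def add_divide_distrib diff_divide_distrib)
    finally show ?thesis .
  qed
  have "((\<lambda>t. quot t ?s + quot t ?d) \<longlongrightarrow> enn2real (Q ?s) + enn2real (Q ?d)) (at_right 0)"
    by (intro tendsto_add Q_tendsto L f)
  moreover have "((\<lambda>t. quot t ?s + quot t ?d) \<longlongrightarrow> 2 * enn2real (Q u) + 2 * enn2real (Q v)) (at_right 0)"
    unfolding quot using u v True by (intro tendsto_intros Q_tendsto) auto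
  ultimately have r: "enn2real (Q ?s) + enn2real (Q ?d) = 2 * enn2real (Q u) + 2 * enn2real (Q v)"
    by (rule tendsto_unique[rotated]) simp
  have e: "Q w = ennreal (enn2real (Q w))" if "Q w < \<top>" for w using that by simp
  have Qeq: "Q ?s + Q ?d = 2 * Q u + 2 * Q v"
  proof -
    have "Q ?s + Q ?d = ennreal (enn2real (Q ?s) + enn2real (Q ?d))"
      using f by (simp add: ennreal_plus)
    also have "\<dots> = 2 * Q u + 2 * Q v"
      unfolding r using True by (simp add: ennreal_plus ennreal_mult)
    finally show ?thesis .
  qed
  have neq: "nsq ?s + nsq ?d = 2 * nsq u + 2 * nsq v"
  proof -
    have "nsq ?s + nsq ?d = ennreal (ip ?s ?s + ip ?d ?d)"
      using L by (simp add: nsq_L2 ip_nonneg ennreal_plus)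
    also have "\<dots> = 2 * nsq u + 2 * nsq v"
      unfolding ipn using u v by (simp add: nsq_L2 ip_nonneg ennreal_plus ennreal_mult)
    finally show ?thesis .
  qed
  have "Qa \<alpha> ?s + Qa \<alpha> ?d = (Q ?s + Q ?d) + ennreal \<alpha> * (nsq ?s + nsq ?d)"
    by (simp add: Qa_def distrib_left ac_simps)
  also have "\<dots> = 2 * Qa \<alpha> u + 2 * Qa \<alpha> v"
    unfolding Qeq neq by (simp add: Qa_def distrib_left ac_simps)
  finally show ?thesis by simp
qed

text \<open>The squared norm is the difference of two consecutive decrements of (u, S_{nt} u).
  Dropping the second leaves (u, u) - (u, S_t u), which is t times a quotient.\<close>

lemma norm_diff_S_le:
  assumes u: "u \<in> L2" and "Q u \<le> ennreal c" "0 \<le> c" "t > 0"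
  shows "ip (\<lambda>x. u x - S t u x) (\<lambda>x. u x - S t u x) \<le> t * c"
proof -
  have "ip (\<lambda>x. u x - S t u x) (\<lambda>x. u x - S t u x) \<le> ip u u - ip u (S t u)"
    using second_difference[OF u assms(4)] ip_S_decreasing[OF u assms(4), of "2 * t"] assms by simp
  also have "\<dots> \<le> t * c" using Q_L2_bound[OF assms] assms by (simp add: quot_def field_simps)
  finally show ?thesis .
qed

text \<open>For r = t / N everything lies on one grid: (w, w) - (w, S_r w) is the decrement of (u,
  S_{nr} u) at n = 2N, hence at most the decrement at 0. Thus the quotients of w at the times t / N
  are at most c, and \<open>quot_almost_decreasing\<close> extends this to every time.\<close>

lemma Q_S_le:
  assumes u: "u \<in> L2" and Qu: "Q u \<le> ennreal c" "0 \<le> c" and t: "t > 0"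
  shows "Q (S t u) \<le> ennreal c"
proof -
  define w where "w = S t u"
  have w: "w \<in> L2" unfolding w_def using u by (rule S_L2)
  have 1: "quot (t / real (Suc n)) w \<le> c" for n
  proof -
    define N where "N = Suc n"
    define r where "r = t / real N"
    have r: "r > 0" "real N * r = t" "N > 0" using t by (auto simp: r_def N_def)
    have "ip w w = iter r u (2 * N)"
    proof -
      have e: "real (2 * N) * r = t + t" using r(2) by simp
      show ?thesis using ip_S_S[OF u u t t] r(3) unfolding iter_def w_def e by simp
    qed
    moreover have "ip w (S r w) = iter r u (Suc (2 * N))"
    proof -
      have "ip w (S r w) = ip w (S (r + t) u)"
        unfolding w_def using S_S[OF u r(1) t] u by (intro ip_cong) (auto intro!: L2_borel S_L2)
      also have "\<dots> = ip u (S (t + (r + t)) u)" unfolding w_def using ip_S_S[OF u u t, of "r + t"] r t by simp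
      also have "t + (r + t) = real (Suc (2 * N)) * r" using r by (simp add: algebra_simps)
      finally show ?thesis by (simp add: iter_def)
    qed
    ultimately have "quot r w \<le> quot r u"
      using iter_diff_decreasing[OF u r(1), of "2 * N"] r by (simp add: quot_def iter_def divide_right_mono)
    also have "\<dots> \<le> c" using Q_L2_bound[OF u Qu r(1)] .
    finally show ?thesis by (simp add: r_def N_def)
  qed
  have lim: "filterlim (\<lambda>n. t / real (Suc n)) (at_right 0) sequentially"
  proof -
    have "(\<lambda>n. t / real (Suc n)) \<longlonglongrightarrow> 0" by (rule LIMSEQ_Suc[OF lim_const_over_n])
    then show ?thesis using t by (auto simp: filterlim_at intro!: always_eventually simp del: of_nat_Suc)
  qed
  have "quot r w \<le> c" if r: "r > 0" for r
  proof (rule tendsto_upperbound)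
    show "((\<lambda>n. quot r w * (r / (r + t / real (Suc n)))) \<longlongrightarrow> quot r w) sequentially"
      by (rule filterlim_compose[OF tendsto_at_right_factor[OF r] lim])
    have "eventually (\<lambda>n. 0 < t / real (Suc n) \<and> t / real (Suc n) \<le> r) sequentially"
      using eventually_at_right_le[OF r] lim by (rule eventually_compose_filterlim)
    then show "eventually (\<lambda>n. quot r w * (r / (r + t / real (Suc n))) \<le> c) sequentially"
    proof eventually_elim
      case (elim n)
      then show ?case using quot_almost_decreasing[OF w, of "t / real (Suc n)" r] 1[of n] by linarith
    qed
  qed simp
  then show ?thesis using Q_le_iff[OF w Qu(2)] by (simp add: w_def)
qed

end

section \<open>The energy inequality\<close>

text \<open>A lower Riemann sum, with right endpoints; the function may blow up at 0.\<close>

lemma sum_le_nn_integral_decreasing: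
  fixes h :: "real \<Rightarrow> ennreal"
  assumes [measurable]: "h \<in> borel_measurable borel"
    and dec: "\<And>r s. 0 < r \<Longrightarrow> r \<le> s \<Longrightarrow> h s \<le> h r" and t: "t > 0"
  shows "(\<Sum>n<N. ennreal t * h (real (Suc n) * t)) \<le> (\<integral>\<^sup>+r\<in>{0<..}. h r \<partial>lborel)"
proof -
  have "(\<Sum>n<N. ennreal t * h (real (Suc n) * t)) \<le> (\<integral>\<^sup>+r\<in>{0<..real N * t}. h r \<partial>lborel)"
  proof (induction N)
    case (Suc N)
    let ?I = "{real N * t<..real (Suc N) * t}"
    have "ennreal t * h (real (Suc N) * t) = (\<integral>\<^sup>+r\<in>?I. h (real (Suc N) * t) \<partial>lborel)"
      using t by (subst nn_integral_cmult_indicator) (auto simp: algebra_simps)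
    also have "\<dots> \<le> (\<integral>\<^sup>+r\<in>?I. h r \<partial>lborel)"
    proof (rule nn_integral_mono)
      fix r
      have "h (real (Suc N) * t) \<le> h r" if "r \<in> ?I"
        using that t by (intro dec) (auto intro: le_less_trans[of 0 "real N * t"])
      then show "h (real (Suc N) * t) * indicator ?I r \<le> h r * indicator ?I r"
        by (auto split: split_indicator)
    qed
    finally have "(\<Sum>n<Suc N. ennreal t * h (real (Suc n) * t)) \<le>
        (\<integral>\<^sup>+r\<in>{0<..real N * t}. h r \<partial>lborel) + (\<integral>\<^sup>+r\<in>?I. h r \<partial>lborel)"
      using Suc.IH by (simp add: add_mono)
    also have "\<dots> = (\<integral>\<^sup>+r. h r * indicator {0<..real N * t} r + h r * indicator ?I r \<partial>lborel)"
      by (subst nn_integral_add) auto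
    also have "\<dots> = (\<integral>\<^sup>+r\<in>{0<..real (Suc N) * t}. h r \<partial>lborel)"
    proof (rule nn_integral_cong)
      fix r :: real
      have "real N * t < r \<Longrightarrow> 0 < r" using t by (auto intro: le_less_trans[of 0 "real N * t"])
      moreover have "real (Suc N) * t = real N * t + t" by (simp add: algebra_simps)
      ultimately show "h r * indicator {0<..real N * t} r + h r * indicator ?I r = h r * indicator {0<..real (Suc N) * t} r"
        using t by (auto split: split_indicator)
    qed
    finally show ?case .
  qed simp
  also have "\<dots> \<le> (\<integral>\<^sup>+r\<in>{0<..}. h r \<partial>lborel)"
    by (intro nn_integral_mono) (auto split: split_indicator)
  finally show ?thesis .
qed

context symmetric_kernel begin

lemma ip_measurable [measurable]:
  assumes [measurable]: "u \<in> borel_measurable borel" "v \<in> borel_measurable borel"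
  shows "(\<lambda>r. ip u (S r v)) \<in> borel_measurable borel"
  unfolding ip_def by measurable

lemma abs_ip_le: "u \<in> L2 \<Longrightarrow> v \<in> L2 \<Longrightarrow> 2 * \<bar>ip u v\<bar> \<le> ip u u + ip v v"
  using ip_nonneg[of "\<lambda>x. u x + v x"] ip_nonneg[of "\<lambda>x. u x - v x"] ip_add_add[of u v] ip_diff_diff[of u v]
  by linarith

section \<open>Neumann series for the approximating forms\<close>

definition pow :: "real \<Rightarrow> ('a \<Rightarrow> real) \<Rightarrow> nat \<Rightarrow> 'a \<Rightarrow> real" where
  "pow t g n = (if n = 0 then g else S (real n * t) g)"

text \<open>Partial sums of (1 - l S_t)^{-1} g. With l = exp(-\<alpha> t), t times the full sum is a
  Riemann sum for the potential R_\<alpha> g.\<close>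

definition neumann :: "real \<Rightarrow> real \<Rightarrow> ('a \<Rightarrow> real) \<Rightarrow> nat \<Rightarrow> 'a \<Rightarrow> real" where
  "neumann t l g N x = (\<Sum>n<N. l ^ n * pow t g n x)"

lemma pow_L2: "g \<in> L2 \<Longrightarrow> pow t g n \<in> L2" by (simp add: pow_def S_L2)

lemma S_pow: assumes "g \<in> L2" "t > 0" shows "AE x in m. S t (pow t g n) x = pow t g (Suc n) x"
proof (cases "n = 0")
  case False
  then have "AE x in m. S t (S (real n * t) g) x = S (t + real n * t) g x"
    using assms by (intro S_S) auto
  then show ?thesis using False by (simp add: pow_def algebra_simps)
qed (simp add: pow_def)

lemma neumann_L2: assumes "g \<in> L2" shows "neumann t l g N \<in> L2"
proof (induction N)
  case (Suc N)
  have "neumann t l g (Suc N) = (\<lambda>x. neumann t l g N x + l ^ N * pow t g N x)"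
    by (simp add: neumann_def fun_eq_iff)
  then show ?case using Suc assms by (simp add: L2_add L2_scale pow_L2)
qed (simp add: neumann_def[abs_def] L2_zero)

lemma ip_neumann:
  assumes "g \<in> L2" "v \<in> L2" shows "ip (neumann t l g N) v = (\<Sum>n<N. l ^ n * ip (pow t g n) v)"
proof (induction N)
  case 0 show ?case by (simp add: neumann_def ip_def)
next
  case (Suc N)
  have "neumann t l g (Suc N) = (\<lambda>x. neumann t l g N x + l ^ N * pow t g N x)"
    by (simp add: neumann_def fun_eq_iff)
  then show ?case using Suc assms by (simp add: ip_add ip_scale L2_scale pow_L2 neumann_L2)
qed

lemma pow_shift: "g \<in> L2 \<Longrightarrow> v \<in> L2 \<Longrightarrow> t > 0 \<Longrightarrow> ip (pow t g n) (S t v) = ip (pow t g (Suc n)) v"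
proof -
  assume a: "g \<in> L2" "v \<in> L2" "t > 0"
  have "ip (pow t g n) (S t v) = ip (S t (pow t g n)) v" using a by (intro S_sym[symmetric] pow_L2)
  also have "\<dots> = ip (pow t g (Suc n)) v"
    using S_pow[OF a(1,3), of n] a by (intro ip_cong) (auto intro!: L2_borel S_L2 pow_L2)
  finally show ?thesis .
qed

lemma pow_pow: assumes g: "g \<in> L2" and t: "t > 0" shows "ip (pow t g i) (pow t g j) = ip g (pow t g (i + j))"
proof (cases "i = 0 \<or> j = 0")
  case True then show ?thesis by (auto simp: pow_def ip_sym)
next
  case False
  then show ?thesis using ip_S_S[OF g g, of "real i * t" "real j * t"] t by (simp add: pow_def algebra_simps)
qed

lemma pow_nonneg: "g \<in> L2 \<Longrightarrow> t > 0 \<Longrightarrow> 0 \<le> ip g (pow t g n)"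
  by (simp add: pow_def ip_nonneg ip_S_nonneg)

text \<open>The bilinear form B(x, y) = (x, y) - l (x, S_t y) is non-negative. For the partial
  Neumann sum w the number B(u, w) telescopes to (u, g) up to a remainder, so Cauchy-Schwarz for B
  yields the claim once B(u, u) <= t c and t B(w, w) <= t (g, g) + d are known.\<close>

lemma discrete_energy_inequality:
  assumes u: "u \<in> L2" and g: "g \<in> L2" and \<alpha>: "\<alpha> > 0" and t: "t > 0"
    and c: "Qa \<alpha> u \<le> ennreal c" "0 \<le> c"
    and d: "(\<integral>\<^sup>+r\<in>{0<..}. ennreal (exp (- \<alpha> * r) * ip g (S r g)) \<partial>lborel) \<le> ennreal d" "0 \<le> d"
  shows "(ip u g - exp (- \<alpha> * t) ^ N * ip (pow t g N) u)\<^sup>2 \<le> c * (t * ip g g + d)"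
proof -
  define l where "l = exp (- \<alpha> * t)"
  have l: "0 < l" "l \<le> 1" "1 - l \<le> \<alpha> * t" using \<alpha> t exp_ge_add_one_self[of "- \<alpha> * t"] by (auto simp: l_def)
  define B where "B x y = ip x y - l * ip x (S t y)" for x y
  have Bpos: "0 \<le> B v v" if "v \<in> L2" for v
  proof -
    have "l * ip v (S t v) \<le> 1 * ip v v"
      using l ip_S_le[OF that t] ip_S_nonneg[OF that t] by (intro mult_mono) auto
    then show ?thesis by (simp add: B_def)
  qed
  have Bsym: "B x y = B y x" if "x \<in> L2" "y \<in> L2" for x y
    unfolding B_def using S_sym[OF that, of t] by (simp add: ip_sym[of "S t x" y] ip_sym[of x y])
  have Badd: "B (\<lambda>x. u x + v x) w = B u w + B v w" if "u \<in> L2" "v \<in> L2" "w \<in> L2" for u v w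
    unfolding B_def using that by (simp add: ip_add S_L2 algebra_simps)
  have Bscale: "B (\<lambda>x. c * u x) w = c * B u w" for c u w
    unfolding B_def by (simp add: ip_scale algebra_simps)
  define w where "w = neumann t l g N"
  have w: "w \<in> L2" unfolding w_def using g by (rule neumann_L2)
  have CS: "(B u w)\<^sup>2 \<le> B u u * B w w"
  proof (rule CS_real)
    fix \<theta>
    let ?v = "\<lambda>x. u x + \<theta> * w x"
    have v: "?v \<in> L2" "(\<lambda>x. \<theta> * w x) \<in> L2" using u w by (auto intro: L2_add L2_scale)
    have "0 \<le> B ?v ?v" using v by (intro Bpos)
    also have "B ?v ?v = B u ?v + \<theta> * B w ?v" using u w v by (simp add: Badd Bscale)
    also have "B u ?v = B u u + \<theta> * B u w"
      using u w v by (simp add: Badd Bscale Bsym[OF u v(1)] Bsym[OF w u])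
    also have "B w ?v = B u w + \<theta> * B w w"
      using u w v by (simp add: Badd Bscale Bsym[OF w v(1)])
    finally show "0 \<le> B u u + 2 * \<theta> * B u w + \<theta>\<^sup>2 * B w w"
      by (simp add: power2_eq_square algebra_simps)
  qed (rule Bpos[OF w])
  \<comment> \<open>Pairing with w telescopes, since applying S_t to a summand yields the next
    power; only the first and the N-th term survive.\<close>
  have Bw: "B v w = ip v g - l ^ N * ip (pow t g N) v" if v: "v \<in> L2" for v
  proof -
    have "B v w = B w v" using v w by (rule Bsym)
    also have "\<dots> = (\<Sum>n<N. l ^ n * ip (pow t g n) v) - (\<Sum>n<N. l ^ Suc n * ip (pow t g (Suc n)) v)"
      unfolding B_def w_def using g v t
      by (simp add: ip_neumann S_L2 pow_shift sum_distrib_left ac_simps)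
    also have "\<dots> = (\<Sum>n<N. l ^ n * ip (pow t g n) v - l ^ Suc n * ip (pow t g (Suc n)) v)"
      by (rule sum_subtractf[symmetric])
    also have "\<dots> = l ^ 0 * ip (pow t g 0) v - l ^ N * ip (pow t g N) v"
      by (rule sum_lessThan_telescope')
    finally show ?thesis by (simp add: pow_def ip_sym)
  qed
  obtain q where q: "Q u = ennreal q" "0 \<le> q"
  proof -
    have "Q u < \<top>" using Q_le_Qa[of u \<alpha>] c by (meson ennreal_less_top le_less_trans)
    then show ?thesis using that[of "enn2real (Q u)"] by simp
  qed
  have qc: "q + \<alpha> * ip u u \<le> c"
  proof -
    have "ennreal (q + \<alpha> * ip u u) = Qa \<alpha> u"
      using q \<alpha> u ip_nonneg by (simp add: Qa_def nsq_L2 ennreal_mult)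
    then show ?thesis using c by (metis ennreal_le_iff)
  qed
  \<comment> \<open>The quotient at time t bounds the first summand by t Q(u), and 1 - l <= \<alpha>
    t bounds the second, so both parts of \<open>Qa\<close> \<alpha> appear.\<close>
  have Bu: "B u u \<le> t * c"
  proof -
    have "B u u = (ip u u - ip u (S t u)) + (1 - l) * ip u (S t u)" by (simp add: B_def algebra_simps)
    also have "ip u u - ip u (S t u) \<le> t * q"
      using Q_L2_bound[OF u _ q(2) t] q t by (simp add: quot_def field_simps)
    also have "(1 - l) * ip u (S t u) \<le> (\<alpha> * t) * ip u u"
      using l ip_S_le[OF u t] ip_S_nonneg[OF u t] \<alpha> t by (intro mult_mono) auto
    finally have "B u u \<le> t * (q + \<alpha> * ip u u)" by (simp add: algebra_simps)
    also have "\<dots> \<le> t * c" using qc t by simp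
    finally show ?thesis .
  qed
  define h where "h r = ennreal (exp (- \<alpha> * r) * ip g (S r g))" for r
  have [measurable]: "h \<in> borel_measurable borel"
    unfolding h_def using L2_borel[OF g] by measurable
  \<comment> \<open>The summands n >= 1 form a Riemann sum of the decreasing function h. The summand
    n = 0 belongs to time 0 and is kept as t (g, g), which vanishes in the limit t -> 0.\<close>
  have Bww: "t * B w w \<le> t * ip g g + d"
  proof -
    have "B w w = ip w g - l ^ N * ip (pow t g N) w" by (rule Bw[OF w])
    also have "ip (pow t g N) w = (\<Sum>n<N. l ^ n * ip g (pow t g (n + N)))"
      unfolding ip_sym[of _ w] unfolding w_def using g t by (simp add: ip_neumann pow_L2 pow_pow)
    also have "ip w g - l ^ N * (\<Sum>n<N. l ^ n * ip g (pow t g (n + N))) \<le> ip w g"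
      using l g t by (auto intro!: mult_nonneg_nonneg sum_nonneg pow_nonneg)
    also have "ip w g = (\<Sum>n<N. l ^ n * ip g (pow t g n))"
      unfolding w_def using ip_neumann[OF g g] by (simp add: ip_sym[of "pow t g _" g])
    also have "\<dots> \<le> (\<Sum>n<Suc N. l ^ n * ip g (pow t g n))"
      using l g t by (auto intro!: mult_nonneg_nonneg pow_nonneg)
    also have "\<dots> = ip g g + (\<Sum>n<N. l ^ Suc n * ip g (S (real (Suc n) * t) g))"
      by (subst sum.lessThan_Suc_shift) (simp add: pow_def)
    finally have "t * B w w \<le> t * (ip g g + (\<Sum>n<N. l ^ Suc n * ip g (S (real (Suc n) * t) g)))"
      using t by (intro mult_left_mono) auto
    moreover have "t * (\<Sum>n<N. l ^ Suc n * ip g (S (real (Suc n) * t) g)) \<le> d"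
    proof -
      have "ennreal (t * (\<Sum>n<N. l ^ Suc n * ip g (S (real (Suc n) * t) g))) = (\<Sum>n<N. ennreal t * h (real (Suc n) * t))"
      proof -
        have e: "l ^ Suc n = exp (- \<alpha> * (real (Suc n) * t))" for n
          unfolding l_def exp_of_nat_mult[symmetric] by (simp add: algebra_simps)
        have pos: "0 \<le> l ^ Suc n * ip g (S (real (Suc n) * t) g)" for n
          using g t l by (intro mult_nonneg_nonneg ip_S_nonneg) auto
        have "ennreal (t * (\<Sum>n<N. l ^ Suc n * ip g (S (real (Suc n) * t) g))) =
            (\<Sum>n<N. ennreal (t * (l ^ Suc n * ip g (S (real (Suc n) * t) g))))"
          unfolding sum_distrib_left using t pos
          by (intro sum_ennreal[symmetric] mult_nonneg_nonneg[OF _ pos]) simp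
        also have "\<dots> = (\<Sum>n<N. ennreal t * h (real (Suc n) * t))"
          unfolding h_def e[symmetric] using t by (intro sum.cong refl ennreal_mult') simp
        finally show ?thesis .
      qed
      also have "\<dots> \<le> (\<integral>\<^sup>+r\<in>{0<..}. h r \<partial>lborel)"
      proof (rule sum_le_nn_integral_decreasing)
        fix r s :: real assume rs: "0 < r" "r \<le> s"
        then show "h s \<le> h r"
          unfolding h_def using g \<alpha> by (intro ennreal_leI mult_mono ip_S_decreasing ip_S_nonneg) auto
      qed (use t in auto)
      also have "\<dots> \<le> ennreal d" using d by (simp add: h_def)
      finally show ?thesis using d by simp
    qed
    ultimately show ?thesis by (simp add: algebra_simps)
  qed
  have "(B u w)\<^sup>2 \<le> (t * c) * B w w"
    using CS Bu Bpos[OF w] by (meson mult_right_mono order_trans)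
  also have "\<dots> = c * (t * B w w)" by simp
  also have "\<dots> \<le> c * (t * ip g g + d)" using Bww c by (intro mult_left_mono)
  finally show ?thesis unfolding Bw[OF u] l_def .
qed

text \<open>First N tends to infinity, where \<alpha> > 0 supplies the geometric factor that removes
  the remainder, then t tends to 0.\<close>

lemma energy_inequality_L2_pos:
  assumes u: "u \<in> L2" and g: "g \<in> L2" and \<alpha>: "\<alpha> > 0"
    and c: "Qa \<alpha> u \<le> ennreal c" "0 \<le> c"
    and d: "(\<integral>\<^sup>+r\<in>{0<..}. ennreal (exp (- \<alpha> * r) * ip g (S r g)) \<partial>lborel) \<le> ennreal d" "0 \<le> d"
  shows "(ip u g)\<^sup>2 \<le> c * d"
proof -
  have *: "(ip u g)\<^sup>2 \<le> c * (t * ip g g + d)" if t: "t > 0" for t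
  proof (rule tendsto_upperbound)
    have bd: "\<bar>ip (pow t g N) u\<bar> \<le> ip g g + ip u u" for N
    proof -
      have "ip (pow t g N) (pow t g N) \<le> ip g g"
        using g by (simp add: pow_def nsq_S_le)
      then show ?thesis using abs_ip_le[OF pow_L2[OF g, of t N] u] ip_nonneg[of g] ip_nonneg[of u] by linarith
    qed
    have "(\<lambda>N. exp (- \<alpha> * t) ^ N * ip (pow t g N) u) \<longlonglongrightarrow> 0"
    proof (rule Lim_null_comparison)
      show "eventually (\<lambda>N. norm (exp (- \<alpha> * t) ^ N * ip (pow t g N) u) \<le> exp (- \<alpha> * t) ^ N * (ip g g + ip u u)) sequentially"
        using bd by (auto simp: abs_mult intro!: mult_left_mono always_eventually)
      show "(\<lambda>N. exp (- \<alpha> * t) ^ N * (ip g g + ip u u)) \<longlonglongrightarrow> 0"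
        using \<alpha> t by (intro tendsto_mult_left_zero LIMSEQ_power_zero) auto
    qed
    then have "(\<lambda>N. (ip u g - exp (- \<alpha> * t) ^ N * ip (pow t g N) u)\<^sup>2) \<longlonglongrightarrow> (ip u g - 0)\<^sup>2"
      by (intro tendsto_intros)
    then show "(\<lambda>N. (ip u g - exp (- \<alpha> * t) ^ N * ip (pow t g N) u)\<^sup>2) \<longlonglongrightarrow> (ip u g)\<^sup>2" by simp
    show "eventually (\<lambda>N. (ip u g - exp (- \<alpha> * t) ^ N * ip (pow t g N) u)\<^sup>2 \<le> c * (t * ip g g + d)) sequentially"
      using discrete_energy_inequality[OF u g \<alpha> t c d] by simp
  qed simp
  show ?thesis
  proof (rule tendsto_lowerbound)
    have "((\<lambda>t. c * (t * ip g g + d)) \<longlongrightarrow> c * (0 * ip g g + d)) (at_right 0)"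
      by (intro tendsto_intros)
    then show "((\<lambda>t. c * (t * ip g g + d)) \<longlongrightarrow> c * d) (at_right 0)" by simp
    show "eventually (\<lambda>t. (ip u g)\<^sup>2 \<le> c * (t * ip g g + d)) (at_right 0)"
      using * by (auto simp: eventually_at_right_field intro!: exI[of _ 1])
  qed simp
qed

text \<open>At \<alpha> = 0 the Neumann remainder has no geometric factor, so \<alpha> is raised by
  \<epsilon>. This adds \<epsilon> (u, u) to the energy and does not increase the integral; then
  \<epsilon> -> 0.\<close>

lemma energy_inequality_L2:
  assumes u: "u \<in> L2" and g: "g \<in> L2" and \<alpha>: "\<alpha> \<ge> 0"
    and c: "Qa \<alpha> u \<le> ennreal c" "0 \<le> c"
    and d: "(\<integral>\<^sup>+r\<in>{0<..}. ennreal (exp (- \<alpha> * r) * ip g (S r g)) \<partial>lborel) \<le> ennreal d" "0 \<le> d"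
  shows "(ip u g)\<^sup>2 \<le> c * d"
proof (rule tendsto_lowerbound)
  have "((\<lambda>\<epsilon>. (c + \<epsilon> * ip u u) * d) \<longlongrightarrow> (c + 0 * ip u u) * d) (at_right 0)"
    by (intro tendsto_intros)
  then show "((\<lambda>\<epsilon>. (c + \<epsilon> * ip u u) * d) \<longlongrightarrow> c * d) (at_right 0)" by simp
  have "(ip u g)\<^sup>2 \<le> (c + \<epsilon> * ip u u) * d" if \<epsilon>: "\<epsilon> > 0" for \<epsilon>
  proof (rule energy_inequality_L2_pos[OF u g])
    show "\<alpha> + \<epsilon> > 0" "0 \<le> c + \<epsilon> * ip u u" "0 \<le> d" using \<alpha> \<epsilon> c d ip_nonneg[of u] by auto
    have "Qa (\<alpha> + \<epsilon>) u = Qa \<alpha> u + ennreal \<epsilon> * nsq u"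
      using \<alpha> \<epsilon> by (simp add: Qa_def distrib_left distrib_right ac_simps)
    also have "\<dots> \<le> ennreal c + ennreal (\<epsilon> * ip u u)"
      using c(1) u \<epsilon> ip_nonneg by (intro add_mono) (simp_all add: nsq_L2 ennreal_mult)
    finally show "Qa (\<alpha> + \<epsilon>) u \<le> ennreal (c + \<epsilon> * ip u u)" using c \<epsilon> ip_nonneg by simp
    have "(\<integral>\<^sup>+r\<in>{0<..}. ennreal (exp (- (\<alpha> + \<epsilon>) * r) * ip g (S r g)) \<partial>lborel) \<le>
        (\<integral>\<^sup>+r\<in>{0<..}. ennreal (exp (- \<alpha> * r) * ip g (S r g)) \<partial>lborel)"
    proof (rule nn_integral_mono)
      fix r :: real
      have "ennreal (exp (- (\<alpha> + \<epsilon>) * r) * ip g (S r g)) \<le> ennreal (exp (- \<alpha> * r) * ip g (S r g))" if "r > 0"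
        using that \<epsilon> ip_S_nonneg[OF g that] by (intro ennreal_leI mult_right_mono) (auto simp: algebra_simps)
      then show "ennreal (exp (- (\<alpha> + \<epsilon>) * r) * ip g (S r g)) * indicator {0<..} r \<le>
          ennreal (exp (- \<alpha> * r) * ip g (S r g)) * indicator {0<..} r" by (auto split: split_indicator)
    qed
    with d(1) show "(\<integral>\<^sup>+r\<in>{0<..}. ennreal (exp (- (\<alpha> + \<epsilon>) * r) * ip g (S r g)) \<partial>lborel) \<le> ennreal d"
      by (rule order_trans[rotated])
  qed
  then show "eventually (\<lambda>\<epsilon>. (ip u g)\<^sup>2 \<le> (c + \<epsilon> * ip u u) * d) (at_right 0)"
    by (auto simp: eventually_at_right_field intro!: exI[of _ 1])
qed simp

section \<open>Potentials and energies of measures\<close>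

definition potential :: "'a measure \<Rightarrow> real \<Rightarrow> 'a \<Rightarrow> ennreal" where
  "potential \<sigma> s x = (\<integral>\<^sup>+y. k s x y \<partial>\<sigma>)"

definition kernel_energy :: "'a measure \<Rightarrow> real \<Rightarrow> ennreal" where
  "kernel_energy \<sigma> r = (\<integral>\<^sup>+x. \<integral>\<^sup>+y. k r x y \<partial>\<sigma> \<partial>\<sigma>)"

context
  fixes \<sigma> :: "'a measure"
  assumes sigma_sets [measurable_cong]: "sets \<sigma> = sets borel" and sigma_fin: "sigma_finite_measure \<sigma>"
begin

interpretation \<sigma>: sigma_finite_measure \<sigma> by (rule sigma_fin)
interpretation m\<sigma>: pair_sigma_finite m \<sigma> ..
interpretation \<sigma>\<sigma>: pair_sigma_finite \<sigma> \<sigma> ..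
interpretation l\<sigma>: pair_sigma_finite lborel \<sigma> ..

lemma potential_meas [measurable]:
  assumes [measurable]: "f \<in> borel_measurable N" "g \<in> borel_measurable N"
  shows "(\<lambda>w. potential \<sigma> (f w) (g w)) \<in> borel_measurable N"
  unfolding potential_def by measurable

lemma kernel_energy_meas [measurable]: "kernel_energy \<sigma> \<in> borel_measurable borel"
  unfolding kernel_energy_def by measurable

lemma integral_nnP_eq:
  assumes [measurable]: "f \<in> borel_measurable borel"
  shows "(\<integral>\<^sup>+x. nnP s f x \<partial>\<sigma>) = (\<integral>\<^sup>+y. f y * potential \<sigma> s y \<partial>m)"
proof -
  have "(\<integral>\<^sup>+x. nnP s f x \<partial>\<sigma>) = (\<integral>\<^sup>+y. \<integral>\<^sup>+x. k s x y * f y \<partial>\<sigma> \<partial>m)"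
    unfolding nnP_def by (rule m\<sigma>.Fubini') measurable
  also have "\<dots> = (\<integral>\<^sup>+y. f y * potential \<sigma> s y \<partial>m)"
    unfolding potential_def
    by (subst nn_integral_cmult[symmetric]) (auto simp: k_sym ac_simps intro!: nn_integral_cong)
  finally show ?thesis .
qed

lemma nnP_potential: "t > 0 \<Longrightarrow> s > 0 \<Longrightarrow> nnP t (potential \<sigma> s) x = potential \<sigma> (t + s) x"
proof -
  assume ts: "t > 0" "s > 0"
  have "nnP t (potential \<sigma> s) x = (\<integral>\<^sup>+z. \<integral>\<^sup>+y. k t x z * k s z y \<partial>\<sigma> \<partial>m)"
    unfolding nnP_def potential_def by (simp add: nn_integral_cmult)
  also have "\<dots> = (\<integral>\<^sup>+y. \<integral>\<^sup>+z. k t x z * k s z y \<partial>m \<partial>\<sigma>)"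
    by (rule m\<sigma>.Fubini'[symmetric]) measurable
  also have "\<dots> = potential \<sigma> (t + s) x"
    unfolding potential_def by (simp add: k_CK[OF ts(2,1), of x, symmetric] add.commute[of s t])
  finally show ?thesis .
qed

lemma integral_potential_potential:
  assumes "s > 0" "r > 0"
  shows "(\<integral>\<^sup>+x. potential \<sigma> s x * potential \<sigma> r x \<partial>m) = kernel_energy \<sigma> (s + r)"
proof -
  have "kernel_energy \<sigma> (s + r) = (\<integral>\<^sup>+x. nnP s (potential \<sigma> r) x \<partial>\<sigma>)"
    unfolding kernel_energy_def using assms by (simp add: nnP_potential potential_def[symmetric])
  also have "\<dots> = (\<integral>\<^sup>+y. potential \<sigma> r y * potential \<sigma> s y \<partial>m)"
    by (rule integral_nnP_eq) measurable
  finally show ?thesis by (simp add: mult.commute)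
qed

text \<open>The energy at time r is the squared L2 norm of the potential at time r / 2, and the
  semigroup contracts this norm.\<close>

lemma kernel_energy_decreasing:
  assumes "0 < s" "s \<le> r" shows "kernel_energy \<sigma> r \<le> kernel_energy \<sigma> s"
proof (cases "s = r")
  case False
  define d where "d = (r - s) / 2"
  have d: "d > 0" "d + s / 2 = r / 2" using False assms by (auto simp: d_def field_simps)
  have e: "nnP d (potential \<sigma> (s / 2)) x = potential \<sigma> (r / 2) x" for x
    using nnP_potential[OF d(1), of "s / 2" x, unfolded d(2)] assms by auto
  have "kernel_energy \<sigma> r = (\<integral>\<^sup>+x. (nnP d (potential \<sigma> (s / 2)) x)\<^sup>2 \<partial>m)"
    using integral_potential_potential[of "r / 2" "r / 2"] assms
    by (simp add: e power2_eq_square)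
  also have "\<dots> \<le> (\<integral>\<^sup>+x. (potential \<sigma> (s / 2) x)\<^sup>2 \<partial>m)"
    by (rule nnP_square_integral_le) measurable
  also have "\<dots> = kernel_energy \<sigma> s"
    using integral_potential_potential[of "s / 2" "s / 2"] assms by (simp add: power2_eq_square)
  finally show ?thesis .
qed simp

lemma resolvent_energy:
  "(\<integral>\<^sup>+x. \<integral>\<^sup>+y. resolvent_kernel k \<alpha> x y \<partial>\<sigma> \<partial>\<sigma>) = (\<integral>\<^sup>+r\<in>{0<..}. ennreal (exp (- \<alpha> * r)) * kernel_energy \<sigma> r \<partial>lborel)"
proof -
  let ?f = "\<lambda>r x y. ennreal (exp (- \<alpha> * r)) * k r x y * indicator {0<..} r"
  have "(\<integral>\<^sup>+y. resolvent_kernel k \<alpha> x y \<partial>\<sigma>) = (\<integral>\<^sup>+r. \<integral>\<^sup>+y. ?f r x y \<partial>\<sigma> \<partial>lborel)" for x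
    unfolding resolvent_kernel_def by (rule l\<sigma>.Fubini') measurable
  then have "(\<integral>\<^sup>+x. \<integral>\<^sup>+y. resolvent_kernel k \<alpha> x y \<partial>\<sigma> \<partial>\<sigma>) = (\<integral>\<^sup>+x. \<integral>\<^sup>+r. \<integral>\<^sup>+y. ?f r x y \<partial>\<sigma> \<partial>lborel \<partial>\<sigma>)" by simp
  also have "\<dots> = (\<integral>\<^sup>+r. \<integral>\<^sup>+x. \<integral>\<^sup>+y. ?f r x y \<partial>\<sigma> \<partial>\<sigma> \<partial>lborel)"
    by (rule l\<sigma>.Fubini') measurable
  also have "\<dots> = (\<integral>\<^sup>+r\<in>{0<..}. ennreal (exp (- \<alpha> * r)) * kernel_energy \<sigma> r \<partial>lborel)"
    unfolding kernel_energy_def by (simp add: nn_integral_cmult nn_integral_multc)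
  finally show ?thesis .
qed

text \<open>A finite time integral gives finiteness at some time before s only; monotonicity carries
  it on to s.\<close>

lemma kernel_energy_finite:
  assumes "(\<integral>\<^sup>+x. \<integral>\<^sup>+y. resolvent_kernel k \<alpha> x y \<partial>\<sigma> \<partial>\<sigma>) < \<top>" and s: "s > 0"
  shows "kernel_energy \<sigma> s < \<top>"
proof -
  have "AE r in lborel. ennreal (exp (- \<alpha> * r)) * kernel_energy \<sigma> r * indicator {0<..} r \<noteq> \<infinity>"
    using assms(1) unfolding resolvent_energy by (intro nn_integral_PInf_AE) auto
  then have ae: "AE r in lborel. r \<in> {0<..<s} \<longrightarrow> kernel_energy \<sigma> r < \<top>"
    by eventually_elim (auto simp: less_top[symmetric] ennreal_mult_eq_top_iff)
  have "\<exists>r\<in>{0<..<s}. kernel_energy \<sigma> r < \<top>"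
  proof (rule ccontr)
    assume "\<not> ?thesis"
    with ae have "AE r in lborel. r \<notin> {0<..<s}" by (auto elim!: eventually_mono)
    then have "emeasure lborel {0<..<s} = 0"
      by (subst (asm) AE_iff_measurable[of "{0<..<s}"]) auto
    then show False using s by simp
  qed
  then obtain r where "0 < r" "r < s" "kernel_energy \<sigma> r < \<top>" by auto
  then show ?thesis using kernel_energy_decreasing[of r s] by simp
qed

text \<open>Smoothing by the semigroup turns the measure into the square integrable density
  \<^term>\<open>potential \<sigma> s\<close>.\<close>

lemma energy_inequality:
  assumes u: "u \<in> L2" "\<And>x. 0 \<le> u x" and \<alpha>: "\<alpha> \<ge> 0" and s: "s > 0"
    and c: "Qa \<alpha> u \<le> ennreal c" "0 \<le> c"
    and d: "(\<integral>\<^sup>+x. \<integral>\<^sup>+y. resolvent_kernel k \<alpha> x y \<partial>\<sigma> \<partial>\<sigma>) \<le> ennreal d" "0 \<le> d"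
  shows "(\<integral>\<^sup>+x. nnP s (\<lambda>y. ennreal (u y)) x \<partial>\<sigma>) \<le> ennreal (exp (\<alpha> * s) * sqrt (c * d))"
proof -
  have [measurable]: "u \<in> borel_measurable borel" using u by (simp add: L2_borel)
  have fin: "kernel_energy \<sigma> r < \<top>" if "r > 0" for r
    using kernel_energy_finite[OF _ that, of \<alpha>] d(1) by (simp add: order.strict_trans1)
  have AEf: "AE x in m. potential \<sigma> r x < \<top>" if r: "r > 0" for r
  proof -
    have "(\<integral>\<^sup>+x. (potential \<sigma> r x)\<^sup>2 \<partial>m) \<noteq> \<infinity>"
      using integral_potential_potential[OF r r] fin[of "r + r"] r by (simp add: power2_eq_square)
    then have "AE x in m. (potential \<sigma> r x)\<^sup>2 \<noteq> \<infinity>" by (intro nn_integral_PInf_AE) auto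
    then show ?thesis by eventually_elim (auto simp: less_top[symmetric] power2_eq_square ennreal_mult_eq_top_iff)
  qed
  define G where "G r x = enn2real (potential \<sigma> r x)" for r x
  have [measurable]: "G r \<in> borel_measurable borel" for r unfolding G_def by measurable
  have G0: "0 \<le> G r x" for r x by (simp add: G_def)
  have GL2: "G r \<in> L2" if r: "r > 0" for r
  proof -
    have "nsq (G r) = (\<integral>\<^sup>+x. potential \<sigma> r x * potential \<sigma> r x \<partial>m)"
      unfolding nsq_def using AEf[OF r]
      by (intro nn_integral_cong_AE, eventually_elim) (simp add: G_def power2_eq_square ennreal_mult)
    then show ?thesis using integral_potential_potential[OF r r] fin[of "r + r"] r by (simp add: L2_iff)
  qed
  define g where "g = G s"
  have g: "g \<in> L2" unfolding g_def using s by (rule GL2)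
  have Sg: "S r g = G (r + s)" if r: "r > 0" for r
  proof
    fix x
    have "S r g x = enn2real (nnP r (\<lambda>y. ennreal (g y)) x)"
      using G0 by (intro S_nn) (auto simp: g_def)
    also have "nnP r (\<lambda>y. ennreal (g y)) x = nnP r (potential \<sigma> s) x"
      using AEf[OF s] by (intro nnP_cong_AE, eventually_elim) (simp add: g_def G_def)
    finally show "S r g x = G (r + s) x" using r s by (simp add: G_def nnP_potential)
  qed
  have ipg: "ennreal (ip g (S r g)) = kernel_energy \<sigma> (2 * s + r)" if r: "r > 0" for r
  proof -
    have "ennreal (ip g (S r g)) = (\<integral>\<^sup>+x. ennreal (G s x) * ennreal (G (r + s) x) \<partial>m)"
      unfolding Sg[OF r] unfolding g_def using G0 r s
      by (intro nn_abs_eq_ip[symmetric] L2_integrable_mult GL2) auto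
    also have "\<dots> = (\<integral>\<^sup>+x. potential \<sigma> s x * potential \<sigma> (r + s) x \<partial>m)"
      using AEf[OF s] AEf[of "r + s"] r s
      by (intro nn_integral_cong_AE) (auto simp: G_def)
    also have "\<dots> = kernel_energy \<sigma> (2 * s + r)"
      using integral_potential_potential[of s "r + s"] r s by (simp add: algebra_simps)
    finally show ?thesis .
  qed
  \<comment> \<open>By \<open>ipg\<close> the energies of g = G_s are those of \<sigma> delayed by
    2s. Undoing the delay in the exponential weight costs exp(2 \<alpha> s).\<close>
  have dd: "(\<integral>\<^sup>+r\<in>{0<..}. ennreal (exp (- \<alpha> * r) * ip g (S r g)) \<partial>lborel) \<le> ennreal (exp (\<alpha> * s) ^ 2 * d)"
  proof -
    let ?h = "\<lambda>r. ennreal (exp (- \<alpha> * r)) * kernel_energy \<sigma> r * indicator {0<..} r"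
    have "(\<integral>\<^sup>+r\<in>{0<..}. ennreal (exp (- \<alpha> * r) * ip g (S r g)) \<partial>lborel) \<le>
        (\<integral>\<^sup>+r. ennreal (exp (\<alpha> * s) ^ 2) * ?h (2 * s + r) \<partial>lborel)"
    proof (rule nn_integral_mono)
      fix r :: real
      show "ennreal (exp (- \<alpha> * r) * ip g (S r g)) * indicator {0<..} r \<le> ennreal (exp (\<alpha> * s) ^ 2) * ?h (2 * s + r)"
      proof (cases "r > 0")
        case True
        have "exp (\<alpha> * s) ^ 2 * exp (- \<alpha> * (2 * s + r)) = exp (- \<alpha> * r)"
          by (simp add: power2_eq_square exp_add[symmetric] algebra_simps)
        then have "ennreal (exp (- \<alpha> * r)) = ennreal (exp (\<alpha> * s) ^ 2) * ennreal (exp (- \<alpha> * (2 * s + r)))"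
          by (simp add: ennreal_mult[symmetric])
        then show ?thesis
          using True s ip_S_nonneg[OF g True] ipg[OF True] by (simp add: ennreal_mult mult.assoc)
      qed simp
    qed
    also have "\<dots> = ennreal (exp (\<alpha> * s) ^ 2) * (\<integral>\<^sup>+r. ?h (2 * s + r) \<partial>lborel)"
      by (rule nn_integral_cmult) measurable
    also have "(\<integral>\<^sup>+r. ?h (2 * s + r) \<partial>lborel) = (\<integral>\<^sup>+r. ?h r \<partial>lborel)"
      using nn_integral_real_affine[of ?h 1 "2 * s"] by simp
    also have "\<dots> \<le> ennreal d" using d(1) unfolding resolvent_energy .
    finally show ?thesis using d(2) by (simp add: ennreal_mult mult_left_mono)
  qed
  have sq: "(ip u g)\<^sup>2 \<le> c * (exp (\<alpha> * s) ^ 2 * d)"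
    using energy_inequality_L2[OF u(1) g \<alpha> c dd] d(2) by simp
  have "(\<integral>\<^sup>+x. nnP s (\<lambda>y. ennreal (u y)) x \<partial>\<sigma>) = (\<integral>\<^sup>+y. ennreal (u y) * potential \<sigma> s y \<partial>m)"
    by (rule integral_nnP_eq) measurable
  also have "\<dots> = (\<integral>\<^sup>+y. ennreal (u y) * ennreal (g y) \<partial>m)"
    using AEf[OF s] by (intro nn_integral_cong_AE, eventually_elim) (simp add: g_def G_def)
  also have "\<dots> = ennreal (ip u g)"
    using u g G0 by (intro nn_abs_eq_ip L2_integrable_mult) (auto simp: g_def)
  also have "\<dots> \<le> ennreal (exp (\<alpha> * s) * sqrt (c * d))"
  proof (rule ennreal_leI)
    have "ip u g \<le> sqrt (c * (exp (\<alpha> * s) ^ 2 * d))" using sq by (rule real_le_rsqrt)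
    also have "\<dots> = exp (\<alpha> * s) * sqrt (c * d)" by (simp add: real_sqrt_mult)
    finally show "ip u g \<le> exp (\<alpha> * s) * sqrt (c * d)" .
  qed
  finally show ?thesis .
qed

end
end

section \<open>Embedding into the Lebesgue spaces of measures with bounded potentials\<close>

lemma measurable_ennreal_powr [measurable]:
  assumes [measurable]: "f \<in> borel_measurable N"
  shows "(\<lambda>x. ennreal_powr (f x) p) \<in> borel_measurable N"
  unfolding ennreal_powr_def by measurable

lemma ennreal_powr_mono: "a \<le> b \<Longrightarrow> p \<ge> 0 \<Longrightarrow> ennreal_powr a p \<le> ennreal_powr b p"
  unfolding ennreal_powr_def
  by (auto simp: top_unique less_top intro!: ennreal_leI powr_mono2 enn2real_mono)

text \<open>Young's inequality with exponents p and q = p / (p - 1) for a / \<Theta>^{1/p} and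
  b^{2p-2} / I^{1-1/p}; note (2p - 2) q = 2p. The normalisation makes the right-hand bracket
  integrate to at most 1, so that integration reproduces Hoelder's inequality. For p = 1 there is no
  q, hence the separate case.\<close>

lemma Young_pointwise:
  fixes p a b \<Theta> I :: real
  assumes p: "p \<ge> 1" and pos: "\<Theta> > 0" "I > 0" and "a \<ge> 0" "b \<ge> 0"
  shows "a * b powr (2 * p - 2) \<le> \<Theta> powr (1 / p) * I powr (1 - 1 / p) *
     (1 / p * (a powr p / \<Theta>) + (1 - 1 / p) * (b powr (2 * p) / I))"
proof (cases "p = 1")
  case True
  then show ?thesis using assms by auto
next
  case False
  with p have p1: "p > 1" by simp
  define A where "A = a / \<Theta> powr (1 / p)"
  define B where "B = b powr (2 * p - 2) / I powr (1 - 1 / p)"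
  define q where "q = p / (p - 1)"
  have q: "q > 1" "1 / p + 1 / q = 1" "1 / q = 1 - 1 / p" using p1 by (auto simp: q_def field_simps)
  have AB: "0 \<le> A" "0 \<le> B" using assms by (auto simp: A_def B_def)
  have "A * B \<le> A powr p / p + B powr q / q"
    using Youngs_inequality[OF p1 q(1,2) AB] .
  moreover have "A powr p = a powr p / \<Theta>"
    unfolding A_def using assms p1 by (simp add: powr_divide powr_powr)
  moreover have "B powr q = b powr (2 * p) / I"
  proof -
    have "(2 * p - 2) * q = 2 * p" "(1 - 1 / p) * q = 1" using p1 by (auto simp: q_def field_simps)
    then show ?thesis unfolding B_def using assms p1 by (simp add: powr_divide powr_powr)
  qed
  ultimately have "A * B \<le> 1 / p * (a powr p / \<Theta>) + (1 - 1 / p) * (b powr (2 * p) / I)"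
    by (simp add: q(3)[symmetric] mult.commute)
  then have "\<Theta> powr (1 / p) * I powr (1 - 1 / p) * (A * B) \<le> \<Theta> powr (1 / p) * I powr (1 - 1 / p) *
     (1 / p * (a powr p / \<Theta>) + (1 - 1 / p) * (b powr (2 * p) / I))"
    by (intro mult_left_mono) auto
  moreover have "\<Theta> powr (1 / p) * I powr (1 - 1 / p) * (A * B) = a * b powr (2 * p - 2)"
    using pos by (simp add: A_def B_def)
  ultimately show ?thesis by simp
qed

text \<open>Both sides contain the factor (a b)^{2p-2}; what remains is 2 a b <= a^2 + b^2.\<close>

lemma AM_GM_pointwise:
  fixes a b p :: real assumes "a \<ge> 0" "b \<ge> 0"
  shows "2 * (a powr (2 * p - 1) * b powr (2 * p - 1)) \<le>
    a powr (2 * p) * b powr (2 * p - 2) + b powr (2 * p) * a powr (2 * p - 2)"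
proof (cases "a = 0 \<or> b = 0")
  case True then show ?thesis by auto
next
  case False
  with assms have ab: "a > 0" "b > 0" by auto
  have 1: "x powr (2 * p - 1) = x powr (2 * p - 2) * x" "x powr (2 * p) = x powr (2 * p - 2) * x\<^sup>2" if "x > 0" for x :: real
    using that by (simp_all add: powr_diff power2_eq_square powr_numeral field_simps)
  have "2 * (a powr (2 * p - 1) * b powr (2 * p - 1)) = (a powr (2 * p - 2) * b powr (2 * p - 2)) * (2 * a * b)"
    using ab by (simp add: 1)
  also have "\<dots> \<le> (a powr (2 * p - 2) * b powr (2 * p - 2)) * (a\<^sup>2 + b\<^sup>2)"
    using sum_squares_bound[of a b] by (intro mult_left_mono) auto
  also have "\<dots> = a powr (2 * p) * b powr (2 * p - 2) + b powr (2 * p) * a powr (2 * p - 2)"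
    unfolding 1[OF ab(1)] 1[OF ab(2)] by (simp add: algebra_simps)
  finally show ?thesis .
qed

text \<open>By \<open>AM_GM_pointwise\<close> and the symmetry of T the double integral is at most
  X, in which the weight \<omega>^{2p} depends on x alone. The inner integral over y is then bounded
  by Hoelder with the hypothesis on T^p, and integrating \<omega>^{2p} contributes the last factor
  I.\<close>

lemma Schur_bound:
  fixes T :: "'a \<Rightarrow> 'a \<Rightarrow> ennreal"
  assumes "sigma_finite_measure \<nu>" and [measurable]: "(\<lambda>(x, y). T x y) \<in> borel_measurable (\<nu> \<Otimes>\<^sub>M \<nu>)"
    and sym: "\<And>x y. T x y = T y x" and p: "p \<ge> 1" and pos: "\<Theta> > 0" "I > 0"
    and T: "AE x in \<nu>. (\<integral>\<^sup>+y. ennreal_powr (T x y) p \<partial>\<nu>) \<le> ennreal \<Theta>"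
    and [measurable]: "\<omega> \<in> borel_measurable \<nu>" and \<omega>: "\<And>x. 0 \<le> \<omega> x"
    and I: "(\<integral>\<^sup>+x. ennreal (\<omega> x powr (2 * p)) \<partial>\<nu>) = ennreal I"
  shows "(\<integral>\<^sup>+x. \<integral>\<^sup>+y. ennreal (\<omega> x powr (2 * p - 1)) * (T x y * ennreal (\<omega> y powr (2 * p - 1))) \<partial>\<nu> \<partial>\<nu>)
    \<le> ennreal (\<Theta> powr (1 / p) * I powr (2 - 1 / p))"
proof -
  interpret sigma_finite_measure \<nu> by fact
  interpret \<nu>\<nu>: pair_sigma_finite \<nu> \<nu> ..
  define C where "C = \<Theta> powr (1 / p) * I powr (1 - 1 / p)"
  have C: "C \<ge> 0" by (simp add: C_def)
  have [measurable]: "T x \<in> borel_measurable \<nu>" if "x \<in> space \<nu>" for x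
    using measurable_compose[OF measurable_Pair1'[OF that] assms(2)] by simp
  define X where "X = (\<integral>\<^sup>+x. \<integral>\<^sup>+y. ennreal (\<omega> x powr (2 * p)) * (T x y * ennreal (\<omega> y powr (2 * p - 2))) \<partial>\<nu> \<partial>\<nu>)"
  \<comment> \<open>Hoelder's inequality with the constant C = \<Theta>^{1/p} I^{1-1/p}, carried out
    pointwise.\<close>
  have inner: "AE x in \<nu>. (\<integral>\<^sup>+y. T x y * ennreal (\<omega> y powr (2 * p - 2)) \<partial>\<nu>) \<le> ennreal C"
    using T AE_space
  proof eventually_elim
    case (elim x)
    then have [measurable]: "T x \<in> borel_measurable \<nu>" by simp
    have pt: "T x y * ennreal (\<omega> y powr (2 * p - 2)) \<le>
        ennreal (C * (1 / p) / \<Theta>) * ennreal_powr (T x y) p + ennreal (C * (1 - 1 / p) / I) * ennreal (\<omega> y powr (2 * p))" for y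
    proof (cases "T x y")
      case (real a)
      have "a * \<omega> y powr (2 * p - 2) \<le> C * (1 / p) / \<Theta> * a powr p + C * (1 - 1 / p) / I * \<omega> y powr (2 * p)"
        using Young_pointwise[OF p pos _ \<omega>, of a y] real by (simp add: C_def[symmetric] distrib_left mult.assoc)
      then show ?thesis
        using real C p pos \<omega>
        by (simp add: ennreal_powr_def ennreal_mult[symmetric] ennreal_plus[symmetric] ennreal_leI del: ennreal_plus)
    next
      \<comment> \<open>The coefficient of the p-th power is strictly positive, so the right-hand
        side is infinite too.\<close>
      case top
      have "ennreal (C * (1 / p) / \<Theta>) > 0" using p pos by (simp add: C_def)
      then have "ennreal (C * (1 / p) / \<Theta>) * \<top> = \<top>" by (metis ennreal_mult_top not_gr_zero)
      then show ?thesis by (simp only: top ennreal_powr_def if_True) simp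
    qed
    have "(\<integral>\<^sup>+y. T x y * ennreal (\<omega> y powr (2 * p - 2)) \<partial>\<nu>) \<le>
       (\<integral>\<^sup>+y. ennreal (C * (1 / p) / \<Theta>) * ennreal_powr (T x y) p + ennreal (C * (1 - 1 / p) / I) * ennreal (\<omega> y powr (2 * p)) \<partial>\<nu>)"
      by (intro nn_integral_mono pt)
    also have "\<dots> = ennreal (C * (1 / p) / \<Theta>) * (\<integral>\<^sup>+y. ennreal_powr (T x y) p \<partial>\<nu>) +
        ennreal (C * (1 - 1 / p) / I) * ennreal I"
      unfolding I[symmetric] by (subst nn_integral_add) (auto simp: nn_integral_cmult)
    also have "\<dots> \<le> ennreal (C * (1 / p) / \<Theta>) * ennreal \<Theta> + ennreal (C * (1 - 1 / p) / I) * ennreal I"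
      using elim by (intro add_mono mult_left_mono) auto
    also have "\<dots> = ennreal (C * (1 / p) + C * (1 - 1 / p))"
      using C p pos by (simp add: ennreal_mult[symmetric] ennreal_plus[symmetric] del: ennreal_plus)
    also have "C * (1 / p) + C * (1 - 1 / p) = C" by (simp add: algebra_simps)
    finally show ?case .
  qed
  have X: "X \<le> ennreal (C * I)"
  proof -
    have "X = (\<integral>\<^sup>+x. ennreal (\<omega> x powr (2 * p)) * (\<integral>\<^sup>+y. T x y * ennreal (\<omega> y powr (2 * p - 2)) \<partial>\<nu>) \<partial>\<nu>)"
      unfolding X_def by (intro nn_integral_cong nn_integral_cmult) measurable
    also have "\<dots> \<le> (\<integral>\<^sup>+x. ennreal (\<omega> x powr (2 * p)) * ennreal C \<partial>\<nu>)"
      using inner by (intro nn_integral_mono_AE, eventually_elim) (auto intro: mult_left_mono)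
    also have "\<dots> = (\<integral>\<^sup>+x. ennreal (\<omega> x powr (2 * p)) \<partial>\<nu>) * ennreal C"
      by (rule nn_integral_multc) measurable
    also have "\<dots> = ennreal (C * I)"
      unfolding I using C pos by (simp add: ennreal_mult mult.commute)
    finally show ?thesis .
  qed
  have swap: "(\<integral>\<^sup>+x. \<integral>\<^sup>+y. ennreal (\<omega> y powr (2 * p)) * (T x y * ennreal (\<omega> x powr (2 * p - 2))) \<partial>\<nu> \<partial>\<nu>) = X"
  proof -
    have [measurable]: "(\<lambda>(x, y). T y x) \<in> borel_measurable (\<nu> \<Otimes>\<^sub>M \<nu>)"
    proof -
      have "(\<lambda>(x, y). T y x) = (\<lambda>(x, y). T x y)" by (auto simp: fun_eq_iff intro: sym)
      with assms(2) show ?thesis by simp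
    qed
    have "(\<integral>\<^sup>+y. \<integral>\<^sup>+x. ennreal (\<omega> x powr (2 * p)) * (T y x * ennreal (\<omega> y powr (2 * p - 2))) \<partial>\<nu> \<partial>\<nu>) =
        (\<integral>\<^sup>+x. \<integral>\<^sup>+y. ennreal (\<omega> x powr (2 * p)) * (T y x * ennreal (\<omega> y powr (2 * p - 2))) \<partial>\<nu> \<partial>\<nu>)"
      by (rule \<nu>\<nu>.Fubini') measurable
    also have "\<dots> = X"
      unfolding X_def by (intro nn_integral_cong arg_cong2[where f="(*)"] refl sym)
    finally show ?thesis .
  qed
  have "2 * (\<integral>\<^sup>+x. \<integral>\<^sup>+y. ennreal (\<omega> x powr (2 * p - 1)) * (T x y * ennreal (\<omega> y powr (2 * p - 1))) \<partial>\<nu> \<partial>\<nu>) =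
     (\<integral>\<^sup>+x. \<integral>\<^sup>+y. T x y * ennreal (2 * (\<omega> x powr (2 * p - 1) * \<omega> y powr (2 * p - 1))) \<partial>\<nu> \<partial>\<nu>)"
  proof -
    have "2 * (\<integral>\<^sup>+x. \<integral>\<^sup>+y. ennreal (\<omega> x powr (2 * p - 1)) * (T x y * ennreal (\<omega> y powr (2 * p - 1))) \<partial>\<nu> \<partial>\<nu>) =
       (\<integral>\<^sup>+x. \<integral>\<^sup>+y. 2 * (ennreal (\<omega> x powr (2 * p - 1)) * (T x y * ennreal (\<omega> y powr (2 * p - 1)))) \<partial>\<nu> \<partial>\<nu>)"
      by (simp add: nn_integral_cmult cong: nn_integral_cong)
    also have "\<dots> = (\<integral>\<^sup>+x. \<integral>\<^sup>+y. T x y * ennreal (2 * (\<omega> x powr (2 * p - 1) * \<omega> y powr (2 * p - 1))) \<partial>\<nu> \<partial>\<nu>)"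
      by (intro nn_integral_cong) (simp add: ennreal_mult ac_simps)
    finally show ?thesis .
  qed
  also have "\<dots> \<le> (\<integral>\<^sup>+x. \<integral>\<^sup>+y. ennreal (\<omega> x powr (2 * p)) * (T x y * ennreal (\<omega> y powr (2 * p - 2))) +
      ennreal (\<omega> y powr (2 * p)) * (T x y * ennreal (\<omega> x powr (2 * p - 2))) \<partial>\<nu> \<partial>\<nu>)"
  proof (intro nn_integral_mono)
    fix x y
    have "T x y * ennreal (2 * (\<omega> x powr (2 * p - 1) * \<omega> y powr (2 * p - 1))) \<le>
        T x y * ennreal (\<omega> x powr (2 * p) * \<omega> y powr (2 * p - 2) + \<omega> y powr (2 * p) * \<omega> x powr (2 * p - 2))"
      by (intro mult_left_mono ennreal_leI AM_GM_pointwise \<omega>) simp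
    then show "T x y * ennreal (2 * (\<omega> x powr (2 * p - 1) * \<omega> y powr (2 * p - 1))) \<le>
        ennreal (\<omega> x powr (2 * p)) * (T x y * ennreal (\<omega> y powr (2 * p - 2))) +
        ennreal (\<omega> y powr (2 * p)) * (T x y * ennreal (\<omega> x powr (2 * p - 2)))"
      by (simp add: ennreal_mult distrib_left ac_simps)
  qed
  also have "\<dots> = X + X"
    unfolding X_def[symmetric] by (simp add: nn_integral_add X_def[symmetric] swap cong: nn_integral_cong)
  also have "\<dots> = 2 * X" by (simp add: mult_2)
  finally have "(\<integral>\<^sup>+x. \<integral>\<^sup>+y. ennreal (\<omega> x powr (2 * p - 1)) * (T x y * ennreal (\<omega> y powr (2 * p - 1))) \<partial>\<nu> \<partial>\<nu>) \<le> X"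
    by (simp add: ennreal_mult_le_mult_iff)
  also note X
  also have "C * I = \<Theta> powr (1 / p) * I powr (2 - 1 / p)"
    using pos by (simp add: C_def powr_diff powr_numeral power2_eq_square)
  finally show ?thesis .
qed

context symmetric_kernel begin

lemma resolvent_meas [measurable]:
  assumes [measurable]: "f \<in> borel_measurable N" "g \<in> borel_measurable N"
  shows "(\<lambda>w. resolvent_kernel k \<alpha> (f w) (g w)) \<in> borel_measurable N"
  unfolding resolvent_kernel_def by measurable

lemma resolvent_sym: "resolvent_kernel k \<alpha> x y = resolvent_kernel k \<alpha> y x"
  by (simp add: resolvent_kernel_def k_sym)

lemma resolvent_antimono: "\<alpha> \<le> \<beta> \<Longrightarrow> resolvent_kernel k \<beta> x y \<le> resolvent_kernel k \<alpha> x y"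
  unfolding resolvent_kernel_def
  by (intro nn_integral_mono) (auto split: split_indicator intro!: mult_right_mono ennreal_leI)

text \<open>The function h stands for the values of u under \<nu>, where u itself is fixed only up
  to \<open>m\<close>-null sets. Requiring h to lie below the lower limit of the smoothed functions
  is weak enough to cover |f| for core f, indicators of open sets, and |f - S_t f|.\<close>

lemma embedding_bound:
  fixes \<nu> :: "'a measure"
  assumes sets\<nu> [measurable_cong]: "sets \<nu> = sets borel" and sf: "sigma_finite_measure \<nu>" and p: "p \<ge> 1" and \<Theta>: "\<Theta> > 0"
    and R: "AE x in \<nu>. (\<integral>\<^sup>+y. ennreal_powr (resolvent_kernel k \<alpha> x y) p \<partial>\<nu>) \<le> ennreal \<Theta>"
    and u: "u \<in> L2" "\<And>x. 0 \<le> u x" and \<alpha>: "\<alpha> \<ge> 0" and c: "Qa \<alpha> u \<le> ennreal c" "0 \<le> c"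
    and s: "\<And>n::nat. s n > 0" "s \<longlonglongrightarrow> 0"
    and [measurable]: "h \<in> borel_measurable borel" and h: "\<And>x. 0 \<le> h x"
    and lim: "AE x in \<nu>. ennreal (h x) \<le> liminf (\<lambda>n. nnP (s n) (\<lambda>y. ennreal (u y)) x)"
  shows "(\<integral>\<^sup>+x. ennreal (h x powr (2 * p)) \<partial>\<nu>) \<le> ennreal (\<Theta> * c powr p)"
proof -
  interpret \<nu>: sigma_finite_measure \<nu> by (rule sf)
  have [measurable]: "u \<in> borel_measurable borel" using u by (simp add: L2_borel)
  obtain E where E: "range E \<subseteq> sets \<nu>" "(\<Union>n::nat. E n) = space \<nu>" "\<And>n. emeasure \<nu> (E n) \<noteq> \<infinity>" "incseq E"
    using \<nu>.sigma_finite_incseq by metis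
  have [measurable]: "E n \<in> sets borel" for n using E(1) sets\<nu> by auto
  have sp: "space \<nu> = UNIV" using sets_eq_imp_space_eq[OF sets\<nu>] by simp
  \<comment> \<open>Cutting h in height and in space makes the integral I of \<omega>^{2p} finite,
    which is what allows the division by a power of I below.\<close>
  define \<omega> where "\<omega> n x = min (h x) (real n) * indicator (E n) x" for n x
  have [measurable]: "\<omega> n \<in> borel_measurable borel" for n unfolding \<omega>_def by measurable
  have \<omega>0: "0 \<le> \<omega> n x" for n x using h by (auto simp: \<omega>_def)
  have \<omega>h: "\<omega> n x \<le> h x" for n x using h by (auto simp: \<omega>_def split: split_indicator)
  have \<omega>n: "\<omega> n x \<le> real n * indicator (E n) x" for n x using h by (auto simp: \<omega>_def split: split_indicator)
  have bound: "(\<integral>\<^sup>+x. ennreal (\<omega> n x powr (2 * p)) \<partial>\<nu>) \<le> ennreal (\<Theta> * c powr p)" for n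
  proof -
    have "(\<integral>\<^sup>+x. ennreal (\<omega> n x powr (2 * p)) \<partial>\<nu>) \<le> (\<integral>\<^sup>+x. ennreal (real n powr (2 * p)) * indicator (E n) x \<partial>\<nu>)"
    proof (rule nn_integral_mono)
      fix x
      show "ennreal (\<omega> n x powr (2 * p)) \<le> ennreal (real n powr (2 * p)) * indicator (E n) x"
        using \<omega>0[of n x] \<omega>n[of n x] p
        by (cases "x \<in> E n") (auto intro!: ennreal_leI powr_mono2)
    qed
    also have "\<dots> < \<top>" using E(3)[of n] by (simp add: nn_integral_cmult_indicator ennreal_mult_less_top less_top)
    finally obtain I where I: "(\<integral>\<^sup>+x. ennreal (\<omega> n x powr (2 * p)) \<partial>\<nu>) = ennreal I" "I \<ge> 0"
      by (metis enn2real_nonneg ennreal_enn2real)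
    show ?thesis
    proof (cases "I = 0")
      case True then show ?thesis using I by simp
    next
      case False
      with I have I0: "I > 0" by simp
      define \<sigma> where "\<sigma> = density \<nu> (\<lambda>x. ennreal (\<omega> n x powr (2 * p - 1)))"
      have sets\<sigma> [measurable_cong]: "sets \<sigma> = sets borel" by (simp add: \<sigma>_def sets\<nu>)
      have int\<sigma>: "(\<integral>\<^sup>+x. f x \<partial>\<sigma>) = (\<integral>\<^sup>+x. ennreal (\<omega> n x powr (2 * p - 1)) * f x \<partial>\<nu>)"
        if [measurable]: "f \<in> borel_measurable borel" for f
        unfolding \<sigma>_def by (subst nn_integral_density) auto
      have sf\<sigma>: "sigma_finite_measure \<sigma>"
        unfolding \<sigma>_def by (subst \<nu>.sigma_finite_iff_density_finite) auto
      interpret \<sigma>: sigma_finite_measure \<sigma> by (rule sf\<sigma>)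
      define d where "d = \<Theta> powr (1 / p) * I powr (2 - 1 / p)"
      have d: "d \<ge> 0" by (simp add: d_def)
      have energy: "(\<integral>\<^sup>+x. \<integral>\<^sup>+y. resolvent_kernel k \<alpha> x y \<partial>\<sigma> \<partial>\<sigma>) \<le> ennreal d"
      proof -
        have "(\<integral>\<^sup>+x. \<integral>\<^sup>+y. resolvent_kernel k \<alpha> x y \<partial>\<sigma> \<partial>\<sigma>) =
          (\<integral>\<^sup>+x. ennreal (\<omega> n x powr (2 * p - 1)) * (\<integral>\<^sup>+y. ennreal (\<omega> n y powr (2 * p - 1)) * resolvent_kernel k \<alpha> x y \<partial>\<nu>) \<partial>\<nu>)"
          by (simp add: int\<sigma>)
        also have "\<dots> = (\<integral>\<^sup>+x. \<integral>\<^sup>+y. ennreal (\<omega> n x powr (2 * p - 1)) *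
            (resolvent_kernel k \<alpha> x y * ennreal (\<omega> n y powr (2 * p - 1))) \<partial>\<nu> \<partial>\<nu>)"
          by (simp add: nn_integral_cmult[symmetric] mult.commute[of "resolvent_kernel _ _ _ _"] cong: nn_integral_cong)
        also have "\<dots> \<le> ennreal d"
          unfolding d_def using sf p \<Theta> I0 R I(1) \<omega>0
          by (intro Schur_bound) (auto intro: resolvent_sym)
        finally show ?thesis .
      qed
      have "ennreal I \<le> (\<integral>\<^sup>+x. ennreal (h x) \<partial>\<sigma>)"
        unfolding I(1)[symmetric]
      proof (subst int\<sigma>)
        show "(\<integral>\<^sup>+x. ennreal (\<omega> n x powr (2 * p)) \<partial>\<nu>) \<le> (\<integral>\<^sup>+x. ennreal (\<omega> n x powr (2 * p - 1)) * ennreal (h x) \<partial>\<nu>)"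
        proof (rule nn_integral_mono)
          fix x
          have "\<omega> n x powr (2 * p) = \<omega> n x powr (2 * p - 1) * \<omega> n x"
            using \<omega>0[of n x] by (cases "\<omega> n x = 0") (auto simp: powr_diff)
          also have "\<dots> \<le> \<omega> n x powr (2 * p - 1) * h x" by (intro mult_left_mono \<omega>h) simp
          finally show "ennreal (\<omega> n x powr (2 * p)) \<le> ennreal (\<omega> n x powr (2 * p - 1)) * ennreal (h x)"
            using h by (simp add: ennreal_mult[symmetric] ennreal_leI)
        qed
      qed simp
      also have "\<dots> \<le> (\<integral>\<^sup>+x. liminf (\<lambda>j. nnP (s j) (\<lambda>y. ennreal (u y)) x) \<partial>\<sigma>)"
      proof (rule nn_integral_mono_AE)
        show "AE x in \<sigma>. ennreal (h x) \<le> liminf (\<lambda>j. nnP (s j) (\<lambda>y. ennreal (u y)) x)"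
          unfolding \<sigma>_def by (subst AE_density) (use lim in auto)
      qed
      also have "\<dots> \<le> liminf (\<lambda>j. \<integral>\<^sup>+x. nnP (s j) (\<lambda>y. ennreal (u y)) x \<partial>\<sigma>)"
        by (rule nn_integral_liminf) measurable
      also have "\<dots> \<le> liminf (\<lambda>j. ennreal (exp (\<alpha> * s j) * sqrt (c * d)))"
        using energy_inequality[OF sets\<sigma> sf\<sigma> u \<alpha> s(1) c energy d]
        by (intro Liminf_mono always_eventually) auto
      also have "\<dots> = ennreal (exp (\<alpha> * 0) * sqrt (c * d))"
        by (intro lim_imp_Liminf tendsto_ennrealI tendsto_intros s) simp
      \<comment> \<open>Here I^2 <= c d with d = \<Theta>^{1/p} I^{2-1/p}. Dividing by I^{2-1/p}
        leaves I^{1/p} <= c \<Theta>^{1/p}, whose p-th power is the claim.\<close>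
      finally have "I \<le> sqrt (c * d)" using c d by simp
      then have "I\<^sup>2 \<le> (sqrt (c * d))\<^sup>2" using I0 by (intro power_mono) auto
      also have "\<dots> = c * d" using c d by simp
      also have "c * d = c * \<Theta> powr (1 / p) * (I\<^sup>2 / I powr (1 / p))"
        using I0 by (simp add: d_def powr_diff)
      finally have "I\<^sup>2 * I powr (1 / p) \<le> I\<^sup>2 * (c * \<Theta> powr (1 / p))"
        using I0 by (simp add: pos_le_divide_eq ac_simps)
      then have "I powr (1 / p) \<le> c * \<Theta> powr (1 / p)"
        using I0 by simp
      then have "(I powr (1 / p)) powr p \<le> (c * \<Theta> powr (1 / p)) powr p"
        using p by (intro powr_mono2) auto
      then have "I \<le> \<Theta> * c powr p"
        using I0 c p \<Theta> by (simp add: powr_powr powr_mult mult.commute)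
      then show ?thesis using I by (simp add: ennreal_leI)
    qed
  qed
  have conv: "(\<lambda>n. ennreal (\<omega> n x powr (2 * p))) \<longlonglongrightarrow> ennreal (h x powr (2 * p))" for x
  proof (rule tendsto_eventually)
    obtain n0 where n0: "x \<in> E n0" using E(2) sp by auto
    have "eventually (\<lambda>n. n \<ge> max n0 (nat \<lceil>h x\<rceil>)) sequentially" by (rule eventually_ge_at_top)
    then show "eventually (\<lambda>n. ennreal (\<omega> n x powr (2 * p)) = ennreal (h x powr (2 * p))) sequentially"
    proof eventually_elim
      case (elim n)
      then have "x \<in> E n" using n0 E(4) by (auto simp: incseq_def)
      moreover have "h x \<le> real n" using elim real_nat_ceiling_ge[of "h x"] by linarith
      ultimately show ?case by (simp add: \<omega>_def)
    qed
  qed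
  have "(\<integral>\<^sup>+x. ennreal (h x powr (2 * p)) \<partial>\<nu>) = (\<integral>\<^sup>+x. liminf (\<lambda>n. ennreal (\<omega> n x powr (2 * p))) \<partial>\<nu>)"
    using lim_imp_Liminf[OF _ conv] by simp
  also have "\<dots> \<le> liminf (\<lambda>n. \<integral>\<^sup>+x. ennreal (\<omega> n x powr (2 * p)) \<partial>\<nu>)"
    by (rule nn_integral_liminf) measurable
  also have "\<dots> \<le> liminf (\<lambda>n. ennreal (\<Theta> * c powr p))"
    using bound by (intro Liminf_mono always_eventually) auto
  finally show ?thesis by (simp add: Liminf_const)
qed

end

section \<open>Capacity\<close>

lemma ennreal_le_suminf: "f j \<le> (\<Sum>j. f j)" for f :: "nat \<Rightarrow> ennreal"
proof -
  have "sum f {j} \<le> suminf f" by (rule sum_le_suminf) auto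
  then show ?thesis by simp
qed

lemma ennreal_sup_diff_square_le:
  fixes a b :: "nat \<Rightarrow> real"
  assumes "bdd_above (range a)" "bdd_above (range b)"
  shows "ennreal (((SUP j. a j) - (SUP j. b j))\<^sup>2) \<le> (\<Sum>j. ennreal ((a j - b j)\<^sup>2))"
proof (cases "\<Sum>j. ennreal ((a j - b j)\<^sup>2)")
  case (real r)
  have le: "\<bar>a j - b j\<bar> \<le> sqrt r" for j
  proof -
    have "ennreal ((a j - b j)\<^sup>2) \<le> ennreal r"
      unfolding real(2)[symmetric] by (rule ennreal_le_suminf)
    then have "(a j - b j)\<^sup>2 \<le> r" using real(1) by simp
    then have "sqrt ((a j - b j)\<^sup>2) \<le> sqrt r" by (rule real_sqrt_le_mono)
    then show ?thesis by simp
  qed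
  have 1: "(SUP j. a j) \<le> (SUP j. b j) + sqrt r"
  proof (rule cSUP_least)
    fix j show "a j \<le> (SUP j. b j) + sqrt r"
      using le[of j] cSUP_upper[OF UNIV_I assms(2), of j] by linarith
  qed simp
  have 2: "(SUP j. b j) \<le> (SUP j. a j) + sqrt r"
  proof (rule cSUP_least)
    fix j show "b j \<le> (SUP j. a j) + sqrt r"
      using le[of j] cSUP_upper[OF UNIV_I assms(1), of j] by linarith
  qed simp
  from 1 2 have "\<bar>(SUP j. a j) - (SUP j. b j)\<bar> \<le> sqrt r" by linarith
  then have "\<bar>(SUP j. a j) - (SUP j. b j)\<bar>\<^sup>2 \<le> (sqrt r)\<^sup>2" by (intro power_mono) auto
  then have "((SUP j. a j) - (SUP j. b j))\<^sup>2 \<le> r" using real(1) by simp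
  then show ?thesis using real by (simp add: ennreal_leI)
qed simp

text \<open>The cut at 1 makes the supremum exist at every point for any sequence, and 1 is the
  height that capacity asks for.\<close>

definition sup1 :: "(nat \<Rightarrow> 'a \<Rightarrow> real) \<Rightarrow> 'a \<Rightarrow> real" where
  "sup1 v x = (SUP j. min 1 \<bar>v j x\<bar>)"

lemma sup1_bdd: "bdd_above (range (\<lambda>j. min 1 \<bar>v j x\<bar> :: real))"
  by (rule bdd_aboveI[of _ 1]) auto

lemma sup1_upper: "min 1 \<bar>v j x\<bar> \<le> sup1 v x"
  unfolding sup1_def by (rule cSUP_upper[OF UNIV_I sup1_bdd])

lemma sup1_bounds: "0 \<le> sup1 v x" "sup1 v x \<le> 1"
  using order_trans[OF _ sup1_upper[of v 0 x]] by (auto simp: sup1_def intro!: cSUP_least)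

lemma sup1_meas [measurable]:
  assumes [measurable]: "\<And>j. v j \<in> borel_measurable N" shows "sup1 v \<in> borel_measurable N"
  unfolding sup1_def[abs_def] by (rule borel_measurable_cSUP) (auto intro: sup1_bdd)

lemma sup1_square_diff:
  "ennreal ((sup1 v x - sup1 v y)\<^sup>2) \<le> (\<Sum>j. ennreal ((v j x - v j y)\<^sup>2))"
proof -
  have "ennreal ((sup1 v x - sup1 v y)\<^sup>2) \<le> (\<Sum>j. ennreal ((min 1 \<bar>v j x\<bar> - min 1 \<bar>v j y\<bar>)\<^sup>2))"
    unfolding sup1_def by (intro ennreal_sup_diff_square_le sup1_bdd)
  also have "\<dots> \<le> (\<Sum>j. ennreal ((v j x - v j y)\<^sup>2))"
    by (intro suminf_le ennreal_leI) (auto simp: abs_le_square_iff[symmetric])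
  finally show ?thesis .
qed

lemma sup1_square: "ennreal ((sup1 v x)\<^sup>2) \<le> (\<Sum>j. ennreal ((v j x)\<^sup>2))"
proof -
  have "ennreal ((sup1 v x - (SUP j::nat. 0 :: real))\<^sup>2) \<le> (\<Sum>j. ennreal ((min 1 \<bar>v j x\<bar> - 0)\<^sup>2))"
    unfolding sup1_def
    by (rule ennreal_sup_diff_square_le[of "\<lambda>j. min 1 \<bar>v j x\<bar>" "\<lambda>j. 0"]) (simp_all add: sup1_bdd)
  also have "\<dots> \<le> (\<Sum>j. ennreal ((v j x)\<^sup>2))"
    by (intro suminf_le ennreal_leI) (auto simp: abs_le_square_iff[symmetric])
  finally show ?thesis by simp
qed

section \<open>Continuous functions with compact support\<close>

lemma C_c_borel [measurable_dest]: "f \<in> C_c \<Longrightarrow> f \<in> borel_measurable borel"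
  by (auto simp: C_c_def intro: borel_measurable_continuous_onI)

lemma C_c_compact_subset:
  assumes "compact (closure A)" "B \<subseteq> closure A" shows "compact (closure B)"
proof -
  have "closure B \<subseteq> closure A" using assms(2) by (simp add: closure_minimal)
  then show ?thesis using compact_Int_closed[OF assms(1) closed_closure[of B]] by (simp add: Int_absorb1)
qed

lemma C_c_combine:
  assumes "f \<in> C_c" "g \<in> C_c" "continuous_on UNIV (\<lambda>z. h (fst z) (snd z))" "h 0 0 = 0"
  shows "(\<lambda>x. h (f x) (g x)) \<in> C_c"
proof -
  have "continuous_on UNIV ((\<lambda>z. h (fst z) (snd z)) \<circ> (\<lambda>x. (f x, g x)))"
    using assms by (intro continuous_on_compose continuous_on_Pair) (auto simp: C_c_def intro: continuous_on_subset)
  then have "continuous_on UNIV (\<lambda>x. h (f x) (g x))" by (simp add: o_def)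
  moreover have "compact (closure ({x. f x \<noteq> 0} \<union> {x. g x \<noteq> 0}))"
    using assms by (simp add: C_c_def compact_Un)
  then have "compact (closure {x. h (f x) (g x) \<noteq> 0})"
  proof (rule C_c_compact_subset)
    have "{x. h (f x) (g x) \<noteq> 0} \<subseteq> {x. f x \<noteq> 0} \<union> {x. g x \<noteq> 0}" using assms(4) by auto
    then show "{x. h (f x) (g x) \<noteq> 0} \<subseteq> closure ({x. f x \<noteq> 0} \<union> {x. g x \<noteq> 0})"
      using closure_subset by (rule order_trans)
  qed
  ultimately show ?thesis by (simp add: C_c_def)
qed

lemma C_c_compose: "f \<in> C_c \<Longrightarrow> continuous_on UNIV h \<Longrightarrow> h 0 = 0 \<Longrightarrow> (\<lambda>x. h (f x)) \<in> C_c"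
  by (rule C_c_combine[of f f "\<lambda>a b. h a"])
    (auto intro!: continuous_on_compose2[of UNIV h] continuous_intros)

lemma C_c_bounded: assumes "f \<in> C_c" obtains B where "B \<ge> 0" "\<And>x. \<bar>f x\<bar> \<le> B"
proof -
  have "compact (f ` closure {x. f x \<noteq> 0})"
    using assms by (intro compact_continuous_image) (auto simp: C_c_def intro: continuous_on_subset)
  then have "bounded (f ` closure {x. f x \<noteq> 0})" by (rule compact_imp_bounded)
  then obtain B where B: "\<And>x. x \<in> closure {x. f x \<noteq> 0} \<Longrightarrow> \<bar>f x\<bar> \<le> B"
    by (auto simp: bounded_iff)
  have "\<bar>f x\<bar> \<le> max B 0" for x
    using B[of x] closure_subset[of "{x. f x \<noteq> 0}"] by (cases "f x = 0") auto
  then show ?thesis using that[of "max B 0"] by auto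
qed

text \<open>What is kept of the process: the form is recovered from the kernel through
  \<open>Q\<close>, and right continuity of the paths at time 0 survives as
  \<open>k_open\<close>.\<close>

locale dirichlet_kernel = regular_dirichlet_form m E F + symmetric_kernel m k
  for m :: "'a::{metric_space, second_countable_topology} measure" and E F k +
  assumes F_iff: "u \<in> F \<longleftrightarrow> u \<in> L2 \<and> Q u < \<top>"
    and E_diag: "u \<in> F \<Longrightarrow> E u u = enn2real (Q u)"
    and locally_compact: "locally_compact_space (euclidean :: 'a topology)"
    and k_open: "open G \<Longrightarrow> x \<in> G \<Longrightarrow> ((\<lambda>t. \<integral>\<^sup>+y\<in>G. k t x y \<partial>m) \<longlongrightarrow> 1) (at_right 0)"
begin

abbreviation D :: "('a \<Rightarrow> real) set" where "D \<equiv> F \<inter> C_c"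

lemma F_L2: "u \<in> F \<Longrightarrow> u \<in> L2" by (simp add: F_iff)
lemma F_borel [measurable_dest]: "u \<in> F \<Longrightarrow> u \<in> borel_measurable borel" by (simp add: F_iff L2_borel)

lemma F_Qa: "u \<in> F \<longleftrightarrow> u \<in> borel_measurable borel \<and> Qa 1 u < \<top>"
  by (auto simp: F_iff L2_iff Qa_def)

lemma F_Qa_finite: "u \<in> F \<Longrightarrow> Qa \<alpha> u < \<top>"
  by (auto simp: F_iff L2_iff Qa_def ennreal_mult_less_top)

lemma form1_eq: assumes "u \<in> F" shows "ennreal (form1 m E u u) = Qa 1 u"
proof -
  have "L2_inner m u u = ip u u" by (simp add: L2_inner_def ip_def)
  then show ?thesis
    using assms ip_nonneg by (simp add: form1_def E_diag Qa_def nsq_L2 F_L2 ennreal_plus F_iff)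
qed

lemma F_dominated:
  assumes "v \<in> F" "u \<in> borel_measurable borel"
    and "\<And>x y. \<bar>u x - u y\<bar> \<le> \<bar>v x - v y\<bar>" and "\<And>x. \<bar>u x\<bar> \<le> \<bar>v x\<bar>"
  shows "u \<in> F"
  using Qa_dominated1[of v u 1] assms F_borel[OF assms(1)] by (auto simp: F_Qa intro: le_less_trans)

lemma D_diff: "u \<in> D \<Longrightarrow> v \<in> D \<Longrightarrow> (\<lambda>x. u x - v x) \<in> D"
  using domain_add[of u "\<lambda>x. (-1) * v x"] domain_scale[of v "-1"]
    C_c_combine[of u v "(-)"] continuous_on_diff[OF continuous_on_fst continuous_on_snd, OF continuous_on_id continuous_on_id]
  by auto

lemma D_scale: "u \<in> D \<Longrightarrow> (\<lambda>x. c * u x) \<in> D"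
  using domain_scale[of u c] C_c_compose[of u "(*) c"] continuous_on_mult_left[OF continuous_on_id, of UNIV c]
  by auto

lemma F_diff: "u \<in> F \<Longrightarrow> v \<in> F \<Longrightarrow> (\<lambda>x. u x - v x) \<in> F"
  using domain_add[of u "\<lambda>x. (-1) * v x"] domain_scale[of v "-1"] by auto

lemma clamp_Lipschitz: "\<bar>max (- L) (min L a) - max (- L) (min L b)\<bar> \<le> \<bar>a - b\<bar>" for a b L :: real
proof -
  have "\<bar>max (- L) (min L a) - max (- L) (min L b)\<bar> \<le> \<bar>min L a - min L b\<bar>" by linarith
  also have "\<dots> \<le> \<bar>a - b\<bar>" by linarith
  finally show ?thesis .
qed

lemma clamp_abs_le: "0 \<le> L \<Longrightarrow> \<bar>max (- L) (min L a)\<bar> \<le> \<bar>a\<bar>" for a L :: real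
  by linarith

lemma D_truncate: assumes "u \<in> D" "L \<ge> 0" shows "(\<lambda>x. max (- L) (min L (u x))) \<in> D"
proof
  have [measurable]: "u \<in> borel_measurable borel" using assms by (simp add: F_borel)
  show "(\<lambda>x. max (- L) (min L (u x))) \<in> F"
    by (rule F_dominated[of u]) (use assms in \<open>simp_all add: clamp_Lipschitz clamp_abs_le\<close>)
  show "(\<lambda>x. max (- L) (min L (u x))) \<in> C_c"
    by (rule C_c_compose) (use assms in \<open>auto intro!: continuous_intros\<close>)
qed

lemma F_abs: "u \<in> F \<Longrightarrow> (\<lambda>x. \<bar>u x\<bar>) \<in> F"
  by (rule F_dominated[of u]) (auto dest: F_borel)

lemma Qa_abs: "u \<in> borel_measurable borel \<Longrightarrow> Qa \<alpha> (\<lambda>x. \<bar>u x\<bar>) \<le> Qa \<alpha> u"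
  by (rule Qa_dominated1) auto

subsection \<open>Subadditivity\<close>

abbreviation cap :: "'a set \<Rightarrow> ennreal" where "cap \<equiv> capacity_open m E F"

lemma cap_le: "u \<in> F \<Longrightarrow> AE x in m. x \<in> G \<longrightarrow> u x \<ge> 1 \<Longrightarrow> cap G \<le> Qa 1 u"
  unfolding capacity_open_def using form1_eq[of u] by (auto intro!: INF_lower2[of u])

lemma cap_less:
  assumes "cap G < c" obtains u where "u \<in> F" "AE x in m. x \<in> G \<longrightarrow> u x \<ge> 1" "Qa 1 u < c"
proof -
  from assms obtain u where "u \<in> F" "AE x in m. x \<in> G \<longrightarrow> u x \<ge> 1" "ennreal (form1 m E u u) < c"
    unfolding capacity_open_def INF_less_iff by auto
  then show ?thesis using that form1_eq by metis
qed

lemma cap_mono_AE: "AE x in m. x \<in> G \<longrightarrow> x \<in> H \<Longrightarrow> cap G \<le> cap H"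
  unfolding capacity_open_def by (intro INF_superset_mono) (auto elim: AE_mp)

lemma cap_mono: "G \<subseteq> H \<Longrightarrow> cap G \<le> cap H"
  by (rule cap_mono_AE) auto

lemma Qa_sup1: "(\<And>j. v j \<in> borel_measurable borel) \<Longrightarrow> Qa \<alpha> (sup1 v) \<le> (\<Sum>j. Qa \<alpha> (v j))"
  by (intro Qa_dominated sup1_square_diff sup1_square)

text \<open>Near-minimizers with errors \<epsilon> 2^{-j-1} are combined by \<open>sup1\<close>,
  whose energy is at most the sum of the energies.\<close>

lemma cap_countable_subadditive: "cap (\<Union>j::nat. G j) \<le> (\<Sum>j. cap (G j))"
proof (rule ennreal_le_epsilon)
  fix \<epsilon> :: real assume fin: "(\<Sum>j. cap (G j)) < \<top>" and \<epsilon>: "\<epsilon> > 0"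
  have "\<exists>u. u \<in> F \<and> (AE x in m. x \<in> G j \<longrightarrow> u x \<ge> 1) \<and> Qa 1 u \<le> cap (G j) + ennreal (\<epsilon> * (1 / 2) ^ Suc j)" for j
  proof -
    have "cap (G j) < \<top>" using fin by (rule le_less_trans[OF ennreal_le_suminf])
    then have "cap (G j) < cap (G j) + ennreal (\<epsilon> * (1 / 2) ^ Suc j)" using \<epsilon> by (simp add: ennreal_zero_less_mult_iff)
    then obtain w where "w \<in> F" "AE x in m. x \<in> G j \<longrightarrow> w x \<ge> 1" "Qa 1 w < cap (G j) + ennreal (\<epsilon> * (1 / 2) ^ Suc j)"
      by (rule cap_less)
    then show ?thesis by (auto intro: less_imp_le)
  qed
  then have "\<exists>u. \<forall>j. u j \<in> F \<and> (AE x in m. x \<in> G j \<longrightarrow> u j x \<ge> 1) \<and> Qa 1 (u j) \<le> cap (G j) + ennreal (\<epsilon> * (1 / 2) ^ Suc j)"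
    by (intro choice allI)
  then obtain u where u: "\<And>j. u j \<in> F" "\<And>j. AE x in m. x \<in> G j \<longrightarrow> u j x \<ge> 1"
    "\<And>j. Qa 1 (u j) \<le> cap (G j) + ennreal (\<epsilon> * (1 / 2) ^ Suc j)" by auto
  have [measurable]: "u j \<in> borel_measurable borel" for j using u(1) by (rule F_borel)
  have "Qa 1 (sup1 u) \<le> (\<Sum>j. Qa 1 (u j))" by (rule Qa_sup1) measurable
  also have "\<dots> \<le> (\<Sum>j. cap (G j) + ennreal (\<epsilon> * (1 / 2) ^ Suc j))" by (intro suminf_le u) auto
  also have "\<dots> = (\<Sum>j. cap (G j)) + (\<Sum>j. ennreal (\<epsilon> * (1 / 2) ^ Suc j))" by (intro suminf_add[symmetric]) auto
  also have "(\<Sum>j. ennreal (\<epsilon> * (1 / 2) ^ Suc j)) = ennreal (\<epsilon> * 1)"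
    using \<epsilon> by (intro suminf_ennreal_eq sums_mult power_half_series) auto
  finally have Q: "Qa 1 (sup1 u) \<le> (\<Sum>j. cap (G j)) + ennreal \<epsilon>" by simp
  have "cap (\<Union>j. G j) \<le> Qa 1 (sup1 u)"
  proof (rule cap_le)
    have "Qa 1 (sup1 u) < \<top>" using Q fin by (auto intro: le_less_trans)
    then show "sup1 u \<in> F" by (simp add: F_Qa)
    have "AE x in m. \<forall>j. x \<in> G j \<longrightarrow> u j x \<ge> 1" using u(2) by (simp add: AE_all_countable)
    then show "AE x in m. x \<in> (\<Union>j. G j) \<longrightarrow> sup1 u x \<ge> 1"
    proof eventually_elim
      case (elim x)
      show ?case
      proof
        assume "x \<in> (\<Union>j. G j)"
        then obtain j where "1 \<le> u j x" using elim by auto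
        then show "1 \<le> sup1 u x" using sup1_upper[of u j x] by simp
      qed
    qed
  qed
  with Q show "cap (\<Union>j. G j) \<le> (\<Sum>j. cap (G j)) + ennreal \<epsilon>" by (rule order_trans[rotated])
qed

lemma emeasure_le_cap: assumes [measurable]: "G \<in> sets borel" shows "emeasure m G \<le> cap G"
  unfolding capacity_open_def
proof (rule INF_greatest)
  fix u assume "u \<in> {u \<in> F. AE x in m. x \<in> G \<longrightarrow> 1 \<le> u x}"
  then have u: "u \<in> F" "AE x in m. x \<in> G \<longrightarrow> 1 \<le> u x" by auto
  have [measurable]: "u \<in> borel_measurable borel" using u by (simp add: F_borel)
  have "emeasure m G = (\<integral>\<^sup>+x. indicator G x \<partial>m)" using sets_m by simp
  also have "\<dots> \<le> nsq u"
    unfolding nsq_def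
  proof (rule nn_integral_mono_AE)
    show "AE x in m. indicator G x \<le> ennreal ((u x)\<^sup>2)"
      using u(2)
    proof eventually_elim
      case (elim x)
      then show ?case using one_le_power[of "u x" 2] by (auto split: split_indicator simp: ennreal_1[symmetric] simp del: ennreal_1 intro!: ennreal_leI)
    qed
  qed
  also have "\<dots> \<le> Qa 1 u" by (simp add: Qa_def)
  finally show "emeasure m G \<le> ennreal (form1 m E u u)" using form1_eq[OF u(1)] by simp
qed

lemma capacity_zero_null:
  assumes "A \<in> sets borel" "capacity m E F A = 0" shows "emeasure m A = 0"
proof -
  have "emeasure m A \<le> capacity m E F A"
    unfolding capacity_def
  proof (rule INF_greatest)
    fix G assume "G \<in> {G. open G \<and> A \<subseteq> G}"
    then show "emeasure m A \<le> cap G"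
      using emeasure_le_cap[of G] emeasure_mono[of A G m] by (auto simp: sets_m intro: order_trans)
  qed
  with assms show ?thesis by simp
qed

lemma capacity_zero_if:
  assumes "\<And>\<epsilon>::real. \<epsilon> > 0 \<Longrightarrow> \<exists>G. open G \<and> A \<subseteq> G \<and> cap G \<le> ennreal \<epsilon>"
  shows "capacity m E F A = 0"
proof -
  have "capacity m E F A \<le> 0"
  proof (rule ennreal_le_epsilon)
    fix \<epsilon> :: real assume "\<epsilon> > 0"
    from assms[OF this] obtain G where "open G" "A \<subseteq> G" "cap G \<le> ennreal \<epsilon>" by blast
    then show "capacity m E F A \<le> 0 + ennreal \<epsilon>"
      unfolding capacity_def by (auto intro: INF_lower2[of G])
  qed
  then show ?thesis by simp
qed

text \<open>A convexity argument: if the capacities decreased to a positive limit, near-minimizers \<open>e\<close> could be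
  improved to \<open>(1 - s) e + s w\<^sub>N\<close>, by the parallelogram law and lower semicontinuity of the energy.\<close>

lemma capacity_vanishes:
  assumes V: "decseq V" and w: "\<And>N. w N \<in> F" "\<And>N x. x \<in> V N \<Longrightarrow> 1 \<le> w N x"
    and C: "\<And>N. Qa 1 (w N) \<le> ennreal C" "C \<ge> 0"
    and lim: "AE x in m. (\<lambda>N. w N x) \<longlonglongrightarrow> 0"
  shows "(\<lambda>N. cap (V N)) \<longlonglongrightarrow> 0"
proof -
  have dec: "decseq (\<lambda>N. cap (V N))" using V by (auto simp: decseq_def intro!: cap_mono)
  define c where "c = (INF N. cap (V N))"
  have conv: "(\<lambda>N. cap (V N)) \<longlonglongrightarrow> c" unfolding c_def using dec by (rule LIMSEQ_INF)
  have "c \<le> cap (V 0)" unfolding c_def by (rule INF_lower) simp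
  also have "\<dots> \<le> Qa 1 (w 0)" using w by (intro cap_le) auto
  also have "\<dots> \<le> ennreal C" by (rule C)
  finally obtain c0 where c0: "c = ennreal c0" "c0 \<ge> 0" by (cases c) (auto simp: top_unique)
  have key: "c0 \<le> s * (1 + 2 * C)" if s: "0 < s" "s < 1" for s
  proof -
    have "c < ennreal (c0 + s\<^sup>2)" using c0 s by (simp add: ennreal_less_iff)
    \<comment> \<open>The error s^2 of the near-minimizer is of second order in s, so it remains
      negligible after the later division by s.\<close>
    then obtain N0 where "cap (V N0) < ennreal (c0 + s\<^sup>2)" unfolding c_def INF_less_iff by auto
    then obtain e where e: "e \<in> F" "AE x in m. x \<in> V N0 \<longrightarrow> e x \<ge> 1" "Qa 1 e < ennreal (c0 + s\<^sup>2)"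
      by (rule cap_less)
    have eb: "e \<in> borel_measurable borel" and wb: "w N \<in> borel_measurable borel" for N
      using e w by (auto intro: F_borel)
    obtain q where q: "Qa 1 e = ennreal q" "q \<ge> 0" using F_Qa_finite[OF e(1), of 1] by (cases "Qa 1 e") auto
    have qle: "q < c0 + s\<^sup>2" using e(3) unfolding q(1) by (simp only: ennreal_less_iff[OF q(2)])
    define z where "z N x = (1 - s) * e x + s * w N x" for N x
    define z' where "z' N x = (1 - s) * e x - s * w N x" for N x
    \<comment> \<open>On V N both e and w N are at least 1, hence so is their convex combination z
      N, which is therefore admissible for the capacity. The difference z' N enters through the
      parallelogram law.\<close>
    have z: "c + Qa 1 (z' N) \<le> ennreal (2 * (1 - s)\<^sup>2 * q + 2 * s\<^sup>2 * C)" if N: "N \<ge> N0" for N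
    proof -
      have zF: "z N \<in> F" unfolding z_def[abs_def] using e w by (intro domain_add domain_scale)
      have "c \<le> cap (V N)" unfolding c_def by (rule INF_lower) simp
      also have "\<dots> \<le> Qa 1 (z N)"
      proof (rule cap_le[OF zF])
        have "V N \<subseteq> V N0" using V N by (auto simp: decseq_def)
        show "AE x in m. x \<in> V N \<longrightarrow> 1 \<le> z N x"
          using e(2)
        proof eventually_elim
          case (elim x)
          show ?case
          proof
            assume x: "x \<in> V N"
            then have "(1 - s) * 1 \<le> (1 - s) * e x" "s * 1 \<le> s * w N x"
              using elim \<open>V N \<subseteq> V N0\<close> w(2)[OF x] s by (auto intro!: mult_left_mono)
            then show "1 \<le> z N x" by (simp add: z_def)
          qed
        qed
      qed
      finally have "c + Qa 1 (z' N) \<le> Qa 1 (z N) + Qa 1 (z' N)" by (rule add_right_mono)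
      also have "\<dots> \<le> 2 * Qa 1 (\<lambda>x. (1 - s) * e x) + 2 * Qa 1 (\<lambda>x. s * w N x)"
        unfolding z_def z'_def[abs_def] using e w
        by (intro Qa_parallelogram L2_scale) (auto intro: F_L2)
      also have "\<dots> = 2 * (ennreal ((1 - s)\<^sup>2) * Qa 1 e) + 2 * (ennreal (s\<^sup>2) * Qa 1 (w N))"
        using eb wb by (simp add: Qa_scale)
      also have "\<dots> \<le> 2 * (ennreal ((1 - s)\<^sup>2) * ennreal q) + 2 * (ennreal (s\<^sup>2) * ennreal C)"
        using C by (auto simp: q(1) intro!: add_mono mult_left_mono)
      also have "\<dots> = ennreal (2 * (1 - s)\<^sup>2 * q + 2 * s\<^sup>2 * C)"
        using q C by (simp add: ennreal_plus ennreal_mult mult.assoc)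
      finally show ?thesis .
    qed
    \<comment> \<open>Since w N tends to 0, z' N tends to (1 - s) e, and lower semicontinuity
      returns the energy of e with the factor (1 - s)^2.\<close>
    have "Qa 1 (\<lambda>x. (1 - s) * e x) \<le> liminf (\<lambda>N. Qa 1 (z' N))"
    proof (rule Qa_liminf)
      show "AE x in m. (\<lambda>N. z' N x) \<longlonglongrightarrow> (1 - s) * e x"
        using lim
      proof eventually_elim
        case (elim x)
        then have "(\<lambda>N. (1 - s) * e x - s * w N x) \<longlonglongrightarrow> (1 - s) * e x - s * 0"
          by (intro tendsto_intros)
        then show ?case by (simp add: z'_def)
      qed
    qed (use eb wb in \<open>auto simp: z'_def[abs_def]\<close>)
    then have "c + ennreal ((1 - s)\<^sup>2) * Qa 1 e \<le> c + liminf (\<lambda>N. Qa 1 (z' N))"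
      using eb by (intro add_left_mono) (simp add: Qa_scale)
    also have "\<dots> = liminf (\<lambda>N. c) + liminf (\<lambda>N. Qa 1 (z' N))" by (simp add: Liminf_const)
    also have "\<dots> \<le> liminf (\<lambda>N. c + Qa 1 (z' N))" by (rule liminf_add_ennreal)
    also have "\<dots> \<le> liminf (\<lambda>N. ennreal (2 * (1 - s)\<^sup>2 * q + 2 * s\<^sup>2 * C))"
      using z by (intro Liminf_mono eventually_sequentiallyI[of N0])
    also have "\<dots> = ennreal (2 * (1 - s)\<^sup>2 * q + 2 * s\<^sup>2 * C)" by (simp add: Liminf_const)
    finally have "ennreal (c0 + (1 - s)\<^sup>2 * q) \<le> ennreal (2 * (1 - s)\<^sup>2 * q + 2 * s\<^sup>2 * C)"
      using c0 q by (simp add: ennreal_plus ennreal_mult)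
    then have "c0 + (1 - s)\<^sup>2 * q \<le> 2 * (1 - s)\<^sup>2 * q + 2 * s\<^sup>2 * C" using q C by (subst (asm) ennreal_le_iff) auto
    then have "c0 \<le> (1 - s)\<^sup>2 * q + 2 * s\<^sup>2 * C" by linarith
    also have "(1 - s)\<^sup>2 * q \<le> (1 - s)\<^sup>2 * c0 + 1 * s\<^sup>2"
    proof -
      have "(1 - s)\<^sup>2 * q \<le> (1 - s)\<^sup>2 * (c0 + s\<^sup>2)" using qle by (intro mult_left_mono) auto
      also have "\<dots> = (1 - s)\<^sup>2 * c0 + (1 - s)\<^sup>2 * s\<^sup>2" by (simp add: distrib_left)
      also have "(1 - s)\<^sup>2 * s\<^sup>2 \<le> 1 * s\<^sup>2" using s by (intro mult_right_mono power_le_one) auto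
      finally show ?thesis by simp
    qed
    finally have "s * (c0 * (2 - s)) \<le> s * (s * (1 + 2 * C))"
      by (simp add: power2_eq_square algebra_simps)
    then have "c0 * (2 - s) \<le> s * (1 + 2 * C)" using s by simp
    moreover have "c0 * 1 \<le> c0 * (2 - s)" using c0 s by (intro mult_left_mono) auto
    ultimately show ?thesis by simp
  qed
  have "c0 \<le> 0"
  proof (rule tendsto_lowerbound)
    have "((\<lambda>s. s * (1 + 2 * C)) \<longlongrightarrow> 0 * (1 + 2 * C)) (at_right 0)" by (intro tendsto_intros)
    then show "((\<lambda>s. s * (1 + 2 * C)) \<longlongrightarrow> 0) (at_right 0)" by simp
    show "eventually (\<lambda>s. c0 \<le> s * (1 + 2 * C)) (at_right 0)"
      using key by (auto simp: eventually_at_right_field intro!: exI[of _ 1])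
  qed simp
  then show ?thesis using conv c0 by simp
qed

end

section \<open>Quasi-continuous limits\<close>

lemma geometric_limit_bound:
  fixes a :: "nat \<Rightarrow> real"
  assumes "\<And>n. n \<ge> N \<Longrightarrow> \<bar>a (Suc n) - a n\<bar> \<le> (1 / 2) ^ n"
  shows "a \<longlonglongrightarrow> lim a" and "n \<ge> N \<Longrightarrow> \<bar>lim a - a n\<bar> \<le> 2 * (1 / 2) ^ n"
proof -
  have step: "\<bar>a (n + i) - a n\<bar> \<le> 2 * (1 / 2) ^ n - 2 * (1 / 2) ^ (n + i)" if "n \<ge> N" for n i
  proof (induction i)
    case (Suc i)
    then show ?case using assms[of "n + i"] that by (simp add: abs_if split: if_splits)
  qed simp
  then have bd: "\<bar>a (n + i) - a n\<bar> \<le> 2 * (1 / 2) ^ n" if "n \<ge> N" for n i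
    using that by (smt (verit) zero_le_power divide_nonneg_nonneg zero_le_one)
  have "Cauchy a"
  proof (rule CauchyI)
    fix e :: real assume e: "e > 0"
    have "(\<lambda>n. 4 * (1 / 2 :: real) ^ n) \<longlonglongrightarrow> 4 * 0" by (intro tendsto_intros LIMSEQ_power_zero) simp
    then have "eventually (\<lambda>n. 4 * (1 / 2 :: real) ^ n < e) sequentially" using e by (intro order_tendstoD) auto
    then obtain M where M: "\<And>n. n \<ge> M \<Longrightarrow> 4 * (1 / 2 :: real) ^ n < e" by (auto simp: eventually_sequentially)
    let ?K = "max M N"
    have "norm (a i - a j) < e" if "i \<ge> ?K" "j \<ge> ?K" for i j
    proof -
      have "\<bar>a i - a ?K\<bar> \<le> 2 * (1 / 2) ^ ?K" "\<bar>a j - a ?K\<bar> \<le> 2 * (1 / 2) ^ ?K"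
        using bd[of ?K "i - ?K"] bd[of ?K "j - ?K"] that by auto
      moreover have "4 * (1 / 2 :: real) ^ ?K < e" by (rule M) simp
      ultimately show ?thesis unfolding real_norm_def by linarith
    qed
    then show "\<exists>K. \<forall>i\<ge>K. \<forall>j\<ge>K. norm (a i - a j) < e" by blast
  qed
  then show lim: "a \<longlonglongrightarrow> lim a" using convergent_LIMSEQ_iff Cauchy_convergent by blast
  show "\<bar>lim a - a n\<bar> \<le> 2 * (1 / 2) ^ n" if n: "n \<ge> N"
  proof (rule tendsto_upperbound)
    show "(\<lambda>i. \<bar>a (i + n) - a n\<bar>) \<longlonglongrightarrow> \<bar>lim a - a n\<bar>"
      by (intro tendsto_intros LIMSEQ_ignore_initial_segment[OF lim])
    show "eventually (\<lambda>i. \<bar>a (i + n) - a n\<bar> \<le> 2 * (1 / 2) ^ n) sequentially"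
      using bd[OF n] by (simp add: add.commute)
  qed simp
qed

context dirichlet_kernel begin

text \<open>An almost everywhere positive weight whose integral against |u| is controlled by the
  energy alone. It holds for \<alpha> = 1 always (\<open>testable_1\<close>) and for \<alpha> = 0
  under transience (\<open>testable_0\<close>), and it replaces the L2 norm wherever small energy
  has to force small values.\<close>

definition testable :: "real \<Rightarrow> bool" where
  "testable \<alpha> \<longleftrightarrow> (\<exists>g \<Gamma>. g \<in> borel_measurable borel \<and> (AE x in m. 0 < g x) \<and> (\<forall>x. 0 \<le> g x) \<and> 0 \<le> \<Gamma> \<and>
     (\<forall>u\<in>F. \<forall>c\<ge>0. Qa \<alpha> u \<le> ennreal c \<longrightarrow> (\<integral>\<^sup>+x. ennreal (\<bar>u x\<bar> * g x) \<partial>m) \<le> ennreal (\<Gamma> * sqrt c)))"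

text \<open>The open sets where \<phi> j exceeds 1 cover the space. They localize capacities,
  because each \<phi> j lies in F and can serve as a cut-off when functions of finite energy need
  not be square integrable.\<close>

lemma exhaustion: "\<exists>\<phi>::nat \<Rightarrow> 'a \<Rightarrow> real. (\<forall>j. \<phi> j \<in> D) \<and> (\<forall>x. \<exists>j. 1 < \<phi> j x)"
proof -
  have ex: "\<exists>f\<in>D. 1 < f x" for x
  proof -
    have "\<exists>U K. openin euclidean U \<and> compactin euclidean K \<and> x \<in> U \<and> U \<subseteq> K"
      using locally_compact unfolding locally_compact_space_def by (rule bspec) simp
    then obtain U K where "openin euclidean U" "compactin euclidean K" and xU: "x \<in> U" "U \<subseteq> K" by (elim exE conjE)
    then have UK: "open U" "compact K" "x \<in> U" "U \<subseteq> K" by simp_all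
    then obtain r where r: "r > 0" "ball x r \<subseteq> U" by (auto simp: open_contains_ball)
    have "cball x (r / 2) \<subseteq> ball x r" using r by auto
    then have sub: "cball x (r / 2) \<subseteq> K" using r UK by auto
    then have cpt: "compact (cball x (r / 2))"
      using compact_Int_closed[OF UK(2) closed_cball[of x "r / 2"]] by (simp add: Int_absorb1)
    \<comment> \<open>A bump of height 3 that vanishes outside the ball of radius r / 2; a uniform
      error below 1 leaves the approximating core function above 1 at x.\<close>
    define g where "g z = max 0 (3 - 6 * dist x z / r)" for z
    have "g \<in> C_c"
      unfolding C_c_def
    proof (intro CollectI conjI)
      show "continuous_on UNIV g" unfolding g_def using r by (intro continuous_intros) auto
      have supp: "{z. g z \<noteq> 0} \<subseteq> cball x (r / 2)"
      proof
        fix z assume "z \<in> {z. g z \<noteq> 0}"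
        then have "0 < 3 - 6 * dist x z / r" by (simp add: g_def max_def split: if_splits)
        then have "dist x z \<le> r / 2" using r by (simp add: field_simps)
        then show "z \<in> cball x (r / 2)" by simp
      qed
      have cl: "closure (cball x (r / 2)) = cball x (r / 2)" by (rule closure_closed[OF closed_cball])
      show "compact (closure {z. g z \<noteq> 0})"
      proof (rule C_c_compact_subset)
        show "compact (closure (cball x (r / 2)))" unfolding cl by (rule cpt)
        show "{z. g z \<noteq> 0} \<subseteq> closure (cball x (r / 2))" unfolding cl by (rule supp)
      qed
    qed
    then obtain f where f: "f \<in> D" "\<forall>z. \<bar>g z - f z\<bar> < 1" using core_dense_C_c[of g 1] by auto
    have "g x = 3" by (simp add: g_def)
    then have "1 < f x" using f(2)[rule_format, of x] by linarith
    then show ?thesis using f by auto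
  qed
  have op: "open {x. 1 < f x}" if "f \<in> D" for f
    using that by (intro open_Collect_less) (auto simp: C_c_def)
  obtain \<G> where \<G>: "\<G> \<subseteq> (\<lambda>f. {x. 1 < f x}) ` D" "countable \<G>" "\<Union>\<G> = \<Union>((\<lambda>f. {x. 1 < f x}) ` D)"
    by (rule Lindelof[of "(\<lambda>f. {x. 1 < f x}) ` D"]) (use op in auto)
  have U: "\<Union>\<G> = UNIV" using \<G>(3) ex by auto
  then have ne: "\<G> \<noteq> {}" by auto
  have "\<forall>j. \<exists>f. f \<in> D \<and> from_nat_into \<G> j = {x. 1 < f x}"
  proof
    fix j
    have "from_nat_into \<G> j \<in> (\<lambda>f. {x. 1 < f x}) ` D" using from_nat_into[OF ne] \<G>(1) by (rule subsetD[rotated])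
    then show "\<exists>f. f \<in> D \<and> from_nat_into \<G> j = {x. 1 < f x}" by blast
  qed
  then obtain \<phi> where "\<forall>j. \<phi> j \<in> D \<and> from_nat_into \<G> j = {x. 1 < \<phi> j x}" by (rule choice[THEN exE])
  then have \<phi>: "\<And>j. \<phi> j \<in> D" "\<And>j. from_nat_into \<G> j = {x. 1 < \<phi> j x}" by blast+
  have "\<exists>j. 1 < \<phi> j x" for x
  proof -
    obtain W where "W \<in> \<G>" "x \<in> W" using U by auto
    then obtain j where "from_nat_into \<G> j = W" using from_nat_into_surj[OF \<G>(2)] by auto
    with \<open>x \<in> W\<close> show ?thesis using \<phi>(2)[of j] by auto
  qed
  with \<phi>(1) show ?thesis by auto
qed

definition tail :: "(nat \<Rightarrow> 'a \<Rightarrow> real) \<Rightarrow> nat \<Rightarrow> 'a set" where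
  "tail d N = (\<Union>n\<in>{N..}. {x. 1 < \<bar>d n x\<bar>})"

lemma sup1_le_suminf: "ennreal (sup1 v x) \<le> (\<Sum>j. ennreal \<bar>v j x\<bar>)"
proof (cases "\<Sum>j. ennreal \<bar>v j x\<bar>")
  case (real r)
  have "\<bar>v j x\<bar> \<le> r" for j
  proof -
    have "ennreal \<bar>v j x\<bar> \<le> ennreal r" unfolding real(2)[symmetric] by (rule ennreal_le_suminf)
    then show ?thesis using real(1) by simp
  qed
  then have "sup1 v x \<le> r" unfolding sup1_def by (intro cSUP_least) (auto intro: min.coboundedI2)
  then show ?thesis unfolding real(2) by (rule ennreal_leI)
qed simp

lemma sum_geometric_tail:
  assumes "0 \<le> q" "q < 1" "0 \<le> a" shows "(\<Sum>j. ennreal (a * q ^ (N + j))) = ennreal (a * q ^ N / (1 - q))"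
proof (rule suminf_ennreal_eq)
  have "(\<lambda>j. a * q ^ N * q ^ j) sums (a * q ^ N * (1 / (1 - q)))"
    using assms by (intro sums_mult geometric_sums) auto
  then show "(\<lambda>j. a * q ^ (N + j)) sums (a * q ^ N / (1 - q))" by (simp add: power_add mult.assoc)
qed (use assms in auto)

text \<open>Let e N be the cut supremum of |d n| over n >= N. Its energy stays bounded, its integral
  against g tends to 0, and it decreases in N, so it tends to 0 almost everywhere; it equals 1 on
  the tail set. Weak control of this kind suffices for \<open>capacity_vanishes\<close>.\<close>

lemma tail_capacity:
  assumes tr: "testable \<alpha>" and \<alpha>: "\<alpha> \<ge> 0" and d: "\<And>n. d n \<in> F" "\<And>n. Qa \<alpha> (d n) \<le> ennreal ((1 / 4) ^ n)" and \<phi>: "\<phi> \<in> F"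
  shows "(\<lambda>N. cap (tail d N \<inter> {x. 1 < \<phi> x})) \<longlonglongrightarrow> 0"
proof -
  have [measurable]: "d n \<in> borel_measurable borel" for n using d(1) by (rule F_borel)
  have [measurable]: "\<phi> \<in> borel_measurable borel" using \<phi> by (rule F_borel)
  obtain g \<Gamma> where [measurable]: "g \<in> borel_measurable borel" and g: "AE x in m. 0 < g x" "\<And>x. 0 \<le> g x" "0 \<le> \<Gamma>"
    and test: "\<And>u c. u \<in> F \<Longrightarrow> c \<ge> 0 \<Longrightarrow> Qa \<alpha> u \<le> ennreal c \<Longrightarrow> (\<integral>\<^sup>+x. ennreal (\<bar>u x\<bar> * g x) \<partial>m) \<le> ennreal (\<Gamma> * sqrt c)"
    using tr unfolding testable_def by auto
  define e where "e N = sup1 (\<lambda>j. d (N + j))" for N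
  have [measurable]: "e N \<in> borel_measurable borel" for N unfolding e_def by measurable
  have e01: "0 \<le> e N x" "e N x \<le> 1" for N x unfolding e_def by (rule sup1_bounds)+
  have eQ: "Qa \<alpha> (e N) \<le> ennreal 2" for N
  proof -
    have "Qa \<alpha> (e N) \<le> (\<Sum>j. Qa \<alpha> (d (N + j)))" unfolding e_def by (rule Qa_sup1) measurable
    also have "\<dots> \<le> (\<Sum>j. ennreal (1 * (1 / 4) ^ (N + j)))" using d(2) by (intro suminf_le) auto
    also have "\<dots> = ennreal (1 * (1 / 4) ^ N / (1 - 1 / 4))" by (rule sum_geometric_tail) auto
    also have "\<dots> \<le> ennreal 2" using power_le_one[of "1 / 4 :: real" N] by (intro ennreal_leI) simp
    finally show ?thesis .
  qed
  have eint: "(\<integral>\<^sup>+x. ennreal (e N x * g x) \<partial>m) \<le> ennreal (\<Gamma> * (1 / 2) ^ N / (1 - 1 / 2))" for N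
  proof -
    have "(\<integral>\<^sup>+x. ennreal (e N x * g x) \<partial>m) \<le> (\<integral>\<^sup>+x. (\<Sum>j. ennreal (\<bar>d (N + j) x\<bar> * g x)) \<partial>m)"
    proof (rule nn_integral_mono)
      fix x
      have "ennreal (e N x * g x) \<le> (\<Sum>j. ennreal \<bar>d (N + j) x\<bar>) * ennreal (g x)"
        using sup1_le_suminf[of "\<lambda>j. d (N + j)" x] e01 g(2) by (simp add: e_def[symmetric] ennreal_mult mult_right_mono)
      also have "\<dots> = (\<Sum>j. ennreal (\<bar>d (N + j) x\<bar> * g x))"
        using g(2) by (simp add: ennreal_mult ennreal_suminf_multc)
      finally show "ennreal (e N x * g x) \<le> (\<Sum>j. ennreal (\<bar>d (N + j) x\<bar> * g x))" .
    qed
    also have "\<dots> = (\<Sum>j. \<integral>\<^sup>+x. ennreal (\<bar>d (N + j) x\<bar> * g x) \<partial>m)" by (rule nn_integral_suminf) measurable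
    also have "\<dots> \<le> (\<Sum>j. ennreal (\<Gamma> * (1 / 2) ^ (N + j)))"
    proof (rule suminf_le)
      fix j
      have "sqrt ((1 / 4) ^ (N + j)) = (1 / 2 :: real) ^ (N + j)"
        by (simp add: real_sqrt_power real_sqrt_divide)
      then show "(\<integral>\<^sup>+x. ennreal (\<bar>d (N + j) x\<bar> * g x) \<partial>m) \<le> ennreal (\<Gamma> * (1 / 2) ^ (N + j))"
        using test[OF d(1) _ d(2), of "N + j"] by simp
    qed auto
    also have "\<dots> = ennreal (\<Gamma> * (1 / 2) ^ N / (1 - 1 / 2))" using g by (intro sum_geometric_tail) auto
    finally show ?thesis .
  qed
  have edec: "e (Suc N) x \<le> e N x" for N x
    unfolding e_def sup1_def[of "\<lambda>j. d (Suc N + j)"]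
  proof (rule cSUP_least)
    fix j show "min 1 \<bar>d (Suc N + j) x\<bar> \<le> sup1 (\<lambda>j. d (N + j)) x"
      using sup1_upper[of "\<lambda>j. d (N + j)" "Suc j" x] by simp
  qed simp
  have elim0: "AE x in m. (\<lambda>N. e N x) \<longlonglongrightarrow> 0"
  proof -
    have conv: "\<exists>l. (\<lambda>N. e N x) \<longlonglongrightarrow> l" for x
    proof -
      have "decseq (\<lambda>N. e N x)" using edec by (rule decseq_SucI)
      then obtain l where "(\<lambda>N. e N x) \<longlonglongrightarrow> l" by (rule decseq_convergent[of _ 0]) (use e01 in auto)
      then show ?thesis by blast
    qed
    define l where "l x = lim (\<lambda>N. e N x)" for x
    have l: "(\<lambda>N. e N x) \<longlonglongrightarrow> l x" for x
      unfolding l_def using conv[of x] by (auto dest: limI)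
    have [measurable]: "l \<in> borel_measurable borel" by (rule borel_measurable_LIMSEQ_real[OF l]) measurable
    have "(\<integral>\<^sup>+x. ennreal (l x * g x) \<partial>m) = (\<integral>\<^sup>+x. liminf (\<lambda>N. ennreal (e N x * g x)) \<partial>m)"
      by (intro nn_integral_cong lim_imp_Liminf[symmetric] tendsto_ennrealI tendsto_intros l) simp
    also have "\<dots> \<le> liminf (\<lambda>N. \<integral>\<^sup>+x. ennreal (e N x * g x) \<partial>m)" by (rule nn_integral_liminf) measurable
    also have "\<dots> \<le> liminf (\<lambda>N. ennreal (\<Gamma> * (1 / 2) ^ N / (1 - 1 / 2)))"
      using eint by (intro Liminf_mono always_eventually) auto
    also have "\<dots> = ennreal (\<Gamma> * 0 / (1 - 1 / 2))"
      by (intro lim_imp_Liminf tendsto_ennrealI tendsto_intros LIMSEQ_power_zero) auto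
    finally have "(\<integral>\<^sup>+x. ennreal (l x * g x) \<partial>m) = 0" by simp
    then have "AE x in m. ennreal (l x * g x) = 0" by (subst (asm) nn_integral_0_iff_AE) auto
    with g(1) show ?thesis
    proof eventually_elim
      case (elim x)
      have "0 \<le> l x" using l[of x] e01 by (intro tendsto_lowerbound[OF l]) auto
      then have "l x = 0" using elim by (auto simp: ennreal_eq_0_iff zero_less_mult_iff mult_le_0_iff)
      then show ?case using l[of x] by simp
    qed
  qed
  \<comment> \<open>For \<alpha> = 0 the function e N need not be square integrable. The minimum
    with |\<phi>| is, and it is still at least 1 on the part of the tail set where \<phi> >
    1.\<close>
  define w where "w N x = min (e N x) \<bar>\<phi> x\<bar>" for N x
  have [measurable]: "w N \<in> borel_measurable borel" for N unfolding w_def by measurable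
  have wQ: "Qa 0 (w N) \<le> Qa 0 (e N) + Qa 0 \<phi>" for N
  proof (rule Qa_dominated2)
    fix x y
    have "\<bar>w N x - w N y\<bar> \<le> \<bar>e N x - e N y\<bar> \<or> \<bar>w N x - w N y\<bar> \<le> \<bar>\<phi> x - \<phi> y\<bar>"
      unfolding w_def by linarith
    then show "(w N x - w N y)\<^sup>2 \<le> (e N x - e N y)\<^sup>2 + (\<phi> x - \<phi> y)\<^sup>2"
      by (auto simp: abs_le_square_iff intro: order_trans add_increasing add_increasing2)
    have "\<bar>w N x\<bar> \<le> \<bar>e N x\<bar>" unfolding w_def using e01(1)[of N x] by linarith
    then show "(w N x)\<^sup>2 \<le> (e N x)\<^sup>2 + (\<phi> x)\<^sup>2" by (simp add: abs_le_square_iff add_increasing2)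
  qed measurable
  have wn: "nsq (w N) \<le> nsq \<phi>" for N
    unfolding nsq_def
  proof (intro nn_integral_mono ennreal_leI)
    fix x
    have "\<bar>w N x\<bar> \<le> \<bar>\<phi> x\<bar>" unfolding w_def using e01(1)[of N x] by linarith
    then show "(w N x)\<^sup>2 \<le> (\<phi> x)\<^sup>2" by (simp add: abs_le_square_iff)
  qed
  obtain C where C: "2 + Qa 1 \<phi> = ennreal C" "C \<ge> 0"
    using F_Qa_finite[OF \<phi>, of 1] by (cases "2 + Qa 1 \<phi>") auto
  have wC: "Qa 1 (w N) \<le> ennreal C" for N
  proof -
    have "Qa 1 (w N) = Qa 0 (w N) + nsq (w N)" by (simp add: Qa_def)
    also have "\<dots> \<le> (Qa 0 (e N) + Qa 0 \<phi>) + nsq \<phi>" by (intro add_mono wQ wn)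
    also have "Qa 0 (e N) \<le> Qa \<alpha> (e N)" by (simp add: Qa_def)
    also have "Qa \<alpha> (e N) \<le> 2" using eQ by simp
    finally show ?thesis unfolding C(1)[symmetric] by (simp add: Qa_def add_right_mono ac_simps)
  qed
  show ?thesis
  proof (rule capacity_vanishes)
    show "decseq (\<lambda>N. tail d N \<inter> {x. 1 < \<phi> x})"
      by (force simp: decseq_def tail_def)
    show "w N \<in> F" for N using wC[of N] by (auto simp: F_Qa intro: le_less_trans)
    show "1 \<le> w N x" if x: "x \<in> tail d N \<inter> {x. 1 < \<phi> x}" for N x
    proof -
      obtain n where n: "n \<ge> N" "1 < \<bar>d n x\<bar>" using x by (auto simp: tail_def)
      then have "1 \<le> e N x" unfolding e_def using sup1_upper[of "\<lambda>j. d (N + j)" "n - N" x] by simp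
      then show ?thesis using x by (simp add: w_def)
    qed
    show "AE x in m. (\<lambda>N. w N x) \<longlonglongrightarrow> 0"
      using elim0
    proof eventually_elim
      case (elim x)
      show ?case
        by (rule tendsto_sandwich[OF _ _ tendsto_const elim]) (use e01 in \<open>auto simp: w_def\<close>)
    qed
  qed (use wC C in auto)
qed

text \<open>Vanishing is known only locally, on each set where \<phi> j > 1, so the starting index N
  depends on j and the errors \<epsilon> 2^{-j-1} are summed.\<close>

lemma cap_tail_small:
  assumes tr: "testable \<alpha>" and \<alpha>: "\<alpha> \<ge> 0" and d: "\<And>n. d n \<in> D" "\<And>n. Qa \<alpha> (d n) \<le> ennreal ((1 / 4) ^ n)"
    and \<phi>: "\<And>j. \<phi> j \<in> D" and \<epsilon>: "\<epsilon> > 0"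
  shows "\<exists>N. open (\<Union>j::nat. tail d (N j) \<inter> {x. 1 < \<phi> j x}) \<and>
     cap (\<Union>j. tail d (N j) \<inter> {x. 1 < \<phi> j x}) \<le> ennreal \<epsilon>"
proof -
  have "\<exists>N. cap (tail d N \<inter> {x. 1 < \<phi> j x}) \<le> ennreal (\<epsilon> * (1 / 2) ^ Suc j)" for j
  proof -
    have "(\<lambda>N. cap (tail d N \<inter> {x. 1 < \<phi> j x})) \<longlonglongrightarrow> 0"
      using d \<phi> by (intro tail_capacity[OF tr \<alpha>]) auto
    then have "eventually (\<lambda>N. cap (tail d N \<inter> {x. 1 < \<phi> j x}) < ennreal (\<epsilon> * (1 / 2) ^ Suc j)) sequentially"
      using \<epsilon> by (intro order_tendstoD) auto
    then show ?thesis by (auto simp: eventually_sequentially intro: less_imp_le)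
  qed
  then obtain N where N: "\<And>j. cap (tail d (N j) \<inter> {x. 1 < \<phi> j x}) \<le> ennreal (\<epsilon> * (1 / 2) ^ Suc j)"
    using choice[of "\<lambda>j N. cap (tail d N \<inter> {x. 1 < \<phi> j x}) \<le> ennreal (\<epsilon> * (1 / 2) ^ Suc j)"] by auto
  have "cap (\<Union>j. tail d (N j) \<inter> {x. 1 < \<phi> j x}) \<le> (\<Sum>j. cap (tail d (N j) \<inter> {x. 1 < \<phi> j x}))"
    by (rule cap_countable_subadditive)
  also have "\<dots> \<le> (\<Sum>j. ennreal (\<epsilon> * (1 / 2) ^ Suc j))" using N by (intro suminf_le) auto
  also have "\<dots> = ennreal (\<epsilon> * 1)"
    using \<epsilon> by (intro suminf_ennreal_eq sums_mult power_half_series) auto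
  finally have 1: "cap (\<Union>j. tail d (N j) \<inter> {x. 1 < \<phi> j x}) \<le> ennreal \<epsilon>" by simp
  have "open (\<Union>j. tail d (N j) \<inter> {x. 1 < \<phi> j x})"
    unfolding tail_def using d \<phi>
    by (intro open_UN ballI open_Int open_Collect_less continuous_intros) (auto simp: C_c_def)
  with 1 show ?thesis by blast
qed

text \<open>Multiplying the increments by 2^n multiplies their energies by 4^n, which the rate
  16^{-n} reduces to the summable 4^{-n}. Outside the sets where a rescaled increment exceeds 1, the
  original increments are at most 2^{-n}.\<close>

lemma quasi_continuous_limit:
  assumes tr: "testable \<alpha>" and \<alpha>: "\<alpha> \<ge> 0" and f: "\<And>n. f n \<in> D"
    and fast: "\<And>n. Qa \<alpha> (\<lambda>x. f (Suc n) x - f n x) \<le> ennreal ((1 / 16) ^ n)"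
  obtains v A where "v \<in> borel_measurable borel" "quasi_continuous m E F v"
    "A \<in> sets borel" "capacity m E F A = 0" "\<And>x. x \<notin> A \<Longrightarrow> (\<lambda>n. f n x) \<longlonglongrightarrow> v x"
proof -
  obtain \<phi> :: "nat \<Rightarrow> 'a \<Rightarrow> real" where \<phi>: "\<And>j. \<phi> j \<in> D" "\<And>x. \<exists>j. 1 < \<phi> j x" using exhaustion by auto
  have [measurable]: "f n \<in> borel_measurable borel" for n using f[of n] by (auto intro: F_borel)
  have cf: "continuous_on S (f n)" for S n using f[of n] by (auto simp: C_c_def intro: continuous_on_subset)
  define d where "d n x = 2 ^ n * (f (Suc n) x - f n x)" for n x
  have dD: "d n \<in> D" for n unfolding d_def[abs_def] by (intro D_scale D_diff f)
  have dQ: "Qa \<alpha> (d n) \<le> ennreal ((1 / 4) ^ n)" for n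
  proof -
    have "Qa \<alpha> (d n) = ennreal ((2 ^ n)\<^sup>2) * Qa \<alpha> (\<lambda>x. f (Suc n) x - f n x)"
      unfolding d_def[abs_def] by (rule Qa_scale) measurable
    also have "\<dots> \<le> ennreal ((2 ^ n)\<^sup>2) * ennreal ((1 / 16) ^ n)" by (intro mult_left_mono fast) simp
    also have "\<dots> = ennreal ((2 ^ n)\<^sup>2 * (1 / 16) ^ n)" by (simp add: ennreal_mult)
    also have "(2 ^ n)\<^sup>2 * (1 / 16) ^ n = (1 / 4 :: real) ^ n"
      by (simp add: power2_eq_square power_mult_distrib[symmetric])
    finally show ?thesis .
  qed
  have "\<exists>N. open (\<Union>j::nat. tail d (N j) \<inter> {x. 1 < \<phi> j x}) \<and>
     cap (\<Union>j. tail d (N j) \<inter> {x. 1 < \<phi> j x}) \<le> ennreal (1 / real (Suc i))" for i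
    using cap_tail_small[of \<alpha> d \<phi> "1 / real (Suc i)"] tr \<alpha> dD dQ \<phi>(1) by auto
  then have "\<exists>N. \<forall>i. open (\<Union>j::nat. tail d (N i j) \<inter> {x. 1 < \<phi> j x}) \<and>
     cap (\<Union>j. tail d (N i j) \<inter> {x. 1 < \<phi> j x}) \<le> ennreal (1 / real (Suc i))"
    by (intro choice allI)
  then obtain N where "\<forall>i. open (\<Union>j::nat. tail d (N i j) \<inter> {x. 1 < \<phi> j x}) \<and>
     cap (\<Union>j. tail d (N i j) \<inter> {x. 1 < \<phi> j x}) \<le> ennreal (1 / real (Suc i))" by auto
  define G where "G i = (\<Union>j. tail d (N i j) \<inter> {x. 1 < \<phi> j x})" for i
  have G: "open (G i)" "cap (G i) \<le> ennreal (1 / real (Suc i))" for i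
    using \<open>\<forall>i. _ i\<close> by (auto simp: G_def)
  define v where "v x = lim (\<lambda>n. f n x)" for x
  have step: "\<bar>f (Suc n) x - f n x\<bar> \<le> (1 / 2) ^ n" if "x \<notin> G i" "1 < \<phi> j x" "n \<ge> N i j" for x i j n
  proof -
    have "\<not> 1 < \<bar>d n x\<bar>" using that by (auto simp: G_def tail_def)
    moreover have "\<bar>d n x\<bar> = 2 ^ n * \<bar>f (Suc n) x - f n x\<bar>" by (simp add: d_def abs_mult)
    ultimately have "\<bar>f (Suc n) x - f n x\<bar> * 2 ^ n \<le> 1" by (simp add: mult.commute)
    then show ?thesis by (simp add: power_one_over pos_le_divide_eq)
  qed
  have conv: "(\<lambda>n. f n x) \<longlonglongrightarrow> v x" if "x \<notin> G i" for x i
  proof -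
    obtain j where "1 < \<phi> j x" using \<phi>(2) by auto
    then show ?thesis unfolding v_def using step[OF that] by (intro geometric_limit_bound(1))
  qed
  \<comment> \<open>The index after which the geometric bound holds depends on j. Convergence is
    therefore uniform only on each open set where \<phi> j > 1, which is enough for continuity at
    every point off G i.\<close>
  have cont: "continuous_on (- G i) v" for i
    unfolding continuous_on_eq_continuous_within
  proof
    fix x assume x: "x \<in> - G i"
    obtain j where j: "1 < \<phi> j x" using \<phi>(2) by auto
    let ?O = "{x. 1 < \<phi> j x}" let ?S = "?O \<inter> - G i"
    have op: "open ?O" using \<phi>(1)[of j] by (intro open_Collect_less) (auto simp: C_c_def)
    have "uniform_limit ?S f v sequentially"
    proof (rule uniform_limitI)
      fix e :: real assume e: "e > 0"
      have "(\<lambda>n. 2 * (1 / 2 :: real) ^ n) \<longlonglongrightarrow> 2 * 0" by (intro tendsto_intros LIMSEQ_power_zero) simp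
      then have "eventually (\<lambda>n. 2 * (1 / 2 :: real) ^ n < e) sequentially" using e by (intro order_tendstoD) auto
      with eventually_ge_at_top[of "N i j"]
      show "eventually (\<lambda>n. \<forall>y\<in>?S. dist (f n y) (v y) < e) sequentially"
      proof eventually_elim
        case (elim n)
        show ?case
        proof
          fix y assume y: "y \<in> ?S"
          have "\<bar>v y - f n y\<bar> \<le> 2 * (1 / 2) ^ n"
            unfolding v_def using step[of y i j] y elim by (intro geometric_limit_bound(2)[of "N i j"]) auto
          then show "dist (f n y) (v y) < e" using elim by (simp add: dist_real_def)
        qed
      qed
    qed
    then have "continuous_on ?S v"
      by (rule uniform_limit_theorem[rotated]) (auto intro!: always_eventually cf)
    then have "continuous (at x within ?S) v" using x j by (auto simp: continuous_on_eq_continuous_within)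
    moreover have "at x within ?S = at x within - G i"
      by (rule at_within_nhd[of x ?O]) (use op j in auto)
    ultimately show "continuous (at x within - G i) v" by (simp add: continuous_within)
  qed
  define A where "A = (\<Inter>i. G i)"
  have small: "\<exists>i. cap (G i) < ennreal \<epsilon>" if "\<epsilon> > 0" for \<epsilon>
  proof -
    obtain i where "1 / real (Suc i) < \<epsilon>" using \<open>\<epsilon> > 0\<close> by (metis inverse_eq_divide reals_Archimedean)
    then have "ennreal (1 / real (Suc i)) < ennreal \<epsilon>" by (intro ennreal_lessI) (use \<open>\<epsilon> > 0\<close> in auto)
    then show ?thesis using G(2)[of i] by (auto intro: le_less_trans)
  qed
  show ?thesis
  proof (rule that[of v A])
    show "v \<in> borel_measurable borel" unfolding v_def[abs_def] by (rule borel_measurable_lim_metric) measurable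
    show "quasi_continuous m E F v"
      unfolding quasi_continuous_def using small G(1) cont by blast
    show "A \<in> sets borel" unfolding A_def using G(1) by (intro sets.countable_INT) auto
    show "capacity m E F A = 0"
    proof (rule capacity_zero_if)
      fix \<epsilon> :: real assume "\<epsilon> > 0"
      from small[OF this] obtain i where "cap (G i) < ennreal \<epsilon>" by blast
      then show "\<exists>G. open G \<and> A \<subseteq> G \<and> cap G \<le> ennreal \<epsilon>"
        using G(1)[of i] by (intro exI[of _ "G i"]) (auto simp: A_def)
    qed
    show "(\<lambda>n. f n x) \<longlonglongrightarrow> v x" if "x \<notin> A" for x using that conv by (auto simp: A_def)
  qed
qed

text \<open>If no bound existed, rescaling would give core functions with energy at most 4^{-n} and
  value 2 at y. The point y would then lie in every tail set and have capacity zero by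
  \<open>cap_tail_small\<close>.\<close>

lemma point_evaluation_bounded:
  assumes tr: "testable \<alpha>" and \<alpha>: "\<alpha> \<ge> 0" and y: "capacity m E F {y} \<noteq> 0"
  shows "\<exists>B\<ge>0. \<forall>f\<in>D. \<forall>c\<ge>0. Qa \<alpha> f \<le> ennreal c \<longrightarrow> (f y)\<^sup>2 \<le> B * c"
proof (rule ccontr)
  assume neg: "\<not> ?thesis"
  \<comment> \<open>The value 2 lies above the threshold 1 in \<open>tail\<close>; scaling f to it
    divides the energy by (f y)^2 / 4.\<close>
  have "\<exists>g. g \<in> D \<and> g y = 2 \<and> Qa \<alpha> g \<le> ennreal ((1 / 4) ^ n)" for n
  proof -
    obtain f c where f: "f \<in> D" "c \<ge> 0" "Qa \<alpha> f \<le> ennreal c" "(f y)\<^sup>2 > 4 * 4 ^ n * c"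
      using neg by (auto simp: not_le dest!: spec[of _ "4 * 4 ^ n"])
    have [measurable]: "f \<in> borel_measurable borel" using f by (auto intro: F_borel)
    have fy: "(f y)\<^sup>2 > 0" using f by (intro le_less_trans[OF _ f(4)]) auto
    let ?g = "\<lambda>x. 2 / f y * f x"
    have "Qa \<alpha> ?g = ennreal ((2 / f y)\<^sup>2) * Qa \<alpha> f" by (rule Qa_scale) measurable
    also have "\<dots> \<le> ennreal ((2 / f y)\<^sup>2) * ennreal c" using f by (intro mult_left_mono) auto
    also have "\<dots> = ennreal ((2 / f y)\<^sup>2 * c)" by (rule ennreal_mult[symmetric]) (use f in auto)
    also have "(2 / f y)\<^sup>2 * c = 4 / (f y)\<^sup>2 * c" by (simp add: power_divide)
    also have "ennreal (4 / (f y)\<^sup>2 * c) \<le> ennreal ((1 / 4) ^ n)"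
      using f fy by (intro ennreal_leI) (simp add: field_simps power_one_over)
    finally have "Qa \<alpha> ?g \<le> ennreal ((1 / 4) ^ n)" .
    then show ?thesis using f fy by (intro exI[of _ ?g] conjI D_scale) auto
  qed
  then have "\<exists>d. \<forall>n. d n \<in> D \<and> d n y = 2 \<and> Qa \<alpha> (d n) \<le> ennreal ((1 / 4) ^ n)" by (intro choice allI)
  then obtain d where dd: "\<forall>n. d n \<in> D \<and> d n y = 2 \<and> Qa \<alpha> (d n) \<le> ennreal ((1 / 4) ^ n)" ..
  have d: "\<And>n. d n \<in> D" "\<And>n. d n y = 2" "\<And>n. Qa \<alpha> (d n) \<le> ennreal ((1 / 4) ^ n)" using dd by blast+
  obtain \<phi> :: "nat \<Rightarrow> 'a \<Rightarrow> real" where \<phi>: "\<And>j. \<phi> j \<in> D" "\<And>x. \<exists>j. 1 < \<phi> j x" using exhaustion by auto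
  have "capacity m E F {y} = 0"
  proof (rule capacity_zero_if)
    fix \<epsilon> :: real assume "\<epsilon> > 0"
    from cap_tail_small[where \<phi>=\<phi>, OF tr \<alpha> d(1) d(3) \<phi>(1) this] obtain N where
      N: "open (\<Union>j::nat. tail d (N j) \<inter> {x. 1 < \<phi> j x})" "cap (\<Union>j. tail d (N j) \<inter> {x. 1 < \<phi> j x}) \<le> ennreal \<epsilon>"
      by (elim exE conjE)
    have "y \<in> (\<Union>j. tail d (N j) \<inter> {x. 1 < \<phi> j x})" using \<phi>(2)[of y] d(2) by (auto simp: tail_def)
    with N show "\<exists>G. open G \<and> {y} \<subseteq> G \<and> cap G \<le> ennreal \<epsilon>" by blast
  qed
  with y show False by simp
qed

end

lemma radon_measure_sigma_finite:
  fixes \<nu> :: "'a::{metric_space, second_countable_topology} measure"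
  assumes lc: "locally_compact_space (euclidean :: 'a topology)" and \<nu>: "radon_measure \<nu>"
  shows "sigma_finite_measure \<nu>"
proof -
  have sets\<nu>: "sets \<nu> = sets borel" and fin: "\<And>K. compact K \<Longrightarrow> emeasure \<nu> K < \<top>"
    using \<nu> by (auto simp: radon_measure_def)
  define \<F> where "\<F> = {U :: 'a set. open U \<and> emeasure \<nu> U < \<top>}"
  obtain \<G> where \<G>: "\<G> \<subseteq> \<F>" "countable \<G>" "\<Union>\<G> = \<Union>\<F>"
    by (rule Lindelof[of \<F>]) (auto simp: \<F>_def)
  have "x \<in> \<Union>\<F>" for x
  proof -
    have "\<exists>U K. openin euclidean U \<and> compactin euclidean K \<and> x \<in> U \<and> U \<subseteq> K"
      using lc unfolding locally_compact_space_def by (rule bspec) simp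
    then obtain U K where "openin euclidean U" "compactin euclidean K" and xU: "x \<in> U" "U \<subseteq> K" by (elim exE conjE)
    then have UK: "open U" "compact K" by simp_all
    have "emeasure \<nu> U \<le> emeasure \<nu> K"
      using UK xU sets\<nu> by (intro emeasure_mono) (auto simp: borel_compact)
    then have "U \<in> \<F>" using UK fin[of K] by (auto simp: \<F>_def intro: le_less_trans)
    then show ?thesis using xU by blast
  qed
  then have "\<Union>\<G> = space \<nu>" using \<G>(3) sets_eq_imp_space_eq[OF sets\<nu>] by auto
  moreover have "\<G> \<subseteq> sets \<nu>"
  proof
    fix U assume "U \<in> \<G>"
    then have "open U" using \<G>(1) by (auto simp: \<F>_def)
    then show "U \<in> sets \<nu>" unfolding sets\<nu> by (rule borel_open)
  qed
  moreover have "\<forall>U\<in>\<G>. emeasure \<nu> U \<noteq> \<infinity>" using \<G>(1) unfolding \<F>_def by fastforce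
  ultimately show ?thesis using \<G>(2) by (intro sigma_finite_measure.intro exI[of _ \<G>] conjI)
qed

context dirichlet_kernel begin

lemma cap_empty: "cap {} = 0"
proof -
  have "cap {} \<le> Qa 1 (\<lambda>x. 0)" using domain_zero by (intro cap_le) auto
  then show ?thesis by (simp add: Qa_zero)
qed

lemma cap_Un: "cap (A \<union> B) \<le> cap A + cap B"
proof -
  let ?G = "\<lambda>j::nat. if j = 0 then A else if j = 1 then B else {}"
  have "(\<Union>j. ?G j) = A \<union> B" by (auto split: if_splits intro: exI[of _ "0::nat"] exI[of _ "1::nat"])
  moreover have "(\<Sum>j. cap (?G j)) = (\<Sum>j\<in>{0, 1}. cap (?G j))"
    by (rule suminf_finite) (auto simp: cap_empty)
  ultimately show ?thesis using cap_countable_subadditive[of ?G] by simp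
qed

text \<open>Adjoining the exceptional set to \<open>G\<close> keeps it open and changes it only by an \<open>m\<close>-null set.\<close>

lemma quasi_continuous_unique:
  assumes v: "quasi_continuous m E F v" and w: "quasi_continuous m E F w" and ae: "AE x in m. v x = w x"
  shows "capacity m E F {x. v x \<noteq> w x} = 0"
proof (rule capacity_zero_if)
  fix \<epsilon> :: real assume \<epsilon>: "\<epsilon> > 0"
  obtain G where G: "open G" "cap G < ennreal (\<epsilon> / 2)" "continuous_on (- G) v"
    using v \<epsilon> unfolding quasi_continuous_def by (meson half_gt_zero)
  obtain H where H: "open H" "cap H < ennreal (\<epsilon> / 2)" "continuous_on (- H) w"
    using w \<epsilon> unfolding quasi_continuous_def by (meson half_gt_zero)
  define U where "U = G \<union> H"
  define W where "W = U \<union> {x. v x \<noteq> w x}"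
  have "continuous_on (- U) (\<lambda>x. v x - w x)"
    using G(3) H(3) unfolding U_def by (intro continuous_intros) (auto intro: continuous_on_subset)
  moreover have "closed (- U)" using G(1) H(1) unfolding U_def by (intro closed_Compl open_Un)
  ultimately have "closed {x \<in> - U. v x - w x = 0}" by (rule continuous_closed_preimage_constant)
  moreover have "- W = {x \<in> - U. v x - w x = 0}" by (auto simp: W_def)
  ultimately have "closed (- W)" by (simp only:)
  then have "open W" unfolding open_closed .
  moreover have "cap W \<le> ennreal \<epsilon>"
  proof -
    have "cap W \<le> cap U" using ae by (intro cap_mono_AE) (auto simp: W_def elim!: eventually_mono)
    also have "\<dots> \<le> cap G + cap H" unfolding U_def by (rule cap_Un)
    also have "\<dots> \<le> ennreal (\<epsilon> / 2) + ennreal (\<epsilon> / 2)" using G H by (intro add_mono) auto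
    also have "\<dots> = ennreal \<epsilon>" using \<epsilon> by (subst ennreal_plus[symmetric]) auto
    finally show ?thesis .
  qed
  ultimately show "\<exists>G. open G \<and> {x. v x \<noteq> w x} \<subseteq> G \<and> cap G \<le> ennreal \<epsilon>"
    by (intro exI[of _ W]) (auto simp: W_def)
qed

section \<open>Behaviour of the semigroup at time zero\<close>

text \<open>A fixed sequence of times, because Fatou's lemma under the measure is applied along
  sequences.\<close>

definition small_time :: "nat \<Rightarrow> real" where "small_time n = 1 / real (Suc n)"

lemma small_time_pos: "small_time n > 0" by (simp add: small_time_def)

lemma small_time_tendsto: "small_time \<longlonglongrightarrow> 0"
  unfolding small_time_def[abs_def] by (rule LIMSEQ_Suc[OF lim_const_over_n])

lemma small_time_filterlim: "filterlim small_time (at_right 0) sequentially"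
proof -
  have "small_time n \<noteq> 0" for n using small_time_pos[of n] by simp
  then show ?thesis using small_time_tendsto small_time_pos by (auto simp: filterlim_at intro!: always_eventually)
qed

lemma small_time_open:
  "open G \<Longrightarrow> x \<in> G \<Longrightarrow> (\<lambda>n. \<integral>\<^sup>+y\<in>G. k (small_time n) x y \<partial>m) \<longlonglongrightarrow> 1"
  using k_open small_time_filterlim by (rule filterlim_compose)

lemma liminf_nnP_open:
  assumes "open G" "x \<in> G" and AE: "AE y in m. y \<in> G \<longrightarrow> ennreal c \<le> f y"
  shows "ennreal c \<le> liminf (\<lambda>n. nnP (small_time n) f x)"
proof -
  have "(\<lambda>n. ennreal c * (\<integral>\<^sup>+y\<in>G. k (small_time n) x y \<partial>m)) \<longlonglongrightarrow> ennreal c * 1"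
    using assms by (intro ennreal_tendsto_cmult small_time_open) auto
  then have "ennreal c = liminf (\<lambda>n. ennreal c * (\<integral>\<^sup>+y\<in>G. k (small_time n) x y \<partial>m))"
    by (intro lim_imp_Liminf[symmetric]) auto
  also have "\<dots> \<le> liminf (\<lambda>n. nnP (small_time n) f x)"
  proof (intro Liminf_mono always_eventually allI)
    fix n
    have [measurable]: "G \<in> sets borel" using assms by simp
    have "ennreal c * (\<integral>\<^sup>+y\<in>G. k (small_time n) x y \<partial>m) = (\<integral>\<^sup>+y. ennreal c * (k (small_time n) x y * indicator G y) \<partial>m)"
      by (rule nn_integral_cmult[symmetric]) measurable
    also have "\<dots> \<le> nnP (small_time n) f x"
      unfolding nnP_def
    proof (rule nn_integral_mono_AE)
      show "AE y in m. ennreal c * (k (small_time n) x y * indicator G y) \<le> k (small_time n) x y * f y"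
        using AE by eventually_elim (auto split: split_indicator simp: mult.commute intro: mult_right_mono)
    qed
    finally show "ennreal c * (\<integral>\<^sup>+y\<in>G. k (small_time n) x y \<partial>m) \<le> nnP (small_time n) f x" .
  qed
  finally show ?thesis .
qed

text \<open>On the open neighbourhood of x where h exceeds h x - \<epsilon>,
  \<open>liminf_nnP_open\<close> applies with this constant.\<close>

lemma liminf_nnP_continuous:
  assumes h: "continuous_on UNIV h" "\<And>x. 0 \<le> h x"
  shows "ennreal (h x) \<le> liminf (\<lambda>n. nnP (small_time n) (\<lambda>y. ennreal (h y)) x)"
proof (rule ennreal_le_epsilon)
  fix \<epsilon> :: real assume \<epsilon>: "\<epsilon> > 0"
  let ?G = "{y. h x - \<epsilon> < h y}"
  have "ennreal (h x - \<epsilon>) \<le> liminf (\<lambda>n. nnP (small_time n) (\<lambda>y. ennreal (h y)) x)"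
    using h \<epsilon> by (intro liminf_nnP_open[of ?G] open_Collect_less) (auto intro!: ennreal_leI)
  then have "ennreal (h x - \<epsilon>) + ennreal \<epsilon> \<le> liminf (\<lambda>n. nnP (small_time n) (\<lambda>y. ennreal (h y)) x) + ennreal \<epsilon>"
    by (rule add_right_mono)
  moreover have "ennreal (h x) \<le> ennreal (h x - \<epsilon>) + ennreal \<epsilon>"
    using \<epsilon> h(2)[of x] by (cases "\<epsilon> \<le> h x") (auto simp: ennreal_plus[symmetric] ennreal_neg ennreal_leI simp del: ennreal_plus)
  ultimately show "ennreal (h x) \<le> liminf (\<lambda>n. nnP (small_time n) (\<lambda>y. ennreal (h y)) x) + ennreal \<epsilon>" by (rule order_trans[rotated])
qed

section \<open>The semigroup on bounded functions, at every point\<close>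

lemma kr_integrable: "integrable m (kr t x)"
proof (rule integrableI_bounded)
  have "(\<integral>\<^sup>+y. ennreal (norm (kr t x y)) \<partial>m) = nnP t (\<lambda>_. 1) x" by (simp add: nnP_kr)
  also have "\<dots> \<le> 1" using k_sub[of t x] by (simp add: nnP_def)
  finally show "(\<integral>\<^sup>+y. ennreal (norm (kr t x y)) \<partial>m) < \<infinity>" by (simp add: order.strict_trans1)
qed simp

lemma kr_integrable_bounded:
  assumes [measurable]: "u \<in> borel_measurable borel" and "\<And>y. \<bar>u y\<bar> \<le> B"
  shows "integrable m (\<lambda>y. kr t x y * u y)"
proof (rule Bochner_Integration.integrable_bound)
  show "integrable m (\<lambda>y. B * kr t x y)" using kr_integrable by simp
  have "0 \<le> B" using assms(2)[of undefined] by linarith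
  then show "AE y in m. norm (kr t x y * u y) \<le> norm (B * kr t x y)"
    using assms(2) by (auto simp: abs_mult mult.commute[of B] intro!: mult_left_mono)
qed measurable

lemma S_bounded:
  assumes [measurable]: "u \<in> borel_measurable borel" and B: "\<And>y. \<bar>u y\<bar> \<le> B" shows "\<bar>S t u x\<bar> \<le> B"
proof -
  have B0: "0 \<le> B" using B[of undefined] by linarith
  have "ennreal \<bar>S t u x\<bar> \<le> nnP t (\<lambda>y. ennreal \<bar>u y\<bar>) x" by (rule S_abs_le) measurable
  also have "\<dots> \<le> (\<integral>\<^sup>+y. k t x y * ennreal B \<partial>m)"
    unfolding nnP_def using B by (intro nn_integral_mono mult_left_mono ennreal_leI) auto
  also have "\<dots> = (\<integral>\<^sup>+y. k t x y \<partial>m) * ennreal B" by (rule nn_integral_multc) measurable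
  also have "\<dots> \<le> 1 * ennreal B" using k_sub by (intro mult_right_mono) auto
  finally show ?thesis using B0 by simp
qed

lemma S_diff_bounded:
  assumes [measurable]: "u \<in> borel_measurable borel" "v \<in> borel_measurable borel"
    and "\<And>y. \<bar>u y\<bar> \<le> B" "\<And>y. \<bar>v y\<bar> \<le> C"
  shows "S t (\<lambda>y. u y - v y) x = S t u x - S t v x"
  unfolding S_def using kr_integrable_bounded[of u B] kr_integrable_bounded[of v C] assms
  by (simp add: right_diff_distrib)

text \<open>Unlike \<open>S_S\<close>, an identity at every point, as integration against measures
  that may charge \<open>m\<close>-null sets requires. Boundedness makes \<open>nnP\<close> finite
  everywhere.\<close>

lemma S_S_bounded:
  assumes [measurable]: "u \<in> borel_measurable borel" and B: "\<And>y. \<bar>u y\<bar> \<le> B" and ts: "t > 0" "s > 0"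
  shows "S t (S s u) x = S (t + s) u x"
proof -
  have B0: "0 \<le> B" using B[of undefined] by linarith
  have nn: "S t (S s v) x = S (t + s) v x"
    if [measurable]: "v \<in> borel_measurable borel" and v: "\<And>y. 0 \<le> v y" "\<And>y. v y \<le> B" for v
  proof -
    have f: "nnP s (\<lambda>y. ennreal (v y)) z < \<top>" for z
    proof -
      have "nnP s (\<lambda>y. ennreal (v y)) z \<le> (\<integral>\<^sup>+y. k s z y * ennreal B \<partial>m)"
        unfolding nnP_def using v by (intro nn_integral_mono mult_left_mono ennreal_leI) auto
      also have "\<dots> = (\<integral>\<^sup>+y. k s z y \<partial>m) * ennreal B" by (rule nn_integral_multc) measurable
      also have "\<dots> \<le> 1 * ennreal B" using k_sub by (intro mult_right_mono) auto
      finally show ?thesis by (auto intro: le_less_trans)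
    qed
    have "S t (S s v) x = enn2real (nnP t (\<lambda>y. ennreal (S s v y)) x)"
      using v by (intro S_nn S_nonneg) auto
    also have "(\<lambda>y. ennreal (S s v y)) = nnP s (\<lambda>y. ennreal (v y))"
      using f by (auto simp: fun_eq_iff S_nn[OF _ v(1)])
    finally show ?thesis using ts S_nn[of v "t + s" x] v by (simp add: nnP_nnP)
  qed
  define p where "p = (\<lambda>x. max 0 (u x))"
  define n where "n = (\<lambda>x. max 0 (- u x))"
  have [measurable]: "p \<in> borel_measurable borel" "n \<in> borel_measurable borel"
    unfolding p_def n_def by measurable
  have pn: "0 \<le> p y" "p y \<le> B" "0 \<le> n y" "n y \<le> B" for y
    using B[of y] B0 by (auto simp: p_def n_def)
  have ab: "\<bar>p y\<bar> \<le> B" "\<bar>n y\<bar> \<le> B" for y using pn[of y] by auto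
  have u: "u = (\<lambda>x. p x - n x)" by (auto simp: p_def n_def)
  have s: "S r u = (\<lambda>x. S r p x - S r n x)" for r
    unfolding u by (intro ext S_diff_bounded[where B=B and C=B] ab) measurable
  have "S t (S s u) x = S t (S s p) x - S t (S s n) x"
    unfolding s[of s] by (intro S_diff_bounded[where B=B and C=B] S_bounded ab) measurable
  then show ?thesis using nn[of p] nn[of n] pn by (simp add: s)
qed

text \<open>The one-sided bound for non-negative functions is applied to B + u and to B - u. Because
  S 1 <= 1, the constant B contributes at most B, and the two lower bounds enclose S u.\<close>

lemma S_small_time:
  assumes c: "continuous_on UNIV u" and B: "\<And>y. \<bar>u y\<bar> \<le> B"
  shows "(\<lambda>n. S (small_time n) u x) \<longlonglongrightarrow> u x"
proof -
  have [measurable]: "u \<in> borel_measurable borel" using c by (rule borel_measurable_continuous_onI)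
  have B0: "0 \<le> B" using B[of undefined] by linarith
  define p where "p = (\<lambda>n. S (small_time n) (\<lambda>y. B + u y) x)"
  define q where "q = (\<lambda>n. S (small_time n) (\<lambda>y. B - u y) x)"
  have ge: "ennreal (h x) \<le> liminf (\<lambda>n. ennreal (S (small_time n) h x))"
    if h: "continuous_on UNIV h" "\<And>y. 0 \<le> h y" "\<And>y. h y \<le> 2 * B" for h
  proof -
    have [measurable]: "h \<in> borel_measurable borel" using h(1) by (rule borel_measurable_continuous_onI)
    have "nnP (small_time n) (\<lambda>y. ennreal (h y)) x = ennreal (S (small_time n) h x)" for n
    proof -
      have "integrable m (\<lambda>y. kr (small_time n) x y * h y)"
        using h by (intro kr_integrable_bounded[of _ "2 * B"]) (auto simp: abs_le_iff order_trans[of "- _" 0])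
      then show ?thesis
        unfolding S_def nnP_kr using h by (subst nn_integral_eq_integral[symmetric]) (auto simp: ennreal_mult)
    qed
    then show ?thesis using liminf_nnP_continuous[OF h(1,2), of x] by simp
  qed
  have ev: "eventually (\<lambda>n. a < S (small_time n) h x) sequentially"
    if h: "continuous_on UNIV h" "\<And>y. 0 \<le> h y" "\<And>y. h y \<le> 2 * B" and a: "a < h x" for h a
  proof (cases "a < 0")
    case True
    then show ?thesis using S_nonneg[of h] h(2) by (auto intro!: always_eventually intro: less_le_trans)
  next
    case False
    then have "ennreal a < ennreal (h x)" using a by (simp add: ennreal_less_iff)
    then have "eventually (\<lambda>n. ennreal a < ennreal (S (small_time n) h x)) sequentially"
      using ge[OF h] by (simp add: le_Liminf_iff)
    then show ?thesis by eventually_elim (use False in \<open>simp add: ennreal_less_iff\<close>)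
  qed
  have hb: "0 \<le> B + u y" "B + u y \<le> 2 * B" "0 \<le> B - u y" "B - u y \<le> 2 * B" for y
    using B[of y] by linarith+
  have one: "S s (\<lambda>y. c + \<sigma> * u y) x = c * S s (\<lambda>_. 1) x + \<sigma> * S s u x" for s c \<sigma>
    unfolding S_def using kr_integrable[of s x] kr_integrable_bounded[of u B s x] B
    by (simp add: distrib_left mult.left_commute)
  have le1: "S s (\<lambda>_. 1) x \<le> 1" for s using S_bounded[of "\<lambda>_. 1" 1 s x] by simp
  show ?thesis
  proof (rule order_tendstoI)
    fix a assume "a < u x"
    then have "eventually (\<lambda>n. B + a < S (small_time n) (\<lambda>y. B + u y) x) sequentially"
      by (intro ev continuous_intros c hb) simp
    then show "eventually (\<lambda>n. a < S (small_time n) u x) sequentially"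
    proof eventually_elim
      case (elim n)
      have "B * S (small_time n) (\<lambda>_. 1) x \<le> B * 1" using le1 B0 by (intro mult_left_mono)
      then show ?case using elim one[of "small_time n" B 1] by simp
    qed
  next
    fix a assume "u x < a"
    then have "eventually (\<lambda>n. B - a < S (small_time n) (\<lambda>y. B - u y) x) sequentially"
      by (intro ev continuous_intros c hb) simp
    then show "eventually (\<lambda>n. S (small_time n) u x < a) sequentially"
    proof eventually_elim
      case (elim n)
      have "B * S (small_time n) (\<lambda>_. 1) x \<le> B * 1" using le1 B0 by (intro mult_left_mono)
      then show ?case using elim one[of "small_time n" B "-1"] by simp
    qed
  qed
qed

text \<open>The function S_t u is not known to be continuous. Commuting the operators puts the small
  time inside, where u is continuous and dominated convergence under the kernel at time t
  applies.\<close>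

lemma S_shift_small_time:
  assumes c: "continuous_on UNIV u" and B: "\<And>y. \<bar>u y\<bar> \<le> B" and t: "t > 0"
  shows "(\<lambda>n. S (small_time n) (S t u) x) \<longlonglongrightarrow> S t u x"
proof -
  have [measurable]: "u \<in> borel_measurable borel" using c by (rule borel_measurable_continuous_onI)
  have "(\<lambda>n. S t (S (small_time n) u) x) \<longlonglongrightarrow> S t u x"
    unfolding S_def[of t]
  proof (rule integral_dominated_convergence)
    show "integrable m (\<lambda>y. B * kr t x y)" using kr_integrable by simp
    show "AE y in m. (\<lambda>n. kr t x y * S (small_time n) u y) \<longlonglongrightarrow> kr t x y * u y"
      by (intro AE_I2 tendsto_mult tendsto_const S_small_time[OF c B])
    show "AE y in m. norm (kr t x y * S (small_time n) u y) \<le> B * kr t x y" for n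
      using S_bounded[of u B "small_time n"] B by (auto simp: abs_mult mult.commute[of B] intro!: mult_left_mono)
  qed measurable
  moreover have "S t (S (small_time n) u) x = S (small_time n) (S t u) x" for n
    using S_S_bounded[of u B t "small_time n" x] S_S_bounded[of u B "small_time n" t x] B t small_time_pos[of n]
    by (simp add: add.commute)
  ultimately show ?thesis by simp
qed

lemma liminf_nnP_difference:
  assumes c: "continuous_on UNIV u" and B: "\<And>y. \<bar>u y\<bar> \<le> B" and t: "t > 0"
  shows "ennreal \<bar>u x - S t u x\<bar> \<le> liminf (\<lambda>n. nnP (small_time n) (\<lambda>y. ennreal \<bar>u y - S t u y\<bar>) x)"
proof -
  have [measurable]: "u \<in> borel_measurable borel" using c by (rule borel_measurable_continuous_onI)
  have "(\<lambda>n. S (small_time n) u x - S (small_time n) (S t u) x) \<longlonglongrightarrow> u x - S t u x"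
    using S_small_time[OF c B] S_shift_small_time[OF c B t] by (intro tendsto_intros)
  then have "(\<lambda>n. ennreal \<bar>S (small_time n) u x - S (small_time n) (S t u) x\<bar>) \<longlonglongrightarrow> ennreal \<bar>u x - S t u x\<bar>"
    by (intro tendsto_ennrealI tendsto_rabs)
  then have "ennreal \<bar>u x - S t u x\<bar> = liminf (\<lambda>n. ennreal \<bar>S (small_time n) u x - S (small_time n) (S t u) x\<bar>)"
    by (intro lim_imp_Liminf[symmetric]) auto
  also have "\<dots> \<le> liminf (\<lambda>n. nnP (small_time n) (\<lambda>y. ennreal \<bar>u y - S t u y\<bar>) x)"
  proof (intro Liminf_mono always_eventually allI)
    fix n
    have "S (small_time n) u x - S (small_time n) (S t u) x = S (small_time n) (\<lambda>y. u y - S t u y) x"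
      using S_diff_bounded[of u "S t u" B B "small_time n" x] B S_bounded[of u B t] by simp
    then show "ennreal \<bar>S (small_time n) u x - S (small_time n) (S t u) x\<bar> \<le> nnP (small_time n) (\<lambda>y. ennreal \<bar>u y - S t u y\<bar>) x"
      using S_abs_le[of "\<lambda>y. u y - S t u y" "small_time n" x] by simp
  qed
  finally show ?thesis .
qed

section \<open>Bounds on the core\<close>

lemma core_bound:
  fixes \<nu> :: "'a measure"
  assumes "sets \<nu> = sets borel" "sigma_finite_measure \<nu>" "p \<ge> 1" "\<Theta> > 0" "\<alpha> \<ge> 0"
    and "AE x in \<nu>. (\<integral>\<^sup>+y. ennreal_powr (resolvent_kernel k \<alpha> x y) p \<partial>\<nu>) \<le> ennreal \<Theta>"
    and f: "f \<in> D" and c: "Qa \<alpha> f \<le> ennreal c" "0 \<le> c"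
  shows "(\<integral>\<^sup>+x. ennreal (\<bar>f x\<bar> powr (2 * p)) \<partial>\<nu>) \<le> ennreal (\<Theta> * c powr p)"
proof (rule embedding_bound[where s = small_time and u = "\<lambda>x. \<bar>f x\<bar>" and \<alpha> = \<alpha>])
  have [measurable]: "f \<in> borel_measurable borel" using f by (auto intro: F_borel)
  show "(\<lambda>x. \<bar>f x\<bar>) \<in> L2" using f by (intro L2_abs F_L2) auto
  show "Qa \<alpha> (\<lambda>x. \<bar>f x\<bar>) \<le> ennreal c" using Qa_abs[of f \<alpha>] c by (auto intro: order_trans)
  show "(\<lambda>x. \<bar>f x\<bar>) \<in> borel_measurable borel" by measurable
  have "continuous_on UNIV (\<lambda>x. \<bar>f x\<bar>)" using f by (intro continuous_intros) (auto simp: C_c_def)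
  then show "AE x in \<nu>. ennreal \<bar>f x\<bar> \<le> liminf (\<lambda>n. nnP (small_time n) (\<lambda>y. ennreal \<bar>f y\<bar>) x)"
    by (intro AE_I2 liminf_nnP_continuous) auto
qed (use assms small_time_pos small_time_tendsto in auto)

text \<open>With t = 1 / \<alpha> the energies of f and S_t f contribute 2c + 2c, and the mass term
  contributes \<alpha> t c = c; together 5c. The L2 gain of order t exactly balances the weight
  \<alpha>.\<close>

lemma difference_bound:
  fixes \<nu> :: "'a measure"
  assumes "sets \<nu> = sets borel" "sigma_finite_measure \<nu>" "p \<ge> 1" "\<Theta> > 0" and \<alpha>: "\<alpha> > 0"
    and "AE x in \<nu>. (\<integral>\<^sup>+y. ennreal_powr (resolvent_kernel k \<alpha> x y) p \<partial>\<nu>) \<le> ennreal \<Theta>"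
    and f: "f \<in> D" and c: "Qa 0 f \<le> ennreal c" "0 \<le> c"
  shows "(\<integral>\<^sup>+x. ennreal (\<bar>f x - S (1 / \<alpha>) f x\<bar> powr (2 * p)) \<partial>\<nu>) \<le> ennreal (\<Theta> * (5 * c) powr p)"
proof (rule embedding_bound[where s = small_time and u = "\<lambda>x. \<bar>f x - S (1 / \<alpha>) f x\<bar>" and \<alpha> = \<alpha>])
  define t where "t = 1 / \<alpha>"
  have t: "t > 0" using \<alpha> by (simp add: t_def)
  have [measurable]: "f \<in> borel_measurable borel" using f by (auto intro: F_borel)
  have L: "f \<in> L2" using f by (auto intro: F_L2)
  let ?v = "\<lambda>x. f x - S t f x"
  have vL: "?v \<in> L2" using L by (intro L2_diff S_L2)
  then show "(\<lambda>x. \<bar>f x - S (1 / \<alpha>) f x\<bar>) \<in> L2" unfolding t_def by (rule L2_abs)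
  show "(\<lambda>x. \<bar>f x - S (1 / \<alpha>) f x\<bar>) \<in> borel_measurable borel" by measurable
  have Qf: "Q f \<le> ennreal c" using c by (simp add: Qa_def)
  have "Qa \<alpha> ?v = Qa 0 ?v + ennreal \<alpha> * nsq ?v" by (simp add: Qa_def)
  also have "\<dots> \<le> (2 * Qa 0 f + 2 * Qa 0 (S t f)) + ennreal \<alpha> * ennreal (t * c)"
  proof (intro add_mono mult_left_mono)
    show "Qa 0 ?v \<le> 2 * Qa 0 f + 2 * Qa 0 (S t f)" by (rule Qa_diff2) measurable
    show "nsq ?v \<le> ennreal (t * c)"
      unfolding nsq_L2[OF vL] by (intro ennreal_leI norm_diff_S_le[OF L Qf c(2) t])
  qed simp
  also have "\<dots> \<le> (2 * ennreal c + 2 * ennreal c) + ennreal \<alpha> * ennreal (t * c)"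
    using Qf Q_S_le[OF L Qf c(2) t] by (intro add_mono mult_left_mono) (auto simp: Qa_def)
  also have "\<dots> = ennreal (2 * c + 2 * c + \<alpha> * (t * c))"
  proof -
    have e1: "2 * ennreal c = ennreal (2 * c)" using c by (simp add: ennreal_mult)
    have e2: "ennreal \<alpha> * ennreal (t * c) = ennreal (\<alpha> * (t * c))"
      by (rule ennreal_mult[symmetric]) (use c \<alpha> t in auto)
    show ?thesis
      unfolding e1 e2 using c \<alpha> t by (simp add: ennreal_plus[symmetric] del: ennreal_plus)
  qed
  also have "2 * c + 2 * c + \<alpha> * (t * c) = 5 * c" using \<alpha> by (simp add: t_def)
  finally have "Qa \<alpha> ?v \<le> ennreal (5 * c)" .
  moreover have "Qa \<alpha> (\<lambda>x. \<bar>?v x\<bar>) \<le> Qa \<alpha> ?v" by (rule Qa_abs) measurable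
  ultimately show "Qa \<alpha> (\<lambda>x. \<bar>f x - S (1 / \<alpha>) f x\<bar>) \<le> ennreal (5 * c)" unfolding t_def by (rule order_trans[rotated])
  obtain B where "B \<ge> 0" and B: "\<And>x. \<bar>f x\<bar> \<le> B" by (rule C_c_bounded[of f]) (use f in auto)
  have "continuous_on UNIV f" using f by (auto simp: C_c_def)
  then show "AE x in \<nu>. ennreal \<bar>f x - S (1 / \<alpha>) f x\<bar> \<le> liminf (\<lambda>n. nnP (small_time n) (\<lambda>y. ennreal \<bar>f y - S (1 / \<alpha>) f y\<bar>) x)"
    using \<alpha> B by (intro AE_I2 liminf_nnP_difference) auto
qed (use assms small_time_pos small_time_tendsto in auto)

text \<open>For an open G of capacity below \<epsilon> the embedding bound is applied with h the
  indicator of G and u a near-minimizer; passing from \<open>Qa\<close> at 1 to \<open>Qa\<close> at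
  \<alpha> costs the factor 1 + \<alpha>. The resulting bound on the measure of G tends to 0 with
  \<epsilon>.\<close>

lemma bounded_potential_smooth:
  fixes \<nu> :: "'a measure"
  assumes sets\<nu>: "sets \<nu> = sets borel" and sf: "sigma_finite_measure \<nu>" and p: "p \<ge> 1" and \<Theta>: "\<Theta> > 0" and \<alpha>: "\<alpha> \<ge> 0"
    and R: "AE x in \<nu>. (\<integral>\<^sup>+y. ennreal_powr (resolvent_kernel k \<alpha> x y) p \<partial>\<nu>) \<le> ennreal \<Theta>"
  shows "charges_no_null_capacity m E F \<nu>"
  unfolding charges_no_null_capacity_def
proof (intro ballI impI)
  fix A assume A: "A \<in> sets borel" "capacity m E F A = 0"
  have bd: "emeasure \<nu> A \<le> ennreal (\<Theta> * ((1 + \<alpha>) * \<epsilon>) powr p)" if \<epsilon>: "\<epsilon> > 0" for \<epsilon>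
  proof -
    have "(INF G\<in>{G. open G \<and> A \<subseteq> G}. cap G) < ennreal \<epsilon>" using A \<epsilon> by (simp add: capacity_def)
    then obtain G where G: "open G" "A \<subseteq> G" "cap G < ennreal \<epsilon>" unfolding INF_less_iff by auto
    then obtain e where e: "e \<in> F" "AE x in m. x \<in> G \<longrightarrow> e x \<ge> 1" "Qa 1 e < ennreal \<epsilon>" by (auto elim: cap_less)
    have [measurable]: "G \<in> sets borel" "e \<in> borel_measurable borel" using G e by (auto intro: F_borel)
    have "(\<integral>\<^sup>+x. ennreal (indicator G x powr (2 * p)) \<partial>\<nu>) \<le> ennreal (\<Theta> * ((1 + \<alpha>) * \<epsilon>) powr p)"
    proof (rule embedding_bound[where s = small_time and u = "\<lambda>x. \<bar>e x\<bar>" and \<alpha> = \<alpha>])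
      show "(\<lambda>x. \<bar>e x\<bar>) \<in> L2" using e by (intro L2_abs F_L2)
      have "Qa \<alpha> (\<lambda>x. \<bar>e x\<bar>) \<le> Qa \<alpha> e" by (rule Qa_abs) measurable
      also have "\<dots> \<le> ennreal (1 + \<alpha>) * Qa 1 e"
        using \<alpha> unfolding Qa_def ennreal_plus[OF zero_le_one \<alpha>]
        by (simp add: distrib_left distrib_right add_increasing2 add_mono)
      also have "\<dots> \<le> ennreal (1 + \<alpha>) * ennreal \<epsilon>" using e by (intro mult_left_mono) auto
      also have "\<dots> = ennreal ((1 + \<alpha>) * \<epsilon>)" using \<alpha> \<epsilon> by (simp add: ennreal_mult)
      finally show "Qa \<alpha> (\<lambda>x. \<bar>e x\<bar>) \<le> ennreal ((1 + \<alpha>) * \<epsilon>)" .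
      show "AE x in \<nu>. ennreal (indicator G x) \<le> liminf (\<lambda>n. nnP (small_time n) (\<lambda>y. ennreal \<bar>e y\<bar>) x)"
      proof (rule AE_I2)
        fix x
        show "ennreal (indicator G x) \<le> liminf (\<lambda>n. nnP (small_time n) (\<lambda>y. ennreal \<bar>e y\<bar>) x)"
        proof (cases "x \<in> G")
          case True
          have "AE y in m. y \<in> G \<longrightarrow> ennreal 1 \<le> ennreal \<bar>e y\<bar>"
            using e(2) by eventually_elim (auto intro!: ennreal_leI simp del: ennreal_1)
          from liminf_nnP_open[OF G(1) True this] True show ?thesis by simp
        qed simp
      qed
    qed (use assms small_time_pos small_time_tendsto \<epsilon> in auto)
    also have "(\<integral>\<^sup>+x. ennreal (indicator G x powr (2 * p)) \<partial>\<nu>) = (\<integral>\<^sup>+x. indicator G x \<partial>\<nu>)"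
      by (intro nn_integral_cong) (auto split: split_indicator)
    also have "\<dots> = emeasure \<nu> G" using sets\<nu> by simp
    finally have "emeasure \<nu> G \<le> ennreal (\<Theta> * ((1 + \<alpha>) * \<epsilon>) powr p)" .
    then show ?thesis using emeasure_mono[of A G \<nu>] G sets\<nu> by (auto intro: order_trans)
  qed
  have lim: "((\<lambda>\<epsilon>. ennreal (\<Theta> * ((1 + \<alpha>) * \<epsilon>) powr p)) \<longlongrightarrow> ennreal (\<Theta> * 0)) (at_right 0)"
  proof (intro tendsto_ennrealI tendsto_mult_left)
    have "((\<lambda>\<epsilon>. (1 + \<alpha>) * \<epsilon>) \<longlongrightarrow> (1 + \<alpha>) * 0) (at_right 0)" by (intro tendsto_intros)
    then have "((\<lambda>\<epsilon>. (1 + \<alpha>) * \<epsilon>) \<longlongrightarrow> 0) (at_right 0)" by simp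
    then show "((\<lambda>\<epsilon>. ((1 + \<alpha>) * \<epsilon>) powr p) \<longlongrightarrow> 0) (at_right 0)"
      using p \<alpha> by (intro tendsto_zero_powrI[of _ _ "\<lambda>_. p" p]) (auto simp: eventually_at_right_field intro!: exI[of _ 1])
  qed
  have "emeasure \<nu> A \<le> ennreal (\<Theta> * 0)"
    by (rule tendsto_lowerbound[OF lim]) (use bd in \<open>auto simp: eventually_at_right_field intro!: exI[of _ 1]\<close>)
  then show "emeasure \<nu> A = 0" by simp
qed

end

section \<open>Fast approximation by the core\<close>

lemma powr_add_le:
  fixes a b q :: real assumes "0 \<le> a" "0 \<le> b" "0 \<le> q"
  shows "(a + b) powr q \<le> 2 powr q * (a powr q + b powr q)"
proof -
  have "(a + b) powr q \<le> (2 * max a b) powr q" using assms by (intro powr_mono2) auto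
  also have "\<dots> = 2 powr q * max a b powr q" by (simp add: powr_mult)
  also have "max a b powr q \<le> a powr q + b powr q" by (cases "a \<le> b") (auto simp: max_def)
  finally show ?thesis by simp
qed

lemma two_ennreal: "0 \<le> a \<Longrightarrow> 2 * ennreal a = ennreal (2 * a)"
  by (simp add: ennreal_mult)

text \<open>The q-th power of the norm, without the root and with values up to infinity: estimates
  then carry no integrability conditions, and a triangle inequality with the factor 2^q is
  sufficient.\<close>

definition qint :: "'a measure \<Rightarrow> real \<Rightarrow> ('a \<Rightarrow> real) \<Rightarrow> ennreal" where
  "qint \<nu> q u = (\<integral>\<^sup>+x. ennreal (\<bar>u x\<bar> powr q) \<partial>\<nu>)"

lemma qint_add:
  assumes [measurable]: "u \<in> borel_measurable \<nu>" "v \<in> borel_measurable \<nu>" and q: "q \<ge> 0"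
  shows "qint \<nu> q (\<lambda>x. u x + v x) \<le> ennreal (2 powr q) * (qint \<nu> q u + qint \<nu> q v)"
proof -
  have "qint \<nu> q (\<lambda>x. u x + v x) \<le> (\<integral>\<^sup>+x. ennreal (2 powr q) * (ennreal (\<bar>u x\<bar> powr q) + ennreal (\<bar>v x\<bar> powr q)) \<partial>\<nu>)"
    unfolding qint_def
  proof (rule nn_integral_mono)
    fix x
    have "\<bar>u x + v x\<bar> powr q \<le> (\<bar>u x\<bar> + \<bar>v x\<bar>) powr q" using q by (intro powr_mono2) auto
    also have "\<dots> \<le> 2 powr q * (\<bar>u x\<bar> powr q + \<bar>v x\<bar> powr q)" using q by (intro powr_add_le) auto
    finally show "ennreal (\<bar>u x + v x\<bar> powr q) \<le> ennreal (2 powr q) * (ennreal (\<bar>u x\<bar> powr q) + ennreal (\<bar>v x\<bar> powr q))"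
      by (simp add: ennreal_mult[symmetric] ennreal_plus[symmetric] ennreal_leI del: ennreal_plus)
  qed
  also have "\<dots> = ennreal (2 powr q) * (qint \<nu> q u + qint \<nu> q v)"
    unfolding qint_def by (simp add: nn_integral_cmult nn_integral_add)
  finally show ?thesis .
qed

lemma qint_minus: "qint \<nu> q (\<lambda>x. - u x) = qint \<nu> q u" by (simp add: qint_def)

lemma qint_diff:
  assumes [measurable]: "u \<in> borel_measurable \<nu>" "v \<in> borel_measurable \<nu>" and q: "q \<ge> 0"
  shows "qint \<nu> q (\<lambda>x. u x - v x) \<le> ennreal (2 powr q) * (qint \<nu> q u + qint \<nu> q v)"
  using qint_add[of u \<nu> "\<lambda>x. - v x" q] q by (simp add: qint_minus)

lemma qint_liminf:
  assumes [measurable]: "\<And>n. v n \<in> borel_measurable \<nu>" "u \<in> borel_measurable \<nu>" and q: "q > 0"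
    and ae: "AE x in \<nu>. (\<lambda>n. v n x) \<longlonglongrightarrow> u x"
  shows "qint \<nu> q u \<le> liminf (\<lambda>n. qint \<nu> q (v n))"
proof -
  have "qint \<nu> q u = (\<integral>\<^sup>+x. liminf (\<lambda>n. ennreal (\<bar>v n x\<bar> powr q)) \<partial>\<nu>)"
    unfolding qint_def
  proof (rule nn_integral_cong_AE)
    show "AE x in \<nu>. ennreal (\<bar>u x\<bar> powr q) = liminf (\<lambda>n. ennreal (\<bar>v n x\<bar> powr q))"
      using ae
    proof eventually_elim
      case (elim x)
      have "(\<lambda>n. \<bar>v n x\<bar> powr q) \<longlonglongrightarrow> \<bar>u x\<bar> powr q"
        using q by (intro tendsto_powr2 tendsto_rabs elim tendsto_const) auto
      then show ?case by (intro lim_imp_Liminf[symmetric] tendsto_ennrealI) auto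
    qed
  qed
  also have "\<dots> \<le> liminf (\<lambda>n. qint \<nu> q (v n))" unfolding qint_def by (rule nn_integral_liminf) measurable
  finally show ?thesis .
qed

text \<open>The Riesz-Fischer argument: along a fast subsequence the increments decay geometrically
  almost everywhere, and Fatou turns the pointwise limit into a limit in
  \<open>qint\<close>.\<close>

lemma qint_complete:
  fixes d :: "nat \<Rightarrow> 'a \<Rightarrow> real"
  assumes d [measurable]: "\<And>n. d n \<in> borel_measurable \<nu>" and q: "q > 0"
    and cauchy: "\<And>\<epsilon>. \<epsilon> > 0 \<Longrightarrow> \<exists>N. \<forall>i\<ge>N. \<forall>j\<ge>N. qint \<nu> q (\<lambda>x. d i x - d j x) \<le> ennreal \<epsilon>"
  obtains f where "f \<in> borel_measurable \<nu>" "\<And>\<epsilon>. \<epsilon> > 0 \<Longrightarrow> \<exists>N. \<forall>i\<ge>N. qint \<nu> q (\<lambda>x. d i x - f x) \<le> ennreal \<epsilon>"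
proof -
  \<comment> \<open>The second factor pays for the weight (2^n)^q put on the n-th increment below;
    the first makes the weighted series converge.\<close>
  define c where "c n = (1 / 2) ^ n * ((1 / 2) ^ n) powr q" for n :: nat
  have c: "c n > 0" for n by (simp add: c_def)
  have "\<forall>n. \<exists>N. \<forall>i\<ge>N. \<forall>j\<ge>N. qint \<nu> q (\<lambda>x. d i x - d j x) \<le> ennreal (c n)" using cauchy c by blast
  then obtain K where K: "\<And>n i j. i \<ge> K n \<Longrightarrow> j \<ge> K n \<Longrightarrow> qint \<nu> q (\<lambda>x. d i x - d j x) \<le> ennreal (c n)" by metis
  \<comment> \<open>Partial sums of K dominate K n and are monotone; the added n makes the indices
    tend to infinity.\<close>
  define s where "s n = (\<Sum>i\<le>n. K i) + n" for n
  have sK: "K n \<le> s n" for n unfolding s_def by (intro trans_le_add1 member_le_sum) auto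
  have smono: "s n \<le> s (Suc n)" for n unfolding s_def by simp
  define e where "e n x = d (s (Suc n)) x - d (s n) x" for n x
  have [measurable]: "e n \<in> borel_measurable \<nu>" for n unfolding e_def by measurable
  have eq: "qint \<nu> q (e n) \<le> ennreal (c n)" for n
    unfolding e_def[abs_def] using sK[of n] smono[of n] by (intro K) auto
  have "(\<integral>\<^sup>+x. (\<Sum>n. ennreal ((2 ^ n) powr q) * ennreal (\<bar>e n x\<bar> powr q)) \<partial>\<nu>) = (\<Sum>n. ennreal ((2 ^ n) powr q) * qint \<nu> q (e n))"
    unfolding qint_def by (subst nn_integral_suminf) (auto simp: nn_integral_cmult)
  also have "\<dots> \<le> (\<Sum>n. ennreal ((1 / 2) ^ n))"
  proof (rule suminf_le)
    fix n
    have "ennreal ((2 ^ n) powr q) * qint \<nu> q (e n) \<le> ennreal ((2 ^ n) powr q) * ennreal (c n)"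
      by (intro mult_left_mono eq) simp
    also have "\<dots> = ennreal ((2 ^ n) powr q * c n)" by (simp add: c_def ennreal_mult)
    also have "(2 ^ n) powr q * c n = (1 / 2) ^ n * ((2 ^ n) * (1 / 2) ^ n) powr q"
      by (simp add: c_def powr_mult)
    also have "\<dots> = (1 / 2) ^ n" by (simp add: power_mult_distrib[symmetric])
    finally show "ennreal ((2 ^ n) powr q) * qint \<nu> q (e n) \<le> ennreal ((1 / 2) ^ n)" .
  qed auto
  also have "\<dots> = ennreal 2" by (intro suminf_ennreal_eq) (use geometric_sums[of "1 / 2 :: real"] in auto)
  finally have "AE x in \<nu>. (\<Sum>n. ennreal ((2 ^ n) powr q) * ennreal (\<bar>e n x\<bar> powr q)) \<noteq> \<infinity>"
    by (intro nn_integral_PInf_AE) (auto simp: top_unique)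
  then have conv: "AE x in \<nu>. (\<lambda>n. d (s n) x) \<longlonglongrightarrow> lim (\<lambda>n. d (s n) x)"
  proof eventually_elim
    case (elim x)
    define r where "r = enn2real (\<Sum>n. ennreal ((2 ^ n) powr q) * ennreal (\<bar>e n x\<bar> powr q))"
    have r: "(\<Sum>n. ennreal ((2 ^ n) powr q) * ennreal (\<bar>e n x\<bar> powr q)) = ennreal r" "r \<ge> 0"
      using elim by (auto simp: r_def less_top)
    \<comment> \<open>After division by R the increments are at most 2^{-n}, as
      \<open>geometric_limit_bound\<close> requires; the summand 1 keeps R away from 0.\<close>
    define R where "R = r powr (1 / q) + 1"
    have R: "R \<ge> 1" by (simp add: R_def)
    have eR: "\<bar>e n x\<bar> \<le> R * (1 / 2) ^ n" for n
    proof -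
      have "ennreal ((2 ^ n) powr q) * ennreal (\<bar>e n x\<bar> powr q) \<le> ennreal r"
        unfolding r(1)[symmetric] by (rule ennreal_le_suminf)
      then have "(2 ^ n) powr q * \<bar>e n x\<bar> powr q \<le> r" using r(2) by (simp add: ennreal_mult[symmetric])
      then have "(2 ^ n * \<bar>e n x\<bar>) powr q \<le> r" by (simp add: powr_mult)
      then have "((2 ^ n * \<bar>e n x\<bar>) powr q) powr (1 / q) \<le> r powr (1 / q)" using q by (intro powr_mono2) auto
      then have "2 ^ n * \<bar>e n x\<bar> \<le> R" using q by (simp add: powr_powr R_def)
      then show ?thesis by (simp add: power_one_over field_simps)
    qed
    have "(\<lambda>n. d (s n) x / R) \<longlonglongrightarrow> lim (\<lambda>n. d (s n) x / R)"
    proof (rule geometric_limit_bound(1)[of 0])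
      fix n
      have "\<bar>d (s (Suc n)) x / R - d (s n) x / R\<bar> = \<bar>e n x\<bar> / R"
        using R by (simp add: e_def diff_divide_distrib[symmetric] abs_div)
      also have "\<dots> \<le> (1 / 2) ^ n" using eR[of n] R by (simp add: field_simps)
      finally show "\<bar>d (s (Suc n)) x / R - d (s n) x / R\<bar> \<le> (1 / 2) ^ n" .
    qed
    from tendsto_mult_left[OF this, of R] have "convergent (\<lambda>n. d (s n) x)"
      using R by (auto simp: convergent_def)
    then show ?case by (simp add: convergent_LIMSEQ_iff)
  qed
  define f where "f x = lim (\<lambda>n. d (s n) x)" for x
  have [measurable]: "f \<in> borel_measurable \<nu>" unfolding f_def[abs_def] by (rule borel_measurable_lim_metric) measurable
  show ?thesis
  proof (rule that[of f])
    fix \<epsilon> :: real assume \<epsilon>: "\<epsilon> > 0"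
    then obtain N where N: "\<And>i j. i \<ge> N \<Longrightarrow> j \<ge> N \<Longrightarrow> qint \<nu> q (\<lambda>x. d i x - d j x) \<le> ennreal \<epsilon>" using cauchy by blast
    show "\<exists>N. \<forall>i\<ge>N. qint \<nu> q (\<lambda>x. d i x - f x) \<le> ennreal \<epsilon>"
    proof (intro exI allI impI)
      fix i assume i: "i \<ge> N"
      have "qint \<nu> q (\<lambda>x. d i x - f x) \<le> liminf (\<lambda>n. qint \<nu> q (\<lambda>x. d i x - d (s (n + N)) x))"
      proof (rule qint_liminf[OF _ _ q])
        show "AE x in \<nu>. (\<lambda>n. d i x - d (s (n + N)) x) \<longlonglongrightarrow> d i x - f x"
          using conv
        proof eventually_elim
          case (elim x)
          then show ?case unfolding f_def by (intro tendsto_diff tendsto_const LIMSEQ_ignore_initial_segment[of "\<lambda>n. d (s n) x"])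
        qed
      qed measurable
      also have "\<dots> \<le> liminf (\<lambda>n. ennreal \<epsilon>)"
      proof (intro Liminf_mono always_eventually allI)
        fix n
        have "N \<le> s (n + N)" by (simp add: s_def)
        then show "qint \<nu> q (\<lambda>x. d i x - d (s (n + N)) x) \<le> ennreal \<epsilon>" by (intro N i)
      qed
      finally show "qint \<nu> q (\<lambda>x. d i x - f x) \<le> ennreal \<epsilon>" by (simp add: Liminf_const)
    qed
  qed measurable
qed

context dirichlet_kernel begin

text \<open>The rate 16^{-n} is the one demanded by \<open>quasi_continuous_limit\<close>. With
  \<alpha> = 0 the notion describes elements of the extended space, with \<alpha> = 1 those of
  F.\<close>

definition approximable :: "real \<Rightarrow> ('a \<Rightarrow> real) \<Rightarrow> (nat \<Rightarrow> 'a \<Rightarrow> real) \<Rightarrow> bool" where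
  "approximable \<alpha> u f \<longleftrightarrow> u \<in> borel_measurable borel \<and> (\<forall>n. f n \<in> D) \<and>
     (\<forall>n. Qa \<alpha> (\<lambda>x. f (Suc n) x - f n x) \<le> ennreal ((1 / 16) ^ n)) \<and> (AE x in m. (\<lambda>n. f n x) \<longlonglongrightarrow> u x)"

text \<open>The factor 4 survives the induction on i in spite of the doubling in
  \<open>Qa_add2\<close>, because 2 * 4 / 16 + 2 <= 4.\<close>

lemma approximable_Cauchy:
  assumes "approximable \<alpha> u f"
  shows "Qa \<alpha> (\<lambda>x. f (n + i) x - f n x) \<le> ennreal (4 * (1 / 16) ^ n)"
proof (induction i arbitrary: n)
  case 0
  show ?case by (simp add: Qa_zero)
next
  case (Suc i)
  have [measurable]: "f n \<in> borel_measurable borel" for n using assms by (auto simp: approximable_def intro: F_borel)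
  have "Qa \<alpha> (\<lambda>x. f (n + Suc i) x - f n x) = Qa \<alpha> (\<lambda>x. (f (Suc n + i) x - f (Suc n) x) + (f (Suc n) x - f n x))" by simp
  also have "\<dots> \<le> 2 * Qa \<alpha> (\<lambda>x. f (Suc n + i) x - f (Suc n) x) + 2 * Qa \<alpha> (\<lambda>x. f (Suc n) x - f n x)"
    by (rule Qa_add2) measurable
  also have "\<dots> \<le> 2 * ennreal (4 * (1 / 16) ^ Suc n) + 2 * ennreal ((1 / 16) ^ n)"
    using assms by (intro add_mono mult_left_mono Suc.IH) (auto simp: approximable_def)
  also have "\<dots> = ennreal (2 * (4 * (1 / 16) ^ Suc n) + 2 * (1 / 16) ^ n)"
  proof -
    have e1: "2 * ennreal (4 * (1 / 16) ^ Suc n) = ennreal (2 * (4 * (1 / 16) ^ Suc n))" by (rule two_ennreal) simp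
    have e2: "2 * ennreal ((1 / 16) ^ n) = ennreal (2 * (1 / 16) ^ n)" by (rule two_ennreal) simp
    show ?thesis unfolding e1 e2 by (rule ennreal_plus[symmetric]) simp_all
  qed
  also have "\<dots> \<le> ennreal (4 * (1 / 16) ^ n)" by (intro ennreal_leI) simp
  finally show ?case .
qed

lemma approximable_diff:
  assumes "approximable \<alpha> u f" shows "Qa \<alpha> (\<lambda>x. u x - f n x) \<le> ennreal (4 * (1 / 16) ^ n)"
proof -
  have [measurable]: "f n \<in> borel_measurable borel" for n using assms by (auto simp: approximable_def intro: F_borel)
  have [measurable]: "u \<in> borel_measurable borel" using assms by (simp add: approximable_def)
  have "Qa \<alpha> (\<lambda>x. u x - f n x) \<le> liminf (\<lambda>i. Qa \<alpha> (\<lambda>x. f (i + n) x - f n x))"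
  proof (rule Qa_liminf)
    have "AE x in m. (\<lambda>n. f n x) \<longlonglongrightarrow> u x" using assms by (simp add: approximable_def)
    then show "AE x in m. (\<lambda>i. f (i + n) x - f n x) \<longlonglongrightarrow> u x - f n x"
    proof eventually_elim
      case (elim x)
      then show ?case by (intro tendsto_diff tendsto_const LIMSEQ_ignore_initial_segment)
    qed
  qed measurable
  also have "\<dots> \<le> liminf (\<lambda>i. ennreal (4 * (1 / 16) ^ n))"
    using approximable_Cauchy[OF assms, of n] by (intro Liminf_mono always_eventually) (simp add: add.commute)
  finally show ?thesis by (simp add: Liminf_const)
qed

lemma approximable_quasi_continuous:
  assumes tr: "testable \<alpha>" and \<alpha>: "\<alpha> \<ge> 0" and ap: "approximable \<alpha> u f"
  obtains v A where "quasi_continuous_version m E F u v" "A \<in> sets borel" "capacity m E F A = 0"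
    "\<forall>x. x \<notin> A \<longrightarrow> (\<lambda>n. f n x) \<longlonglongrightarrow> v x"
proof -
  obtain v A where vA: "v \<in> borel_measurable borel" "quasi_continuous m E F v"
    "A \<in> sets borel" "capacity m E F A = 0" "\<And>x. x \<notin> A \<Longrightarrow> (\<lambda>n. f n x) \<longlonglongrightarrow> v x"
    by (rule quasi_continuous_limit[OF tr \<alpha>, of f]) (use ap in \<open>auto simp: approximable_def\<close>)
  have "A \<in> null_sets m" using capacity_zero_null[OF vA(3,4)] vA(3) by (auto simp: sets_m)
  then have "AE x in m. x \<notin> A" by (rule AE_not_in)
  moreover have "AE x in m. (\<lambda>n. f n x) \<longlonglongrightarrow> u x" using ap by (simp add: approximable_def)
  ultimately have "AE x in m. v x = u x"
    by eventually_elim (use vA(5) LIMSEQ_unique in blast)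
  then show ?thesis using that vA by (simp add: quasi_continuous_version_def)
qed

lemma smooth_AE:
  assumes "charges_no_null_capacity m E F \<nu>" "sets \<nu> = sets borel" "A \<in> sets borel" "capacity m E F A = 0"
  shows "AE x in \<nu>. x \<notin> A"
proof -
  have "A \<in> null_sets \<nu>" using assms by (auto simp: charges_no_null_capacity_def)
  then show ?thesis by (rule AE_not_in)
qed

lemma version_unique_AE:
  assumes \<nu>: "charges_no_null_capacity m E F \<nu>" "sets \<nu> = sets borel"
    and v: "quasi_continuous_version m E F u v" and w: "quasi_continuous_version m E F u w"
  shows "AE x in \<nu>. v x = w x"
proof -
  have [measurable]: "v \<in> borel_measurable borel" "w \<in> borel_measurable borel"
    using v w by (auto simp: quasi_continuous_version_def)
  have "AE x in m. v x = u x" "AE x in m. w x = u x" using v w by (auto simp: quasi_continuous_version_def)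
  then have "AE x in m. v x = w x" by eventually_elim simp
  then have "capacity m E F {x. v x \<noteq> w x} = 0"
    using v w by (intro quasi_continuous_unique) (auto simp: quasi_continuous_version_def)
  moreover have "{x. v x \<noteq> w x} \<in> sets borel" by measurable
  ultimately have "AE x in \<nu>. x \<notin> {x. v x \<noteq> w x}" using \<nu> by (intro smooth_AE)
  then show ?thesis by simp
qed

text \<open>Boundedness of the embedding in homogeneous form; for core functions no choice of a
  version is involved.\<close>

definition core_bounded :: "real \<Rightarrow> 'a measure \<Rightarrow> real \<Rightarrow> real \<Rightarrow> bool" where
  "core_bounded \<alpha> \<nu> p B \<longleftrightarrow> 0 \<le> B \<and> (\<forall>f\<in>D. \<forall>c\<ge>0. Qa \<alpha> f \<le> ennreal c \<longrightarrow> qint \<nu> (2 * p) f \<le> ennreal (B * c powr p))"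

text \<open>Compactness as the existence of Cauchy subsequences; the limit is supplied later by
  \<open>qint_complete\<close>.\<close>

definition core_compact :: "real \<Rightarrow> 'a measure \<Rightarrow> real \<Rightarrow> bool" where
  "core_compact \<alpha> \<nu> p \<longleftrightarrow> (\<forall>d C. (\<forall>n. d n \<in> D \<and> Qa \<alpha> (d n) \<le> ennreal C) \<longrightarrow>
     (\<exists>r::nat \<Rightarrow> nat. strict_mono r \<and>
        (\<forall>\<epsilon>>0. \<exists>N. \<forall>i\<ge>N. \<forall>j\<ge>N. qint \<nu> (2 * p) (\<lambda>x. d (r i) x - d (r j) x) \<le> ennreal \<epsilon>)))"

text \<open>Since \<nu> ignores sets of capacity zero, the core functions converge to w almost
  everywhere under \<nu>, and Fatou passes the bound for their differences to the limit.\<close>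

lemma approximation_in_Lp:
  assumes tr: "testable \<alpha>" and \<alpha>: "\<alpha> \<ge> 0" and ap: "approximable \<alpha> u f" and p: "p > 0"
    and \<nu>: "charges_no_null_capacity m E F \<nu>" and sets\<nu> [measurable_cong]: "sets \<nu> = sets borel" and B: "core_bounded \<alpha> \<nu> p B"
    and w: "quasi_continuous_version m E F u w"
  shows "qint \<nu> (2 * p) (\<lambda>x. w x - f n x) \<le> ennreal (B * (4 * (1 / 16) ^ n) powr p)"
proof -
  have fD: "f n \<in> D" for n using ap by (simp add: approximable_def)
  have [measurable]: "f n \<in> borel_measurable borel" for n using fD by (auto intro: F_borel)
  have [measurable]: "w \<in> borel_measurable borel" using w by (simp add: quasi_continuous_version_def)
  obtain v A where v: "quasi_continuous_version m E F u v" and A: "A \<in> sets borel" "capacity m E F A = 0"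
    "\<forall>x. x \<notin> A \<longrightarrow> (\<lambda>n. f n x) \<longlonglongrightarrow> v x"
    using approximable_quasi_continuous[OF tr \<alpha> ap] .
  have lim: "AE x in \<nu>. (\<lambda>n. f n x) \<longlonglongrightarrow> w x"
    using version_unique_AE[OF \<nu> sets\<nu> v w] smooth_AE[OF \<nu> sets\<nu> A(1,2)]
    by eventually_elim (use A(3) in force)
  have "qint \<nu> (2 * p) (\<lambda>x. w x - f n x) \<le> liminf (\<lambda>i. qint \<nu> (2 * p) (\<lambda>x. f (i + n) x - f n x))"
  proof (rule qint_liminf)
    show "AE x in \<nu>. (\<lambda>i. f (i + n) x - f n x) \<longlonglongrightarrow> w x - f n x"
      using lim
    proof eventually_elim
      case (elim x)
      then show ?case by (intro tendsto_diff tendsto_const LIMSEQ_ignore_initial_segment)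
    qed
  qed (use p in auto)
  also have "\<dots> \<le> liminf (\<lambda>i. ennreal (B * (4 * (1 / 16) ^ n) powr p))"
  proof (intro Liminf_mono always_eventually allI)
    fix i
    have "(\<lambda>x. f (i + n) x - f n x) \<in> D" by (intro D_diff fD)
    moreover have "Qa \<alpha> (\<lambda>x. f (i + n) x - f n x) \<le> ennreal (4 * (1 / 16) ^ n)"
      using approximable_Cauchy[OF ap, of n i] by (simp add: add.commute)
    ultimately show "qint \<nu> (2 * p) (\<lambda>x. f (i + n) x - f n x) \<le> ennreal (B * (4 * (1 / 16) ^ n) powr p)"
      using B by (auto simp: core_bounded_def)
  qed
  finally show ?thesis by (simp add: Liminf_const)
qed

lemma Lp_iff_qint:
  assumes sets\<nu>: "sets \<nu> = sets borel"
  shows "f \<in> Lp \<nu> q \<longleftrightarrow> f \<in> borel_measurable borel \<and> qint \<nu> q f < \<top>"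
proof -
  have "f \<in> borel_measurable \<nu> \<longleftrightarrow> f \<in> borel_measurable borel" using measurable_cong_sets[OF sets\<nu> refl] by auto
  moreover have "(\<lambda>x. \<bar>f x\<bar> powr q) \<in> borel_measurable \<nu>" if "f \<in> borel_measurable \<nu>" using that by measurable
  ultimately show ?thesis by (auto simp: Lp_def qint_def integrable_iff_bounded)
qed

lemma Lp_norm_tendsto_0:
  assumes meas [measurable]: "\<And>n. v n \<in> borel_measurable \<nu>" and q: "q > 0"
    and lim: "\<And>\<epsilon>. \<epsilon> > 0 \<Longrightarrow> eventually (\<lambda>n. qint \<nu> q (v n) \<le> ennreal \<epsilon>) sequentially"
  shows "(\<lambda>n. Lp_norm \<nu> q (v n)) \<longlonglongrightarrow> 0"
proof -
  have eq: "(\<integral>x. \<bar>v n x\<bar> powr q \<partial>\<nu>) = enn2real (qint \<nu> q (v n))" for n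
    unfolding qint_def by (rule integral_eq_nn_integral) auto
  have "(\<lambda>n. enn2real (qint \<nu> q (v n))) \<longlonglongrightarrow> 0"
  proof (rule order_tendstoI)
    fix a :: real assume "a < 0"
    then show "eventually (\<lambda>n. a < enn2real (qint \<nu> q (v n))) sequentially"
      by (intro always_eventually allI) (rule less_le_trans[OF _ enn2real_nonneg])
  next
    fix a :: real assume a: "0 < a"
    then have "eventually (\<lambda>n. qint \<nu> q (v n) \<le> ennreal (a / 2)) sequentially" by (intro lim) simp
    then show "eventually (\<lambda>n. enn2real (qint \<nu> q (v n)) < a) sequentially"
    proof eventually_elim
      case (elim n)
      have "enn2real (qint \<nu> q (v n)) \<le> a / 2" using elim a by (intro enn2real_leI) auto
      then show ?case using a by simp
    qed
  qed
  then show ?thesis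
    unfolding Lp_norm_def eq using q by (intro tendsto_zero_powrI[where b = "1 / q"]) auto
qed

text \<open>Transfer from the core: each version is within a vanishing error of a core function of
  comparable energy, so boundedness and compactness for core functions suffice.\<close>

lemma compact_embedding:
  assumes tr: "testable \<alpha>" and \<alpha>: "\<alpha> \<ge> 0" and p: "p \<ge> 1"
    and \<nu>: "charges_no_null_capacity m E F \<nu>" and sets\<nu> [measurable_cong]: "sets \<nu> = sets borel"
    and B: "core_bounded \<alpha> \<nu> p B" and compact: "core_compact \<alpha> \<nu> p"
    and H: "\<And>u. u \<in> H \<Longrightarrow> \<exists>f. approximable \<alpha> u f"
    and a: "\<And>u. u \<in> H \<Longrightarrow> a u u = enn2real (Qa \<alpha> u)"
  shows "compactly_embedded m E F H a \<nu> (2 * p)"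
  unfolding compactly_embedded_def
proof (intro conjI ballI allI impI)
  have q: "2 * p > 0" using p by simp
  have p0: "p > 0" using p by simp
  note mc = measurable_cong_sets[OF sets\<nu> refl]
  have core_fin: "qint \<nu> (2 * p) f < \<top>" if f: "f \<in> D" for f
  proof -
    obtain c where c: "Qa \<alpha> f = ennreal c" "c \<ge> 0" using F_Qa_finite[of f \<alpha>] f by (cases "Qa \<alpha> f") auto
    then have "qint \<nu> (2 * p) f \<le> ennreal (B * c powr p)" using B f by (auto simp: core_bounded_def)
    then show ?thesis by (rule le_less_trans) simp
  qed
  {
    fix u assume "u \<in> H"
    then obtain f where f: "approximable \<alpha> u f" using H by blast
    show "\<exists>v. quasi_continuous_version m E F u v" by (rule approximable_quasi_continuous[OF tr \<alpha> f]) blast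
    fix v w assume "quasi_continuous_version m E F u v \<and> quasi_continuous_version m E F u w"
    then show "AE x in \<nu>. v x = w x" using version_unique_AE[OF \<nu> sets\<nu>] by blast
  }
  {
    fix u v assume "u \<in> H" and v: "quasi_continuous_version m E F u v"
    then obtain f where f: "approximable \<alpha> u f" using H by blast
    have fD: "f 0 \<in> D" using f by (simp add: approximable_def)
    have [measurable]: "f 0 \<in> borel_measurable borel" using fD by (auto intro: F_borel)
    have vb [measurable]: "v \<in> borel_measurable borel" using v by (simp add: quasi_continuous_version_def)
    have "qint \<nu> (2 * p) v = qint \<nu> (2 * p) (\<lambda>x. (v x - f 0 x) + f 0 x)" by simp
    also have "\<dots> \<le> ennreal (2 powr (2 * p)) * (qint \<nu> (2 * p) (\<lambda>x. v x - f 0 x) + qint \<nu> (2 * p) (f 0))"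
      using q by (intro qint_add) (auto simp: mc)
    also have "\<dots> < \<top>"
      using approximation_in_Lp[OF tr \<alpha> f p0 \<nu> sets\<nu> B v, of 0] core_fin[OF fD]
      by (auto simp: ennreal_mult_less_top intro: le_less_trans)
    finally show "v \<in> Lp \<nu> (2 * p)" using vb by (simp add: Lp_iff_qint[OF sets\<nu>])
  }
  fix un vn :: "nat \<Rightarrow> 'a \<Rightarrow> real"
  assume A: "(\<forall>n. un n \<in> H \<and> quasi_continuous_version m E F (un n) (vn n)) \<and> (\<exists>C. \<forall>n. sqrt (a (un n) (un n)) \<le> C)"
  then have un: "\<And>n. un n \<in> H" and vn: "\<And>n. quasi_continuous_version m E F (un n) (vn n)" by blast+
  from A obtain C where C: "\<And>n. sqrt (a (un n) (un n)) \<le> C" by blast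
  have vb [measurable]: "vn n \<in> borel_measurable borel" for n using vn[of n] by (simp add: quasi_continuous_version_def)
  have "\<forall>n. \<exists>f. approximable \<alpha> (un n) f" using H un by blast
  then obtain f where "\<forall>n. approximable \<alpha> (un n) (f n)" by (rule choice[THEN exE])
  then have f: "approximable \<alpha> (un n) (f n)" for n by blast
  \<comment> \<open>The n-th approximation of the n-th function, so that the error vanishes along
    the sequence.\<close>
  define d where "d n = f n n" for n
  have dD: "d n \<in> D" for n unfolding d_def using f[of n] by (simp add: approximable_def)
  have db [measurable]: "d n \<in> borel_measurable borel" for n using dD by (auto intro: F_borel)
  have ub [measurable]: "un n \<in> borel_measurable borel" for n using f[of n] by (simp add: approximable_def)
  define \<beta> where "\<beta> n = B * (4 * (1 / 16) ^ n) powr p" for n :: nat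
  have close: "qint \<nu> (2 * p) (\<lambda>x. vn n x - d n x) \<le> ennreal (\<beta> n)" for n
    unfolding \<beta>_def d_def by (rule approximation_in_Lp[OF tr \<alpha> f p0 \<nu> sets\<nu> B vn])
  have Qd: "Qa \<alpha> (d n) \<le> ennreal (2 * C\<^sup>2 + 2 * 4)" for n
  proof -
    have small: "Qa \<alpha> (\<lambda>x. un n x - d n x) \<le> ennreal 4"
    proof -
      have "Qa \<alpha> (\<lambda>x. un n x - d n x) \<le> ennreal (4 * (1 / 16) ^ n)" unfolding d_def by (rule approximable_diff[OF f])
      also have "\<dots> \<le> ennreal 4" using power_le_one[of "1 / 16 :: real" n] by (intro ennreal_leI) simp
      finally show ?thesis .
    qed
    have "Qa \<alpha> (un n) = Qa \<alpha> (\<lambda>x. (un n x - d n x) + d n x)" by simp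
    also have "\<dots> \<le> 2 * Qa \<alpha> (\<lambda>x. un n x - d n x) + 2 * Qa \<alpha> (d n)" by (rule Qa_add2) measurable
    also have "\<dots> < \<top>"
      using small F_Qa_finite[of "d n" \<alpha>] dD[of n] by (auto simp: ennreal_mult_less_top intro: le_less_trans)
    finally have fin: "Qa \<alpha> (un n) < \<top>" .
    have "sqrt (enn2real (Qa \<alpha> (un n))) \<le> C" using C[of n] a[OF un[of n]] by simp
    then have "(sqrt (enn2real (Qa \<alpha> (un n))))\<^sup>2 \<le> C\<^sup>2" by (intro power_mono) auto
    then have "enn2real (Qa \<alpha> (un n)) \<le> C\<^sup>2" by simp
    then have Qu: "Qa \<alpha> (un n) \<le> ennreal (C\<^sup>2)" using fin by (metis ennreal_enn2real ennreal_leI)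
    have "Qa \<alpha> (d n) = Qa \<alpha> (\<lambda>x. un n x - (un n x - d n x))" by simp
    also have "\<dots> \<le> 2 * Qa \<alpha> (un n) + 2 * Qa \<alpha> (\<lambda>x. un n x - d n x)" by (rule Qa_diff2) measurable
    also have "\<dots> \<le> 2 * ennreal (C\<^sup>2) + 2 * ennreal 4" by (intro add_mono mult_left_mono Qu small) auto
    also have "\<dots> = ennreal (2 * C\<^sup>2 + 2 * 4)"
      using two_ennreal[of "C\<^sup>2"] two_ennreal[of 4] by (simp add: ennreal_plus)
    finally show ?thesis .
  qed
  have "\<exists>r::nat \<Rightarrow> nat. strict_mono r \<and>
      (\<forall>\<epsilon>>0. \<exists>N. \<forall>i\<ge>N. \<forall>j\<ge>N. qint \<nu> (2 * p) (\<lambda>x. d (r i) x - d (r j) x) \<le> ennreal \<epsilon>)"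
    by (rule compact[unfolded core_compact_def, rule_format, of d "2 * C\<^sup>2 + 2 * 4"]) (use dD Qd in blast)
  then obtain r :: "nat \<Rightarrow> nat" where r: "strict_mono r"
    "\<forall>\<epsilon>>0. \<exists>N. \<forall>i\<ge>N. \<forall>j\<ge>N. qint \<nu> (2 * p) (\<lambda>x. d (r i) x - d (r j) x) \<le> ennreal \<epsilon>"
    by (elim exE conjE)
  obtain g where g: "g \<in> borel_measurable \<nu>"
    and glim: "\<And>\<epsilon>. \<epsilon> > 0 \<Longrightarrow> \<exists>N. \<forall>i\<ge>N. qint \<nu> (2 * p) (\<lambda>x. d (r i) x - g x) \<le> ennreal \<epsilon>"
    by (rule qint_complete[of "\<lambda>i. d (r i)" \<nu> "2 * p"]) (use r(2) q db in \<open>auto simp: mc\<close>)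
  have gb [measurable]: "g \<in> borel_measurable borel" using g by (simp add: mc)
  obtain N where N: "qint \<nu> (2 * p) (\<lambda>x. d (r N) x - g x) \<le> ennreal 1" using glim[of 1] by auto
  have "qint \<nu> (2 * p) g = qint \<nu> (2 * p) (\<lambda>x. d (r N) x - (d (r N) x - g x))" by simp
  also have "\<dots> \<le> ennreal (2 powr (2 * p)) * (qint \<nu> (2 * p) (d (r N)) + qint \<nu> (2 * p) (\<lambda>x. d (r N) x - g x))"
    using q by (intro qint_diff) (auto simp: mc)
  also have "\<dots> < \<top>"
    using N core_fin[OF dD[of "r N"]] by (auto simp: ennreal_mult_less_top intro: le_less_trans)
  finally have gLp: "g \<in> Lp \<nu> (2 * p)" using gb by (simp add: Lp_iff_qint[OF sets\<nu>])
  have "\<beta> \<longlonglongrightarrow> B * 0"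
    unfolding \<beta>_def[abs_def]
  proof (intro tendsto_mult_left tendsto_zero_powrI)
    have "(\<lambda>n. 4 * (1 / 16 :: real) ^ n) \<longlonglongrightarrow> 4 * 0" by (intro tendsto_intros LIMSEQ_power_zero) simp
    then show "(\<lambda>n. 4 * (1 / 16 :: real) ^ n) \<longlonglongrightarrow> 0" by simp
  qed (use p in auto)
  then have "(\<lambda>n. \<beta> (r n)) \<longlonglongrightarrow> 0" using LIMSEQ_subseq_LIMSEQ[OF _ r(1)] by (fastforce simp: o_def)
  then have \<beta>r: "eventually (\<lambda>n. \<beta> (r n) < \<epsilon>) sequentially" if "\<epsilon> > 0" for \<epsilon> using that by (rule order_tendstoD(2))
  have "(\<lambda>n. Lp_norm \<nu> (2 * p) (\<lambda>x. vn (r n) x - g x)) \<longlonglongrightarrow> 0"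
  proof (rule Lp_norm_tendsto_0)
    fix \<epsilon> :: real assume \<epsilon>: "\<epsilon> > 0"
    define \<eta> where "\<eta> = \<epsilon> / (2 * 2 powr (2 * p))"
    have \<eta>: "\<eta> > 0" using \<epsilon> by (simp add: \<eta>_def)
    obtain N where N: "\<And>i. i \<ge> N \<Longrightarrow> qint \<nu> (2 * p) (\<lambda>x. d (r i) x - g x) \<le> ennreal \<eta>" using glim[OF \<eta>] by blast
    from \<beta>r[OF \<eta>] eventually_ge_at_top[of N]
    show "eventually (\<lambda>n. qint \<nu> (2 * p) (\<lambda>x. vn (r n) x - g x) \<le> ennreal \<epsilon>) sequentially"
    proof eventually_elim
      case (elim n)
      have "qint \<nu> (2 * p) (\<lambda>x. vn (r n) x - g x) = qint \<nu> (2 * p) (\<lambda>x. (vn (r n) x - d (r n) x) + (d (r n) x - g x))" by simp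
      also have "\<dots> \<le> ennreal (2 powr (2 * p)) * (qint \<nu> (2 * p) (\<lambda>x. vn (r n) x - d (r n) x) + qint \<nu> (2 * p) (\<lambda>x. d (r n) x - g x))"
        using q by (intro qint_add) (auto simp: mc)
      also have "\<dots> \<le> ennreal (2 powr (2 * p)) * (ennreal \<eta> + ennreal \<eta>)"
        using elim by (intro mult_left_mono add_mono N order_trans[OF close] ennreal_leI) auto
      also have "\<dots> = ennreal (2 powr (2 * p) * (\<eta> + \<eta>))"
      proof -
        have e: "ennreal \<eta> + ennreal \<eta> = ennreal (\<eta> + \<eta>)" using \<eta> by (intro ennreal_plus[symmetric]) auto
        show ?thesis unfolding e using \<eta> by (intro ennreal_mult[symmetric]) auto
      qed
      also have "2 powr (2 * p) * (\<eta> + \<eta>) = \<epsilon>" by (simp add: \<eta>_def field_simps)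
      finally show ?case .
    qed
  qed (use q in \<open>auto simp: mc\<close>)
  then show "\<exists>r f. strict_mono r \<and> f \<in> Lp \<nu> (2 * p) \<and> (\<lambda>n. Lp_norm \<nu> (2 * p) (\<lambda>x. vn (r n) x - f x)) \<longlonglongrightarrow> 0"
    using r(1) gLp by blast
qed

end

section \<open>Weak convergence of bounded sequences\<close>

lemma convergent_approx:
  fixes b :: "nat \<Rightarrow> real"
  assumes "\<And>\<epsilon>. \<epsilon> > 0 \<Longrightarrow> \<exists>c. convergent c \<and> (\<forall>n. \<bar>b n - c n\<bar> \<le> \<epsilon>)"
  shows "convergent b"
proof -
  have "Cauchy b"
  proof (rule CauchyI)
    fix e :: real assume e: "e > 0"
    obtain c where c: "convergent c" "\<And>n. \<bar>b n - c n\<bar> \<le> e / 4" using assms[of "e / 4"] e by auto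
    have "Cauchy c" using c(1) by (rule convergent_Cauchy)
    then obtain N where N: "\<And>i j. i \<ge> N \<Longrightarrow> j \<ge> N \<Longrightarrow> norm (c i - c j) < e / 4"
      using CauchyD[of c "e / 4"] e by auto
    have "norm (b i - b j) < e" if "i \<ge> N" "j \<ge> N" for i j
      using N[OF that] c(2)[of i] c(2)[of j] e unfolding real_norm_def by linarith
    then show "\<exists>N. \<forall>i\<ge>N. \<forall>j\<ge>N. norm (b i - b j) < e" by blast
  qed
  then show ?thesis by (rule Cauchy_convergent)
qed

lemma diagonal_convergent_subsequence:
  fixes f :: "nat \<Rightarrow> nat \<Rightarrow> real"
  assumes bd: "\<And>i. bounded (range (\<lambda>n. f n i))"
  shows "\<exists>r. strict_mono r \<and> (\<forall>i. convergent (\<lambda>n. f (r n) i))"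
proof -
  interpret subseqs "\<lambda>i s. convergent (\<lambda>n. f (s n) i)"
  proof
    fix i and s :: "nat \<Rightarrow> nat"
    have "bounded (range (\<lambda>n. f (s n) i))" by (rule bounded_subset[OF bd[of i]]) auto
    then obtain l r where "strict_mono r" "((\<lambda>n. f (s n) i) \<circ> r) \<longlonglongrightarrow> l"
      using bounded_imp_convergent_subsequence by blast
    then show "\<exists>r'. strict_mono r' \<and> convergent (\<lambda>n. f ((s \<circ> r') n) i)" by (auto simp: o_def convergent_def)
  qed
  have "convergent (\<lambda>n. f (diagseq n) i)" for i
  proof -
    have "convergent (\<lambda>n. f ((diagseq \<circ> (+) (Suc i)) n) i)"
    proof (rule diagseq_holds)
      fix r s :: "nat \<Rightarrow> nat" and n
      assume "strict_mono r" "convergent (\<lambda>m. f (s m) n)"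
      then show "convergent (\<lambda>m. f ((s \<circ> r) m) n)"
        using convergent_subseq_convergent[of "\<lambda>m. f (s m) n" r] by (simp add: o_def)
    qed
    then have "convergent (\<lambda>n. f (diagseq (n + Suc i)) i)" by (simp add: o_def add.commute)
    then show ?thesis by (subst (asm) convergent_ignore_initial_segment)
  qed
  then show ?thesis using subseq_diagseq by blast
qed

lemma countable_Int_stable_generator:
  "\<exists>W :: nat \<Rightarrow> 'a::second_countable_topology set. Int_stable (range W) \<and> UNIV \<in> range W \<and>
     sets borel = sigma_sets UNIV (range W)"
proof -
  obtain B :: "'a set set" where B: "countable B" "topological_basis B" using ex_countable_basis by auto
  define \<W> where "\<W> = Inter ` {F. finite F \<and> F \<subseteq> B}"
  have cnt: "countable \<W>" unfolding \<W>_def using B(1) by (intro countable_image countable_Collect_finite_subset)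
  \<comment> \<open>The intersection of the empty family is the whole space.\<close>
  have U: "UNIV \<in> \<W>" unfolding \<W>_def by (intro image_eqI[of _ _ "{}"]) auto
  have int: "Int_stable \<W>"
  proof (rule Int_stableI)
    fix a b assume "a \<in> \<W>" "b \<in> \<W>"
    then obtain F G where "a = \<Inter>F" "finite F" "F \<subseteq> B" "b = \<Inter>G" "finite G" "G \<subseteq> B" by (auto simp: \<W>_def)
    then show "a \<inter> b \<in> \<W>" unfolding \<W>_def by (intro image_eqI[of _ _ "F \<union> G"]) auto
  qed
  have op: "open W" if "W \<in> \<W>" for W
    using that topological_basis_open[OF B(2)] by (auto simp: \<W>_def intro!: open_Inter)
  have "sets (borel :: 'a measure) = sigma_sets UNIV \<W>"
  proof
    have "sets (borel :: 'a measure) = sigma_sets UNIV B"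
      by (subst borel_eq_countable_basis[OF B]) (simp add: sets_measure_of_conv)
    also have "\<dots> \<subseteq> sigma_sets UNIV \<W>"
    proof (rule sigma_sets_mono')
      show "B \<subseteq> \<W>" unfolding \<W>_def by (auto intro!: image_eqI[of _ _ "{_}"])
    qed
    finally show "sets (borel :: 'a measure) \<subseteq> sigma_sets UNIV \<W>" .
    show "sigma_sets UNIV \<W> \<subseteq> sets (borel :: 'a measure)"
    proof -
      have "\<W> \<subseteq> sets borel" using op by (auto intro: borel_open)
      from sets.sigma_sets_subset[OF this] show ?thesis by simp
    qed
  qed
  moreover obtain W :: "nat \<Rightarrow> 'a set" where "range W = \<W>"
    using cnt U by (metis empty_iff range_from_nat_into)
  ultimately show ?thesis using int U by (intro exI[of _ W]) auto
qed

text \<open>Sequential weak-star convergence in L-infinity of a finite measure, tested on countably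
  many sets: Dynkin's argument reaches all Borel sets, and the uniform bound L extends convergence
  to all integrable h.\<close>

lemma weak_convergence:
  fixes f :: "nat \<Rightarrow> 'a::second_countable_topology \<Rightarrow> real"
  assumes fin: "finite_measure N" and setsN [measurable_cong]: "sets N = sets borel"
    and W: "Int_stable (range W)" "UNIV \<in> range W" "sets (borel :: 'a measure) = sigma_sets UNIV (range W)"
    and f [measurable]: "\<And>n. f n \<in> borel_measurable borel" and L: "\<And>n x. \<bar>f n x\<bar> \<le> L"
    and conv: "\<And>i::nat. convergent (\<lambda>n. \<integral>x. indicator (W i) x * f n x \<partial>N)"
    and h: "integrable N h"
  shows "convergent (\<lambda>n. \<integral>x. f n x * h x \<partial>N)"
proof -
  interpret finite_measure N by (rule fin)
  have L0: "0 \<le> L" using L[of 0 undefined] by linarith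
  have spN: "space N = UNIV" using sets_eq_imp_space_eq[OF setsN] by simp
  have int1: "integrable N (\<lambda>x. indicator A x * f n x)" if "A \<in> sets borel" for A n
  proof (rule integrable_const_bound[of _ L])
    show "AE x in N. norm (indicator A x * f n x) \<le> L" using L[of n] L0 by (auto split: split_indicator)
    show "(\<lambda>x. indicator A x * f n x) \<in> borel_measurable N" using that by measurable
  qed
  have bd: "\<bar>\<integral>x. indicator A x * f n x \<partial>N\<bar> \<le> L * measure N A" if A: "A \<in> sets borel" for A n
  proof -
    have "\<bar>\<integral>x. indicator A x * f n x \<partial>N\<bar> \<le> (\<integral>x. \<bar>indicator A x * f n x\<bar> \<partial>N)" by (rule integral_abs_bound)
    also have "\<dots> \<le> (\<integral>x. L * indicator A x \<partial>N)"
    proof (rule integral_mono)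
      show "integrable N (\<lambda>x. \<bar>indicator A x * f n x\<bar>)" using int1[OF A] by (rule integrable_abs)
      show "integrable N (\<lambda>x. L * indicator A x)" using A setsN by (intro integrable_mult_right) (simp add: integrable_indicator_iff less_top[symmetric])
      show "\<bar>indicator A x * f n x\<bar> \<le> L * indicator A x" for x using L[of n x] by (auto split: split_indicator)
    qed
    also have "\<dots> = L * measure N A" using A setsN spN by simp
    finally show ?thesis .
  qed
  have WP: "range W \<subseteq> Pow UNIV" by simp
  have sets: "convergent (\<lambda>n. \<integral>x. indicator A x * f n x \<partial>N)" if A: "A \<in> sigma_sets UNIV (range W)" for A
    using W(1) WP A
  proof (induction rule: sigma_sets_induct_disjoint)
    case (basic A)
    then show ?case using conv by auto
  next
    case empty
    show ?case by (simp add: convergent_const)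
  next
    case (compl A)
    obtain i where i: "W i = UNIV" using W(2) by (metis imageE)
    have A: "A \<in> sets borel" using compl W(3) by simp
    have "(\<integral>x. indicator (UNIV - A) x * f n x \<partial>N) = (\<integral>x. indicator (W i) x * f n x \<partial>N) - (\<integral>x. indicator A x * f n x \<partial>N)" for n
    proof -
      have "(\<integral>x. indicator (UNIV - A) x * f n x \<partial>N) = (\<integral>x. indicator UNIV x * f n x - indicator A x * f n x \<partial>N)"
        by (intro Bochner_Integration.integral_cong) (auto split: split_indicator)
      also have "\<dots> = (\<integral>x. indicator UNIV x * f n x \<partial>N) - (\<integral>x. indicator A x * f n x \<partial>N)"
        by (intro Bochner_Integration.integral_diff int1 A) simp
      finally show ?thesis by (simp add: i)
    qed
    then show ?case using convergent_diff[OF conv[of i] compl(2)] by simp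
  next
    case (union A)
    have A: "A i \<in> sets borel" for i using union(2) W(3) by auto
    show ?case
    proof (rule convergent_approx)
      fix \<epsilon> :: real assume \<epsilon>: "\<epsilon> > 0"
      \<comment> \<open>The part of the disjoint union beyond its first k members. Its measure tends
        to 0, so finite sums approximate uniformly in n and \<open>convergent_approx\<close>
        applies.\<close>
      define T where "T k = (\<Union>i. A i) - (\<Union>i<k. A i)" for k :: nat
      have Tm: "T k \<in> sets borel" for k unfolding T_def using A by auto
      have "(\<lambda>k. measure N (T k)) \<longlonglongrightarrow> measure N (\<Inter>k. T k)"
        by (rule finite_Lim_measure_decseq) (use Tm setsN in \<open>auto simp: T_def decseq_def\<close>)
      moreover have "(\<Inter>k. T k) = {}" by (auto simp: T_def)
      ultimately have "(\<lambda>k. L * measure N (T k)) \<longlonglongrightarrow> L * 0" by (intro tendsto_mult_left) simp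
      then have "eventually (\<lambda>k. L * measure N (T k) < \<epsilon>) sequentially" using \<epsilon> by (intro order_tendstoD) auto
      then obtain k where k: "L * measure N (T k) < \<epsilon>" by (auto simp: eventually_sequentially)
      define c where "c n = (\<Sum>i<k. \<integral>x. indicator (A i) x * f n x \<partial>N)" for n
      have "convergent c" unfolding c_def[abs_def] using union(3) by (intro convergent_sum)
      moreover have "\<bar>(\<integral>x. indicator (\<Union>i. A i) x * f n x \<partial>N) - c n\<bar> \<le> \<epsilon>" for n
      proof -
        have ind: "indicator (\<Union>i. A i) x = (\<Sum>i<k. indicator (A i) x) + (indicator (T k) x :: real)" for x
        proof -
          have "(\<Sum>i<k. indicator (A i) x) = (indicator (\<Union>i<k. A i) x :: real)"
            using union(1) by (intro indicator_UN_disjoint[symmetric]) (auto simp: disjoint_family_on_def)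
          then show ?thesis by (auto simp: T_def split: split_indicator)
        qed
        have "(\<integral>x. indicator (\<Union>i. A i) x * f n x \<partial>N) =
           (\<integral>x. (\<Sum>i<k. indicator (A i) x * f n x) + indicator (T k) x * f n x \<partial>N)"
          unfolding ind by (simp add: distrib_right sum_distrib_right)
        also have "\<dots> = c n + (\<integral>x. indicator (T k) x * f n x \<partial>N)"
        proof -
          have s1: "integrable N (\<lambda>x. \<Sum>i<k. indicator (A i) x * f n x)" by (intro Bochner_Integration.integrable_sum int1 A)
          have s2: "(\<integral>x. (\<Sum>i<k. indicator (A i) x * f n x) \<partial>N) = c n"
            unfolding c_def by (intro Bochner_Integration.integral_sum int1 A)
          show ?thesis unfolding s2[symmetric] by (intro Bochner_Integration.integral_add s1 int1 Tm)
        qed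
        finally show ?thesis using bd[OF Tm, of k n] k by simp
      qed
      ultimately show "\<exists>c. convergent c \<and> (\<forall>n. \<bar>(\<integral>x. indicator (\<Union>i. A i) x * f n x \<partial>N) - c n\<bar> \<le> \<epsilon>)" by blast
    qed
  qed
  have intf: "integrable N (\<lambda>x. f n x * g x)" if g: "integrable N g" for g n
  proof (rule Bochner_Integration.integrable_bound)
    show "integrable N (\<lambda>x. L * g x)" using g by simp
    show "AE x in N. norm (f n x * g x) \<le> norm (L * g x)" using L[of n] L0 by (auto simp: abs_mult intro!: mult_right_mono)
    show "(\<lambda>x. f n x * g x) \<in> borel_measurable N" using borel_measurable_integrable[OF g] by measurable
  qed
  show ?thesis
    using h
  proof (induction rule: integrable_induct)
    case (base A c)
    have "convergent (\<lambda>n. c * (\<integral>x. indicator A x * f n x \<partial>N))"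
      using base W(3) setsN by (intro convergent_mult convergent_const sets) auto
    moreover have "c * (\<integral>x. indicator A x * f n x \<partial>N) = (\<integral>x. f n x * (indicator A x *\<^sub>R c) \<partial>N)" for n
    proof -
      have "(\<integral>x. f n x * (indicator A x *\<^sub>R c) \<partial>N) = (\<integral>x. c * (indicator A x * f n x) \<partial>N)"
        by (intro Bochner_Integration.integral_cong refl) (simp add: ac_simps)
      then show ?thesis by simp
    qed
    ultimately show ?case by simp
  next
    case (add g h)
    then show ?case
      using convergent_add[OF add.IH] intf by (simp add: distrib_left)
  next
    case (lim g s)
    show ?case
    proof (rule convergent_approx)
      fix \<epsilon> :: real assume \<epsilon>: "\<epsilon> > 0"
      have "(\<lambda>i. \<integral>x. \<bar>s i x - g x\<bar> \<partial>N) \<longlonglongrightarrow> (\<integral>x. 0 \<partial>N)"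
      proof (rule integral_dominated_convergence)
        show "integrable N (\<lambda>x. 3 * \<bar>g x\<bar>)" using lim by simp
        show "AE x in N. (\<lambda>i. \<bar>s i x - g x\<bar>) \<longlonglongrightarrow> 0"
        proof (rule AE_I2)
          fix x assume "x \<in> space N"
          then have "(\<lambda>i. s i x - g x) \<longlonglongrightarrow> g x - g x" by (intro tendsto_intros lim)
          then show "(\<lambda>i. \<bar>s i x - g x\<bar>) \<longlonglongrightarrow> 0" by (intro tendsto_rabs_zero) simp
        qed
        show "AE x in N. norm \<bar>s i x - g x\<bar> \<le> 3 * \<bar>g x\<bar>" for i
        proof (rule AE_I2)
          fix x assume "x \<in> space N"
          then have "norm (s i x) \<le> 2 * norm (g x)" by (rule lim)
          then show "norm \<bar>s i x - g x\<bar> \<le> 3 * \<bar>g x\<bar>" unfolding real_norm_def by linarith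
        qed
        show "(\<lambda>x. 0) \<in> borel_measurable N" by simp
        show "(\<lambda>x. \<bar>s i x - g x\<bar>) \<in> borel_measurable N" for i
          using borel_measurable_integrable[OF lim(1)[of i]] borel_measurable_integrable[OF lim(4)] by measurable
      qed
      then have "(\<lambda>i. L * (\<integral>x. \<bar>s i x - g x\<bar> \<partial>N)) \<longlonglongrightarrow> L * 0" by (intro tendsto_mult_left) simp
      then have "eventually (\<lambda>i. L * (\<integral>x. \<bar>s i x - g x\<bar> \<partial>N) < \<epsilon>) sequentially" using \<epsilon> by (intro order_tendstoD) auto
      then obtain i where i: "L * (\<integral>x. \<bar>s i x - g x\<bar> \<partial>N) < \<epsilon>" by (auto simp: eventually_sequentially)
      have "\<bar>(\<integral>x. f n x * g x \<partial>N) - (\<integral>x. f n x * s i x \<partial>N)\<bar> \<le> \<epsilon>" for n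
      proof -
        have "(\<integral>x. f n x * g x \<partial>N) - (\<integral>x. f n x * s i x \<partial>N) = (\<integral>x. f n x * (g x - s i x) \<partial>N)"
          using intf lim by (simp add: right_diff_distrib)
        also have "\<bar>\<dots>\<bar> \<le> (\<integral>x. \<bar>f n x * (g x - s i x)\<bar> \<partial>N)" by (rule integral_abs_bound)
        also have "\<dots> \<le> (\<integral>x. L * \<bar>s i x - g x\<bar> \<partial>N)"
        proof (rule integral_mono)
          show "integrable N (\<lambda>x. \<bar>f n x * (g x - s i x)\<bar>)" using lim by (intro integrable_abs intf) auto
          show "integrable N (\<lambda>x. L * \<bar>s i x - g x\<bar>)" using lim by simp
          show "\<bar>f n x * (g x - s i x)\<bar> \<le> L * \<bar>s i x - g x\<bar>" for x
            unfolding abs_mult abs_minus_commute[of "g x"] using L by (intro mult_right_mono) auto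
        qed
        also have "\<dots> = L * (\<integral>x. \<bar>s i x - g x\<bar> \<partial>N)" by simp
        finally show ?thesis using i by linarith
      qed
      then show "\<exists>c. convergent c \<and> (\<forall>n. \<bar>(\<integral>x. f n x * g x \<partial>N) - c n\<bar> \<le> \<epsilon>)"
        using lim.IH[of i] by blast
    qed
  qed
qed

context symmetric_kernel begin

text \<open>Under the finite measure with density \<rho>, the functions kr t x / \<rho> are
  integrable because \<open>kr t x\<close> is integrable under m. Countably many test integrals,
  chosen before the sequence, thus decide convergence of S_t at all t and x at once.\<close>

lemma pointwise_convergence_S:
  "\<exists>\<rho> W. integrable m \<rho> \<and> (\<forall>x. 0 < \<rho> x \<and> \<rho> x \<le> (1::real)) \<and> (\<forall>i::nat. W i \<in> sets borel) \<and>
    (\<forall>f L. (\<forall>n. f n \<in> borel_measurable borel) \<longrightarrow> (\<forall>n x. \<bar>f n x\<bar> \<le> L) \<longrightarrow>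
      (\<forall>i. convergent (\<lambda>n::nat. \<integral>x. \<rho> x * (indicator (W i) x * f n x) \<partial>m)) \<longrightarrow>
      (\<forall>t x. convergent (\<lambda>n. S t (f n) x)))"
proof -
  obtain \<rho> :: "'a \<Rightarrow> real" where \<rho> [measurable]: "\<rho> \<in> borel_measurable m" and pos: "\<And>x. \<rho> x > 0" "\<And>x. \<rho> x \<le> 1" and int: "integrable m \<rho>"
    using obtain_positive_integrable_function by blast
  obtain W :: "nat \<Rightarrow> 'a set" where W: "Int_stable (range W)" "UNIV \<in> range W" "sets borel = sigma_sets UNIV (range W)"
    using countable_Int_stable_generator by blast
  have Wm [measurable]: "W i \<in> sets borel" for i unfolding W(3) by (rule sigma_sets.Basic) simp
  define N where "N = density m (\<lambda>x. ennreal (\<rho> x))"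
  have setsN: "sets N = sets borel" by (simp add: N_def sets_m)
  have fin: "finite_measure N"
  proof (rule finite_measureI)
    have "emeasure N (space N) = (\<integral>\<^sup>+x. ennreal (\<rho> x) \<partial>m)"
      unfolding N_def by (simp add: emeasure_density space_density)
    also have "\<dots> = ennreal (\<integral>x. \<rho> x \<partial>m)" using int pos by (intro nn_integral_eq_integral) (auto intro: less_imp_le)
    finally show "emeasure N (space N) \<noteq> \<infinity>" by simp
  qed
  have intN: "(\<integral>x. g x \<partial>N) = (\<integral>x. \<rho> x * g x \<partial>m)" if "g \<in> borel_measurable borel" for g
    unfolding N_def using that pos by (subst integral_density) (auto intro: less_imp_le)
  have "convergent (\<lambda>n. S t (f n) x)"
    if f [measurable]: "\<forall>n. f n \<in> borel_measurable borel" and L: "\<forall>n x. \<bar>f n x\<bar> \<le> L"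
      and conv: "\<forall>i. convergent (\<lambda>n::nat. \<integral>x. \<rho> x * (indicator (W i) x * f n x) \<partial>m)" for f L t x
  proof -
    have fm [measurable]: "f n \<in> borel_measurable borel" for n using f by simp
    have \<rho>b [measurable]: "\<rho> \<in> borel_measurable borel" using \<rho> by simp
    have "integrable N (\<lambda>y. kr t x y / \<rho> y)"
    proof -
      have "kr t x \<in> borel_measurable m" by measurable
      moreover have "\<rho> y *\<^sub>R (kr t x y / \<rho> y) = kr t x y" for y using pos(1)[of y] by simp
      moreover have "integrable m (kr t x)"
      proof (rule integrableI_bounded)
        have "(\<integral>\<^sup>+y. ennreal (norm (kr t x y)) \<partial>m) = nnP t (\<lambda>_. 1) x" by (simp add: nnP_kr)
        also have "\<dots> \<le> 1" using k_sub[of t x] by (simp add: nnP_def)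
        finally show "(\<integral>\<^sup>+y. ennreal (norm (kr t x y)) \<partial>m) < \<infinity>" by (simp add: order.strict_trans1)
      qed simp
      ultimately show ?thesis
        unfolding N_def using pos by (subst integrable_density) (auto intro: less_imp_le)
    qed
    then have "convergent (\<lambda>n. \<integral>y. f n y * (kr t x y / \<rho> y) \<partial>N)"
      using L conv by (intro weak_convergence[OF fin setsN W]) (auto simp: intN)
    moreover have "(\<integral>y. f n y * (kr t x y / \<rho> y) \<partial>N) = S t (f n) x" for n
    proof -
      have "(\<integral>y. f n y * (kr t x y / \<rho> y) \<partial>N) = (\<integral>y. \<rho> y * (f n y * (kr t x y / \<rho> y)) \<partial>m)"
        by (rule intN) measurable
      also have "\<dots> = S t (f n) x"
        unfolding S_def
      proof (rule Bochner_Integration.integral_cong[OF refl])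
        fix y show "\<rho> y * (f n y * (kr t x y / \<rho> y)) = kr t x y * f n y" using pos(1)[of y] by simp
      qed
      finally show ?thesis .
    qed
    ultimately show ?thesis by simp
  qed
  then show ?thesis using int pos Wm by (intro exI[of _ \<rho>] exI[of _ W]) blast
qed

end

section \<open>Green-tight measures\<close>

abbreviation res :: "'a measure \<Rightarrow> 'a set \<Rightarrow> 'a measure" where "res \<nu> S \<equiv> density \<nu> (indicator S)"

lemma nn_integral_res:
  assumes [measurable]: "S \<in> sets \<nu>" "f \<in> borel_measurable \<nu>"
  shows "(\<integral>\<^sup>+x. f x \<partial>res \<nu> S) = (\<integral>\<^sup>+x\<in>S. f x \<partial>\<nu>)"
  by (subst nn_integral_density) (auto simp: mult.commute)

lemma qint_res:
  assumes [measurable]: "S \<in> sets \<nu>" "u \<in> borel_measurable \<nu>"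
  shows "qint (res \<nu> S) q u = (\<integral>\<^sup>+x\<in>S. ennreal (\<bar>u x\<bar> powr q) \<partial>\<nu>)"
  unfolding qint_def by (rule nn_integral_res) measurable

lemma qint_res_mono:
  assumes "S \<in> sets \<nu>" "T \<in> sets \<nu>" "u \<in> borel_measurable \<nu>" "v \<in> borel_measurable \<nu>"
    and "\<And>x. x \<in> S \<Longrightarrow> u x \<noteq> 0 \<Longrightarrow> x \<in> T \<and> \<bar>u x\<bar> \<le> \<bar>v x\<bar>" "q \<ge> 0"
  shows "qint (res \<nu> S) q u \<le> qint (res \<nu> T) q v"
  unfolding qint_res[OF assms(1,3)] qint_res[OF assms(2,4)]
proof (rule nn_integral_mono)
  fix x
  show "ennreal (\<bar>u x\<bar> powr q) * indicator S x \<le> ennreal (\<bar>v x\<bar> powr q) * indicator T x"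
  proof (cases "x \<in> S \<and> u x \<noteq> 0")
    case True
    then show ?thesis using assms(5)[of x] assms(6) by (auto intro!: ennreal_leI powr_mono2)
  qed (auto split: split_indicator)
qed

lemma qint_res_Un:
  assumes [measurable]: "S \<in> sets \<nu>" "T \<in> sets \<nu>" "u \<in> borel_measurable \<nu>"
  shows "qint (res \<nu> (S \<union> T)) q u \<le> qint (res \<nu> S) q u + qint (res \<nu> T) q u"
proof -
  have "qint (res \<nu> (S \<union> T)) q u \<le> (\<integral>\<^sup>+x. ennreal (\<bar>u x\<bar> powr q) * indicator S x + ennreal (\<bar>u x\<bar> powr q) * indicator T x \<partial>\<nu>)"
    unfolding qint_res[OF sets.Un[OF assms(1,2)] assms(3)]
    by (intro nn_integral_mono) (auto split: split_indicator)
  also have "\<dots> = qint (res \<nu> S) q u + qint (res \<nu> T) q u"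
    unfolding qint_res[OF assms(1,3)] qint_res[OF assms(2,3)] by (rule nn_integral_add) measurable
  finally show ?thesis .
qed

section \<open>Large atoms and pieces of small measure\<close>

lemma finite_borel: "finite A \<Longrightarrow> A \<in> sets borel" for A :: "'a::metric_space set"
  by (intro borel_closed finite_imp_closed)

lemma finite_large_atoms:
  assumes sets\<nu>: "sets \<nu> = sets (borel :: 'a::{metric_space, second_countable_topology} measure)"
    and K: "K \<in> sets borel" "emeasure \<nu> K < \<top>" and \<delta>: "\<delta> > (0::real)"
  shows "finite {a \<in> K. ennreal \<delta> \<le> emeasure \<nu> {a}}" (is "finite ?A")
proof (rule ccontr)
  assume inf: "infinite ?A"
  obtain \<kappa> where \<kappa>: "emeasure \<nu> K = ennreal \<kappa>" "\<kappa> \<ge> 0" using K(2) by (cases "emeasure \<nu> K") auto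
  obtain n :: nat where n: "\<kappa> / \<delta> < real n" using reals_Archimedean2 by blast
  obtain T where T: "finite T" "card T = n" "T \<subseteq> ?A" using infinite_arbitrarily_large[OF inf] by blast
  have "ennreal (real n * \<delta>) = (\<Sum>a\<in>T. ennreal \<delta>)"
    using T \<delta> by (simp add: ennreal_mult ennreal_of_nat_eq_real_of_nat)
  also have "\<dots> \<le> (\<Sum>a\<in>T. emeasure \<nu> {a})" using T(3) by (intro sum_mono) auto
  also have "\<dots> = emeasure \<nu> T" using T(1) sets\<nu> by (intro emeasure_eq_sum_singleton[symmetric]) auto
  also have "\<dots> \<le> emeasure \<nu> K" using T(3) K(1) sets\<nu> by (intro emeasure_mono) auto
  finally have "real n * \<delta> \<le> \<kappa>" using \<kappa> by simp
  then show False using n \<delta> by (simp add: field_simps)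
qed

text \<open>A point of mass below \<delta> has a ball whose trace on K has measure below \<delta>,
  by continuity from above. Lindeloef reduces to countably many such open sets, and what finitely
  many of them leave uncovered shrinks to the empty set.\<close>

lemma small_cover:
  fixes \<nu> :: "'a::{metric_space, second_countable_topology} measure"
  assumes sets\<nu>: "sets \<nu> = sets borel" and K: "K \<in> sets borel" "emeasure \<nu> K < \<top>" and \<delta>: "\<delta> > (0::real)"
  shows "\<exists>V n. (\<forall>i::nat. V i \<in> sets borel \<and> V i \<subseteq> K \<and> emeasure \<nu> (V i) < ennreal \<delta>) \<and>
    K \<subseteq> {a \<in> K. ennreal \<delta> \<le> emeasure \<nu> {a}} \<union> (\<Union>i<n. V i)"
proof -
  let ?A = "{a \<in> K. ennreal \<delta> \<le> emeasure \<nu> {a}}"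
  define \<U> where "\<U> = {U :: 'a set. open U \<and> emeasure \<nu> (U \<inter> K) < ennreal \<delta>}"
  obtain \<G> where \<G>: "\<G> \<subseteq> \<U>" "countable \<G>" "\<Union>\<G> = \<Union>\<U>"
    by (rule Lindelof[of \<U>]) (auto simp: \<U>_def)
  have empty: "{} \<in> \<U>" using \<delta> by (simp add: \<U>_def)
  define U where "U = from_nat_into (insert {} \<G>)"
  have U: "U i \<in> \<U>" for i
    using from_nat_into[of "insert {} \<G>" i] \<G>(1) empty by (auto simp: U_def)
  have rangeU: "range U = insert {} \<G>" unfolding U_def using \<G>(2) by (intro range_from_nat_into) auto
  have Um: "U i \<in> sets borel" for i using U[of i] by (auto simp: \<U>_def)
  have cover: "\<exists>i. x \<in> U i" if x: "x \<in> K" "x \<notin> ?A" for x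
  proof -
    have small: "emeasure \<nu> {x} < ennreal \<delta>" using x by (auto simp: not_le)
    let ?B = "\<lambda>n::nat. ball x (1 / real (Suc n)) \<inter> K"
    have "(\<lambda>n. emeasure \<nu> (?B n)) \<longlonglongrightarrow> emeasure \<nu> (\<Inter>n. ?B n)"
    proof (rule Lim_emeasure_decseq)
      show "range ?B \<subseteq> sets \<nu>" using K(1) unfolding sets\<nu> by (intro image_subsetI sets.Int[OF borel_open[OF open_ball] K(1)])
      show "decseq ?B"
      proof (rule decseq_SucI)
        fix n
        have "1 / real (Suc (Suc n)) \<le> 1 / real (Suc n)" by (simp add: frac_le)
        then show "?B (Suc n) \<subseteq> ?B n" by (intro Int_mono subset_ball) auto
      qed
      show "emeasure \<nu> (?B n) \<noteq> \<infinity>" for n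
        using emeasure_mono[of "?B n" K \<nu>] K sets\<nu> by (auto simp: top_unique)
    qed
    moreover have "(\<Inter>n. ?B n) = {x}"
    proof
      show "(\<Inter>n. ?B n) \<subseteq> {x}"
      proof
        fix y assume y: "y \<in> (\<Inter>n. ?B n)"
        show "y \<in> {x}"
        proof (rule ccontr)
          assume "y \<notin> {x}"
          then have "dist x y > 0" by simp
          then obtain n where "inverse (real (Suc n)) < dist x y" using reals_Archimedean by blast
          then show False using y by (auto simp: inverse_eq_divide dest!: spec[of _ n])
        qed
      qed
    qed (use x in auto)
    ultimately have "(\<lambda>n. emeasure \<nu> (?B n)) \<longlonglongrightarrow> emeasure \<nu> {x}" by (simp only:)
    then have "eventually (\<lambda>n. emeasure \<nu> (?B n) < ennreal \<delta>) sequentially" using small by (rule order_tendstoD)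
    then obtain n where "emeasure \<nu> (?B n) < ennreal \<delta>" by (auto simp: eventually_sequentially)
    then have "ball x (1 / real (Suc n)) \<in> \<U>" by (simp add: \<U>_def)
    then have "x \<in> \<Union>\<U>" by (intro UnionI[of "ball x (1 / real (Suc n))"]) auto
    then have "x \<in> \<Union>\<G>" using \<G>(3) by simp
    then have "x \<in> \<Union>(range U)" unfolding rangeU by auto
    then show ?thesis by auto
  qed
  have fA: "finite ?A" by (rule finite_large_atoms[OF sets\<nu> K \<delta>])
  then have Am: "?A \<in> sets borel" by (rule finite_borel)
  define T where "T n = K - ?A - (\<Union>i<n. U i)" for n :: nat
  have Tm: "T n \<in> sets borel" for n
    unfolding T_def using K(1) Am Um by (intro sets.Diff sets.finite_UN) auto
  have "(\<lambda>n. emeasure \<nu> (T n)) \<longlonglongrightarrow> emeasure \<nu> (\<Inter>n. T n)"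
  proof (rule Lim_emeasure_decseq)
    show "range T \<subseteq> sets \<nu>" using Tm sets\<nu> by auto
    show "decseq T" by (auto simp: decseq_def T_def)
    show "emeasure \<nu> (T n) \<noteq> \<infinity>" for n
    proof -
      have "T n \<subseteq> K" by (auto simp: T_def)
      then have "emeasure \<nu> (T n) \<le> emeasure \<nu> K" by (rule emeasure_mono) (simp add: sets\<nu> K(1))
      then show ?thesis using K(2) by (auto simp: top_unique)
    qed
  qed
  moreover have "(\<Inter>n. T n) = {}"
  proof -
    have "x \<notin> (\<Inter>n. T n)" for x
    proof
      assume x: "x \<in> (\<Inter>n. T n)"
      then have "x \<in> K" "x \<notin> ?A" by (auto simp: T_def)
      then obtain i where "x \<in> U i" using cover by blast
      then have "x \<notin> T (Suc i)" by (auto simp: T_def)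
      then show False using x by auto
    qed
    then show ?thesis by blast
  qed
  ultimately have "(\<lambda>n. emeasure \<nu> (T n)) \<longlonglongrightarrow> 0" by simp
  then have "eventually (\<lambda>n. emeasure \<nu> (T n) < ennreal \<delta>) sequentially" using \<delta> by (intro order_tendstoD) auto
  then obtain n where n: "emeasure \<nu> (T n) < ennreal \<delta>" by (auto simp: eventually_sequentially)
  \<comment> \<open>The uncovered remainder serves as the n-th piece, so Suc n pieces are
    counted.\<close>
  define V where "V i = (if i < n then U i \<inter> K else T n)" for i
  have "V i \<in> sets borel \<and> V i \<subseteq> K \<and> emeasure \<nu> (V i) < ennreal \<delta>" for i
    using U[of i] Um[of i] K(1) Tm[of n] n by (auto simp: V_def \<U>_def T_def)
  moreover have "K \<subseteq> ?A \<union> (\<Union>i<Suc n. V i)"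
  proof
    fix x assume x: "x \<in> K"
    show "x \<in> ?A \<union> (\<Union>i<Suc n. V i)"
    proof (cases "x \<in> ?A \<or> (\<exists>i<n. x \<in> U i)")
      case True
      then show ?thesis using x by (auto simp: V_def intro: less_SucI)
    next
      case False
      then have "x \<in> V n" using x by (auto simp: V_def T_def)
      then show ?thesis by blast
    qed
  qed
  ultimately show ?thesis by blast
qed

context dirichlet_kernel begin

definition pot :: "'a measure \<Rightarrow> real \<Rightarrow> real \<Rightarrow> 'a set \<Rightarrow> 'a \<Rightarrow> ennreal" where
  "pot \<nu> \<alpha> p Z x = (\<integral>\<^sup>+y\<in>Z. ennreal_powr (resolvent_kernel k \<alpha> x y) p \<partial>\<nu>)"

text \<open>Chen's integral condition with the resolvent of order \<alpha>: order 0 for the process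
  itself, order 1 for its 1-subprocess.\<close>

definition green_tight :: "real \<Rightarrow> 'a measure \<Rightarrow> real \<Rightarrow> bool" where
  "green_tight \<alpha> \<nu> p \<longleftrightarrow> (\<forall>\<epsilon>>0. \<exists>K\<in>sets borel. emeasure \<nu> K < \<top> \<and> (\<exists>\<delta>>0. \<forall>B\<in>sets borel.
        B \<subseteq> K \<and> emeasure \<nu> B < ennreal \<delta> \<longrightarrow> (SUP x. pot \<nu> \<alpha> p (- K \<union> B) x) < ennreal \<epsilon>))"

lemma res_sigma_finite:
  "sigma_finite_measure \<nu> \<Longrightarrow> Z \<in> sets \<nu> \<Longrightarrow> sigma_finite_measure (res \<nu> Z)"
  by (subst sigma_finite_measure.sigma_finite_iff_density_finite) (auto split: split_indicator)

lemma pot_res: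
  assumes [measurable_cong]: "sets \<nu> = sets borel" and [measurable]: "Z \<in> sets borel"
  shows "(\<integral>\<^sup>+y. ennreal_powr (resolvent_kernel k \<alpha> x y) p \<partial>res \<nu> Z) = pot \<nu> \<alpha> p Z x"
  unfolding pot_def by (rule nn_integral_res) measurable

lemma pot_mono: "Z \<subseteq> T \<Longrightarrow> pot \<nu> \<alpha> p Z x \<le> pot \<nu> \<alpha> p T x"
  unfolding pot_def by (intro nn_integral_mono) (auto split: split_indicator)

lemma pot_UN_le:
  assumes [measurable_cong]: "sets \<nu> = sets borel" and V: "\<And>i. V i \<in> sets borel"
  shows "pot \<nu> \<alpha> p (\<Union>i<n::nat. V i) x \<le> (\<Sum>i<n. pot \<nu> \<alpha> p (V i) x)"
proof (induction n)
  case 0 show ?case by (simp add: pot_def)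
next
  case (Suc n)
  have [measurable]: "(\<Union>i<n. V i) \<in> sets borel" "V n \<in> sets borel" using V by auto
  have "pot \<nu> \<alpha> p (\<Union>i<Suc n. V i) x \<le> (\<integral>\<^sup>+y. ennreal_powr (resolvent_kernel k \<alpha> x y) p * indicator (\<Union>i<n. V i) y +
      ennreal_powr (resolvent_kernel k \<alpha> x y) p * indicator (V n) y \<partial>\<nu>)"
    unfolding pot_def by (intro nn_integral_mono) (auto split: split_indicator simp: less_Suc_eq)
  also have "\<dots> = pot \<nu> \<alpha> p (\<Union>i<n. V i) x + pot \<nu> \<alpha> p (V n) x"
    unfolding pot_def by (rule nn_integral_add) measurable
  finally show ?case using Suc.IH by (simp add: add_right_mono order_trans)
qed

lemma restricted_bound:
  assumes sets\<nu>: "sets \<nu> = sets borel" and sf: "sigma_finite_measure \<nu>" and p: "p \<ge> 1" and \<Theta>: "\<Theta> > 0" and \<alpha>: "\<alpha> \<ge> 0"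
    and Z: "Z \<in> sets borel" and pot: "\<And>x. pot \<nu> \<alpha> p Z x \<le> ennreal \<Theta>"
    and f: "f \<in> D" and c: "Qa \<alpha> f \<le> ennreal c" "0 \<le> c"
  shows "qint (res \<nu> Z) (2 * p) f \<le> ennreal (\<Theta> * c powr p)"
  unfolding qint_def
proof (rule core_bound[OF _ _ p \<Theta> \<alpha> _ f c])
  show "sets (res \<nu> Z) = sets borel" by (simp add: sets\<nu>)
  show "sigma_finite_measure (res \<nu> Z)" using sf Z sets\<nu> by (intro res_sigma_finite) auto
  show "AE x in res \<nu> Z. (\<integral>\<^sup>+y. ennreal_powr (resolvent_kernel k \<alpha> x y) p \<partial>res \<nu> Z) \<le> ennreal \<Theta>"
    using pot by (simp add: pot_res[OF sets\<nu> Z])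
qed

text \<open>Only sets of measure below \<delta> have small potentials, so K is cut into its finitely
  many atoms of mass at least \<delta> and a part L covered by n such sets. On L the potentials are
  bounded but not small.\<close>

lemma green_tight_split:
  assumes sets\<nu>: "sets \<nu> = sets borel" and gt: "green_tight \<alpha> \<nu> p" and \<epsilon>: "\<epsilon> > (0::real)"
  shows "\<exists>K \<delta> A L \<Theta>. K \<in> sets borel \<and> emeasure \<nu> K < \<top> \<and> \<delta> > (0::real) \<and>
    (\<forall>B\<in>sets borel. B \<subseteq> K \<longrightarrow> emeasure \<nu> B < ennreal \<delta> \<longrightarrow> (\<forall>x. pot \<nu> \<alpha> p (- K \<union> B) x \<le> ennreal \<epsilon>)) \<and>
    finite A \<and> A \<subseteq> K \<and> (\<forall>a\<in>A. 0 < emeasure \<nu> {a}) \<and> L \<in> sets borel \<and> L \<subseteq> K \<and> K = A \<union> L \<and>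
    \<Theta> > (0::real) \<and> (\<forall>x. pot \<nu> \<alpha> p L x \<le> ennreal \<Theta>)"
proof -
  obtain K \<delta> where K: "K \<in> sets borel" "emeasure \<nu> K < \<top>" and \<delta>: "\<delta> > 0"
    and sup: "\<And>B. B \<in> sets borel \<Longrightarrow> B \<subseteq> K \<Longrightarrow> emeasure \<nu> B < ennreal \<delta> \<Longrightarrow> (SUP x. pot \<nu> \<alpha> p (- K \<union> B) x) < ennreal \<epsilon>"
    using gt[unfolded green_tight_def, rule_format, OF \<epsilon>] by blast
  have tail: "pot \<nu> \<alpha> p (- K \<union> B) x \<le> ennreal \<epsilon>" if "B \<in> sets borel" "B \<subseteq> K" "emeasure \<nu> B < ennreal \<delta>" for B x
    using less_imp_le[OF sup[OF that]] by (rule order_trans[OF SUP_upper[OF UNIV_I]])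
  define A where "A = {a \<in> K. ennreal \<delta> \<le> emeasure \<nu> {a}}"
  obtain V n where V: "\<And>i::nat. V i \<in> sets borel" "\<And>i. V i \<subseteq> K" "\<And>i. emeasure \<nu> (V i) < ennreal \<delta>"
    and cover: "K \<subseteq> A \<union> (\<Union>i<n. V i)"
    using small_cover[OF sets\<nu> K \<delta>] unfolding A_def by blast
  define L where "L = (\<Union>i<n. V i)"
  \<comment> \<open>Each of the n pieces contributes at most \<epsilon>; the additional 1 keeps the
    bound positive when n = 0.\<close>
  have potL: "pot \<nu> \<alpha> p L x \<le> ennreal (real n * \<epsilon> + 1)" for x
  proof -
    have "pot \<nu> \<alpha> p L x \<le> (\<Sum>i<n. pot \<nu> \<alpha> p (V i) x)" unfolding L_def by (rule pot_UN_le[OF sets\<nu> V(1)])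
    also have "\<dots> \<le> (\<Sum>i<n. ennreal \<epsilon>)"
      by (intro sum_mono order_trans[OF pot_mono tail[OF V(1,2,3)]]) auto
    also have "\<dots> = ennreal (real n * \<epsilon>)" using \<epsilon> by (simp add: ennreal_mult ennreal_of_nat_eq_real_of_nat)
    also have "\<dots> \<le> ennreal (real n * \<epsilon> + 1)" by (intro ennreal_leI) simp
    finally show ?thesis .
  qed
  have A: "finite A" "A \<subseteq> K" "\<forall>a\<in>A. 0 < emeasure \<nu> {a}"
    using finite_large_atoms[OF sets\<nu> K \<delta>] \<delta> by (auto simp: A_def intro: less_le_trans[of 0 "ennreal \<delta>"])
  have L: "L \<in> sets borel" "L \<subseteq> K" using V by (auto simp: L_def)
  with A(2) cover have KAL: "K = A \<union> L" by (auto simp: L_def)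
  have pos: "real n * \<epsilon> + 1 > 0" using \<epsilon> by (intro add_nonneg_pos) auto
  show ?thesis
    by (rule exI[of _ K], rule exI[of _ \<delta>], rule exI[of _ A], rule exI[of _ L], rule exI[of _ "real n * \<epsilon> + 1"])
      (intro conjI ballI impI allI K \<delta> tail A L KAL pos potL; assumption)
qed

lemma qint_finite_set:
  fixes \<nu> :: "'a measure"
  assumes sets\<nu> [measurable_cong]: "sets \<nu> = sets borel" and A: "finite A" and [measurable]: "u \<in> borel_measurable borel"
  shows "qint (res \<nu> A) q u = (\<Sum>a\<in>A. emeasure \<nu> {a} * ennreal (\<bar>u a\<bar> powr q))"
  using A
proof induction
  case empty
  show ?case by (subst qint_res) auto
next
  case (insert a A)
  have [measurable]: "A \<in> sets \<nu>" unfolding sets\<nu> by (rule finite_borel, rule insert(1))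
  have [measurable]: "{a} \<in> sets \<nu>" "insert a A \<in> sets \<nu>"
    unfolding sets\<nu> by (rule finite_borel, simp add: insert(1))+
  have "qint (res \<nu> (insert a A)) q u = (\<integral>\<^sup>+x. ennreal (\<bar>u a\<bar> powr q) * indicator {a} x + ennreal (\<bar>u x\<bar> powr q) * indicator A x \<partial>\<nu>)"
    using insert(2) by (subst qint_res) (auto intro!: nn_integral_cong split: split_indicator)
  also have "\<dots> = (\<integral>\<^sup>+x. ennreal (\<bar>u a\<bar> powr q) * indicator {a} x \<partial>\<nu>) + (\<integral>\<^sup>+x. ennreal (\<bar>u x\<bar> powr q) * indicator A x \<partial>\<nu>)"
    by (rule nn_integral_add) measurable
  also have "(\<integral>\<^sup>+x. ennreal (\<bar>u x\<bar> powr q) * indicator A x \<partial>\<nu>) = qint (res \<nu> A) q u"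
    by (subst qint_res) auto
  also have "(\<integral>\<^sup>+x. ennreal (\<bar>u a\<bar> powr q) * indicator {a} x \<partial>\<nu>) = emeasure \<nu> {a} * ennreal (\<bar>u a\<bar> powr q)"
    by (subst nn_integral_cmult_indicator) (auto simp: mult.commute)
  finally show ?case using insert by simp
qed

text \<open>A point charged by a smooth measure has positive capacity.\<close>

lemma atom_evaluation:
  assumes tr: "testable \<alpha>" and \<alpha>: "\<alpha> \<ge> 0" and ch: "charges_no_null_capacity m E F \<nu>" and a: "0 < emeasure \<nu> {a}"
  shows "\<exists>b\<ge>0. \<forall>f\<in>D. \<forall>c\<ge>0. Qa \<alpha> f \<le> ennreal c \<longrightarrow> (f a)\<^sup>2 \<le> b * c"
proof (rule point_evaluation_bounded[OF tr \<alpha>])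
  have "{a} \<in> sets borel" by simp
  then show "capacity m E F {a} \<noteq> 0" using ch a by (auto simp: charges_no_null_capacity_def)
qed

lemma green_tight_core_bounded:
  assumes tr: "testable \<alpha>" and \<alpha>: "\<alpha> \<ge> 0" and p: "p \<ge> 1" and ch: "charges_no_null_capacity m E F \<nu>"
    and sets\<nu> [measurable_cong]: "sets \<nu> = sets borel" and sf: "sigma_finite_measure \<nu>" and gt: "green_tight \<alpha> \<nu> p"
  shows "\<exists>B. core_bounded \<alpha> \<nu> p B"
proof -
  obtain K \<delta> A L \<Theta> where K: "K \<in> sets borel" "emeasure \<nu> K < \<top>" and \<delta>: "\<delta> > (0::real)"
    and tail: "\<And>B x. B \<in> sets borel \<Longrightarrow> B \<subseteq> K \<Longrightarrow> emeasure \<nu> B < ennreal \<delta> \<Longrightarrow> pot \<nu> \<alpha> p (- K \<union> B) x \<le> ennreal 1"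
    and A: "finite A" "A \<subseteq> K" "\<And>a. a \<in> A \<Longrightarrow> 0 < emeasure \<nu> {a}" and L: "L \<in> sets borel" "L \<subseteq> K" "K = A \<union> L"
    and \<Theta>: "\<Theta> > (0::real)" "\<And>x. pot \<nu> \<alpha> p L x \<le> ennreal \<Theta>"
    using green_tight_split[OF sets\<nu> gt zero_less_one] by metis
  have "\<forall>a\<in>A. \<exists>b\<ge>0. \<forall>f\<in>D. \<forall>c\<ge>0. Qa \<alpha> f \<le> ennreal c \<longrightarrow> (f a)\<^sup>2 \<le> b * c"
    using atom_evaluation[OF tr \<alpha> ch A(3)] by blast
  then obtain b where b: "\<And>a. a \<in> A \<Longrightarrow> 0 \<le> b a"
    "\<And>a f c. a \<in> A \<Longrightarrow> f \<in> D \<Longrightarrow> 0 \<le> c \<Longrightarrow> Qa \<alpha> f \<le> ennreal c \<Longrightarrow> (f a)\<^sup>2 \<le> b a * c"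
    by (metis (no_types, lifting))
  have mf: "emeasure \<nu> {a} = ennreal (measure \<nu> {a})" if "a \<in> A" for a
  proof -
    have "emeasure \<nu> {a} \<le> emeasure \<nu> K" using that A(2) K(1) sets\<nu> by (intro emeasure_mono) auto
    then show ?thesis using K(2) by (intro emeasure_eq_ennreal_measure) (auto simp: top_unique)
  qed
  \<comment> \<open>The three summands are the contributions of the complement of K, of L, and of
    the atoms.\<close>
  define B where "B = 1 + \<Theta> + (\<Sum>a\<in>A. measure \<nu> {a} * b a powr p)"
  have "core_bounded \<alpha> \<nu> p B"
    unfolding core_bounded_def
  proof (intro conjI ballI allI impI)
    show "0 \<le> B" unfolding B_def using \<Theta>(1) by (intro add_nonneg_nonneg sum_nonneg mult_nonneg_nonneg) auto
    fix f and c :: real assume f: "f \<in> D" and c: "0 \<le> c" "Qa \<alpha> f \<le> ennreal c"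
    have [measurable]: "f \<in> borel_measurable borel" using f by (auto intro: F_borel)
    have fA: "A \<in> sets borel" using A(1) by (rule finite_borel)
    have tailm: "- K \<in> sets borel" using K(1) by simp
    have U: "UNIV = (- K \<union> L) \<union> A" using L by auto
    have "qint \<nu> (2 * p) f = qint (res \<nu> ((- K \<union> L) \<union> A)) (2 * p) f"
      unfolding U[symmetric] by (subst qint_res) (auto simp: sets\<nu> qint_def)
    also have "\<dots> \<le> qint (res \<nu> (- K \<union> L)) (2 * p) f + qint (res \<nu> A) (2 * p) f"
      using tailm L fA by (intro qint_res_Un) (auto simp: sets\<nu>)
    also have "\<dots> \<le> (qint (res \<nu> (- K)) (2 * p) f + qint (res \<nu> L) (2 * p) f) + qint (res \<nu> A) (2 * p) f"
      using tailm L by (intro add_right_mono qint_res_Un) (auto simp: sets\<nu>)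
    also have "\<dots> \<le> (ennreal (1 * c powr p) + ennreal (\<Theta> * c powr p)) + ennreal ((\<Sum>a\<in>A. measure \<nu> {a} * b a powr p) * c powr p)"
    proof (intro add_mono)
      show "qint (res \<nu> (- K)) (2 * p) f \<le> ennreal (1 * c powr p)"
        using tail[of "{}"] \<delta> by (intro restricted_bound[OF sets\<nu> sf p _ \<alpha> tailm _ f c(2,1)]) auto
      show "qint (res \<nu> L) (2 * p) f \<le> ennreal (\<Theta> * c powr p)"
        by (intro restricted_bound[OF sets\<nu> sf p \<Theta>(1) \<alpha> L(1) \<Theta>(2) f c(2,1)])
      have "qint (res \<nu> A) (2 * p) f = (\<Sum>a\<in>A. emeasure \<nu> {a} * ennreal (\<bar>f a\<bar> powr (2 * p)))"
        by (rule qint_finite_set[OF sets\<nu> A(1)]) measurable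
      also have "\<dots> \<le> (\<Sum>a\<in>A. ennreal (measure \<nu> {a} * b a powr p * c powr p))"
      proof (rule sum_mono)
        fix a assume a: "a \<in> A"
        have "\<bar>f a\<bar> powr (2 * p) = ((f a)\<^sup>2) powr p"
          by (cases "f a = 0") (auto simp: powr_powr[symmetric] powr_numeral)
        also have "\<dots> \<le> (b a * c) powr p" using b(2)[OF a f c] p by (intro powr_mono2) auto
        also have "\<dots> = b a powr p * c powr p" by (simp add: powr_mult)
        finally show "emeasure \<nu> {a} * ennreal (\<bar>f a\<bar> powr (2 * p)) \<le> ennreal (measure \<nu> {a} * b a powr p * c powr p)"
          unfolding mf[OF a] by (simp add: ennreal_mult[symmetric] mult.assoc mult_left_mono ennreal_leI)
      qed
      also have "\<dots> = ennreal ((\<Sum>a\<in>A. measure \<nu> {a} * b a powr p) * c powr p)"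
        by (subst sum_ennreal) (auto simp: sum_distrib_right)
      finally show "qint (res \<nu> A) (2 * p) f \<le> ennreal ((\<Sum>a\<in>A. measure \<nu> {a} * b a powr p) * c powr p)" .
    qed
    also have "\<dots> = ennreal (B * c powr p)"
    proof -
      have nn: "0 \<le> (\<Sum>a\<in>A. measure \<nu> {a} * b a powr p) * c powr p"
        by (intro mult_nonneg_nonneg sum_nonneg) auto
      have "B * c powr p = (1 * c powr p + \<Theta> * c powr p) + (\<Sum>a\<in>A. measure \<nu> {a} * b a powr p) * c powr p"
        by (simp add: B_def distrib_right)
      then show ?thesis using \<Theta>(1) nn by (simp only: ennreal_plus mult_nonneg_nonneg add_nonneg_nonneg zero_le_one powr_ge_zero less_imp_le)
    qed
    finally show "qint \<nu> (2 * p) f \<le> ennreal (B * c powr p)" .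
  qed
  then show ?thesis ..
qed

end

lemma ennreal_powr_tendsto_0:
  assumes "a \<longlonglongrightarrow> (0::ennreal)" "p > 0" shows "(\<lambda>n. ennreal_powr (a n) p) \<longlonglongrightarrow> 0"
proof -
  have "(\<lambda>n. enn2real (a n)) \<longlonglongrightarrow> 0" using assms(1) by (intro tendsto_enn2real) simp_all
  then have "(\<lambda>n. enn2real (a n) powr p) \<longlonglongrightarrow> 0" using assms(2) by (intro tendsto_zero_powrI[where b = p]) auto
  then have "(\<lambda>n. ennreal (enn2real (a n) powr p)) \<longlonglongrightarrow> ennreal 0" by (rule tendsto_ennrealI)
  moreover have "eventually (\<lambda>n. a n < \<top>) sequentially" using assms(1) by (rule order_tendstoD) simp
  then have "eventually (\<lambda>n. ennreal (enn2real (a n) powr p) = ennreal_powr (a n) p) sequentially"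
    by eventually_elim (auto simp: ennreal_powr_def)
  ultimately show ?thesis by (simp add: filterlim_cong[OF refl refl] tendsto_cong)
qed

context dirichlet_kernel begin

lemma clamp_mono: "a \<le> b \<Longrightarrow> max (- L) (min L a) \<le> max (- L) (min L b)" for a b L :: real
  by (intro max.mono min.mono) auto

lemma clamp_rest_Lipschitz:
  "\<bar>(a - max (- L) (min L a)) - (b - max (- L) (min L b))\<bar> \<le> \<bar>a - b\<bar>" for a b L :: real
proof -
  have le: "\<bar>a - b - (c - d)\<bar> \<le> \<bar>a - b\<bar>" if "a \<le> b \<and> c \<le> d \<or> b \<le> a \<and> d \<le> c" "\<bar>c - d\<bar> \<le> \<bar>a - b\<bar>" for c d
    using that by linarith
  have "\<bar>a - b - (max (- L) (min L a) - max (- L) (min L b))\<bar> \<le> \<bar>a - b\<bar>"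
    by (rule le[OF _ clamp_Lipschitz]) (use clamp_mono[of a b L] clamp_mono[of b a L] in linarith)
  then show ?thesis by (simp add: algebra_simps)
qed

lemma resolvent_tendsto_0:
  assumes "resolvent_kernel k \<alpha> x y < \<top>"
  shows "(\<lambda>n. resolvent_kernel k (\<alpha> + real (Suc n)) x y) \<longlonglongrightarrow> 0"
proof -
  let ?f = "\<lambda>\<beta> t. ennreal (exp (- \<beta> * t)) * k t x y * indicator {0<..} t"
  have fin: "(\<integral>\<^sup>+t. ?f \<alpha> t \<partial>lborel) < \<infinity>" using assms by (simp add: resolvent_kernel_def)
  have "(\<lambda>n. \<integral>\<^sup>+t. ?f (\<alpha> + real (Suc n)) t \<partial>lborel) \<longlonglongrightarrow> (\<integral>\<^sup>+t. 0 \<partial>(lborel :: real measure))"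
  proof (rule nn_integral_dominated_convergence[where w = "?f \<alpha>"])
    show "AE t in lborel. ?f (\<alpha> + real (Suc n)) t \<le> ?f \<alpha> t" for n
    proof (rule AE_I2)
      fix t :: real
      have "exp (- (\<alpha> + real (Suc n)) * t) \<le> exp (- \<alpha> * t)" if "t > 0"
      proof -
        have "- (\<alpha> + real (Suc n)) * t \<le> - \<alpha> * t" using that by (intro mult_right_mono) auto
        then show ?thesis by simp
      qed
      then show "?f (\<alpha> + real (Suc n)) t \<le> ?f \<alpha> t"
        by (auto split: split_indicator intro!: mult_right_mono ennreal_leI)
    qed
    have "AE t in lborel. ?f \<alpha> t \<noteq> \<infinity>" using fin by (intro nn_integral_PInf_AE) auto
    then show "AE t in lborel. (\<lambda>n. ?f (\<alpha> + real (Suc n)) t) \<longlonglongrightarrow> 0"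
    proof eventually_elim
      case (elim t)
      show ?case
      proof (cases "t > 0")
        case True
        have "(\<lambda>n. exp (- t) ^ n) \<longlonglongrightarrow> 0" using True by (intro LIMSEQ_power_zero) auto
        then have "(\<lambda>n. exp (- t) ^ Suc n) \<longlonglongrightarrow> 0" by (rule LIMSEQ_Suc)
        then have "(\<lambda>n. ennreal (exp (- t) ^ Suc n)) \<longlonglongrightarrow> ennreal 0" by (rule tendsto_ennrealI)
        then have "(\<lambda>n. ennreal (exp (- t) ^ Suc n) * ?f \<alpha> t) \<longlonglongrightarrow> ennreal 0 * ?f \<alpha> t"
          using elim by (intro tendsto_mult_ennreal tendsto_const) (auto simp: less_top)
        moreover have "ennreal (exp (- t) ^ Suc n) * ?f \<alpha> t = ?f (\<alpha> + real (Suc n)) t" for n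
        proof -
          have "exp (- t) ^ Suc n = exp (- (real (Suc n) * t))" by (subst exp_of_nat_mult[symmetric]) simp
          then have "exp (- t) ^ Suc n * exp (- \<alpha> * t) = exp (- (\<alpha> + real (Suc n)) * t)"
            by (simp only: exp_add[symmetric]) (simp add: algebra_simps)
          then have "ennreal (exp (- t) ^ Suc n) * ennreal (exp (- \<alpha> * t)) = ennreal (exp (- (\<alpha> + real (Suc n)) * t))"
            by (subst ennreal_mult[symmetric]) auto
          then show ?thesis by (simp only: mult.assoc[symmetric])
        qed
        ultimately show ?thesis by simp
      qed simp
    qed
  qed (use fin in measurable)
  then show ?thesis by (simp add: resolvent_kernel_def)
qed

lemma pot_tendsto_0:
  assumes [measurable_cong]: "sets \<nu> = sets borel" and [measurable]: "Z \<in> sets borel" and p: "p > 0"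
    and fin: "pot \<nu> \<alpha> p Z x < \<top>"
  shows "(\<lambda>n. pot \<nu> (\<alpha> + real (Suc n)) p Z x) \<longlonglongrightarrow> 0"
proof -
  let ?f = "\<lambda>\<beta> y. ennreal_powr (resolvent_kernel k \<beta> x y) p * indicator Z y"
  have "(\<lambda>n. \<integral>\<^sup>+y. ?f (\<alpha> + real (Suc n)) y \<partial>\<nu>) \<longlonglongrightarrow> (\<integral>\<^sup>+y. 0 \<partial>\<nu>)"
  proof (rule nn_integral_dominated_convergence[where w = "?f \<alpha>"])
    show "(\<integral>\<^sup>+y. ?f \<alpha> y \<partial>\<nu>) < \<infinity>" using fin by (simp add: pot_def)
    show "AE y in \<nu>. ?f (\<alpha> + real (Suc n)) y \<le> ?f \<alpha> y" for n
      using p by (intro AE_I2 mult_right_mono ennreal_powr_mono resolvent_antimono) auto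
    have "AE y in \<nu>. ?f \<alpha> y \<noteq> \<infinity>" using fin by (intro nn_integral_PInf_AE) (auto simp: pot_def)
    then show "AE y in \<nu>. (\<lambda>n. ?f (\<alpha> + real (Suc n)) y) \<longlonglongrightarrow> 0"
    proof eventually_elim
      case (elim y)
      show ?case
      proof (cases "y \<in> Z")
        case True
        then have "resolvent_kernel k \<alpha> x y < \<top>" using elim by (auto simp: ennreal_powr_def less_top split: if_splits)
        then have "(\<lambda>n. ennreal_powr (resolvent_kernel k (\<alpha> + real (Suc n)) x y) p) \<longlonglongrightarrow> 0"
          using p by (intro ennreal_powr_tendsto_0 resolvent_tendsto_0)
        then show ?thesis using True by simp
      qed simp
    qed
  qed measurable
  then show ?thesis by (simp add: pot_def)
qed

lemma pot_meas [measurable]: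
  assumes sets\<nu> [measurable_cong]: "sets \<nu> = sets borel" and sf: "sigma_finite_measure \<nu>" and [measurable]: "Z \<in> sets borel"
  shows "pot \<nu> \<alpha> p Z \<in> borel_measurable borel"
proof -
  interpret \<nu>: sigma_finite_measure \<nu> by (rule sf)
  show ?thesis unfolding pot_def[abs_def] by measurable
qed

text \<open>An Egorov argument: the potentials decrease to 0 at every point as the order grows, so
  the exceptional sets decrease to the empty set inside L, which has finite measure.\<close>

lemma uniform_small_potential:
  assumes sets\<nu> [measurable_cong]: "sets \<nu> = sets borel" and sf: "sigma_finite_measure \<nu>" and L [measurable]: "L \<in> sets borel"
    and Lfin: "emeasure \<nu> L < \<top>" and p: "p > 0" and \<epsilon>: "\<epsilon> > (0::real)" and \<delta>: "\<delta> > (0::real)"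
    and fin: "\<And>x. pot \<nu> \<alpha> p L x < \<top>"
  shows "\<exists>n. emeasure \<nu> {x \<in> L. \<not> pot \<nu> (\<alpha> + real (Suc n)) p L x \<le> ennreal \<epsilon>} < ennreal \<delta>"
proof -
  define B where "B n = {x \<in> L. \<not> pot \<nu> (\<alpha> + real (Suc n)) p L x \<le> ennreal \<epsilon>}" for n
  note [measurable] = pot_meas[OF sets\<nu> sf L]
  have Bm: "B n \<in> sets borel" for n
  proof -
    have "{x \<in> space borel. \<not> pot \<nu> (\<alpha> + real (Suc n)) p L x \<le> ennreal \<epsilon>} \<in> sets borel" by measurable
    then have "L \<inter> {x \<in> space borel. \<not> pot \<nu> (\<alpha> + real (Suc n)) p L x \<le> ennreal \<epsilon>} \<in> sets borel" by (intro sets.Int L)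
    moreover have "L \<inter> {x \<in> space borel. \<not> pot \<nu> (\<alpha> + real (Suc n)) p L x \<le> ennreal \<epsilon>} = B n" by (auto simp: B_def)
    ultimately show ?thesis by (simp only:)
  qed
  have anti: "pot \<nu> (\<alpha> + real (Suc n')) p L x \<le> pot \<nu> (\<alpha> + real (Suc n)) p L x" if "n \<le> n'" for n n' x
    unfolding pot_def using that p
    by (intro nn_integral_mono mult_right_mono ennreal_powr_mono resolvent_antimono) auto
  have "(\<lambda>n. emeasure \<nu> (B n)) \<longlonglongrightarrow> emeasure \<nu> (\<Inter>n. B n)"
  proof (rule Lim_emeasure_decseq)
    show "range B \<subseteq> sets \<nu>" using Bm sets\<nu> by auto
    show "decseq B" unfolding decseq_def B_def using anti by (auto intro: order_trans)
    show "emeasure \<nu> (B n) \<noteq> \<infinity>" for n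
      using emeasure_mono[of "B n" L \<nu>] Lfin L sets\<nu> by (auto simp: top_unique B_def)
  qed
  moreover have "(\<Inter>n. B n) = {}"
  proof -
    have "x \<notin> (\<Inter>n. B n)" for x
    proof
      assume x: "x \<in> (\<Inter>n. B n)"
      have "eventually (\<lambda>n. pot \<nu> (\<alpha> + real (Suc n)) p L x < ennreal \<epsilon>) sequentially"
        using pot_tendsto_0[OF sets\<nu> L p fin] \<epsilon> by (intro order_tendstoD) auto
      then obtain n where "pot \<nu> (\<alpha> + real (Suc n)) p L x < ennreal \<epsilon>" by (auto simp: eventually_sequentially)
      then have "pot \<nu> (\<alpha> + real (Suc n)) p L x \<le> ennreal \<epsilon>" by (rule less_imp_le)
      then have "x \<notin> B n" by (simp only: B_def mem_Collect_eq not_not) blast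
      then show False using x by auto
    qed
    then show ?thesis by blast
  qed
  ultimately have "(\<lambda>n. emeasure \<nu> (B n)) \<longlonglongrightarrow> 0" by simp
  then have "eventually (\<lambda>n. emeasure \<nu> (B n) < ennreal \<delta>) sequentially" using \<delta> by (intro order_tendstoD) auto
  then show ?thesis by (auto simp: eventually_sequentially B_def)
qed

text \<open>The level is at least 1, so beyond it a q-th power with q >= 1 dominates the level
  itself; a Chebyshev estimate uses this.\<close>

definition trunc :: "nat \<Rightarrow> ('a \<Rightarrow> real) \<Rightarrow> 'a \<Rightarrow> real" where
  "trunc l u x = max (- real (Suc l)) (min (real (Suc l)) (u x))"

lemma trunc_D: "u \<in> D \<Longrightarrow> trunc l u \<in> D"
  unfolding trunc_def[abs_def] by (rule D_truncate) auto

lemma trunc_bound: "\<bar>trunc l u x\<bar> \<le> real (Suc l)"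
  by (auto simp: trunc_def abs_le_iff)

lemma Qa_trunc: assumes "u \<in> D" shows "Qa \<alpha> (trunc l u) \<le> Qa \<alpha> u"
proof (rule Qa_dominated1)
  show "u \<in> borel_measurable borel" using assms by (auto intro: F_borel)
  show "\<bar>trunc l u x - trunc l u y\<bar> \<le> \<bar>u x - u y\<bar>" for x y unfolding trunc_def by (rule clamp_Lipschitz)
  show "\<bar>trunc l u x\<bar> \<le> \<bar>u x\<bar>" for x unfolding trunc_def by (rule clamp_abs_le) simp
qed

lemma Qa_trunc_rest: assumes "u \<in> D" shows "Qa \<alpha> (\<lambda>x. u x - trunc l u x) \<le> Qa \<alpha> u"
proof (rule Qa_dominated1)
  show "u \<in> borel_measurable borel" using assms by (auto intro: F_borel)
  show "\<bar>(u x - trunc l u x) - (u y - trunc l u y)\<bar> \<le> \<bar>u x - u y\<bar>" for x y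
    unfolding trunc_def by (rule clamp_rest_Lipschitz)
  show "\<bar>u x - trunc l u x\<bar> \<le> \<bar>u x\<bar>" for x
    using clamp_rest_Lipschitz[of "u x" "real (Suc l)" 0] by (simp add: trunc_def)
qed

text \<open>All requirements amount to convergence of countably many bounded real sequences: the
  values at the points of At, and the test integrals of \<open>pointwise_convergence_S\<close> for
  every truncation level.\<close>

lemma weakly_convergent_subsequence:
  assumes dD: "\<And>n. d n \<in> D" and At: "countable At" and bd: "\<And>a. a \<in> At \<Longrightarrow> bounded (range (\<lambda>n. d n a))"
  shows "\<exists>r::nat \<Rightarrow> nat. strict_mono r \<and> (\<forall>a\<in>At. convergent (\<lambda>n. d (r n) a)) \<and>
    (\<forall>l t x. convergent (\<lambda>n. S t (trunc l (d (r n))) x))"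
proof -
  have db [measurable]: "d n \<in> borel_measurable borel" for n using dD[of n] by (auto intro: F_borel)
  define G where "G n i = (if from_nat_into At i \<in> At then d n (from_nat_into At i) else 0)" for n i
  have "bounded (range (\<lambda>n. G n i))" for i
    using bd[of "from_nat_into At i"] by (cases "from_nat_into At i \<in> At") (auto simp: G_def)
  then obtain r1 where r1: "strict_mono r1" "\<And>i. convergent (\<lambda>n. G (r1 n) i)"
    using diagonal_convergent_subsequence[of G] by blast
  obtain \<rho> :: "'a \<Rightarrow> real" and W :: "nat \<Rightarrow> 'a set" where \<rho>: "integrable m \<rho>" "\<forall>x. 0 < \<rho> x \<and> \<rho> x \<le> 1"
    and W: "\<forall>i. W i \<in> sets borel"
    and key: "\<forall>f L. (\<forall>n. f n \<in> borel_measurable borel) \<longrightarrow> (\<forall>n x. \<bar>f n x\<bar> \<le> L) \<longrightarrow>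
      (\<forall>i. convergent (\<lambda>n::nat. \<integral>x. \<rho> x * (indicator (W i) x * f n x) \<partial>m)) \<longrightarrow> (\<forall>t x. convergent (\<lambda>n. S t (f n) x))"
    using pointwise_convergence_S by (elim exE conjE)
  have [measurable]: "W i \<in> sets borel" for i using W by simp
  have tb [measurable]: "trunc l (d n) \<in> borel_measurable borel" for l n
    using trunc_D[OF dD] by (auto intro: F_borel)
  have \<rho>m [measurable]: "\<rho> \<in> borel_measurable m" using \<rho>(1) by simp
  \<comment> \<open>One natural number encodes the truncation level and the test set.\<close>
  define H where "H n i = (\<integral>x. \<rho> x * (indicator (W (snd (prod_decode i))) x * trunc (fst (prod_decode i)) (d (r1 n)) x) \<partial>m)" for n i
  have "bounded (range (\<lambda>n. H n i))" for i
  proof -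
    define l w where "l = fst (prod_decode i)" and "w = snd (prod_decode i)"
    have "\<bar>H n i\<bar> \<le> (\<integral>x. real (Suc l) * \<rho> x \<partial>m)" for n
    proof -
      have le: "norm (\<rho> x * (indicator (W w) x * trunc l (d (r1 n)) x)) \<le> real (Suc l) * \<rho> x" for x
      proof -
        have "\<bar>indicator (W w) x * trunc l (d (r1 n)) x\<bar> \<le> real (Suc l)"
          using trunc_bound[of l "d (r1 n)" x] by (auto split: split_indicator)
        then have "\<rho> x * \<bar>indicator (W w) x * trunc l (d (r1 n)) x\<bar> \<le> \<rho> x * real (Suc l)"
          using \<rho>(2) by (intro mult_left_mono) (auto intro: less_imp_le)
        then show ?thesis using \<rho>(2) by (simp add: abs_mult abs_of_pos mult.commute)
      qed
      have "norm (H n i) \<le> (\<integral>x. real (Suc l) * \<rho> x \<partial>m)"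
        unfolding H_def l_def[symmetric] w_def[symmetric]
      proof (rule order_trans[OF integral_norm_bound integral_mono])
        show i2: "integrable m (\<lambda>x. real (Suc l) * \<rho> x)" using \<rho>(1) by simp
        show "integrable m (\<lambda>x. norm (\<rho> x * (indicator (W w) x * trunc l (d (r1 n)) x)))"
        proof (rule integrable_norm, rule Bochner_Integration.integrable_bound[OF i2])
          show "AE x in m. norm (\<rho> x * (indicator (W w) x * trunc l (d (r1 n)) x)) \<le> norm (real (Suc l) * \<rho> x)"
            using le by (intro AE_I2) (metis abs_ge_self order_trans real_norm_def)
        qed measurable
      qed (use le in auto)
      then show ?thesis by simp
    qed
    then show ?thesis by (auto simp: bounded_iff)
  qed
  then obtain r2 where r2: "strict_mono r2" "\<And>i. convergent (\<lambda>n. H (r2 n) i)"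
    using diagonal_convergent_subsequence[of H] by blast
  define r where "r = r1 \<circ> r2"
  have r: "strict_mono r" unfolding r_def using r1(1) r2(1) by (rule strict_mono_o)
  have 1: "convergent (\<lambda>n. d (r n) a)" if a: "a \<in> At" for a
  proof -
    obtain i where i: "from_nat_into At i = a" using from_nat_into_surj[OF At a] by auto
    have "convergent ((\<lambda>n. G (r1 n) i) \<circ> r2)" using r1(2) r2(1) by (rule convergent_subseq_convergent)
    then show ?thesis using a by (simp add: G_def i r_def o_def)
  qed
  have 2: "convergent (\<lambda>n. S t (trunc l (d (r n))) x)" for l t x
  proof -
    have "convergent (\<lambda>n. \<integral>x. \<rho> x * (indicator (W i) x * trunc l (d (r n)) x) \<partial>m)" for i
      using r2(2)[of "prod_encode (l, i)"] by (simp add: H_def r_def)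
    then show ?thesis
      using key[rule_format, of "\<lambda>n. trunc l (d (r n))" "real (Suc l)" t x] trunc_bound tb by blast
  qed
  show ?thesis using r 1 2 by blast
qed

end

lemma qint_tendsto_0:
  fixes v :: "nat \<Rightarrow> 'a::{metric_space, second_countable_topology} \<Rightarrow> real"
  assumes sets\<kappa> [measurable_cong]: "sets \<kappa> = sets borel" and fin: "emeasure \<kappa> UNIV < \<top>" and q: "q > 0"
    and [measurable]: "\<And>n. v n \<in> borel_measurable borel" "s \<in> borel_measurable borel"
    and bd: "\<And>n x. \<bar>v n x\<bar> \<le> B" and lim: "\<And>x. (\<lambda>n. v n x) \<longlonglongrightarrow> s x"
  shows "(\<lambda>n. qint \<kappa> q (\<lambda>x. v n x - s x)) \<longlonglongrightarrow> 0"
proof -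
  have sB: "\<bar>s x\<bar> \<le> B" for x using tendsto_rabs[OF lim] bd by (intro LIMSEQ_le_const2[of "\<lambda>n. \<bar>v n x\<bar>"]) auto
  have sp: "space \<kappa> = UNIV" using sets_eq_imp_space_eq[OF sets\<kappa>] by simp
  have "(\<lambda>n. \<integral>\<^sup>+x. ennreal (\<bar>v n x - s x\<bar> powr q) \<partial>\<kappa>) \<longlonglongrightarrow> (\<integral>\<^sup>+x. 0 \<partial>\<kappa>)"
  proof (rule nn_integral_dominated_convergence[where w = "\<lambda>_. ennreal ((2 * B) powr q)"])
    show "(\<integral>\<^sup>+x. ennreal ((2 * B) powr q) \<partial>\<kappa>) < \<infinity>" using fin by (simp add: sp ennreal_mult_less_top)
    show "AE x in \<kappa>. ennreal (\<bar>v n x - s x\<bar> powr q) \<le> ennreal ((2 * B) powr q)" for n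
    proof (intro AE_I2 ennreal_leI powr_mono2)
      show "\<bar>v n x - s x\<bar> \<le> 2 * B" for x using bd[of n x] sB[of x] by linarith
    qed (use q in auto)
    show "AE x in \<kappa>. (\<lambda>n. ennreal (\<bar>v n x - s x\<bar> powr q)) \<longlonglongrightarrow> 0"
    proof (rule AE_I2)
      fix x
      have "(\<lambda>n. v n x - s x) \<longlonglongrightarrow> 0" using lim[of x] by (simp add: LIM_zero)
      then have "(\<lambda>n. \<bar>v n x - s x\<bar>) \<longlonglongrightarrow> 0" by (rule tendsto_rabs_zero)
      then have "(\<lambda>n. \<bar>v n x - s x\<bar> powr q) \<longlonglongrightarrow> 0" using q by (intro tendsto_zero_powrI[where b = q]) auto
      then show "(\<lambda>n. ennreal (\<bar>v n x - s x\<bar> powr q)) \<longlonglongrightarrow> 0" using tendsto_ennrealI by fastforce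
    qed
  qed measurable
  then show ?thesis by (simp add: qint_def)
qed

lemma qint_Cauchy:
  fixes v :: "nat \<Rightarrow> 'a::{metric_space, second_countable_topology} \<Rightarrow> real"
  assumes sets\<kappa> [measurable_cong]: "sets \<kappa> = sets borel" and q: "q > 0"
    and [measurable]: "\<And>n. v n \<in> borel_measurable borel" "s \<in> borel_measurable borel"
    and lim: "(\<lambda>n. qint \<kappa> q (\<lambda>x. v n x - s x)) \<longlonglongrightarrow> 0" and \<eta>: "\<eta> > (0::real)"
  shows "\<exists>N. \<forall>i\<ge>N. \<forall>j\<ge>N. qint \<kappa> q (\<lambda>x. v i x - v j x) \<le> ennreal \<eta>"
proof -
  define e where "e = \<eta> / (2 * 2 powr q)"
  have e: "e > 0" using \<eta> by (simp add: e_def)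
  have "eventually (\<lambda>n. qint \<kappa> q (\<lambda>x. v n x - s x) < ennreal e) sequentially"
    using lim by (rule order_tendstoD) (use e in simp)
  then obtain N where N: "\<And>n. n \<ge> N \<Longrightarrow> qint \<kappa> q (\<lambda>x. v n x - s x) \<le> ennreal e"
    by (auto simp: eventually_sequentially intro: less_imp_le)
  have "qint \<kappa> q (\<lambda>x. v i x - v j x) \<le> ennreal \<eta>" if "i \<ge> N" "j \<ge> N" for i j
  proof -
    have "qint \<kappa> q (\<lambda>x. v i x - v j x) = qint \<kappa> q (\<lambda>x. (v i x - s x) - (v j x - s x))" by simp
    also have "\<dots> \<le> ennreal (2 powr q) * (qint \<kappa> q (\<lambda>x. v i x - s x) + qint \<kappa> q (\<lambda>x. v j x - s x))"
      using q by (intro qint_diff) auto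
    also have "\<dots> \<le> ennreal (2 powr q) * (ennreal e + ennreal e)"
      using N that by (intro mult_left_mono add_mono) auto
    also have "\<dots> = ennreal (2 powr q * (e + e))"
      using e by (simp only: ennreal_plus ennreal_mult less_imp_le powr_ge_zero add_nonneg_nonneg)
    also have "2 powr q * (e + e) = \<eta>" by (simp add: e_def field_simps)
    finally show ?thesis .
  qed
  then show ?thesis by blast
qed

context dirichlet_kernel begin

text \<open>The space is split into - K \<union> B, the finite set A, and G = L - B. On the first,
  potentials are at most \<epsilon>; on A the values converge; on G each d n is close to W n, the
  smoothed truncation, and W n converges boundedly on a set of finite measure. All \<epsilon>-terms
  are uniform in n, while \<eta> is reached by large indices.\<close>

lemma green_tight_part:
  fixes \<nu> :: "'a measure"
  assumes sets\<nu> [measurable_cong]: "sets \<nu> = sets borel" and sf: "sigma_finite_measure \<nu>" and p: "p \<ge> 1" and \<alpha>: "\<alpha> \<ge> 0"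
    and K: "K \<in> sets borel" "emeasure \<nu> K < \<top>" and \<delta>: "\<delta> > (0::real)" and \<epsilon>: "\<epsilon> > (0::real)"
    and tail: "\<And>B x. B \<in> sets borel \<Longrightarrow> B \<subseteq> K \<Longrightarrow> emeasure \<nu> B < ennreal \<delta> \<Longrightarrow> pot \<nu> \<alpha> p (- K \<union> B) x \<le> ennreal \<epsilon>"
    and A: "finite A" "A \<subseteq> K" and L: "L \<in> sets borel" "L \<subseteq> K" "K = A \<union> L"
    and \<Theta>: "\<Theta> > (0::real)" "\<And>x. pot \<nu> \<alpha> p L x \<le> ennreal \<Theta>"
    and d: "\<And>n. d n \<in> D" "\<And>n. Qa \<alpha> (d n) \<le> ennreal C" and C: "C \<ge> 0"
    and conv1: "\<And>a. a \<in> A \<Longrightarrow> convergent (\<lambda>n. d n a)"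
    and conv2: "\<And>l t x. convergent (\<lambda>n. S t (trunc l (d n)) x)" and \<eta>: "\<eta> > 0"
  shows "\<exists>N. \<forall>i\<ge>N. \<forall>j\<ge>N. qint \<nu> (2 * p) (\<lambda>x. d i x - d j x) \<le>
    ennreal (\<epsilon> * ((4 * C) powr p + 2 * (2 powr (2 * p)) ^ 3 * (C powr p + (5 * C) powr p)) + \<eta>)"
proof -
  have [measurable]: "d n \<in> borel_measurable borel" for n using d(1)[of n] by (auto intro: F_borel)
  define q where "q = 2 * p"
  have q: "q > 0" "q \<ge> 1" using p by (auto simp: q_def)
  have p0: "p > 0" using p by simp
  note mc = measurable_cong_sets[OF sets\<nu> refl]
  have Lfin: "emeasure \<nu> L < \<top>" using emeasure_mono[of L K \<nu>] K L sets\<nu> by (auto simp: le_less_trans)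
  have potfin: "pot \<nu> \<alpha> p L x < \<top>" for x using \<Theta>(2)[of x] by (auto simp: le_less_trans)
  obtain n0 where n0: "emeasure \<nu> {x \<in> L. \<not> pot \<nu> (\<alpha> + real (Suc n0)) p L x \<le> ennreal \<epsilon>} < ennreal \<delta>"
    using uniform_small_potential[OF sets\<nu> sf L(1) Lfin p0 \<epsilon> \<delta> potfin] by blast
  define \<beta> where "\<beta> = \<alpha> + real (Suc n0)"
  have \<beta>: "\<beta> > 0" using \<alpha> unfolding \<beta>_def by linarith
  \<comment> \<open>The points of L at which the potential of order \<beta> is still large; by the
    choice of n0 this set has measure below \<delta> and is treated together with the complement of
    K.\<close>
  define B where "B = {x \<in> L. \<not> pot \<nu> \<beta> p L x \<le> ennreal \<epsilon>}"
  have \<nu>B: "emeasure \<nu> B < ennreal \<delta>" using n0 by (simp only: B_def \<beta>_def)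
  have Bm [measurable]: "B \<in> sets borel"
  proof -
    note [measurable] = pot_meas[OF sets\<nu> sf L(1)]
    have "{x \<in> space borel. \<not> pot \<nu> \<beta> p L x \<le> ennreal \<epsilon>} \<in> sets borel" by measurable
    then have "L \<inter> {x \<in> space borel. \<not> pot \<nu> \<beta> p L x \<le> ennreal \<epsilon>} \<in> sets borel" by (intro sets.Int L)
    moreover have "L \<inter> {x \<in> space borel. \<not> pot \<nu> \<beta> p L x \<le> ennreal \<epsilon>} = B" by (auto simp: B_def)
    ultimately show ?thesis by (simp only:)
  qed
  have BK: "B \<subseteq> K" using L(2) by (auto simp: B_def)
  define G where "G = L - B"
  have Gm [measurable]: "G \<in> sets borel" using L(1) Bm unfolding G_def by (rule sets.Diff)
  have GL: "G \<subseteq> L" by (auto simp: G_def)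
  have Am [measurable]: "A \<in> sets borel" using A(1) by (rule finite_borel)
  have KBm [measurable]: "- K \<union> B \<in> sets borel" using K(1) Bm by auto
  define \<kappa> where "\<kappa> = res \<nu> G"
  have sets\<kappa> [measurable_cong]: "sets \<kappa> = sets borel" by (simp add: \<kappa>_def sets\<nu>)
  have sf\<kappa>: "sigma_finite_measure \<kappa>" unfolding \<kappa>_def using sf Gm sets\<nu> by (intro res_sigma_finite) auto
  have \<kappa>fin: "emeasure \<kappa> UNIV < \<top>"
  proof -
    have "emeasure \<kappa> UNIV = (\<integral>\<^sup>+x. indicator G x \<partial>\<nu>)" unfolding \<kappa>_def by (subst emeasure_density) auto
    also have "\<dots> = emeasure \<nu> G" using Gm sets\<nu> by (intro nn_integral_indicator) auto
    also have "\<dots> \<le> emeasure \<nu> L" using GL L(1) sets\<nu> by (intro emeasure_mono) auto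
    finally show ?thesis using Lfin by (rule le_less_trans)
  qed
  have pot\<kappa>: "AE x in \<kappa>. (\<integral>\<^sup>+y. ennreal_powr (resolvent_kernel k \<beta> x y) p \<partial>\<kappa>) \<le> ennreal \<epsilon>"
  proof -
    have "AE x in \<kappa>. x \<in> G" unfolding \<kappa>_def by (subst AE_density) (auto simp: sets\<nu> split: split_indicator)
    then show ?thesis
    proof eventually_elim
      case (elim x)
      then have "pot \<nu> \<beta> p L x \<le> ennreal \<epsilon>" by (auto simp: G_def B_def)
      then show ?case unfolding \<kappa>_def pot_res[OF sets\<nu> Gm] using pot_mono[OF GL] by (rule order_trans[rotated])
    qed
  qed
  \<comment> \<open>By Chebyshev and the bound on L, the set V n where |d n| exceeds the level has
    measure at most \<Theta> C^p / Suc l, hence below \<delta>, uniformly in n.\<close>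
  obtain l :: nat where "\<Theta> * C powr p / \<delta> < real l" using reals_Archimedean2 by blast
  then have l: "\<Theta> * C powr p < real (Suc l) * \<delta>" using \<delta> by (simp add: field_simps)
  define V where "V n = {x \<in> L. real (Suc l) < \<bar>d n x\<bar>}" for n
  have Vm [measurable]: "V n \<in> sets borel" for n
  proof -
    have "V n = L \<inter> {x \<in> space borel. real (Suc l) < \<bar>d n x\<bar>}" by (auto simp: V_def)
    also have "\<dots> \<in> sets borel" by (intro sets.Int L(1)) measurable
    finally show ?thesis .
  qed
  have \<nu>V: "emeasure \<nu> (V n) < ennreal \<delta>" for n
  proof (rule ccontr)
    assume "\<not> emeasure \<nu> (V n) < ennreal \<delta>"
    then have "ennreal (real (Suc l) * \<delta>) \<le> ennreal (real (Suc l)) * emeasure \<nu> (V n)"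
      using \<delta> by (subst ennreal_mult) (auto intro!: mult_left_mono simp: not_less)
    also have "\<dots> = (\<integral>\<^sup>+x. ennreal (real (Suc l)) * indicator (V n) x \<partial>\<nu>)"
      using Vm by (intro nn_integral_cmult_indicator[symmetric]) (simp add: sets\<nu>)
    also have "\<dots> \<le> (\<integral>\<^sup>+x\<in>L. ennreal (\<bar>d n x\<bar> powr q) \<partial>\<nu>)"
    proof (rule nn_integral_mono)
      fix x
      show "ennreal (real (Suc l)) * indicator (V n) x \<le> ennreal (\<bar>d n x\<bar> powr q) * indicator L x"
      proof (cases "x \<in> V n")
        case True
        then have x: "x \<in> L" "real (Suc l) < \<bar>d n x\<bar>" by (auto simp: V_def)
        have "real (Suc l) = real (Suc l) powr 1" by simp
        also have "\<dots> \<le> real (Suc l) powr q" using q by (intro powr_mono) auto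
        also have "\<dots> \<le> \<bar>d n x\<bar> powr q" using x(2) q by (intro powr_mono2) auto
        finally have "ennreal (real (Suc l)) \<le> ennreal (\<bar>d n x\<bar> powr q)" by (rule ennreal_leI)
        then show ?thesis using x True by (simp del: of_nat_Suc)
      qed simp
    qed
    also have "\<dots> = qint (res \<nu> L) q (d n)" using L(1) by (subst qint_res) (auto simp: sets\<nu>)
    also have "\<dots> \<le> ennreal (\<Theta> * C powr p)"
      unfolding q_def by (rule restricted_bound[OF sets\<nu> sf p \<Theta>(1) \<alpha> L(1) \<Theta>(2) d C])
    finally have "real (Suc l) * \<delta> \<le> \<Theta> * C powr p" using \<Theta>(1) by (subst (asm) ennreal_le_iff) auto
    then show False using l by simp
  qed
  define T where "T n = trunc l (d n)" for n
  define W where "W n = S (1 / \<beta>) (T n)" for n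
  have TD: "T n \<in> D" for n unfolding T_def by (rule trunc_D[OF d(1)])
  have Tm [measurable]: "T n \<in> borel_measurable borel" for n using TD[of n] by (auto intro: F_borel)
  have Wm [measurable]: "W n \<in> borel_measurable borel" for n unfolding W_def by measurable
  have KVm: "- K \<union> V n \<in> sets borel" for n using K(1) Vm[of n] by auto
  define c where "c = 2 powr q"
  have c: "c > 0" by (simp add: c_def)
  \<comment> \<open>On G the function d n differs from its truncation only on V n, and the integral
    is enlarged to - K \<union> V n, where potentials of order \<alpha> are at most
    \<epsilon>.\<close>
  have part1: "qint \<kappa> q (\<lambda>x. d n x - T n x) \<le> ennreal (\<epsilon> * C powr p)" for n
  proof -
    have "qint \<kappa> q (\<lambda>x. d n x - T n x) \<le> qint (res \<nu> (- K \<union> V n)) q (\<lambda>x. d n x - T n x)"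
      unfolding \<kappa>_def
    proof (rule qint_res_mono)
      fix x assume "x \<in> G" "d n x - T n x \<noteq> 0"
      then show "x \<in> - K \<union> V n \<and> \<bar>d n x - T n x\<bar> \<le> \<bar>d n x - T n x\<bar>"
        using GL by (auto simp: V_def T_def trunc_def max_def min_def split: if_splits)
    qed (use KVm q in \<open>auto simp: mc sets\<nu>\<close>)
    also have "\<dots> \<le> ennreal (\<epsilon> * C powr p)"
      unfolding q_def
    proof (rule restricted_bound[OF sets\<nu> sf p \<epsilon> \<alpha> KVm _ _ _ C])
      show "pot \<nu> \<alpha> p (- K \<union> V n) x \<le> ennreal \<epsilon>" for x
        using L(2) by (intro tail Vm \<nu>V) (auto simp: V_def)
      show "(\<lambda>x. d n x - T n x) \<in> D" by (rule D_diff[OF d(1) TD])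
      show "Qa \<alpha> (\<lambda>x. d n x - T n x) \<le> ennreal C"
        unfolding T_def by (rule order_trans[OF Qa_trunc_rest[OF d(1)] d(2)])
    qed
    finally show ?thesis .
  qed
  \<comment> \<open>On G potentials of order \<beta> are at most \<epsilon>, so smoothing by the
    time 1 / \<beta> changes the truncation little.\<close>
  have part2: "qint \<kappa> q (\<lambda>x. T n x - W n x) \<le> ennreal (\<epsilon> * (5 * C) powr p)" for n
    unfolding qint_def q_def W_def
  proof (rule difference_bound[OF sets\<kappa> sf\<kappa> p \<epsilon> \<beta> pot\<kappa> TD _ C])
    have "Qa 0 (T n) \<le> Qa \<alpha> (T n)" by (simp add: Qa_def)
    also have "\<dots> \<le> Qa \<alpha> (d n)" unfolding T_def by (rule Qa_trunc[OF d(1)])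
    also have "\<dots> \<le> ennreal C" by (rule d(2))
    finally show "Qa 0 (T n) \<le> ennreal C" .
  qed
  define e where "e = c * (\<epsilon> * C powr p + \<epsilon> * (5 * C) powr p)"
  have e: "e \<ge> 0" using \<epsilon> c by (simp add: e_def)
  have part: "qint \<kappa> q (\<lambda>x. d n x - W n x) \<le> ennreal e" for n
  proof -
    have "qint \<kappa> q (\<lambda>x. d n x - W n x) = qint \<kappa> q (\<lambda>x. (d n x - T n x) + (T n x - W n x))" by simp
    also have "\<dots> \<le> ennreal c * (qint \<kappa> q (\<lambda>x. d n x - T n x) + qint \<kappa> q (\<lambda>x. T n x - W n x))"
      unfolding c_def using q by (intro qint_add) auto
    also have "\<dots> \<le> ennreal c * (ennreal (\<epsilon> * C powr p) + ennreal (\<epsilon> * (5 * C) powr p))"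
      by (intro mult_left_mono add_mono part1 part2) simp
    also have "\<dots> = ennreal e" unfolding e_def
      using \<epsilon> c by (simp only: ennreal_plus ennreal_mult less_imp_le powr_ge_zero add_nonneg_nonneg mult_nonneg_nonneg)
    finally show ?thesis .
  qed
  define s where "s x = lim (\<lambda>n. W n x)" for x
  have Wlim: "(\<lambda>n. W n x) \<longlonglongrightarrow> s x" for x
    unfolding s_def convergent_LIMSEQ_iff[symmetric] using conv2 by (simp add: W_def T_def)
  have sm [measurable]: "s \<in> borel_measurable borel" by (rule borel_measurable_LIMSEQ_real[OF Wlim Wm])
  have Wbd: "\<bar>W n x\<bar> \<le> real (Suc l)" for n x
    unfolding W_def by (rule S_bounded[OF Tm]) (simp only: T_def trunc_bound)
  have Ws: "(\<lambda>n. qint \<kappa> q (\<lambda>x. W n x - s x)) \<longlonglongrightarrow> 0"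
    by (rule qint_tendsto_0[OF sets\<kappa> \<kappa>fin q(1) Wm sm Wbd Wlim])
  have "\<eta> / (2 * c) > 0" using \<eta> c by simp
  then have "\<exists>N. \<forall>i\<ge>N. \<forall>j\<ge>N. qint \<kappa> q (\<lambda>x. W i x - W j x) \<le> ennreal (\<eta> / (2 * c))"
    by (rule qint_Cauchy[OF sets\<kappa> q(1) Wm sm Ws])
  then obtain N1 where N1: "\<And>i j. i \<ge> N1 \<Longrightarrow> j \<ge> N1 \<Longrightarrow> qint \<kappa> q (\<lambda>x. W i x - W j x) \<le> ennreal (\<eta> / (2 * c))"
    by blast
  \<comment> \<open>The limit on the atoms, extended by 0; as a finite sum of multiples of
    indicators it is Borel.\<close>
  define z where "z x = (if x \<in> A then lim (\<lambda>n. d n x) else 0)" for x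
  have zm [measurable]: "z \<in> borel_measurable borel"
  proof -
    have "z = (\<lambda>x. \<Sum>a\<in>A. lim (\<lambda>n. d n a) * indicator {a} x)"
      using A(1) by (auto simp: z_def fun_eq_iff indicator_def sum.delta' if_distrib cong: if_cong)
    then show ?thesis by simp
  qed
  have zlim: "(\<lambda>n. d n a) \<longlonglongrightarrow> z a" if "a \<in> A" for a
    using conv1[OF that] that by (simp add: z_def convergent_LIMSEQ_iff)
  have atom_fin: "emeasure \<nu> {a} < \<top>" if "a \<in> A" for a
  proof -
    have "emeasure \<nu> {a} \<le> emeasure \<nu> K" using that A(2) K(1) sets\<nu> by (intro emeasure_mono) auto
    then show ?thesis using K(2) by (rule le_less_trans)
  qed
  have "(\<lambda>n. qint (res \<nu> A) q (\<lambda>x. d n x - z x)) \<longlonglongrightarrow> 0"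
  proof -
    have "(\<lambda>n. \<Sum>a\<in>A. emeasure \<nu> {a} * ennreal (\<bar>d n a - z a\<bar> powr q)) \<longlonglongrightarrow> (\<Sum>a\<in>A. 0)"
    proof (rule tendsto_sum)
      fix a assume a: "a \<in> A"
      have "(\<lambda>n. d n a - z a) \<longlonglongrightarrow> 0" using zlim[OF a] by (simp add: LIM_zero)
      then have "(\<lambda>n. \<bar>d n a - z a\<bar>) \<longlonglongrightarrow> 0" by (rule tendsto_rabs_zero)
      then have "(\<lambda>n. \<bar>d n a - z a\<bar> powr q) \<longlonglongrightarrow> 0" using q by (intro tendsto_zero_powrI[where b = q]) auto
      then have "(\<lambda>n. ennreal (\<bar>d n a - z a\<bar> powr q)) \<longlonglongrightarrow> ennreal 0" by (rule tendsto_ennrealI)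
      then have "(\<lambda>n. emeasure \<nu> {a} * ennreal (\<bar>d n a - z a\<bar> powr q)) \<longlonglongrightarrow> emeasure \<nu> {a} * ennreal 0"
        using atom_fin[OF a] by (intro tendsto_mult_ennreal tendsto_const) auto
      then show "(\<lambda>n. emeasure \<nu> {a} * ennreal (\<bar>d n a - z a\<bar> powr q)) \<longlonglongrightarrow> 0" by simp
    qed
    moreover have "qint (res \<nu> A) q (\<lambda>x. d n x - z x) = (\<Sum>a\<in>A. emeasure \<nu> {a} * ennreal (\<bar>d n a - z a\<bar> powr q))" for n
      by (rule qint_finite_set[OF sets\<nu> A(1)]) measurable
    ultimately show ?thesis by simp
  qed
  moreover have setsA: "sets (res \<nu> A) = sets borel" by (simp add: sets\<nu>)
  ultimately obtain N2 where N2: "\<And>i j. i \<ge> N2 \<Longrightarrow> j \<ge> N2 \<Longrightarrow> qint (res \<nu> A) q (\<lambda>x. d i x - d j x) \<le> ennreal (\<eta> / 2)"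
    using qint_Cauchy[where \<kappa> = "res \<nu> A" and q = q and v = d and s = z and \<eta> = "\<eta> / 2"] \<eta> q zm by auto
  \<comment> \<open>Doubling gives energy at most 4C for a difference. The factor c = 2^q enters
    once for each use of the triangle inequality, three times on G, whence c^3.\<close>
  have "qint \<nu> q (\<lambda>x. d i x - d j x) \<le> ennreal (\<epsilon> * ((4 * C) powr p + 2 * c ^ 3 * (C powr p + (5 * C) powr p)) + \<eta>)"
    if "i \<ge> max N1 N2" "j \<ge> max N1 N2" for i j
  proof -
    let ?w = "\<lambda>x. d i x - d j x"
    have wm: "?w \<in> borel_measurable \<nu>" by measurable
    have wD: "?w \<in> D" by (rule D_diff[OF d(1) d(1)])
    have "Qa \<alpha> ?w \<le> 2 * Qa \<alpha> (d i) + 2 * Qa \<alpha> (d j)" by (rule Qa_diff2) measurable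
    also have "\<dots> \<le> 2 * ennreal C + 2 * ennreal C" by (intro add_mono mult_left_mono d(2)) auto
    also have "\<dots> = ennreal (4 * C)" using C by (simp add: two_ennreal ennreal_plus[symmetric] del: ennreal_plus)
    finally have Qw: "Qa \<alpha> ?w \<le> ennreal (4 * C)" .
    have far: "qint (res \<nu> (- K \<union> B)) q ?w \<le> ennreal (\<epsilon> * (4 * C) powr p)"
      unfolding q_def by (rule restricted_bound[OF sets\<nu> sf p \<epsilon> \<alpha> KBm tail[OF Bm BK \<nu>B] wD Qw]) (use C in simp)
    have near: "qint \<kappa> q ?w \<le> ennreal (c * (c * (e + e) + \<eta> / (2 * c)))"
    proof -
      have "qint \<kappa> q ?w = qint \<kappa> q (\<lambda>x. ((d i x - W i x) - (d j x - W j x)) + (W i x - W j x))" by simp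
      also have "\<dots> \<le> ennreal c * (qint \<kappa> q (\<lambda>x. (d i x - W i x) - (d j x - W j x)) + qint \<kappa> q (\<lambda>x. W i x - W j x))"
        unfolding c_def using q by (intro qint_add) auto
      also have "\<dots> \<le> ennreal c * (ennreal c * (qint \<kappa> q (\<lambda>x. d i x - W i x) + qint \<kappa> q (\<lambda>x. d j x - W j x)) + ennreal (\<eta> / (2 * c)))"
        unfolding c_def using q that N1[of i j] by (intro mult_left_mono add_mono qint_diff) (auto simp: c_def)
      also have "\<dots> \<le> ennreal c * (ennreal c * (ennreal e + ennreal e) + ennreal (\<eta> / (2 * c)))"
        by (intro mult_left_mono add_mono part) auto
      also have "\<dots> = ennreal (c * (c * (e + e) + \<eta> / (2 * c)))"
      proof -
        have h: "0 \<le> c" "0 \<le> \<eta> / (2 * c)" using c \<eta> by auto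
        show ?thesis using h e by (simp only: ennreal_plus ennreal_mult add_nonneg_nonneg mult_nonneg_nonneg)
      qed
      finally show ?thesis .
    qed
    have at: "qint (res \<nu> A) q ?w \<le> ennreal (\<eta> / 2)" using that by (intro N2) auto
    have U: "UNIV = ((- K \<union> B) \<union> G) \<union> A" using L by (auto simp: G_def)
    have "qint \<nu> q ?w = qint (res \<nu> (((- K \<union> B) \<union> G) \<union> A)) q ?w"
      unfolding U[symmetric] by (subst qint_res) (auto simp: sets\<nu> qint_def)
    also have "\<dots> \<le> qint (res \<nu> ((- K \<union> B) \<union> G)) q ?w + qint (res \<nu> A) q ?w"
      using KBm by (intro qint_res_Un wm) (auto simp: sets\<nu>)
    also have "\<dots> \<le> (qint (res \<nu> (- K \<union> B)) q ?w + qint (res \<nu> G) q ?w) + qint (res \<nu> A) q ?w"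
      using KBm by (intro add_right_mono qint_res_Un wm) (auto simp: sets\<nu>)
    also have "\<dots> \<le> (ennreal (\<epsilon> * (4 * C) powr p) + ennreal (c * (c * (e + e) + \<eta> / (2 * c)))) + ennreal (\<eta> / 2)"
      using far near at by (intro add_mono) (simp_all add: \<kappa>_def)
    also have "\<dots> = ennreal ((\<epsilon> * (4 * C) powr p + c * (c * (e + e) + \<eta> / (2 * c))) + \<eta> / 2)"
    proof -
      have h: "0 \<le> c * (c * (e + e) + \<eta> / (2 * c))" "0 \<le> \<eta> / 2" "0 \<le> \<epsilon> * (4 * C) powr p" using c \<eta> e \<epsilon> by auto
      show ?thesis using h by (simp only: ennreal_plus add_nonneg_nonneg)
    qed
    also have "(\<epsilon> * (4 * C) powr p + c * (c * (e + e) + \<eta> / (2 * c))) + \<eta> / 2 =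
        \<epsilon> * ((4 * C) powr p + 2 * c ^ 3 * (C powr p + (5 * C) powr p)) + \<eta>"
      unfolding e_def using c by (simp add: field_simps power3_eq_cube)
    finally show ?thesis .
  qed
  then show ?thesis unfolding q_def c_def by blast
qed

text \<open>The splittings for the tolerances 1 / (j + 1) are fixed beforehand. Their atoms form a
  countable set, so one subsequence serves all of them and \<open>green_tight_part\<close> is
  applied to it for each tolerance.\<close>

lemma green_tight_core_compact:
  assumes tr: "testable \<alpha>" and \<alpha>: "\<alpha> \<ge> 0" and p: "p \<ge> 1" and ch: "charges_no_null_capacity m E F \<nu>"
    and sets\<nu>: "sets \<nu> = sets borel" and sf: "sigma_finite_measure \<nu>" and gt: "green_tight \<alpha> \<nu> p"
  shows "core_compact \<alpha> \<nu> p"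
  unfolding core_compact_def
proof (intro allI impI)
  fix d :: "nat \<Rightarrow> 'a \<Rightarrow> real" and C0 :: real
  assume d0: "\<forall>n. d n \<in> D \<and> Qa \<alpha> (d n) \<le> ennreal C0"
  define C where "C = max 0 C0"
  have C: "C \<ge> 0" by (simp add: C_def)
  have dD: "d n \<in> D" for n using d0 by blast
  have dC: "Qa \<alpha> (d n) \<le> ennreal C" for n using d0 by (auto simp: C_def intro: order_trans ennreal_leI)
  define \<epsilon> where "\<epsilon> j = 1 / real (Suc j)" for j
  have \<epsilon>: "\<epsilon> j > 0" for j by (simp add: \<epsilon>_def)
  let ?P = "\<lambda>j A. \<exists>K \<delta> L \<Theta>. K \<in> sets borel \<and> emeasure \<nu> K < \<top> \<and> \<delta> > (0::real) \<and>
    (\<forall>B\<in>sets borel. B \<subseteq> K \<longrightarrow> emeasure \<nu> B < ennreal \<delta> \<longrightarrow> (\<forall>x. pot \<nu> \<alpha> p (- K \<union> B) x \<le> ennreal (\<epsilon> j))) \<and>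
    finite A \<and> A \<subseteq> K \<and> (\<forall>a\<in>A. 0 < emeasure \<nu> {a}) \<and> L \<in> sets borel \<and> L \<subseteq> K \<and> K = A \<union> L \<and>
    \<Theta> > (0::real) \<and> (\<forall>x. pot \<nu> \<alpha> p L x \<le> ennreal \<Theta>)"
  have "\<forall>j. \<exists>A. ?P j A"
  proof
    fix j
    show "\<exists>A. ?P j A" using green_tight_split[OF sets\<nu> gt \<epsilon>[of j]] by (elim exE) (intro exI; assumption)
  qed
  then obtain A where A: "\<forall>j. ?P j (A j)" by (rule choice[THEN exE])
  have fin: "finite (A j)" for j using A[rule_format, of j] by (elim exE conjE)
  have pos: "0 < emeasure \<nu> {a}" if "a \<in> A j" for a j
    using A[rule_format, of j] that by (elim exE conjE) (erule bspec)
  have "bounded (range (\<lambda>n. d n a))" if a: "a \<in> (\<Union>j. A j)" for a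
  proof -
    obtain b where b: "b \<ge> 0" "\<And>f c. f \<in> D \<Longrightarrow> c \<ge> 0 \<Longrightarrow> Qa \<alpha> f \<le> ennreal c \<Longrightarrow> (f a)\<^sup>2 \<le> b * c"
      using atom_evaluation[OF tr \<alpha> ch pos] a by blast
    have "\<bar>d n a\<bar> \<le> sqrt (b * C)" for n using b(2)[OF dD C dC, of n] by (rule real_le_rsqrt[of "\<bar>d n a\<bar>", simplified])
    then show ?thesis by (auto simp: bounded_iff)
  qed
  moreover have "countable (\<Union>j. A j)" using fin by (auto intro: countable_finite)
  ultimately have "\<exists>r::nat \<Rightarrow> nat. strict_mono r \<and> (\<forall>a\<in>(\<Union>j. A j). convergent (\<lambda>n. d (r n) a)) \<and>
      (\<forall>l t x. convergent (\<lambda>n. S t (trunc l (d (r n))) x))"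
    by (intro weakly_convergent_subsequence[of d "\<Union>j. A j", OF dD])
  then obtain r :: "nat \<Rightarrow> nat" where r: "strict_mono r"
    and c1: "\<forall>a\<in>(\<Union>j. A j). convergent (\<lambda>n. d (r n) a)" and c2: "\<forall>l t x. convergent (\<lambda>n. S t (trunc l (d (r n))) x)"
    by (elim exE conjE)
  have "\<exists>N. \<forall>i\<ge>N. \<forall>j\<ge>N. qint \<nu> (2 * p) (\<lambda>x. d (r i) x - d (r j) x) \<le> ennreal \<eta>" if \<eta>: "\<eta> > 0" for \<eta>
  proof -
    define T where "T = (4 * C) powr p + 2 * (2 powr (2 * p)) ^ 3 * (C powr p + (5 * C) powr p)"
    have T: "T \<ge> 0" by (simp add: T_def)
    obtain j :: nat where "2 * T / \<eta> < real j" using reals_Archimedean2 by blast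
    then have "2 * T < real (Suc j) * \<eta>" using \<eta> by (simp add: field_simps)
    then have j: "\<epsilon> j * T + \<eta> / 2 \<le> \<eta>" by (simp add: \<epsilon>_def field_simps)
    have "\<exists>N. \<forall>i\<ge>N. \<forall>i'\<ge>N. qint \<nu> (2 * p) (\<lambda>x. d (r i) x - d (r i') x) \<le> ennreal (\<epsilon> j * T + \<eta> / 2)"
      using A[rule_format, of j]
    proof (elim exE conjE)
      fix K \<delta> L \<Theta>
      assume K: "K \<in> sets borel" "emeasure \<nu> K < \<top>" "(0::real) < \<delta>"
        and tail: "\<forall>B\<in>sets borel. B \<subseteq> K \<longrightarrow> emeasure \<nu> B < ennreal \<delta> \<longrightarrow> (\<forall>x. pot \<nu> \<alpha> p (- K \<union> B) x \<le> ennreal (\<epsilon> j))"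
        and A': "finite (A j)" "A j \<subseteq> K" and L: "L \<in> sets borel" "L \<subseteq> K" "K = A j \<union> L"
        and \<Theta>: "(0::real) < \<Theta>" "\<forall>x. pot \<nu> \<alpha> p L x \<le> ennreal \<Theta>"
      show ?thesis unfolding T_def
      proof (rule green_tight_part[OF sets\<nu> sf p \<alpha> K \<epsilon> _ A' L \<Theta>(1)])
        show "convergent (\<lambda>n. d (r n) a)" if "a \<in> A j" for a using c1 that by blast
        show "convergent (\<lambda>n. S t (trunc l (d (r n))) x)" for l t x using c2 by blast
      qed (use tail \<Theta>(2) dD dC C \<eta> in auto)
    qed
    then show ?thesis using ennreal_leI[OF j] by (meson order_trans)
  qed
  then show "\<exists>r::nat \<Rightarrow> nat. strict_mono r \<and>
      (\<forall>\<epsilon>>0. \<exists>N. \<forall>i\<ge>N. \<forall>j\<ge>N. qint \<nu> (2 * p) (\<lambda>x. d (r i) x - d (r j) x) \<le> ennreal \<epsilon>)"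
    using r by blast
qed

section \<open>Measures of Kato class, with \<open>m\<close> as reference\<close>

definition kato :: "'a measure \<Rightarrow> real \<Rightarrow> bool" where
  "kato \<nu> p \<longleftrightarrow> (\<forall>\<epsilon>>0. \<exists>\<beta>>0. \<forall>x. (\<integral>\<^sup>+y. ennreal_powr (resolvent_kernel k \<beta> x y) p \<partial>\<nu>) \<le> ennreal \<epsilon>)"

lemma qint_m_2: "qint m 2 u = nsq u"
  by (simp add: qint_def nsq_def powr_numeral)

lemma kato_bound:
  assumes sets\<nu>: "sets \<nu> = sets borel" and sf: "sigma_finite_measure \<nu>" and p: "p \<ge> 1" and \<beta>: "\<beta> > 0" and \<epsilon>: "\<epsilon> > 0"
    and R: "\<And>x. (\<integral>\<^sup>+y. ennreal_powr (resolvent_kernel k \<beta> x y) p \<partial>\<nu>) \<le> ennreal \<epsilon>" and f: "f \<in> D"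
    and a: "Q f \<le> ennreal a" "a \<ge> 0" and b: "nsq f \<le> ennreal b" "b \<ge> 0"
  shows "qint \<nu> (2 * p) f \<le> ennreal (\<epsilon> * (a + \<beta> * b) powr p)"
  unfolding qint_def
proof (rule core_bound[OF sets\<nu> sf p \<epsilon> _ _ f])
  have "Qa \<beta> f \<le> ennreal a + ennreal \<beta> * ennreal b" unfolding Qa_def using a b by (intro add_mono mult_left_mono) auto
  also have "\<dots> = ennreal (a + \<beta> * b)"
    using a b \<beta> by (simp only: ennreal_plus ennreal_mult less_imp_le mult_nonneg_nonneg)
  finally show "Qa \<beta> f \<le> ennreal (a + \<beta> * b)" .
qed (use a b \<beta> R in auto)

lemma kato_core_bounded:
  assumes sets\<nu>: "sets \<nu> = sets borel" and sf: "sigma_finite_measure \<nu>" and p: "p \<ge> 1" and kato: "kato \<nu> p"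
    and m: "core_bounded \<alpha> m 1 B0"
  shows "\<exists>B. core_bounded \<alpha> \<nu> p B"
proof -
  obtain \<beta> where \<beta>: "\<beta> > 0" and R: "\<And>x. (\<integral>\<^sup>+y. ennreal_powr (resolvent_kernel k \<beta> x y) p \<partial>\<nu>) \<le> ennreal 1"
    using kato[unfolded kato_def, rule_format, OF zero_less_one] by blast
  have B0: "B0 \<ge> 0" using m by (simp add: core_bounded_def)
  have "core_bounded \<alpha> \<nu> p ((1 + \<beta> * B0) powr p)"
    unfolding core_bounded_def
  proof (intro conjI ballI allI impI)
    fix f and c :: real assume f: "f \<in> D" and c: "0 \<le> c" "Qa \<alpha> f \<le> ennreal c"
    \<comment> \<open>Boundedness for m controls the L2 part of the energy of order \<beta>, which
      therefore is at most (1 + \<beta> B0) c.\<close>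
    have n: "nsq f \<le> ennreal (B0 * c)"
      using m f c by (auto simp: core_bounded_def qint_m_2[symmetric])
    have "qint \<nu> (2 * p) f \<le> ennreal (1 * (c + \<beta> * (B0 * c)) powr p)"
      by (rule kato_bound[OF sets\<nu> sf p \<beta> _ R f order_trans[OF Q_le_Qa c(2)] c(1) n]) (use B0 c in auto)
    also have "c + \<beta> * (B0 * c) = (1 + \<beta> * B0) * c" by (simp add: algebra_simps)
    finally show "qint \<nu> (2 * p) f \<le> ennreal ((1 + \<beta> * B0) powr p * c powr p)"
      using \<beta> B0 c by (simp add: powr_mult)
  qed simp
  then show ?thesis ..
qed

text \<open>The energies of differences are merely bounded, but a large order \<beta> makes the
  constant in the embedding small. For this fixed \<beta>, convergence in L2 of m controls the extra
  term \<beta> nsq.\<close>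

lemma kato_core_compact:
  assumes sets\<nu>: "sets \<nu> = sets borel" and sf: "sigma_finite_measure \<nu>" and p: "p \<ge> 1" and kato: "kato \<nu> p"
    and m: "core_compact \<alpha> m 1"
  shows "core_compact \<alpha> \<nu> p"
  unfolding core_compact_def
proof (intro allI impI)
  fix d :: "nat \<Rightarrow> 'a \<Rightarrow> real" and C0 :: real
  assume d0: "\<forall>n. d n \<in> D \<and> Qa \<alpha> (d n) \<le> ennreal C0"
  define C where "C = max 0 C0"
  have C: "C \<ge> 0" by (simp add: C_def)
  have dD: "d n \<in> D" for n using d0 by blast
  have db [measurable]: "d n \<in> borel_measurable borel" for n using dD[of n] by (auto intro: F_borel)
  have dC: "Q (d n) \<le> ennreal C" for n
  proof -
    have "Q (d n) \<le> Qa \<alpha> (d n)" by (rule Q_le_Qa)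
    also have "\<dots> \<le> ennreal C0" using d0 by blast
    also have "\<dots> \<le> ennreal C" by (intro ennreal_leI) (simp add: C_def)
    finally show ?thesis .
  qed
  have "\<exists>r::nat \<Rightarrow> nat. strict_mono r \<and>
      (\<forall>\<epsilon>>0. \<exists>N. \<forall>i\<ge>N. \<forall>j\<ge>N. qint m (2 * 1) (\<lambda>x. d (r i) x - d (r j) x) \<le> ennreal \<epsilon>)"
    by (rule m[unfolded core_compact_def, rule_format, of d C0]) (use d0 in blast)
  then obtain r :: "nat \<Rightarrow> nat" where r: "strict_mono r"
    and cauchy: "\<And>\<epsilon>. \<epsilon> > 0 \<Longrightarrow> \<exists>N. \<forall>i\<ge>N. \<forall>j\<ge>N. qint m (2 * 1) (\<lambda>x. d (r i) x - d (r j) x) \<le> ennreal \<epsilon>"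
    by (elim exE conjE) simp
  have "\<exists>N. \<forall>i\<ge>N. \<forall>j\<ge>N. qint \<nu> (2 * p) (\<lambda>x. d (r i) x - d (r j) x) \<le> ennreal \<eta>" if \<eta>: "\<eta> > 0" for \<eta>
  proof -
    \<comment> \<open>The energy of order \<beta> will be at most 4C + 1: the differences have
      energy at most 4C, and N is taken so large that their squared L2 norm is at most 1 /
      \<beta>.\<close>
    define \<epsilon> where "\<epsilon> = \<eta> / (4 * C + 1) powr p"
    have \<epsilon>: "\<epsilon> > 0" using \<eta> C by (simp add: \<epsilon>_def)
    obtain \<beta> where \<beta>: "\<beta> > 0" and R: "\<And>x. (\<integral>\<^sup>+y. ennreal_powr (resolvent_kernel k \<beta> x y) p \<partial>\<nu>) \<le> ennreal \<epsilon>"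
      using kato[unfolded kato_def, rule_format, OF \<epsilon>] by blast
    obtain N where N: "\<And>i j. i \<ge> N \<Longrightarrow> j \<ge> N \<Longrightarrow> qint m (2 * 1) (\<lambda>x. d (r i) x - d (r j) x) \<le> ennreal (1 / \<beta>)"
      using cauchy[of "1 / \<beta>"] \<beta> by auto
    have "qint \<nu> (2 * p) (\<lambda>x. d (r i) x - d (r j) x) \<le> ennreal \<eta>" if "i \<ge> N" "j \<ge> N" for i j
    proof -
      have "Q (\<lambda>x. d (r i) x - d (r j) x) = Qa 0 (\<lambda>x. d (r i) x - d (r j) x)" by (simp add: Qa_def)
      also have "\<dots> \<le> 2 * Qa 0 (d (r i)) + 2 * Qa 0 (d (r j))" by (rule Qa_diff2) measurable
      also have "\<dots> \<le> 2 * ennreal C + 2 * ennreal C"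
        using dC by (intro add_mono mult_left_mono) (auto simp: Qa_def)
      also have "\<dots> = ennreal (4 * C)" using C by (simp add: two_ennreal ennreal_plus[symmetric] del: ennreal_plus)
      finally have Qw: "Q (\<lambda>x. d (r i) x - d (r j) x) \<le> ennreal (4 * C)" .
      have "nsq (\<lambda>x. d (r i) x - d (r j) x) \<le> ennreal (1 / \<beta>)" using N[OF that] by (simp add: qint_m_2)
      then have "qint \<nu> (2 * p) (\<lambda>x. d (r i) x - d (r j) x) \<le> ennreal (\<epsilon> * (4 * C + \<beta> * (1 / \<beta>)) powr p)"
        by (intro kato_bound[OF sets\<nu> sf p \<beta> \<epsilon> R D_diff[OF dD dD] Qw]) (use C \<beta> in auto)
      also have "\<epsilon> * (4 * C + \<beta> * (1 / \<beta>)) powr p = \<eta>" using \<beta> C by (simp add: \<epsilon>_def)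
      finally show ?thesis .
    qed
    then show ?thesis by blast
  qed
  then show "\<exists>r::nat \<Rightarrow> nat. strict_mono r \<and>
      (\<forall>\<epsilon>>0. \<exists>N. \<forall>i\<ge>N. \<forall>j\<ge>N. qint \<nu> (2 * p) (\<lambda>x. d (r i) x - d (r j) x) \<le> ennreal \<epsilon>)"
    using r by blast
qed

section \<open>Strictly positive weights of finite energy\<close>

lemma testableI:
  assumes \<alpha>: "\<alpha> \<ge> 0" and g: "g \<in> L2" "AE x in m. 0 < g x" "\<And>x. 0 \<le> g x" and \<Gamma>: "\<Gamma> \<ge> 0"
    and int: "(\<integral>\<^sup>+r\<in>{0<..}. ennreal (exp (- \<alpha> * r) * ip g (S r g)) \<partial>lborel) \<le> ennreal \<Gamma>"
  shows "testable \<alpha>"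
  unfolding testable_def
proof (intro exI[of _ g] exI[of _ "sqrt \<Gamma>"] conjI ballI allI impI)
  have [measurable]: "g \<in> borel_measurable borel" by (rule L2_borel[OF g(1)])
  then show "g \<in> borel_measurable borel" .
  fix u c assume u: "u \<in> F" and c: "0 \<le> c" "Qa \<alpha> u \<le> ennreal c"
  have au: "(\<lambda>x. \<bar>u x\<bar>) \<in> L2" by (rule F_L2[OF F_abs[OF u]])
  have "Qa \<alpha> (\<lambda>x. \<bar>u x\<bar>) \<le> ennreal c" using Qa_abs[of u \<alpha>] F_borel[OF u] c by (auto intro: order_trans)
  \<comment> \<open>The energy inequality is applied to |u|, whose energy does not exceed that of
    u.\<close>
  then have "(ip (\<lambda>x. \<bar>u x\<bar>) g)\<^sup>2 \<le> c * \<Gamma>" by (rule energy_inequality_L2[OF au g(1) \<alpha> _ c(1) int \<Gamma>])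
  then have "ip (\<lambda>x. \<bar>u x\<bar>) g \<le> sqrt \<Gamma> * sqrt c" by (subst real_sqrt_mult[symmetric], intro real_le_rsqrt) (simp only: mult.commute)
  moreover have "(\<integral>\<^sup>+x. ennreal (\<bar>u x\<bar> * g x) \<partial>m) = ennreal (ip (\<lambda>x. \<bar>u x\<bar>) g)"
    unfolding ip_def using L2_integrable_mult[OF au g(1)] g(3) by (intro nn_integral_eq_integral) auto
  ultimately show "(\<integral>\<^sup>+x. ennreal (\<bar>u x\<bar> * g x) \<partial>m) \<le> ennreal (sqrt \<Gamma> * sqrt c)" by (simp add: ennreal_leI)
qed (use g \<Gamma> in auto)

lemma positive_L2_function:
  "\<exists>\<rho>\<in>L2. integrable m \<rho> \<and> (\<forall>x. 0 < \<rho> x)"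
proof -
  obtain \<rho> :: "'a \<Rightarrow> real" where \<rho>: "\<rho> \<in> borel_measurable m" "\<And>x. \<rho> x > 0" "\<And>x. \<rho> x \<le> 1" "integrable m \<rho>"
    using obtain_positive_integrable_function by blast
  have [measurable]: "\<rho> \<in> borel_measurable borel" using \<rho>(1) by (simp cong: measurable_cong_sets)
  have "integrable m (\<lambda>x. (\<rho> x)\<^sup>2)"
  proof (rule Bochner_Integration.integrable_bound[OF \<rho>(4)])
    have "(\<rho> x)\<^sup>2 \<le> \<rho> x" for x using \<rho>(2)[of x] \<rho>(3)[of x] by (simp add: power2_eq_square mult_left_le)
    then show "AE x in m. norm ((\<rho> x)\<^sup>2) \<le> norm (\<rho> x)" using \<rho>(2) by (intro AE_I2) (simp add: abs_of_pos)
  qed measurable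
  then show ?thesis using \<rho> by (intro bexI[of _ \<rho>]) (auto simp: L2_def)
qed

lemma testable_1: "testable 1"
proof -
  obtain \<rho> where \<rho>: "\<rho> \<in> L2" "\<And>x. 0 < \<rho> x" using positive_L2_function by blast
  \<comment> \<open>Proved from the contraction property alone, for every real r;
    \<open>ip_S_le\<close> covers positive times only.\<close>
  have le: "ip \<rho> (S r \<rho>) \<le> ip \<rho> \<rho>" for r
  proof -
    have "0 \<le> ip (\<lambda>x. \<rho> x - S r \<rho> x) (\<lambda>x. \<rho> x - S r \<rho> x)" by (rule ip_nonneg)
    also have "\<dots> = ip \<rho> \<rho> - 2 * ip \<rho> (S r \<rho>) + ip (S r \<rho>) (S r \<rho>)"
    proof -
      have "ip (\<lambda>x. \<rho> x - S r \<rho> x) (\<lambda>x. \<rho> x - S r \<rho> x) = ip \<rho> (\<lambda>x. \<rho> x - S r \<rho> x) - ip (S r \<rho>) (\<lambda>x. \<rho> x - S r \<rho> x)"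
        by (intro ip_diff L2_diff S_L2 \<rho>(1))
      moreover have "ip \<rho> (\<lambda>x. \<rho> x - S r \<rho> x) = ip \<rho> \<rho> - ip (S r \<rho>) \<rho>"
        by (subst ip_sym) (intro ip_diff S_L2 \<rho>(1))
      moreover have "ip (S r \<rho>) (\<lambda>x. \<rho> x - S r \<rho> x) = ip \<rho> (S r \<rho>) - ip (S r \<rho>) (S r \<rho>)"
        by (subst ip_sym) (intro ip_diff S_L2 \<rho>(1))
      moreover have "ip (S r \<rho>) \<rho> = ip \<rho> (S r \<rho>)" by (rule ip_sym)
      ultimately show ?thesis by linarith
    qed
    finally show ?thesis using nsq_S_le[OF \<rho>(1), of r] by linarith
  qed
  have exp1: "(\<integral>\<^sup>+r. ennreal (exp (- r)) * indicator {0<..} r \<partial>lborel) = 1"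
  proof -
    have "(\<integral>\<^sup>+r. ennreal (exp (- r)) * indicator {0<..} r \<partial>lborel) = (\<integral>\<^sup>+r. ennreal (exponential_density 1 r) \<partial>lborel)"
    proof (rule nn_integral_cong_AE)
      have "AE r in lborel. r \<noteq> (0::real)" by (rule AE_lborel_singleton)
      then show "AE r in lborel. ennreal (exp (- r)) * indicator {0<..} r = ennreal (exponential_density 1 r)"
        by eventually_elim (auto simp: exponential_density_def split: split_indicator)
    qed
    also have "\<dots> = emeasure (density lborel (exponential_density 1)) UNIV" by (simp add: emeasure_density)
    also have "\<dots> = 1"
      using prob_space.emeasure_space_1[OF prob_space_exponential_density[OF zero_less_one]] by simp
    finally show ?thesis .
  qed
  show ?thesis
  proof (rule testableI[of 1 \<rho>])
    have "(\<integral>\<^sup>+r\<in>{0<..}. ennreal (exp (- 1 * r) * ip \<rho> (S r \<rho>)) \<partial>lborel) \<le>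
        (\<integral>\<^sup>+r. ennreal (ip \<rho> \<rho>) * (ennreal (exp (- r)) * indicator {0<..} r) \<partial>lborel)"
      using le ip_nonneg by (intro nn_integral_mono)
        (auto simp: ennreal_mult[symmetric] mult.commute intro!: ennreal_leI mult_right_mono split: split_indicator)
    also have "\<dots> = ennreal (ip \<rho> \<rho>)" by (subst nn_integral_cmult) (auto simp: exp1)
    finally show "(\<integral>\<^sup>+r\<in>{0<..}. ennreal (exp (- 1 * r) * ip \<rho> (S r \<rho>)) \<partial>lborel) \<le> ennreal (ip \<rho> \<rho>)" .
  qed (use \<rho> ip_nonneg in \<open>auto intro: less_imp_le\<close>)
qed

text \<open>With h the potential of a positive integrable \<rho>, the weight g = \<rho> / (1 + h)
  satisfies g <= \<rho> and g h <= \<rho>. Its energy is therefore at most the integral of g h,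
  hence at most that of \<rho>. Transience makes h finite, and so g positive, almost
  everywhere.\<close>

lemma testable_0:
  assumes transient: "\<And>f. f \<in> borel_measurable borel \<Longrightarrow> (\<integral>\<^sup>+x. f x \<partial>m) < \<top> \<Longrightarrow>
    AE x in m. (\<integral>\<^sup>+t\<in>{0<..}. nnP t f x \<partial>lborel) < \<top>"
  shows "testable 0"
proof -
  obtain \<rho> where \<rho>: "\<rho> \<in> L2" "integrable m \<rho>" "\<And>x. 0 < \<rho> x" using positive_L2_function by blast
  have [measurable]: "\<rho> \<in> borel_measurable borel" by (rule L2_borel[OF \<rho>(1)])
  define h where "h x = (\<integral>\<^sup>+t\<in>{0<..}. nnP t (\<lambda>x. ennreal (\<rho> x)) x \<partial>lborel)" for x
  have [measurable]: "h \<in> borel_measurable borel" unfolding h_def[abs_def] by measurable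
  have \<rho>int: "(\<integral>\<^sup>+x. ennreal (\<rho> x) \<partial>m) = ennreal (\<integral>x. \<rho> x \<partial>m)"
    using \<rho> by (intro nn_integral_eq_integral) (auto intro: less_imp_le)
  have hfin: "AE x in m. h x < \<top>" unfolding h_def by (rule transient) (auto simp: \<rho>int)
  define g where "g x = (if h x = \<top> then 0 else \<rho> x / (1 + enn2real (h x)))" for x
  have g0: "0 \<le> g x" for x using \<rho>(3)[of x] by (simp add: g_def)
  have g\<rho>: "g x \<le> \<rho> x" for x
    using \<rho>(3)[of x] by (auto simp: g_def divide_le_eq mult_le_cancel_left1 less_imp_le intro!: add_pos_nonneg)
  have [measurable]: "g \<in> borel_measurable borel" unfolding g_def[abs_def] by measurable
  have gL: "g \<in> L2"
  proof (rule L2_dominated[OF \<rho>(1)])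
    show "\<bar>g x\<bar> \<le> \<bar>\<rho> x\<bar>" for x using g0[of x] g\<rho>[of x] by simp
  qed measurable
  have gh: "ennreal (g x) * h x \<le> ennreal (\<rho> x)" for x
  proof (cases "h x = \<top>")
    case False
    then obtain y where y: "h x = ennreal y" "y \<ge> 0" by (cases "h x") auto
    have "g x * y = \<rho> x * (y / (1 + y))" using False y by (simp add: g_def)
    also have "\<dots> \<le> \<rho> x" using y \<rho>(3)[of x] by (intro mult_left_le) (auto intro: less_imp_le)
    finally show ?thesis using y g0[of x] by (simp add: ennreal_mult[symmetric] ennreal_leI)
  qed (simp add: g_def)
  show ?thesis
  proof (rule testableI[of 0 g])
    show "AE x in m. 0 < g x" using hfin
    proof eventually_elim
      case (elim x)
      have "1 + enn2real (h x) > 0" by (intro add_pos_nonneg) auto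
      then show ?case using elim \<rho>(3)[of x] by (simp add: g_def)
    qed
    have pt: "ennreal (ip g (S r g)) \<le> (\<integral>\<^sup>+x. ennreal (g x) * nnP r (\<lambda>x. ennreal (\<rho> x)) x \<partial>m)" for r
    proof -
      have "ennreal (ip g (S r g)) = (\<integral>\<^sup>+x. ennreal (g x) * ennreal (S r g x) \<partial>m)"
        by (rule nn_abs_eq_ip[symmetric]) (use L2_integrable_mult[OF gL S_L2[OF gL]] g0 S_nonneg in auto)
      also have "\<dots> \<le> (\<integral>\<^sup>+x. ennreal (g x) * nnP r (\<lambda>x. ennreal (\<rho> x)) x \<partial>m)"
      proof (intro nn_integral_mono mult_left_mono)
        fix x
        have "ennreal (S r g x) \<le> ennreal \<bar>S r g x\<bar>" by (intro ennreal_leI) simp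
        also have "\<dots> \<le> nnP r (\<lambda>y. ennreal \<bar>g y\<bar>) x" by (rule S_abs_le) measurable
        also have "\<dots> \<le> nnP r (\<lambda>x. ennreal (\<rho> x)) x" unfolding nnP_def
          using g0 g\<rho> by (intro nn_integral_mono mult_left_mono ennreal_leI) auto
        finally show "ennreal (S r g x) \<le> nnP r (\<lambda>x. ennreal (\<rho> x)) x" .
      qed simp
      finally show ?thesis .
    qed
    have "(\<integral>\<^sup>+r\<in>{0<..}. ennreal (exp (- 0 * r) * ip g (S r g)) \<partial>lborel) \<le>
        (\<integral>\<^sup>+r. (\<integral>\<^sup>+x. ennreal (g x) * (nnP r (\<lambda>x. ennreal (\<rho> x)) x * indicator {0<..} r) \<partial>m) \<partial>(lborel :: real measure))"
      using pt by (intro nn_integral_mono) (auto split: split_indicator)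
    also have "\<dots> = (\<integral>\<^sup>+x. (\<integral>\<^sup>+r. ennreal (g x) * (nnP r (\<lambda>x. ennreal (\<rho> x)) x * indicator {0<..} r) \<partial>(lborel :: real measure)) \<partial>m)"
    proof -
      interpret pair_sigma_finite "lborel :: real measure" m ..
      show ?thesis by (rule Fubini'[symmetric]) measurable
    qed
    also have "\<dots> = (\<integral>\<^sup>+x. ennreal (g x) * h x \<partial>m)"
      unfolding h_def by (intro nn_integral_cong nn_integral_cmult) measurable
    also have "\<dots> \<le> (\<integral>\<^sup>+x. ennreal (\<rho> x) \<partial>m)" by (intro nn_integral_mono gh)
    finally show "(\<integral>\<^sup>+r\<in>{0<..}. ennreal (exp (- 0 * r) * ip g (S r g)) \<partial>lborel) \<le> ennreal (\<integral>x. \<rho> x \<partial>m)"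
      unfolding \<rho>int .
    show "0 \<le> (\<integral>x. \<rho> x \<partial>m)" using \<rho>(3) by (intro Bochner_Integration.integral_nonneg) (auto intro: less_imp_le)
  qed (use gL g0 in auto)
qed

end

section \<open>The extended Dirichlet space\<close>

lemma positive_ennreal_below:
  fixes y :: ennreal assumes "0 < y" obtains e where "0 < e" "ennreal e < y"
proof -
  obtain z where z: "0 < z" "z < y" using dense[OF assms] by blast
  then obtain e where "z = ennreal e" "e \<ge> 0" by (cases z) auto
  then show ?thesis using z that[of e] by auto
qed

context dirichlet_kernel begin

lemma E_eq: "u \<in> F \<Longrightarrow> ennreal (E u u) = Q u"
  by (simp add: E_diag F_iff less_top[symmetric])

lemma Qa_0: "Qa 0 u = Q u" by (simp add: Qa_def)

text \<open>Continuity of a quadratic functional derived from \<open>Qa_add\<close> with a weight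
  \<eta> that varies with n; applied in both directions it sandwiches the energies.\<close>

lemma Q_continuous:
  assumes [measurable]: "\<And>n. w n \<in> borel_measurable borel" "v \<in> borel_measurable borel"
    and fin: "\<And>n. Q (w n) < \<top>" "Q v < \<top>" and lim: "(\<lambda>n. Q (\<lambda>x. w n x - v x)) \<longlonglongrightarrow> 0"
  shows "(\<lambda>n. enn2real (Q (w n))) \<longlonglongrightarrow> enn2real (Q v)"
proof -
  define a where "a n = enn2real (Q (w n))" for n
  define b where "b n = enn2real (Q (\<lambda>x. w n x - v x))" for n
  define A where "A = enn2real (Q v)"
  have a: "Q (w n) = ennreal (a n)" "a n \<ge> 0" for n using fin(1)[of n] by (auto simp: a_def)
  have A: "Q v = ennreal A" "A \<ge> 0" using fin(2) by (auto simp: A_def)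
  have b: "Q (\<lambda>x. w n x - v x) = ennreal (b n)" "b n \<ge> 0" for n
  proof -
    have "Q (\<lambda>x. w n x - v x) \<le> 2 * Q (w n) + 2 * Q v"
      using Qa_diff2[of "w n" v 0] by (simp add: Qa_0)
    also have "\<dots> < \<top>" using fin by (simp add: ennreal_mult_less_top)
    finally show "Q (\<lambda>x. w n x - v x) = ennreal (b n)" "b n \<ge> 0" by (auto simp: b_def)
  qed
  have b': "Q (\<lambda>x. v x - w n x) = ennreal (b n)" for n
    using Qa_minus[of "\<lambda>x. w n x - v x" 0] b(1)[of n] by (simp add: Qa_0)
  have b0: "b \<longlonglongrightarrow> 0" unfolding b_def using lim by (intro tendsto_enn2real) auto
  \<comment> \<open>The square root makes b n / \<eta> n vanish along with b n; the added term keeps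
    the weight positive when b n = 0.\<close>
  define \<eta> where "\<eta> n = sqrt (b n) + 1 / real (Suc n)" for n
  have \<eta>: "\<eta> n > 0" for n unfolding \<eta>_def using b(2)[of n] by (intro add_nonneg_pos) auto
  have "(\<lambda>n. sqrt (b n)) \<longlonglongrightarrow> sqrt 0" by (intro tendsto_real_sqrt b0)
  then have sb: "(\<lambda>n. sqrt (b n)) \<longlonglongrightarrow> 0" by simp
  have "\<eta> \<longlonglongrightarrow> 0 + 0" unfolding \<eta>_def[abs_def] using LIMSEQ_inverse_real_of_nat
    by (intro tendsto_add sb) (simp add: inverse_eq_divide)
  then have \<eta>0: "\<eta> \<longlonglongrightarrow> 0" by simp
  have quot: "b n / \<eta> n \<le> sqrt (b n)" for n
  proof -
    have "b n = sqrt (b n) * sqrt (b n)" using b(2) by simp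
    also have "\<dots> \<le> sqrt (b n) * \<eta> n" using b(2) by (intro mult_left_mono) (auto simp: \<eta>_def)
    finally show ?thesis using \<eta> by (simp add: divide_le_eq)
  qed
  have step: "x \<le> (1 + \<eta> n) * y + b n + sqrt (b n)"
    if "Q f = ennreal x" "Q g = ennreal y" "Q h = ennreal (b n)" "0 \<le> x" "0 \<le> y" "f = (\<lambda>x. g x + h x)"
      and [measurable]: "g \<in> borel_measurable borel" "h \<in> borel_measurable borel" for f g h x y n
  proof -
    have "Q f \<le> ennreal (1 + \<eta> n) * Q g + ennreal (1 + 1 / \<eta> n) * Q h"
      unfolding that(6) using Qa_add[OF that(7,8) \<eta>[of n], of 0] by (simp only: Qa_0)
    then have "ennreal x \<le> ennreal (1 + \<eta> n) * ennreal y + ennreal (1 + 1 / \<eta> n) * ennreal (b n)"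
      unfolding that(1-3) .
    also have "\<dots> = ennreal ((1 + \<eta> n) * y + (1 + 1 / \<eta> n) * b n)"
    proof -
      have h: "0 \<le> 1 + \<eta> n" "0 \<le> 1 + 1 / \<eta> n" using \<eta>[of n] by auto
      show ?thesis using h that(5) b(2)[of n] by (simp only: ennreal_plus ennreal_mult mult_nonneg_nonneg)
    qed
    finally have "x \<le> (1 + \<eta> n) * y + (1 + 1 / \<eta> n) * b n"
      using \<eta>[of n] that(5) b(2)[of n] by (subst (asm) ennreal_le_iff) (auto intro!: add_nonneg_nonneg mult_nonneg_nonneg)
    moreover have "(1 + 1 / \<eta> n) * b n = b n + b n / \<eta> n" by (simp add: distrib_right)
    ultimately show ?thesis using quot[of n] by linarith
  qed
  have up: "a n \<le> (1 + \<eta> n) * A + b n + sqrt (b n)" for n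
    by (rule step[OF a(1) A(1) b(1) a(2) A(2)]) auto
  have "A \<le> (1 + \<eta> n) * a n + b n + sqrt (b n)" for n
    by (rule step[OF A(1) a(1) b' A(2) a(2)]) auto
  then have low: "(A - b n - sqrt (b n)) / (1 + \<eta> n) \<le> a n" for n
    using \<eta>[of n] by (simp add: divide_le_eq mult.commute algebra_simps)
  have "(\<lambda>n. (1 + \<eta> n) * A + b n + sqrt (b n)) \<longlonglongrightarrow> (1 + 0) * A + 0 + 0"
    by (intro tendsto_intros \<eta>0 b0 sb)
  moreover have "(\<lambda>n. (A - b n - sqrt (b n)) / (1 + \<eta> n)) \<longlonglongrightarrow> (A - 0 - 0) / (1 + 0)"
    by (intro tendsto_intros \<eta>0 b0 sb) simp
  ultimately have "a \<longlonglongrightarrow> A"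
    by (intro real_tendsto_sandwich[OF always_eventually[OF allI[OF low]] always_eventually[OF allI[OF up]]]) simp_all
  then show ?thesis unfolding a_def A_def .
qed

text \<open>In the Cauchy condition one index is sent to infinity by lower semicontinuity.\<close>

lemma approximating_sequence_Q:
  assumes [measurable]: "u \<in> borel_measurable borel" and ap: "approximating_sequence m E F un u"
  shows "(\<lambda>n. Q (\<lambda>x. un n x - u x)) \<longlonglongrightarrow> 0" and "Q u < \<top>"
proof -
  have unF: "un n \<in> F" for n using ap by (simp add: approximating_sequence_def)
  have [measurable]: "un n \<in> borel_measurable borel" for n by (rule F_borel[OF unF])
  have ae: "AE x in m. (\<lambda>n. un n x) \<longlonglongrightarrow> u x" using ap by (simp add: approximating_sequence_def)
  have bound: "\<exists>N. \<forall>n\<ge>N. Q (\<lambda>x. un n x - u x) \<le> ennreal \<epsilon>" if \<epsilon>: "\<epsilon> > 0" for \<epsilon>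
  proof -
    obtain N where N: "\<And>i j. i \<ge> N \<Longrightarrow> j \<ge> N \<Longrightarrow> E (\<lambda>x. un i x - un j x) (\<lambda>x. un i x - un j x) < \<epsilon>"
      using ap \<epsilon> unfolding approximating_sequence_def form_Cauchy_def by blast
    have "Q (\<lambda>x. un n x - u x) \<le> ennreal \<epsilon>" if n: "n \<ge> N" for n
    proof -
      have "Qa 0 (\<lambda>x. un n x - u x) \<le> liminf (\<lambda>i. Qa 0 (\<lambda>x. un n x - un i x))"
      proof (rule Qa_liminf)
        show "AE x in m. (\<lambda>i. un n x - un i x) \<longlonglongrightarrow> un n x - u x"
          using ae by eventually_elim (intro tendsto_diff tendsto_const)
      qed measurable
      also have "\<dots> \<le> liminf (\<lambda>i. ennreal \<epsilon>)"
      proof (rule Liminf_mono)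
        have "Qa 0 (\<lambda>x. un n x - un i x) \<le> ennreal \<epsilon>" if "i \<ge> N" for i
          using ennreal_leI[OF less_imp_le[OF N[OF n that]]] unfolding E_eq[OF F_diff[OF unF unF]] Qa_0 .
        then show "eventually (\<lambda>i. Qa 0 (\<lambda>x. un n x - un i x) \<le> ennreal \<epsilon>) sequentially"
          by (auto simp: eventually_sequentially)
      qed
      finally show ?thesis by (simp add: Qa_0 Liminf_const)
    qed
    then show ?thesis by blast
  qed
  show "(\<lambda>n. Q (\<lambda>x. un n x - u x)) \<longlonglongrightarrow> 0"
  proof (rule order_tendstoI)
    fix y :: ennreal assume "0 < y"
    then obtain e where e: "0 < e" "ennreal e < y" by (rule positive_ennreal_below)
    obtain N where "\<And>n. n \<ge> N \<Longrightarrow> Q (\<lambda>x. un n x - u x) \<le> ennreal e" using bound[OF e(1)] by blast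
    then show "eventually (\<lambda>n. Q (\<lambda>x. un n x - u x) < y) sequentially"
      using e(2) by (auto simp: eventually_sequentially intro: le_less_trans)
  qed simp
  obtain N where N: "\<And>n. n \<ge> N \<Longrightarrow> Q (\<lambda>x. un n x - u x) \<le> ennreal 1" using bound[OF zero_less_one] by blast
  have "Q u = Qa 0 (\<lambda>x. un N x - (un N x - u x))" by (simp add: Qa_0)
  also have "\<dots> \<le> 2 * Qa 0 (un N) + 2 * Qa 0 (\<lambda>x. un N x - u x)" by (rule Qa_diff2) measurable
  also have "\<dots> < \<top>" using N[OF order_refl] unF[of N]
    by (auto simp: Qa_0 ennreal_mult_less_top F_iff intro: le_less_trans)
  finally show "Q u < \<top>" .
qed

lemma polarization:
  assumes u: "u \<in> F" and v: "v \<in> F"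
  shows "4 * E u v = enn2real (Q (\<lambda>x. u x + v x)) - enn2real (Q (\<lambda>x. u x - v x))"
proof -
  let ?w = "\<lambda>x. -1 * v x"
  have w: "?w \<in> F" by (rule domain_scale[OF v])
  have p: "(\<lambda>x. u x + v x) \<in> F" by (rule domain_add[OF u v])
  have q: "(\<lambda>x. u x + ?w x) \<in> F" by (rule domain_add[OF u w])
  have "E (\<lambda>x. u x + v x) (\<lambda>x. u x + v x) = E u u + 2 * E u v + E v v"
    using form_add[OF u v p] form_sym[OF u p] form_sym[OF v p] form_add[OF u v u] form_add[OF u v v] form_sym[OF u v] by simp
  moreover have "E (\<lambda>x. u x + ?w x) (\<lambda>x. u x + ?w x) = E u u + 2 * E u ?w + E ?w ?w"
    using form_add[OF u w q] form_sym[OF u q] form_sym[OF w q] form_add[OF u w u] form_add[OF u w w] form_sym[OF u w] by simp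
  moreover have "E u ?w = - E u v" using form_scale[OF v u, of "-1"] form_sym[OF u w] form_sym[OF u v] by simp
  moreover have "E ?w ?w = E v v" using form_scale[OF v w, of "-1"] form_scale[OF v v, of "-1"] form_sym[OF v w] by simp
  ultimately have "E (\<lambda>x. u x + v x) (\<lambda>x. u x + v x) - E (\<lambda>x. u x + ?w x) (\<lambda>x. u x + ?w x) = 4 * E u v" by linarith
  then show ?thesis using E_diag[OF p] E_diag[OF q] by simp
qed

text \<open>The definite description ranges over pairs of approximating sequences. By polarization
  each pairing is a difference of energies of the sum and of the difference, and these tend to Q(2u)
  = 4 Q(u) and Q(0) = 0 for every pair.\<close>

lemma extended_form_eq:
  assumes "u \<in> extended_domain m E F"
  shows "extended_form m E F u u = enn2real (Qa 0 u)"
proof -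
  have [measurable]: "u \<in> borel_measurable borel" using assms by (simp add: extended_domain_def)
  obtain an where an: "approximating_sequence m E F an u" using assms by (auto simp: extended_domain_def)
  have lim: "(\<lambda>n. E (un n) (vn n)) \<longlonglongrightarrow> enn2real (Q u)"
    if un: "approximating_sequence m E F un u" and vn: "approximating_sequence m E F vn u" for un vn
  proof -
    have F: "un n \<in> F" "vn n \<in> F" for n using un vn by (auto simp: approximating_sequence_def)
    have [measurable]: "un n \<in> borel_measurable borel" "vn n \<in> borel_measurable borel" for n
      by (rule F_borel[OF F(1)], rule F_borel[OF F(2)])
    have fin: "Q u < \<top>" by (rule approximating_sequence_Q[OF _ un]) measurable
    have l0: "(\<lambda>n. 2 * Q (\<lambda>x. un n x - u x) + 2 * Q (\<lambda>x. vn n x - u x)) \<longlonglongrightarrow> 2 * 0 + 2 * 0"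
      using approximating_sequence_Q[of u, OF _ un] approximating_sequence_Q[of u, OF _ vn]
      by (intro tendsto_add tendsto_mult_ennreal tendsto_const) auto
    have p: "(\<lambda>n. enn2real (Q (\<lambda>x. un n x + vn n x))) \<longlonglongrightarrow> enn2real (Q (\<lambda>x. u x + u x))"
    proof (rule Q_continuous)
      show "Q (\<lambda>x. un n x + vn n x) < \<top>" for n using domain_add[OF F, of n n] by (simp add: F_iff)
      have "Q (\<lambda>x. u x + u x) \<le> 2 * Q u + 2 * Q u" using Qa_add2[of u u 0] by (simp add: Qa_0)
      also have "\<dots> < \<top>" using fin by (simp add: ennreal_mult_less_top)
      finally show "Q (\<lambda>x. u x + u x) < \<top>" .
      show "(\<lambda>n. Q (\<lambda>x. un n x + vn n x - (u x + u x))) \<longlonglongrightarrow> 0"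
      proof (rule tendsto_sandwich[OF _ _ tendsto_const])
        have "Q (\<lambda>x. un n x + vn n x - (u x + u x)) \<le> 2 * Q (\<lambda>x. un n x - u x) + 2 * Q (\<lambda>x. vn n x - u x)" for n
          using Qa_add2[of "\<lambda>x. un n x - u x" "\<lambda>x. vn n x - u x" 0] by (simp add: Qa_0 algebra_simps)
        then show "eventually (\<lambda>n. Q (\<lambda>x. un n x + vn n x - (u x + u x)) \<le> 2 * Q (\<lambda>x. un n x - u x) + 2 * Q (\<lambda>x. vn n x - u x)) sequentially"
          by simp
      qed (use l0 in auto)
    qed measurable
    have q: "(\<lambda>n. enn2real (Q (\<lambda>x. un n x - vn n x))) \<longlonglongrightarrow> enn2real (Q (\<lambda>x. 0))"
    proof (rule Q_continuous)
      show "Q (\<lambda>x. un n x - vn n x) < \<top>" for n using F_diff[OF F, of n n] by (simp add: F_iff)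
      show "Q (\<lambda>x. 0) < \<top>" using Qa_zero[of 0] by (simp add: Qa_0)
      show "(\<lambda>n. Q (\<lambda>x. un n x - vn n x - 0)) \<longlonglongrightarrow> 0"
      proof (rule tendsto_sandwich[OF _ _ tendsto_const])
        have "Q (\<lambda>x. un n x - vn n x - 0) \<le> 2 * Q (\<lambda>x. un n x - u x) + 2 * Q (\<lambda>x. vn n x - u x)" for n
          using Qa_diff2[of "\<lambda>x. un n x - u x" "\<lambda>x. vn n x - u x" 0] by (simp add: Qa_0 algebra_simps)
        then show "eventually (\<lambda>n. Q (\<lambda>x. un n x - vn n x - 0) \<le> 2 * Q (\<lambda>x. un n x - u x) + 2 * Q (\<lambda>x. vn n x - u x)) sequentially"
          by simp
      qed (use l0 in auto)
    qed measurable
    have 4: "enn2real (Q (\<lambda>x. u x + u x)) = 4 * enn2real (Q u)"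
      using Qa_scale[of u 0 2] by (simp add: Qa_0 enn2real_mult)
    have "(\<lambda>n. (enn2real (Q (\<lambda>x. un n x + vn n x)) - enn2real (Q (\<lambda>x. un n x - vn n x))) / 4) \<longlonglongrightarrow> (4 * enn2real (Q u) - 0) / 4"
      using p q Qa_zero[of 0] unfolding 4 by (intro tendsto_divide tendsto_diff tendsto_const) (auto simp: Qa_0)
    moreover have "(enn2real (Q (\<lambda>x. un n x + vn n x)) - enn2real (Q (\<lambda>x. un n x - vn n x))) / 4 = E (un n) (vn n)" for n
      using polarization[OF F, of n n] by simp
    ultimately show ?thesis by simp
  qed
  show ?thesis
    unfolding extended_form_def Qa_0
  proof (rule the_equality)
    show "\<exists>un vn. approximating_sequence m E F un u \<and> approximating_sequence m E F vn u \<and> (\<lambda>n. E (un n) (vn n)) \<longlonglongrightarrow> enn2real (Q u)"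
      using an lim by blast
    fix l assume "\<exists>un vn. approximating_sequence m E F un u \<and> approximating_sequence m E F vn u \<and> (\<lambda>n. E (un n) (vn n)) \<longlonglongrightarrow> l"
    then show "l = enn2real (Q u)" using lim LIMSEQ_unique by blast
  qed
qed

lemma form1_eq_Qa:
  assumes "u \<in> F" shows "form1 m E u u = enn2real (Qa 1 u)"
proof -
  have "0 \<le> form1 m E u u" using form_nonneg[OF assms] by (simp add: form1_def L2_inner_def)
  then show ?thesis unfolding form1_eq[OF assms, symmetric] by simp
qed

text \<open>Replacing each v n by a core function within 16^{-n} / 16 in the form of order 1 keeps
  the rate: 2 / 8 + 2 (2 / 16 + 2 / 16) = 3 / 4. The L2 part of these errors is summable, so the
  errors also vanish almost everywhere.\<close>

lemma approximable_core:
  assumes ub: "u \<in> borel_measurable borel" and vF: "\<And>n. v n \<in> F" and \<alpha>: "\<alpha> = 0 \<or> \<alpha> = 1"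
    and fast: "\<And>n. Qa \<alpha> (\<lambda>x. v (Suc n) x - v n x) \<le> ennreal ((1 / 16) ^ n / 8)"
    and lim: "AE x in m. (\<lambda>n. v n x) \<longlonglongrightarrow> u x"
  shows "\<exists>f. approximable \<alpha> u f"
proof -
  have [measurable]: "v n \<in> borel_measurable borel" for n by (rule F_borel[OF vF])
  have "\<exists>f\<in>D. form1 m E (\<lambda>x. v n x - f x) (\<lambda>x. v n x - f x) < (1 / 16) ^ n / 16" for n
    by (rule core_dense_domain[OF vF]) simp
  then have "\<forall>n. \<exists>f. f \<in> D \<and> form1 m E (\<lambda>x. v n x - f x) (\<lambda>x. v n x - f x) < (1 / 16) ^ n / 16" by blast
  then obtain f where f: "\<forall>n. f n \<in> D \<and> form1 m E (\<lambda>x. v n x - f n x) (\<lambda>x. v n x - f n x) < (1 / 16) ^ n / 16"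
    by (rule choice[THEN exE])
  have fD: "f n \<in> D" for n using f by blast
  have [measurable]: "f n \<in> borel_measurable borel" for n using fD[of n] by (auto intro: F_borel)
  have Q1: "Qa 1 (\<lambda>x. v n x - f n x) \<le> ennreal ((1 / 16) ^ n / 16)" for n
  proof -
    have "(\<lambda>x. v n x - f n x) \<in> F" using fD[of n] by (intro F_diff vF) auto
    from form1_eq[OF this] show ?thesis using f by (metis ennreal_leI less_imp_le)
  qed
  have Q\<alpha>: "Qa \<alpha> (\<lambda>x. v n x - f n x) \<le> ennreal ((1 / 16) ^ n / 16)" for n
    using \<alpha> Q1[of n] order_trans[OF Q_le_Qa Q1] by (auto simp: Qa_0)
  have nsq: "nsq (\<lambda>x. v n x - f n x) \<le> ennreal ((1 / 16) ^ n / 16)" for n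
  proof -
    have "nsq (\<lambda>x. v n x - f n x) \<le> Qa 1 (\<lambda>x. v n x - f n x)" by (simp add: Qa_def)
    then show ?thesis using Q1 by (rule order_trans)
  qed
  have "AE x in m. (\<lambda>n. v n x - f n x) \<longlonglongrightarrow> 0"
  proof -
    have sm: "summable (\<lambda>n. (1 / 16 :: real) ^ n / 16)" by (intro summable_divide summable_geometric) simp
    have "(\<integral>\<^sup>+x. (\<Sum>n. ennreal ((v n x - f n x)\<^sup>2)) \<partial>m) = (\<Sum>n. nsq (\<lambda>x. v n x - f n x))"
      unfolding nsq_def by (rule nn_integral_suminf) measurable
    also have "\<dots> \<le> (\<Sum>n. ennreal ((1 / 16) ^ n / 16))" by (intro suminf_le nsq) auto
    also have "\<dots> = ennreal (\<Sum>n. (1 / 16) ^ n / 16)" by (rule suminf_ennreal2) (use sm in auto)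
    finally have "(\<integral>\<^sup>+x. (\<Sum>n. ennreal ((v n x - f n x)\<^sup>2)) \<partial>m) \<noteq> \<infinity>" by (auto simp: top_unique)
    then have "AE x in m. (\<Sum>n. ennreal ((v n x - f n x)\<^sup>2)) \<noteq> \<infinity>" by (intro nn_integral_PInf_AE) measurable
    then show ?thesis
    proof eventually_elim
      case (elim x)
      then have "summable (\<lambda>n. (v n x - f n x)\<^sup>2)" by (intro summable_suminf_not_top) auto
      then have "(\<lambda>n. (v n x - f n x)\<^sup>2) \<longlonglongrightarrow> 0" by (rule summable_LIMSEQ_zero)
      then have "(\<lambda>n. sqrt ((v n x - f n x)\<^sup>2)) \<longlonglongrightarrow> sqrt 0" by (rule tendsto_real_sqrt)
      then show ?case by (simp add: tendsto_rabs_zero_iff)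
    qed
  qed
  with lim have "AE x in m. (\<lambda>n. f n x) \<longlonglongrightarrow> u x"
  proof eventually_elim
    case (elim x)
    have "(\<lambda>n. v n x - (v n x - f n x)) \<longlonglongrightarrow> u x - 0" using elim by (rule tendsto_diff)
    then show ?case by simp
  qed
  moreover have "Qa \<alpha> (\<lambda>x. f (Suc n) x - f n x) \<le> ennreal ((1 / 16) ^ n)" for n
  proof -
    define e where "e = (1 / 16 :: real) ^ n"
    have e: "e \<ge> 0" by (simp add: e_def)
    have e2: "(1 / 16 :: real) ^ Suc n / 16 \<le> e / 16" using e by (simp add: e_def)
    have "Qa \<alpha> (\<lambda>x. f (Suc n) x - f n x) =
        Qa \<alpha> (\<lambda>x. (v (Suc n) x - v n x) - ((v (Suc n) x - f (Suc n) x) - (v n x - f n x)))" by simp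
    also have "\<dots> \<le> 2 * Qa \<alpha> (\<lambda>x. v (Suc n) x - v n x) +
        2 * Qa \<alpha> (\<lambda>x. (v (Suc n) x - f (Suc n) x) - (v n x - f n x))" by (rule Qa_diff2) measurable
    also have "\<dots> \<le> 2 * ennreal (e / 8) + 2 * (2 * ennreal (e / 16) + 2 * ennreal (e / 16))"
    proof (intro add_mono mult_left_mono)
      show "Qa \<alpha> (\<lambda>x. v (Suc n) x - v n x) \<le> ennreal (e / 8)" using fast[of n] by (simp add: e_def)
      have "Qa \<alpha> (\<lambda>x. (v (Suc n) x - f (Suc n) x) - (v n x - f n x)) \<le>
          2 * Qa \<alpha> (\<lambda>x. v (Suc n) x - f (Suc n) x) + 2 * Qa \<alpha> (\<lambda>x. v n x - f n x)" by (rule Qa_diff2) measurable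
      also have "\<dots> \<le> 2 * ennreal (e / 16) + 2 * ennreal (e / 16)"
        using Q\<alpha>[of n] order_trans[OF Q\<alpha>[of "Suc n"] ennreal_leI[OF e2]]
        by (intro add_mono mult_left_mono) (auto simp: e_def)
      finally show "Qa \<alpha> (\<lambda>x. (v (Suc n) x - f (Suc n) x) - (v n x - f n x)) \<le> 2 * ennreal (e / 16) + 2 * ennreal (e / 16)" .
    qed auto
    also have "\<dots> = ennreal (3 / 4 * e)"
      using e by (simp add: two_ennreal ennreal_plus[symmetric] del: ennreal_plus)
    also have "\<dots> \<le> ennreal e" using e by (intro ennreal_leI) simp
    finally show ?thesis by (simp add: e_def)
  qed
  ultimately show ?thesis unfolding approximable_def using ub fD by blast
qed

lemma F_approximable: "u \<in> F \<Longrightarrow> \<exists>f. approximable 1 u f"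
  by (rule approximable_core[where v = "\<lambda>n. u"]) (auto simp: Qa_zero F_borel)

lemma extended_approximable:
  assumes "u \<in> extended_domain m E F"
  shows "\<exists>f. approximable 0 u f"
proof -
  have ub: "u \<in> borel_measurable borel" using assms by (simp add: extended_domain_def)
  obtain w where w: "approximating_sequence m E F w u" using assms by (auto simp: extended_domain_def)
  have wF: "w n \<in> F" for n using w by (simp add: approximating_sequence_def)
  have fc: "form_Cauchy E w" using w by (simp add: approximating_sequence_def)
  have "\<exists>N. \<forall>i\<ge>N. \<forall>j\<ge>N. E (\<lambda>x. w i x - w j x) (\<lambda>x. w i x - w j x) < (1 / 16) ^ n / 8" for n
    by (rule fc[unfolded form_Cauchy_def, THEN spec, THEN mp]) simp
  then have "\<forall>n. \<exists>N. \<forall>i\<ge>N. \<forall>j\<ge>N. E (\<lambda>x. w i x - w j x) (\<lambda>x. w i x - w j x) < (1 / 16) ^ n / 8" by blast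
  then obtain N where N: "\<forall>n. \<forall>i\<ge>N n. \<forall>j\<ge>N n. E (\<lambda>x. w i x - w j x) (\<lambda>x. w i x - w j x) < (1 / 16) ^ n / 8"
    by (rule choice[THEN exE])
  define s where "s n = n + (\<Sum>i\<le>n. N i)" for n
  have s: "strict_mono s" unfolding strict_mono_Suc_iff by (simp add: s_def)
  have sN: "N n \<le> s n" for n unfolding s_def using member_le_sum[of n "{..n}" N] by simp
  show ?thesis
  proof (rule approximable_core[OF ub, where v = "\<lambda>n. w (s n)"])
    show "Qa 0 (\<lambda>x. w (s (Suc n)) x - w (s n) x) \<le> ennreal ((1 / 16) ^ n / 8)" for n
    proof -
      have "s n \<le> s (Suc n)" using s by (simp add: strict_mono_less_eq)
      then have "E (\<lambda>x. w (s (Suc n)) x - w (s n) x) (\<lambda>x. w (s (Suc n)) x - w (s n) x) \<le> (1 / 16) ^ n / 8"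
        using N sN[of n] by (intro less_imp_le) (meson order_trans)
      then have "ennreal (E (\<lambda>x. w (s (Suc n)) x - w (s n) x) (\<lambda>x. w (s (Suc n)) x - w (s n) x)) \<le> ennreal ((1 / 16) ^ n / 8)"
        by (rule ennreal_leI)
      then show ?thesis unfolding Qa_0 E_eq[OF F_diff[OF wF wF]] .
    qed
    have "AE x in m. (\<lambda>n. w n x) \<longlonglongrightarrow> u x" using w by (simp add: approximating_sequence_def)
    then show "AE x in m. (\<lambda>n. w (s n) x) \<longlonglongrightarrow> u x"
      by eventually_elim (use LIMSEQ_subseq_LIMSEQ[OF _ s] in \<open>fastforce simp: o_def\<close>)
  qed (use wF in auto)
qed

end

section \<open>The form and the heat kernel of a Hunt process\<close>

text \<open>Open sets remain open in the compactification, and a complement in the state space is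
  taken relative to the open image of the whole space.\<close>

lemma Some_image_cemetery:
  fixes B :: "'a::{metric_space, second_countable_topology} set"
  assumes "B \<in> sets borel" shows "Some ` B \<in> sets cemetery_borel"
proof -
  have gen: "sets (cemetery_borel :: 'a option measure) = sigma_sets UNIV {U. openin cemetery_topology U}"
    unfolding cemetery_borel_def by (rule sets_measure_of) simp
  have op: "Some ` U \<in> sets (cemetery_borel :: 'a option measure)" if "open U" for U :: "'a set"
    unfolding gen using that by (intro sigma_sets.Basic) (auto simp: openin_Alexandroff_compactification)
  have "B \<in> sigma_sets UNIV {S. open S}" using assms by (simp add: borel_def)
  then show ?thesis
  proof induction
    case (Compl B)
    have "Some ` (UNIV - B) = Some ` (UNIV :: 'a set) - Some ` B" by auto
    then show ?case using Compl op[OF open_UNIV] by auto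
  next
    case (Union A)
    have "Some ` (\<Union>i. A i) = (\<Union>i. Some ` A i)" by auto
    then show ?case using Union by auto
  qed (use op in auto)
qed

lemma case_option_cemetery:
  fixes u :: "'a::{metric_space, second_countable_topology} \<Rightarrow> 'b::topological_space"
  assumes u: "u \<in> borel_measurable borel"
  shows "case_option c u \<in> borel_measurable (cemetery_borel :: 'a option measure)"
proof (rule measurableI)
  have sp: "space (cemetery_borel :: 'a option measure) = UNIV" by (simp add: cemetery_borel_def)
  fix A :: "'b set" assume A: "A \<in> sets borel"
  have "u -` A \<in> sets borel" using measurable_sets[OF u A] by simp
  then have 1: "Some ` (u -` A) \<in> sets cemetery_borel" by (rule Some_image_cemetery)
  have "UNIV - Some ` (UNIV :: 'a set) \<in> sets cemetery_borel"
    using sets.compl_sets[OF Some_image_cemetery[of "UNIV :: 'a set"]] sp by simp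
  moreover have "UNIV - Some ` (UNIV :: 'a set) = {None}" by (auto simp: notin_range_Some)
  ultimately have 2: "{None :: 'a option} \<in> sets cemetery_borel" by simp
  have 3: "Some ` (u -` A) \<union> {None} \<in> sets cemetery_borel" using 1 2 by (rule sets.Un)
  have eq: "case_option c u -` A \<inter> space cemetery_borel = Some ` (u -` A) \<union> (if c \<in> A then {None} else {})"
    unfolding sp by (auto split: option.splits)
  show "case_option c u -` A \<inter> space cemetery_borel \<in> sets cemetery_borel"
    by (cases "c \<in> A") (use 1 3 eq in simp_all)
qed simp

locale heat_kernel_process = regular_dirichlet_form m E F + hunt_process M X \<zeta> P
  for m :: "'a::{metric_space, second_countable_topology} measure" and E and F
    and M :: "'w measure" and X :: "ennreal \<Rightarrow> 'w \<Rightarrow> 'a option" and \<zeta> and P +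
  fixes h :: "real \<Rightarrow> 'a \<Rightarrow> 'a \<Rightarrow> ennreal"
  assumes lc: "locally_compact_space (euclidean :: 'a topology)"
    and radon: "radon_measure m" and assoc: "associated m E F X P" and heat: "heat_kernel m X P h"
begin

text \<open>The extension by 0 to non-positive times turns measurability on the half-line into
  measurability on the full product and keeps symmetry and mass at most 1 for all t.\<close>

definition k :: "real \<Rightarrow> 'a \<Rightarrow> 'a \<Rightarrow> ennreal" where "k t x y = (if t > 0 then h t x y else 0)"

lemma X_measurable:
  assumes "u \<in> borel_measurable borel"
  shows "(\<lambda>\<omega>. case_option c u (X (ennreal t) \<omega>)) \<in> borel_measurable (P x)"
proof -
  have "(\<lambda>\<omega>. case_option c u (X (ennreal t) \<omega>)) \<in> borel_measurable M"
    by (rule measurable_compose[OF measurable_X case_option_cemetery[OF assms]])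
  then show ?thesis by (simp cong: measurable_cong_sets add: sets_P measurable_cong_sets[OF sets_P refl])
qed

lemma nn_transition_k:
  assumes "t > 0" "u \<in> borel_measurable borel"
  shows "nn_transition X P t u x = (\<integral>\<^sup>+y. k t x y * u y \<partial>m)"
  using heat assms by (simp add: heat_kernel_def k_def)

sublocale symmetric_kernel m k
proof -
  interpret sigma_finite_measure m by (rule radon_measure_sigma_finite[OF lc radon])
  show "symmetric_kernel m k"
  proof unfold_locales
    show "sets m = sets borel" using radon by (simp add: radon_measure_def)
    show "(\<lambda>(t, x, y). k t x y) \<in> borel_measurable (borel \<Otimes>\<^sub>M borel \<Otimes>\<^sub>M borel)"
    proof -
      have "open ({0<..} \<times> UNIV \<times> UNIV :: (real \<times> 'a \<times> 'a) set)" by (intro open_Times) auto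
      then have s: "({0<..} \<times> UNIV \<times> UNIV :: (real \<times> 'a \<times> 'a) set) \<inter> space borel \<in> sets borel" by simp
      have "(\<lambda>(t, x, y). h t x y) \<in> borel_measurable (restrict_space borel ({0<..} \<times> UNIV \<times> UNIV))"
        using heat by (simp add: heat_kernel_def)
      then have "(\<lambda>w. if w \<in> {0<..} \<times> UNIV \<times> UNIV then (\<lambda>(t, x, y). h t x y) w else 0) \<in> borel_measurable (borel :: (real \<times> 'a \<times> 'a) measure)"
        by (subst (asm) measurable_restrict_space_iff[OF s, of 0]) simp_all
      moreover have "(\<lambda>w. if w \<in> {0<..} \<times> UNIV \<times> UNIV then (\<lambda>(t, x, y). h t x y) w else 0) = (\<lambda>(t, x, y). k t x y)"
        by (auto simp: k_def fun_eq_iff)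
      ultimately show ?thesis by (simp only: borel_prod)
    qed
    show "k t x y = k t y x" for t x y using heat by (simp add: k_def heat_kernel_def)
    show "(\<integral>\<^sup>+y. k t x y \<partial>m) \<le> 1" for t x
    proof (cases "t > 0")
      case True
      interpret prob_space "P (Some x)" by (rule prob)
      have "(\<integral>\<^sup>+y. k t x y \<partial>m) = nn_transition X P t (\<lambda>_. 1) x" using nn_transition_k[OF True, of "\<lambda>_. 1" x] by simp
      also have "\<dots> \<le> (\<integral>\<^sup>+\<omega>. 1 \<partial>P (Some x))"
        unfolding nn_transition_def by (intro nn_integral_mono) (auto split: option.split)
      also have "\<dots> = 1" by (simp add: emeasure_space_1)
      finally show ?thesis .
    qed (simp add: k_def)
    show "k (t + s) x y = (\<integral>\<^sup>+z. k s x z * k t z y \<partial>m)" if "t > 0" "s > 0" for t s x y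
      using heat that by (simp add: k_def heat_kernel_def)
  qed
qed

lemma transition_eq_S:
  assumes t: "t > 0" and [measurable]: "u \<in> borel_measurable borel"
  shows "transition X P t u x = (if nnP t (\<lambda>y. ennreal \<bar>u y\<bar>) x < \<top> then S t u x else 0)"
proof -
  let ?f = "\<lambda>\<omega>. case_option 0 u (X (ennreal t) \<omega>)"
  have fm [measurable]: "?f \<in> borel_measurable (P (Some x))" by (rule X_measurable) measurable
  \<comment> \<open>The heat kernel is given for non-negative functions only; this formula is later
    used with the absolute value and with the positive and negative parts.\<close>
  have nn: "(\<integral>\<^sup>+\<omega>. g (?f \<omega>) \<partial>P (Some x)) = nnP t (\<lambda>y. g (u y)) x"
    if g: "g 0 = 0" and [measurable]: "g \<in> borel_measurable borel" for g :: "real \<Rightarrow> ennreal"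
  proof -
    have "(\<integral>\<^sup>+\<omega>. g (?f \<omega>) \<partial>P (Some x)) = nn_transition X P t (\<lambda>y. g (u y)) x"
      unfolding nn_transition_def by (intro nn_integral_cong) (simp add: g split: option.split)
    also have "\<dots> = nnP t (\<lambda>y. g (u y)) x" unfolding nnP_def by (rule nn_transition_k[OF t]) measurable
    finally show ?thesis .
  qed
  have int: "integrable (P (Some x)) ?f \<longleftrightarrow> nnP t (\<lambda>y. ennreal \<bar>u y\<bar>) x < \<top>"
    using nn[of "\<lambda>r. ennreal \<bar>r\<bar>"] fm by (simp add: integrable_iff_bounded)
  show ?thesis
  proof (cases "nnP t (\<lambda>y. ennreal \<bar>u y\<bar>) x < \<top>")
    case True
    have i: "integrable m (\<lambda>y. kr t x y * u y)" by (rule S_integrable[OF _ True]) measurable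
    have "transition X P t u x = enn2real (nnP t (\<lambda>y. ennreal (u y)) x) - enn2real (nnP t (\<lambda>y. ennreal (- u y)) x)"
      unfolding transition_def using int True nn[of ennreal] nn[of "\<lambda>r. ennreal (- r)"]
      by (subst real_lebesgue_integral_def) auto
    also have "\<dots> = S t u x"
    proof -
      have e: "ennreal (kr t x y * a) = ennreal (kr t x y) * ennreal a" for y a by (rule ennreal_mult') simp
      show ?thesis unfolding S_def real_lebesgue_integral_def[OF i] nnP_kr
        by (simp only: mult_minus_right[symmetric] e)
    qed
    finally show ?thesis using True by simp
  next
    case False
    then show ?thesis using int by (simp add: transition_def not_integrable_integral_eq)
  qed
qed

lemma Lp_2_eq_L2: "Lp m 2 = L2"
  by (auto simp: Lp_def L2_def powr_numeral)

lemma quot_eq: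
  assumes u: "u \<in> L2" and t: "t > 0"
  shows "L2_inner m (\<lambda>x. u x - transition X P t u x) u / t = quot t u"
proof -
  have [measurable]: "u \<in> borel_measurable borel" by (rule L2_borel[OF u])
  have ae: "AE x in m. transition X P t u x = S t u x"
    using nnP_AE_finite[OF u, of t] by eventually_elim (simp add: transition_eq_S[OF t L2_borel[OF u]])
  have [measurable]: "(\<lambda>x. transition X P t u x) \<in> borel_measurable borel"
    unfolding transition_eq_S[OF t L2_borel[OF u]] by measurable
  have "L2_inner m (\<lambda>x. u x - transition X P t u x) u = ip (\<lambda>x. u x - S t u x) u"
    unfolding L2_inner_def ip_def
  proof (rule integral_cong_AE)
    show "AE x in m. (u x - transition X P t u x) * u x = (u x - S t u x) * u x" using ae by eventually_elim simp
  qed measurable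
  also have "\<dots> = ip u u - ip u (S t u)" using ip_diff[OF u S_L2[OF u] u] ip_sym[of "S t u" u] by simp
  finally show ?thesis by (simp add: quot_def)
qed

lemma quot_tendsto_iff:
  assumes "u \<in> L2"
  shows "((\<lambda>t. L2_inner m (\<lambda>x. u x - transition X P t u x) u / t) \<longlongrightarrow> l) (at_right 0) \<longleftrightarrow>
    ((\<lambda>t. quot t u) \<longlongrightarrow> l) (at_right 0)"
  by (rule tendsto_cong) (auto simp: quot_eq[OF assms] eventually_at_filter)

text \<open>The mass is the probability of being in G at time t. Paths start at x and are right
  continuous, and the image of G is an open neighbourhood of x in the compactification.\<close>

lemma short_time_mass:
  assumes G: "open G" and x: "x \<in> G"
  shows "((\<lambda>t. \<integral>\<^sup>+y\<in>G. k t x y \<partial>m) \<longlongrightarrow> 1) (at_right 0)"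
proof (rule tendsto_at_right_sequentially[of 0 1])
  interpret prob_space "P (Some x)" by (rule prob)
  fix s :: "nat \<Rightarrow> real" assume s: "\<And>n. 0 < s n" "s \<longlonglongrightarrow> 0"
  define g where "g n \<omega> = (case_option 0 (indicator G) (X (ennreal (s n)) \<omega>) :: ennreal)" for n \<omega>
  have [measurable]: "g n \<in> borel_measurable (P (Some x))" for n
    unfolding g_def[abs_def] using G by (intro X_measurable) measurable
  have spP: "space (P (Some x)) = space M" by (rule sets_eq_imp_space_eq[OF sets_P])
  have "(\<lambda>n. \<integral>\<^sup>+\<omega>. g n \<omega> \<partial>P (Some x)) \<longlonglongrightarrow> (\<integral>\<^sup>+\<omega>. 1 \<partial>P (Some x))"
  proof (rule nn_integral_dominated_convergence[where w = "\<lambda>_. 1"])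
    show "AE \<omega> in P (Some x). (\<lambda>n. g n \<omega>) \<longlonglongrightarrow> 1"
      using normal[of "Some x"] AE_space
    proof eventually_elim
      case (elim \<omega>)
      then have \<omega>: "\<omega> \<in> space M" "X 0 \<omega> = Some x" by (auto simp: spP)
      have "limitin cemetery_topology (\<lambda>s. X (ennreal s) \<omega>) (Some x) (at_right 0)"
        using right_continuous[OF \<omega>(1), of 0] \<omega>(2) by simp
      moreover have "openin cemetery_topology (Some ` G)" using G by (auto simp: openin_Alexandroff_compactification)
      ultimately have "eventually (\<lambda>r. X (ennreal r) \<omega> \<in> Some ` G) (at_right 0)" using x by (auto simp: limitin_def)
      moreover have "filterlim s (at_right 0) sequentially"
        using s less_imp_neq[OF s(1)] by (auto simp: filterlim_at)
      ultimately have "eventually (\<lambda>n. X (ennreal (s n)) \<omega> \<in> Some ` G) sequentially" by (rule eventually_compose_filterlim)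
      then have "eventually (\<lambda>n. g n \<omega> = 1) sequentially" by eventually_elim (auto simp: g_def)
      then show ?case by (rule tendsto_eventually)
    qed
    show "AE \<omega> in P (Some x). g n \<omega> \<le> 1" for n
      by (auto simp: g_def split: option.split split_indicator)
  qed (auto simp: emeasure_space_1)
  moreover have "(\<integral>\<^sup>+\<omega>. g n \<omega> \<partial>P (Some x)) = (\<integral>\<^sup>+y\<in>G. k (s n) x y \<partial>m)" for n
    using nn_transition_k[OF s(1)[of n], of "indicator G" x] G by (simp add: g_def nn_transition_def)
  ultimately show "(\<lambda>n. \<integral>\<^sup>+y\<in>G. k (s n) x y \<partial>m) \<longlonglongrightarrow> 1" by (simp add: emeasure_space_1)
qed simp

text \<open>Association describes F by the existence of the limit of the quotients;
  \<open>Q_tendsto\<close> and \<open>Q_finite_if_tendsto\<close> identify this with finiteness of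
  the supremum.\<close>

sublocale dirichlet_kernel m E F k
proof unfold_locales
  have lim: "((\<lambda>t. quot t u) \<longlongrightarrow> E u u) (at_right 0)" if "u \<in> F" for u
    using assoc that domain_L2 quot_tendsto_iff[of u] unfolding associated_def Lp_2_eq_L2 by blast
  show F_iff: "u \<in> F \<longleftrightarrow> u \<in> L2 \<and> Q u < \<top>" for u
  proof
    assume u: "u \<in> F"
    then have "u \<in> L2" using domain_L2 by (auto simp: Lp_2_eq_L2)
    then show "u \<in> L2 \<and> Q u < \<top>" using Q_finite_if_tendsto lim[OF u] by blast
  next
    assume u: "u \<in> L2 \<and> Q u < \<top>"
    then have "((\<lambda>t. quot t u) \<longlongrightarrow> enn2real (Q u)) (at_right 0)" using Q_tendsto by blast
    then have "\<exists>l. ((\<lambda>t. L2_inner m (\<lambda>x. u x - transition X P t u x) u / t) \<longlongrightarrow> l) (at_right 0)"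
      using quot_tendsto_iff u by blast
    moreover have "F = {u \<in> L2. \<exists>l. ((\<lambda>t. L2_inner m (\<lambda>x. u x - transition X P t u x) u / t) \<longlongrightarrow> l) (at_right 0)}"
      using assoc by (simp add: associated_def Lp_2_eq_L2)
    ultimately show "u \<in> F" using u by blast
  qed
  show "E u u = enn2real (Q u)" if u: "u \<in> F" for u
  proof (rule tendsto_unique[OF _ lim[OF u]])
    show "((\<lambda>t. quot t u) \<longlongrightarrow> enn2real (Q u)) (at_right 0)" using u F_iff by (intro Q_tendsto) auto
  qed simp
qed (use lc short_time_mass in auto)

lemma resolvent_kernel_k: "resolvent_kernel k = resolvent_kernel h"
  unfolding resolvent_kernel_def[abs_def] by (intro ext nn_integral_cong) (auto simp: k_def split: split_indicator)

lemma transient_testable: "transient_process m X P \<Longrightarrow> testable 0"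
proof (rule testable_0)
  fix f :: "'a \<Rightarrow> ennreal" assume tr: "transient_process m X P" and f: "f \<in> borel_measurable borel" "(\<integral>\<^sup>+x. f x \<partial>m) < \<top>"
  have "(\<integral>\<^sup>+t\<in>{0<..}. nnP t f x \<partial>lborel) = (\<integral>\<^sup>+t\<in>{0<..}. nn_transition X P t f x \<partial>lborel)" for x
    using nn_transition_k[OF _ f(1)] by (intro nn_integral_cong) (auto simp: nnP_def split: split_indicator)
  then show "AE x in m. (\<integral>\<^sup>+t\<in>{0<..}. nnP t f x \<partial>lborel) < \<top>"
    using tr f by (simp add: transient_process_def)
qed

lemma chen_green_tight:
  assumes "\<nu> \<in> chen_green_tight_class m E F l p" and "resolvent_kernel l 0 = resolvent_kernel h \<alpha>"
  shows "green_tight \<alpha> \<nu> p" and "charges_no_null_capacity m E F \<nu>"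
  using assms unfolding chen_green_tight_class_def green_tight_def pot_def resolvent_kernel_k by simp_all

lemma kato_class_kato:
  assumes "\<nu> \<in> kato_class h p" shows "kato \<nu> p"
  unfolding kato_def
proof (intro allI impI)
  fix \<epsilon> :: real assume "\<epsilon> > 0"
  then have "eventually (\<lambda>\<alpha>. (SUP x. \<integral>\<^sup>+y. ennreal_powr (resolvent_kernel h \<alpha> x y) p \<partial>\<nu>) < ennreal \<epsilon>) at_top"
    using assms by (intro order_tendstoD(2)[of _ 0]) (auto simp: kato_class_def)
  then have "eventually (\<lambda>\<alpha>. \<alpha> > 0 \<and> (SUP x. \<integral>\<^sup>+y. ennreal_powr (resolvent_kernel h \<alpha> x y) p \<partial>\<nu>) < ennreal \<epsilon>) at_top"
    using eventually_gt_at_top[of 0] by eventually_elim simp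
  then obtain \<beta> where \<beta>: "\<beta> > 0" "(SUP x. \<integral>\<^sup>+y. ennreal_powr (resolvent_kernel h \<beta> x y) p \<partial>\<nu>) < ennreal \<epsilon>"
    using eventually_happens'[OF trivial_limit_at_top_linorder] by blast
  have "(\<integral>\<^sup>+y. ennreal_powr (resolvent_kernel k \<beta> x y) p \<partial>\<nu>) \<le> ennreal \<epsilon>" for x
    unfolding resolvent_kernel_k using SUP_upper[OF UNIV_I] less_imp_le[OF \<beta>(2)] by (rule order_trans)
  then show "\<exists>\<beta>>0. \<forall>x. (\<integral>\<^sup>+y. ennreal_powr (resolvent_kernel k \<beta> x y) p \<partial>\<nu>) \<le> ennreal \<epsilon>" using \<beta>(1) by blast
qed

text \<open>The kernel l carries the Green-tight classes and \<alpha> is its order seen from h: l =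
  h with \<alpha> = 0, or the kernel of the 1-subprocess with \<alpha> = 1. The Kato class always
  refers to h.\<close>

lemma class_compact_embedding:
  assumes tr: "testable \<alpha>" and \<alpha>: "\<alpha> \<ge> 0" and p: "p \<ge> 1" and \<mu>: "radon_measure \<mu>"
    and cls: "\<mu> \<in> chen_green_tight_class m E F l p \<or> \<mu> \<in> kato_class h p \<and> m \<in> chen_green_tight_class m E F l 1"
    and l: "resolvent_kernel l 0 = resolvent_kernel h \<alpha>"
    and H: "\<And>u. u \<in> H \<Longrightarrow> \<exists>f. approximable \<alpha> u f"
    and a: "\<And>u. u \<in> H \<Longrightarrow> a u u = enn2real (Qa \<alpha> u)"
  shows "compactly_embedded m E F H a \<mu> (2 * p)"
proof -
  have sets: "sets \<mu> = sets borel" using \<mu> by (simp add: radon_measure_def)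
  have sf: "sigma_finite_measure \<mu>" by (rule radon_measure_sigma_finite[OF lc \<mu>])
  have "charges_no_null_capacity m E F \<mu> \<and> (\<exists>B. core_bounded \<alpha> \<mu> p B) \<and> core_compact \<alpha> \<mu> p"
    using cls
  proof
    assume "\<mu> \<in> chen_green_tight_class m E F l p"
    note gt = chen_green_tight[OF this l]
    show ?thesis
      using gt(2) green_tight_core_bounded[OF tr \<alpha> p gt(2) sets sf gt(1)] green_tight_core_compact[OF tr \<alpha> p gt(2) sets sf gt(1)]
      by blast
  next
    assume A: "\<mu> \<in> kato_class h p \<and> m \<in> chen_green_tight_class m E F l 1"
    then have kato: "kato \<mu> p" by (intro kato_class_kato) simp
    have "m \<in> chen_green_tight_class m E F l 1" using A by simp
    note gt = chen_green_tight[OF this l]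
    have sfm: "sigma_finite_measure m" by unfold_locales
    obtain B0 where B0: "core_bounded \<alpha> m 1 B0"
      using green_tight_core_bounded[OF tr \<alpha> order_refl gt(2) sets_m sfm gt(1)] by blast
    obtain \<beta> where "\<beta> > 0" and "\<And>x. (\<integral>\<^sup>+y. ennreal_powr (resolvent_kernel k \<beta> x y) p \<partial>\<mu>) \<le> ennreal 1"
      using kato[unfolded kato_def, rule_format, OF zero_less_one] by blast
    then have "charges_no_null_capacity m E F \<mu>"
      by (intro bounded_potential_smooth[OF sets sf p zero_less_one, of \<beta>]) auto
    then show ?thesis
      using kato_core_bounded[OF sets sf p kato B0]
        kato_core_compact[OF sets sf p kato green_tight_core_compact[OF tr \<alpha> order_refl gt(2) sets_m sfm gt(1)]] by blast
  qed
  then obtain B where B: "charges_no_null_capacity m E F \<mu>" "core_bounded \<alpha> \<mu> p B" "core_compact \<alpha> \<mu> p" by blast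
  show ?thesis by (rule compact_embedding[OF tr \<alpha> p B(1) sets B(2,3)]) (use H a in auto)
qed

end

theorem theorem1p1:
  fixes m \<mu> :: "'a::{metric_space, second_countable_topology} measure"
    and \<E> :: "('a \<Rightarrow> real) \<Rightarrow> ('a \<Rightarrow> real) \<Rightarrow> real"
    and \<F> :: "('a \<Rightarrow> real) set"
    and M :: "'w measure"
    and X :: "ennreal \<Rightarrow> 'w \<Rightarrow> 'a option"
    and \<zeta> :: "'w \<Rightarrow> ennreal"
    and P :: "'a option \<Rightarrow> 'w measure"
    and k :: "real \<Rightarrow> 'a \<Rightarrow> 'a \<Rightarrow> ennreal"
    and p :: real
  assumes "locally_compact_space (euclidean :: 'a topology)"
    and "radon_measure m" and "full_support m"
    and "regular_dirichlet_form m \<E> \<F>"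
    and "hunt_process M X \<zeta> P" and "associated m \<E> \<F> X P"
    and "absolute_continuity m X P" and "heat_kernel m X P k"
    and "p \<ge> 1" and "radon_measure \<mu>"
  shows "(transient_process m X P \<and>
            (\<mu> \<in> chen_green_tight_class m \<E> \<F> k p \<or>
             \<mu> \<in> kato_class k p \<and> m \<in> chen_green_tight_class m \<E> \<F> k 1) \<longrightarrow>
            compactly_embedded m \<E> \<F> (extended_domain m \<E> \<F>) (extended_form m \<E> \<F>) \<mu> (2 * p))
       \<and> (\<mu> \<in> chen_green_tight_class m \<E> \<F> (subprocess1_kernel k) p \<or>
             \<mu> \<in> kato_class k p \<and> m \<in> chen_green_tight_class m \<E> \<F> (subprocess1_kernel k) 1 \<longrightarrow>
            compactly_embedded m \<E> \<F> \<F> (form1 m \<E>) \<mu> (2 * p))"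
proof -
  interpret heat_kernel_process m \<E> \<F> M X \<zeta> P k
    using assms by (simp add: heat_kernel_process_def heat_kernel_process_axioms_def)
  show ?thesis
  proof (intro conjI impI)
    assume "transient_process m X P \<and>
      (\<mu> \<in> chen_green_tight_class m \<E> \<F> k p \<or> \<mu> \<in> kato_class k p \<and> m \<in> chen_green_tight_class m \<E> \<F> k 1)"
    then show "compactly_embedded m \<E> \<F> (extended_domain m \<E> \<F>) (extended_form m \<E> \<F>) \<mu> (2 * p)"
      using assms(9,10) by (intro class_compact_embedding[of 0 p \<mu> k])
        (auto intro: transient_testable extended_approximable extended_form_eq)
  next
    assume "\<mu> \<in> chen_green_tight_class m \<E> \<F> (subprocess1_kernel k) p \<or>
      \<mu> \<in> kato_class k p \<and> m \<in> chen_green_tight_class m \<E> \<F> (subprocess1_kernel k) 1"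
    then show "compactly_embedded m \<E> \<F> \<F> (form1 m \<E>) \<mu> (2 * p)"
      using assms(9,10) by (intro class_compact_embedding[of 1 p \<mu> "subprocess1_kernel k"])
        (auto intro: testable_1 F_approximable form1_eq_Qa simp: resolvent_kernel_subprocess1)
  qed
qed

end
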